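(* Let $d\ge 1$, let $W$ be the finite reflection group associated with a normalized root system $R$ in $\mathbb{R}^d$, let $\Omega\subset\mathbb{R}^d$ be a nonempty open $W$-symmetric set with positive part $\Omega_+$, and let $\eta\in\mathrm{Hom}(W,\{1,-1\})$. Let $p_t^{\eta,\Omega_+}$ and $p_t^{D,\Omega_+}$ denote the $\eta$-heat kernel and the Dirichlet heat kernel on $\Omega_+$, and $p_t^{N,\Omega}$ and $p_t^{D,\Omega}$ the Neumann and the Dirichlet heat kernels on $\Omega$. Then $$p_t^{\eta,\Omega_+}(x,y)=\sum_{g\in W}\eta(g)\,p_t^{N,\Omega}(gx,y),\qquad x,y\in\Omega_+,\ t>0,$$ and $$p_t^{D,\Omega_+}(x,y)=\sum_{g\in W}\mathrm{sgn}(g)\,p_t^{D,\Omega}(gx,y),\qquad x,y\in\Omega_+,\ t>0.$$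
   Context: Reflection group and symmetric sets. A normalized root system $R$ in $\mathbb{R}^d$ is a finite set of unit vectors such that $\sigma_\alpha(R)=R$ for every $\alpha\in R$, where $\sigma_\alpha(x)=x-2\langle\alpha,x\rangle\alpha$. $W=W(R)\subset O(\mathbb{R}^d)$ is the (finite) group generated by the reflections $\sigma_\alpha$, $\alpha\in R$. A set of positive roots is $R_+=\{\alpha\in R:\langle\alpha,\check\alpha\rangle>0\}$, where $\check\alpha\in\mathbb{R}^d$ is a chosen vector with $\langle\alpha,\check\alpha\rangle\ne0$ for all $\alpha\in R$. A set $\Omega\subset\mathbb{R}^d$ is $W$-symmetric if $\sigma_\alpha(\Omega)=\Omega$ for all $\alpha\in R$ (hence $g\Omega=\Omega$ for $g\in W$). Its positive part is $\Omega_+=\{x\in\Omega:\langle x,\alpha\rangle>0\ \text{for all }\alpha\in R_+\}$, the intersection of $\Omega$ with the positive Weyl chamber. $\mathrm{Hom}(W,\{1,-1\})$ is the set of homomorphisms into the multiplicative group $\{1,-1\}$, and $\mathrm{sgn}(g)=\det(g)$. Symmetrization. For $\eta\in\mathrm{Hom}(W,\{1,-1\})$ and a function $F$ on $\Omega$, put $\mathcal{A}_\eta F(y)=\frac1{|W|}\sum_{g\in W}\eta(g)F(gy)$, $y\in\Omega$, and let $F^+=F|_{\Omega_+}$. Let $H^1_\eta(\Omega_+)=\{(\mathcal{A}_\eta F)^+:F\in H^1(\Omega)\}\subset H^1(\Omega_+)$. Operators. For a non-negative Hermitian closed densely defined sesquilinear form $\mathfrak{s}$ on a Hilbert space $\mathcal{H}$,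 the associated operator $A_{\mathfrak{s}}$ has domain $\{h\in\mathrm{Dom}(\mathfrak{s}):\exists u_h\in\mathcal{H}\ \forall h'\in\mathrm{Dom}(\mathfrak{s})\ \mathfrak{s}[h,h']=\langle u_h,h'\rangle\}$ and acts by $A_{\mathfrak{s}}h=u_h$; it is self-adjoint and non-negative. For an open set $U$ let $\mathfrak{t}_U[f,g]=\int_U\sum_{j=1}^d\partial_jf\,\overline{\partial_jg}\,dx$ (weak derivatives). The Neumann Laplacian $-\Delta_{N,U}$ is the operator on $L^2(U)$ associated with $\mathfrak{t}_U$ with domain $H^1(U)$; the Dirichlet Laplacian $-\Delta_{D,U}$ is the operator associated with $\mathfrak{t}_U$ restricted to $H^1_0(U)$ (the closure of $C_c^\infty(U)$ in $H^1(U)$). The $\eta$-Laplacian $-\Delta^+_\eta$ is the operator on $L^2(\Omega_+)$ associated with the (closed) form $\mathfrak{t}_{\Omega_+}$ restricted to $H^1_\eta(\Omega_+)$. Heat kernels. For $t>0$, $p_t^{N,\Omega}$, $p_t^{D,\Omega}$, $p_t^{D,\Omega_+}$ and $p_t^{\eta,\Omega_+}$ denote the integral kernels of the operators $\exp(-t(-\Delta_{N,\Omega}))$, $\exp(-t(-\Delta_{D,\Omega}))$, $\exp(-t(-\Delta_{D,\Omega_+}))$ and $\exp(-t(-\Delta^+_\eta))$, respectively, where $T$ on $L^2(U)$ has integral kernel $K$ if $Tf(x)=\int_UK(x,y)f(y)\,dy$ for a.e. $x$, for every $f\in L^2(U)$. It is known that the Neumann and Dirichlet heat kernels on an open set exist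 and may be taken to be $C^\infty$ functions of $(t,x,y)$. *)

theory Defs
  imports "HOL-Analysis.Analysis"
begin

section \<open>Reflection groups and symmetric sets\<close>

definition reflection :: "real^'n \<Rightarrow> real^'n \<Rightarrow> real^'n" where
  "reflection \<alpha> x = x - (2 * (\<alpha> \<bullet> x)) *\<^sub>R \<alpha>"

definition normalized_root_system :: "(real^'n) set \<Rightarrow> bool" where
  "normalized_root_system R \<longleftrightarrow>
     finite R \<and> (\<forall>\<alpha>\<in>R. norm \<alpha> = 1) \<and> (\<forall>\<alpha>\<in>R. reflection \<alpha> ` R = R)"

inductive_set reflection_group :: "(real^'n) set \<Rightarrow> (real^'n \<Rightarrow> real^'n) set"
  for R :: "(real^'n) set" where
  one: "id \<in> reflection_group R"
| gen: "\<alpha> \<in> R \<Longrightarrow> reflection \<alpha> \<in> reflection_group R"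
| mult: "g \<in> reflection_group R \<Longrightarrow> h \<in> reflection_group R \<Longrightarrow> g \<circ> h \<in> reflection_group R"
| inv: "g \<in> reflection_group R \<Longrightarrow> inv g \<in> reflection_group R"

definition sign_homs :: "(real^'n) set \<Rightarrow> ((real^'n \<Rightarrow> real^'n) \<Rightarrow> real) set" where
  "sign_homs R = {\<eta>. (\<forall>g\<in>reflection_group R. \<eta> g \<in> {1, -1}) \<and>
     (\<forall>g\<in>reflection_group R. \<forall>h\<in>reflection_group R. \<eta> (g \<circ> h) = \<eta> g * \<eta> h)}"

definition sgn_det :: "(real^'n \<Rightarrow> real^'n) \<Rightarrow> real" where
  "sgn_det g = det (matrix g)"

text \<open>The positive roots determined by a vector \<open>v\<close> not orthogonal to any root.\<close>

definition positive_roots :: "(real^'n) set \<Rightarrow> real^'n \<Rightarrow> (real^'n) set" where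
  "positive_roots R v = {\<alpha>\<in>R. \<alpha> \<bullet> v > 0}"

definition W_symmetric :: "(real^'n) set \<Rightarrow> (real^'n) set \<Rightarrow> bool" where
  "W_symmetric R \<Omega> \<longleftrightarrow> (\<forall>\<alpha>\<in>R. reflection \<alpha> ` \<Omega> = \<Omega>)"

definition positive_part :: "(real^'n) set \<Rightarrow> real^'n \<Rightarrow> (real^'n) set \<Rightarrow> (real^'n) set" where
  "positive_part R v \<Omega> = {x\<in>\<Omega>. \<forall>\<alpha>\<in>positive_roots R v. x \<bullet> \<alpha> > 0}"

definition symmetrization ::
  "(real^'n) set \<Rightarrow> ((real^'n \<Rightarrow> real^'n) \<Rightarrow> real) \<Rightarrow> (real^'n \<Rightarrow> complex) \<Rightarrow> real^'n \<Rightarrow> complex" where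
  "symmetrization R \<eta> F y =
     (1 / real (card (reflection_group R))) *\<^sub>R (\<Sum>g\<in>reflection_group R. \<eta> g *\<^sub>R F (g y))"


section \<open>Square integrable functions and operators\<close>

text \<open>
  Elements of \<open>L\<^sup>2(M)\<close> are represented by functions, two of which represent the same element
  iff they agree almost everywhere on \<open>M\<close>; values outside \<open>space M\<close> are irrelevant.
  A possibly unbounded operator is given by its graph \<open>A\<close>: \<open>A f u\<close> means that \<open>f\<close> lies in the
  domain and \<open>A f = u\<close>. All graphs below are closed under a.e. equality in both arguments.
\<close>

definition L2 :: "'a measure \<Rightarrow> ('a \<Rightarrow> complex) set" where
  "L2 M = {f \<in> borel_measurable M. integrable M (\<lambda>x. (cmod (f x))\<^sup>2)}"

definition l2_inner :: "'a measure \<Rightarrow> ('a \<Rightarrow> complex) \<Rightarrow> ('a \<Rightarrow> complex) \<Rightarrow> complex" where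
  "l2_inner M f g = (LINT x|M. f x * cnj (g x))"

definition l2_norm :: "'a measure \<Rightarrow> ('a \<Rightarrow> complex) \<Rightarrow> real" where
  "l2_norm M f = sqrt (LINT x|M. (cmod (f x))\<^sup>2)"

definition form_operator ::
  "'a measure \<Rightarrow> ('a \<Rightarrow> complex) set \<Rightarrow> (('a \<Rightarrow> complex) \<Rightarrow> ('a \<Rightarrow> complex) \<Rightarrow> complex)
    \<Rightarrow> ('a \<Rightarrow> complex) \<Rightarrow> ('a \<Rightarrow> complex) \<Rightarrow> bool" where
  "form_operator M D s h u \<longleftrightarrow> h \<in> D \<and> u \<in> L2 M \<and> (\<forall>h'\<in>D. s h h' = l2_inner M u h')"


subsection \<open>Borel functional calculus\<close>

text \<open>
  Projection-valued measures on the real line. An everywhere defined map \<open>E B\<close> that is symmetric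
  with respect to the inner product is automatically well defined and linear up to a.e. equality,
  and bounded.
\<close>

definition projection_valued_measure ::
  "'a measure \<Rightarrow> (real set \<Rightarrow> ('a \<Rightarrow> complex) \<Rightarrow> ('a \<Rightarrow> complex)) \<Rightarrow> bool" where
  "projection_valued_measure M E \<longleftrightarrow>
     (\<forall>B\<in>sets borel. \<forall>f\<in>L2 M. E B f \<in> L2 M) \<and>
     (\<forall>B\<in>sets borel. \<forall>f\<in>L2 M. \<forall>g\<in>L2 M. l2_inner M (E B f) g = l2_inner M f (E B g)) \<and>
     (\<forall>B\<in>sets borel. \<forall>C\<in>sets borel. \<forall>f\<in>L2 M. AE x in M. E B (E C f) x = E (B \<inter> C) f x) \<and>
     (\<forall>f\<in>L2 M. AE x in M. E UNIV f x = f x) \<and>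
     (\<forall>B :: nat \<Rightarrow> real set. range B \<subseteq> sets borel \<and> disjoint_family B \<longrightarrow>
        (\<forall>f\<in>L2 M. \<forall>g\<in>L2 M.
           (\<lambda>n. l2_inner M (E (B n) f) g) sums l2_inner M (E (\<Union>n. B n) f) g))"

text \<open>The finite measure \<open>B \<mapsto> \<langle>E(B)f, f\<rangle>\<close>.\<close>

definition diagonal_measure ::
  "'a measure \<Rightarrow> (real set \<Rightarrow> ('a \<Rightarrow> complex) \<Rightarrow> ('a \<Rightarrow> complex)) \<Rightarrow> ('a \<Rightarrow> complex) \<Rightarrow> real measure" where
  "diagonal_measure M E f =
     measure_of UNIV (sets borel) (\<lambda>B. ennreal (Re (l2_inner M (E B f) f)))"

definition simple_spectral_integral ::
  "(real set \<Rightarrow> ('a \<Rightarrow> complex) \<Rightarrow> ('a \<Rightarrow> complex)) \<Rightarrow> (real \<Rightarrow> real)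
    \<Rightarrow> ('a \<Rightarrow> complex) \<Rightarrow> ('a \<Rightarrow> complex)" where
  "simple_spectral_integral E s f x = (\<Sum>c\<in>range s. c *\<^sub>R E (s -` {c}) f x)"

text \<open>
  The graph of the operator \<open>\<integral> \<phi> dE\<close>: its domain is \<open>{f. \<phi> \<in> L\<^sup>2(\<langle>E f, f\<rangle>)}\<close>, and it is obtained
  from simple functions through the isometry \<open>L\<^sup>2(\<langle>E f, f\<rangle>) \<rightarrow> L\<^sup>2(M)\<close>.
\<close>

definition spectral_integral ::
  "'a measure \<Rightarrow> (real set \<Rightarrow> ('a \<Rightarrow> complex) \<Rightarrow> ('a \<Rightarrow> complex)) \<Rightarrow> (real \<Rightarrow> real)
    \<Rightarrow> ('a \<Rightarrow> complex) \<Rightarrow> ('a \<Rightarrow> complex) \<Rightarrow> bool" where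
  "spectral_integral M E \<phi> f u \<longleftrightarrow> f \<in> L2 M \<and> u \<in> L2 M \<and>
     (\<exists>s :: nat \<Rightarrow> real \<Rightarrow> real.
        (\<forall>n. simple_function borel (s n)) \<and>
        (\<forall>n. integrable (diagonal_measure M E f) (\<lambda>l. (s n l - \<phi> l)\<^sup>2)) \<and>
        (\<lambda>n. LINT l|diagonal_measure M E f. (s n l - \<phi> l)\<^sup>2) \<longlonglongrightarrow> 0 \<and>
        (\<lambda>n. l2_norm M (\<lambda>x. simple_spectral_integral E (s n) f x - u x)) \<longlonglongrightarrow> 0)"

definition is_spectral_measure_of ::
  "'a measure \<Rightarrow> (real set \<Rightarrow> ('a \<Rightarrow> complex) \<Rightarrow> ('a \<Rightarrow> complex))
    \<Rightarrow> (('a \<Rightarrow> complex) \<Rightarrow> ('a \<Rightarrow> complex) \<Rightarrow> bool) \<Rightarrow> bool" where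
  "is_spectral_measure_of M E A \<longleftrightarrow>
     projection_valued_measure M E \<and> (\<forall>f u. A f u \<longleftrightarrow> spectral_integral M E (\<lambda>l. l) f u)"

text \<open>
  The graph of \<open>exp(-tA)\<close> for self-adjoint \<open>A\<close>. The spectral measure exists and is unique up to
  a.e. equality by the spectral theorem.
\<close>

definition exp_operator ::
  "'a measure \<Rightarrow> (('a \<Rightarrow> complex) \<Rightarrow> ('a \<Rightarrow> complex) \<Rightarrow> bool) \<Rightarrow> real
    \<Rightarrow> ('a \<Rightarrow> complex) \<Rightarrow> ('a \<Rightarrow> complex) \<Rightarrow> bool" where
  "exp_operator M A t f u \<longleftrightarrow>
     (\<exists>E. is_spectral_measure_of M E A \<and> spectral_integral M E (\<lambda>l. exp (- t * l)) f u)"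

text \<open>
  Since \<open>T\<close> is a graph, the second conjunct says that \<open>T\<close> is everywhere defined and that \<open>T f\<close> is
  a.e. equal to the integral.
\<close>

definition has_integral_kernel ::
  "'a measure \<Rightarrow> (('a \<Rightarrow> complex) \<Rightarrow> ('a \<Rightarrow> complex) \<Rightarrow> bool) \<Rightarrow> ('a \<Rightarrow> 'a \<Rightarrow> complex) \<Rightarrow> bool" where
  "has_integral_kernel M T K \<longleftrightarrow> (\<forall>f\<in>L2 M.
     (AE x in M. integrable M (\<lambda>y. K x y * f y)) \<and> T f (\<lambda>x. LINT y|M. K x y * f y))"


section \<open>Sobolev spaces and Laplacians\<close>

definition dir_deriv ::
  "'a::real_normed_vector \<Rightarrow> ('a \<Rightarrow> 'b::real_normed_vector) \<Rightarrow> 'a \<Rightarrow> 'b" where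
  "dir_deriv b f x = frechet_derivative f (at x) b"

text \<open>
  For open \<open>S\<close> this is \<open>C\<^sup>\<infinity>\<close>: all iterated partial derivatives, the function itself included, are
  (totally) differentiable at every point of \<open>S\<close>, and hence continuous there.
\<close>

definition smooth_on :: "'a::euclidean_space set \<Rightarrow> ('a \<Rightarrow> 'b::real_normed_vector) \<Rightarrow> bool" where
  "smooth_on S f \<longleftrightarrow> (\<forall>bs. set bs \<subseteq> Basis \<longrightarrow> (\<forall>x\<in>S. foldr dir_deriv bs f differentiable (at x)))"

definition test_functions :: "(real^'n) set \<Rightarrow> (real^'n \<Rightarrow> complex) set" where
  "test_functions U = {\<phi>. smooth_on UNIV \<phi> \<and>
     compact (closure {x. \<phi> x \<noteq> 0}) \<and> closure {x. \<phi> x \<noteq> 0} \<subseteq> U}"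

abbreviation partial :: "'n \<Rightarrow> (real^'n \<Rightarrow> complex) \<Rightarrow> real^'n \<Rightarrow> complex" where
  "partial j \<equiv> dir_deriv (axis j 1)"

definition is_weak_partial ::
  "(real^'n) set \<Rightarrow> 'n \<Rightarrow> (real^'n \<Rightarrow> complex) \<Rightarrow> (real^'n \<Rightarrow> complex) \<Rightarrow> bool" where
  "is_weak_partial U j f u \<longleftrightarrow> (\<forall>\<phi>\<in>test_functions U.
     (LINT x|lebesgue_on U. f x * partial j \<phi> x) = - (LINT x|lebesgue_on U. u x * \<phi> x))"

definition H1 :: "(real^'n) set \<Rightarrow> (real^'n \<Rightarrow> complex) set" where
  "H1 U = {f \<in> L2 (lebesgue_on U). \<forall>j. \<exists>u \<in> L2 (lebesgue_on U). is_weak_partial U j f u}"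

definition weak_partial ::
  "(real^'n) set \<Rightarrow> 'n \<Rightarrow> (real^'n \<Rightarrow> complex) \<Rightarrow> real^'n \<Rightarrow> complex" where
  "weak_partial U j f = (SOME u. u \<in> L2 (lebesgue_on U) \<and> is_weak_partial U j f u)"

definition dirichlet_form ::
  "(real^'n) set \<Rightarrow> (real^'n \<Rightarrow> complex) \<Rightarrow> (real^'n \<Rightarrow> complex) \<Rightarrow> complex" where
  "dirichlet_form U f g =
     (LINT x|lebesgue_on U. (\<Sum>j\<in>UNIV. weak_partial U j f x * cnj (weak_partial U j g x)))"

definition H1_norm :: "(real^'n) set \<Rightarrow> (real^'n \<Rightarrow> complex) \<Rightarrow> real" where
  "H1_norm U f = sqrt ((l2_norm (lebesgue_on U) f)\<^sup>2 + Re (dirichlet_form U f f))"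

definition H10 :: "(real^'n) set \<Rightarrow> (real^'n \<Rightarrow> complex) set" where
  "H10 U = {f \<in> H1 U. \<exists>\<phi> :: nat \<Rightarrow> real^'n \<Rightarrow> complex.
     (\<forall>n. \<phi> n \<in> test_functions U) \<and> (\<lambda>n. H1_norm U (\<lambda>x. \<phi> n x - f x)) \<longlonglongrightarrow> 0}"

text \<open>The restrictions to the positive part of the symmetrizations of functions in \<open>H\<^sup>1(\<Omega>)\<close>.\<close>

definition H1_eta ::
  "(real^'n) set \<Rightarrow> real^'n \<Rightarrow> ((real^'n \<Rightarrow> real^'n) \<Rightarrow> real) \<Rightarrow> (real^'n) set
    \<Rightarrow> (real^'n \<Rightarrow> complex) set" where
  "H1_eta R v \<eta> \<Omega> = {f. \<exists>F\<in>H1 \<Omega>.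
     AE x in lebesgue_on (positive_part R v \<Omega>). f x = symmetrization R \<eta> F x}"

definition neumann_laplacian ::
  "(real^'n) set \<Rightarrow> (real^'n \<Rightarrow> complex) \<Rightarrow> (real^'n \<Rightarrow> complex) \<Rightarrow> bool" where
  "neumann_laplacian U = form_operator (lebesgue_on U) (H1 U) (dirichlet_form U)"

definition dirichlet_laplacian ::
  "(real^'n) set \<Rightarrow> (real^'n \<Rightarrow> complex) \<Rightarrow> (real^'n \<Rightarrow> complex) \<Rightarrow> bool" where
  "dirichlet_laplacian U = form_operator (lebesgue_on U) (H10 U) (dirichlet_form U)"

definition eta_laplacian ::
  "(real^'n) set \<Rightarrow> real^'n \<Rightarrow> ((real^'n \<Rightarrow> real^'n) \<Rightarrow> real) \<Rightarrow> (real^'n) set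
    \<Rightarrow> (real^'n \<Rightarrow> complex) \<Rightarrow> (real^'n \<Rightarrow> complex) \<Rightarrow> bool" where
  "eta_laplacian R v \<eta> \<Omega> =
     form_operator (lebesgue_on (positive_part R v \<Omega>)) (H1_eta R v \<eta> \<Omega>)
       (dirichlet_form (positive_part R v \<Omega>))"


section \<open>Heat kernels\<close>

definition heat_kernel_at ::
  "(real^'n) set \<Rightarrow> ((real^'n \<Rightarrow> complex) \<Rightarrow> (real^'n \<Rightarrow> complex) \<Rightarrow> bool) \<Rightarrow> real
    \<Rightarrow> (real^'n \<Rightarrow> real^'n \<Rightarrow> complex) \<Rightarrow> bool" where
  "heat_kernel_at U A t K \<longleftrightarrow>
     has_integral_kernel (lebesgue_on U) (exp_operator (lebesgue_on U) A t) K"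

text \<open>The smooth version of the heat kernel; it is determined everywhere on \<open>(0,\<infinity>) \<times> U \<times> U\<close>.\<close>

definition smooth_heat_kernel ::
  "(real^'n) set \<Rightarrow> ((real^'n \<Rightarrow> complex) \<Rightarrow> (real^'n \<Rightarrow> complex) \<Rightarrow> bool)
    \<Rightarrow> (real \<Rightarrow> real^'n \<Rightarrow> real^'n \<Rightarrow> complex) \<Rightarrow> bool" where
  "smooth_heat_kernel U A p \<longleftrightarrow>
     (\<forall>t>0. heat_kernel_at U A t (p t)) \<and>
     smooth_on ({0<..} \<times> U \<times> U) (\<lambda>(t, x, y). p t x y)"

end

theory Submission
  imports Defs
begin

text \<open>
  For a function \<open>f\<close> on \<open>\<Omega>\<^sub>+\<close> let \<open>J f\<close> be its \<open>\<eta>\<close>-equivariant extension to \<open>\<Omega>\<close>. Since \<open>W\<close> acts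
  simply transitively on the chambers, \<open>J\<close> is, up to the factor \<open>|W|\<close>, an isometry of
  \<open>L\<^sup>2(\<Omega>\<^sub>+)\<close> onto the equivariant part of \<open>L\<^sup>2(\<Omega>)\<close>, and it turns the form with domain
  \<open>{f. J f \<in> D}\<close> on \<open>\<Omega>\<^sub>+\<close> into the Dirichlet form with the invariant domain \<open>D\<close> on \<open>\<Omega>\<close>. The spectral
  measure \<open>E\<close> of the operator on \<open>\<Omega>\<close> is unique, hence commutes with \<open>W\<close>, so that
  \<open>f \<mapsto> (E(B) J f)|\<^bsub>\<Omega>\<^sub>+\<^esub>\<close> is the spectral measure of the operator on \<open>\<Omega>\<^sub>+\<close>. As \<open>J f\<close> is the signed sum
  of the translates of the extension by zero of \<open>f\<close>, the heat semigroup on \<open>\<Omega>\<^sub>+\<close> has the asserted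
  kernel. For \<open>D = H\<^sup>1(\<Omega>)\<close> this gives the first formula. For the second one,
  \<open>D = H\<^sup>1\<^sub>0(\<Omega>)\<close> and \<open>\<eta> = sgn\<close>, one needs that \<open>J f \<in> H\<^sup>1\<^sub>0(\<Omega>)\<close> implies \<open>f \<in> H\<^sup>1\<^sub>0(\<Omega>\<^sub>+)\<close>: an
  antisymmetric test function \<open>u\<close> satisfies \<open>|u(x)| \<le> L |\<langle>\<alpha>, x\<rangle>|\<close> for all roots \<open>\<alpha>\<close>, which makes
  cutting it off near the walls harmless.
\<close>

section \<open>Square integrable functions\<close>

text \<open>\<open>exp_operator\<close> quantifies existentially over spectral measures, so
  statements about a semigroup need some spectral measure to exist and all of them to agree.
  Existence on \<Omega> is read off from the hypothesis that the semigroup has a kernel there, and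
  on the positive part the measure is built from the one on \<Omega>; no spectral theorem is
  invoked. Uniqueness is a growth argument: powers of \<open>A - c\<close> stay below
  \<open>a ^ n\<close> on the spectral subspace of an interval of radius \<open>a\<close>, but grow
  like \<open>b ^ n\<close> on components beyond radius \<open>b > a\<close>. It gives commutation
  with the group and makes the semigroup single-valued, so that kernels can be compared. Elements of
  L2 are functions, hence identities hold almost everywhere, and kernels are tested against
  countably many rational boxes to keep one exceptional null set. The two form domains differ in
  difficulty: \<open>H1_eta\<close> is itself defined by symmetrization, so identifying it with the
  invariant side is formal, whereas membership in the closure of the test functions of the smaller
  set has to be earned near the walls.\<close>

lemma L2_measurable: "f \<in> L2 M \<Longrightarrow> f \<in> borel_measurable M"
  and L2_integrable: "f \<in> L2 M \<Longrightarrow> integrable M (\<lambda>x. (cmod (f x))\<^sup>2)"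
  by (auto simp: L2_def)

lemma norm_add_square_le: "(norm (a + b))\<^sup>2 \<le> 2 * (norm a)\<^sup>2 + 2 * (norm b)\<^sup>2"
  for a b :: "'a::real_normed_vector"
proof -
  have "(norm (a + b))\<^sup>2 \<le> (norm a + norm b)\<^sup>2"
    by (intro power_mono norm_triangle_ineq) simp
  also have "\<dots> \<le> 2 * (norm a)\<^sup>2 + 2 * (norm b)\<^sup>2"
    using zero_le_power2[of "norm a - norm b"] by (simp add: power2_eq_square algebra_simps)
  finally show ?thesis .
qed

lemma L2_bound:
  assumes "f \<in> borel_measurable M" "integrable M h" "AE x in M. (cmod (f x))\<^sup>2 \<le> h x"
  shows "f \<in> L2 M"
  unfolding L2_def using assms by (auto intro!: Bochner_Integration.integrable_bound[OF assms(2)])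

lemma L2_zero: "(\<lambda>_. 0) \<in> L2 M"
  by (simp add: L2_def)

lemma L2_add: assumes "f \<in> L2 M" "g \<in> L2 M" shows "(\<lambda>x. f x + g x) \<in> L2 M"
  by (rule L2_bound[where h="\<lambda>x. 2 * (cmod (f x))\<^sup>2 + 2 * (cmod (g x))\<^sup>2"])
    (use assms in \<open>auto simp: norm_add_square_le L2_def\<close>)

lemma L2_cmult: assumes "f \<in> L2 M" shows "(\<lambda>x. c * f x) \<in> L2 M"
  by (rule L2_bound[where h="\<lambda>x. (cmod c)\<^sup>2 * (cmod (f x))\<^sup>2"])
    (use assms in \<open>auto simp: L2_def norm_mult power_mult_distrib\<close>)

lemma L2_scaleR: "f \<in> L2 M \<Longrightarrow> (\<lambda>x. c *\<^sub>R f x) \<in> L2 M" for c :: real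
  using L2_cmult[of f M "of_real c"] by (simp add: scaleR_conv_of_real)

lemma L2_uminus: "f \<in> L2 M \<Longrightarrow> (\<lambda>x. - f x) \<in> L2 M"
  using L2_cmult[of f M "-1"] by simp

lemma L2_diff: "f \<in> L2 M \<Longrightarrow> g \<in> L2 M \<Longrightarrow> (\<lambda>x. f x - g x) \<in> L2 M"
  using L2_add[OF _ L2_uminus, of f M g] by simp

lemma L2_sum: "(\<And>i. i \<in> I \<Longrightarrow> f i \<in> L2 M) \<Longrightarrow> (\<lambda>x. \<Sum>i\<in>I. f i x) \<in> L2 M"
  by (induction I rule: infinite_finite_induct) (auto simp: L2_zero L2_add)

lemma L2_cong_AE:
  assumes "f \<in> L2 M" "g \<in> borel_measurable M" "AE x in M. f x = g x" shows "g \<in> L2 M"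
  by (rule L2_bound[OF assms(2) L2_integrable[OF assms(1)]]) (use assms(3) in auto)

lemma L2_integrable_mult:
  assumes "f \<in> L2 M" "g \<in> L2 M" shows "integrable M (\<lambda>x. f x * g x)"
proof (rule Bochner_Integration.integrable_bound[where f="\<lambda>x. (cmod (f x))\<^sup>2 + (cmod (g x))\<^sup>2"])
  show "AE x in M. cmod (f x * g x) \<le> norm ((cmod (f x))\<^sup>2 + (cmod (g x))\<^sup>2)"
  proof (rule AE_I2)
    fix x
    have "cmod (f x) * cmod (g x) * 2 \<le> (cmod (f x))\<^sup>2 + (cmod (g x))\<^sup>2"
      using zero_le_power2[of "cmod (f x) - cmod (g x)"] by (simp add: power2_eq_square algebra_simps)
    moreover have "0 \<le> cmod (f x) * cmod (g x)" by simp
    ultimately have "cmod (f x) * cmod (g x) \<le> (cmod (f x))\<^sup>2 + (cmod (g x))\<^sup>2" by linarith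
    then show "cmod (f x * g x) \<le> norm ((cmod (f x))\<^sup>2 + (cmod (g x))\<^sup>2)"
      by (simp add: norm_mult)
  qed
qed (use assms in \<open>auto simp: L2_def\<close>)

lemma borel_measurable_cnj [measurable]: "f \<in> borel_measurable M \<Longrightarrow> (\<lambda>x. cnj (f x)) \<in> borel_measurable M"
  by (rule borel_measurable_continuous_on) (auto intro: continuous_intros)

lemma L2_cnj: "f \<in> L2 M \<Longrightarrow> (\<lambda>x. cnj (f x)) \<in> L2 M"
  by (auto simp: L2_def)

lemma L2_integrable_inner:
  "f \<in> L2 M \<Longrightarrow> g \<in> L2 M \<Longrightarrow> integrable M (\<lambda>x. f x * cnj (g x))"
  by (intro L2_integrable_mult L2_cnj)

lemma l2_inner_add_left: "f \<in> L2 M \<Longrightarrow> g \<in> L2 M \<Longrightarrow> h \<in> L2 M \<Longrightarrow>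
    l2_inner M (\<lambda>x. f x + g x) h = l2_inner M f h + l2_inner M g h"
  by (simp add: l2_inner_def distrib_right L2_integrable_inner)

lemma l2_inner_diff_left: "f \<in> L2 M \<Longrightarrow> g \<in> L2 M \<Longrightarrow> h \<in> L2 M \<Longrightarrow>
    l2_inner M (\<lambda>x. f x - g x) h = l2_inner M f h - l2_inner M g h"
  by (simp add: l2_inner_def left_diff_distrib L2_integrable_inner)

lemma l2_inner_cmult_left: "l2_inner M (\<lambda>x. c * f x) h = c * l2_inner M f h"
  by (simp add: l2_inner_def mult.assoc)

lemma l2_inner_scaleR_left: "l2_inner M (\<lambda>x. c *\<^sub>R f x) h = c *\<^sub>R l2_inner M f h"
  by (simp add: l2_inner_def)

lemma l2_inner_sum_left: "(\<And>i. i \<in> I \<Longrightarrow> f i \<in> L2 M) \<Longrightarrow> h \<in> L2 M \<Longrightarrow>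
    l2_inner M (\<lambda>x. \<Sum>i\<in>I. f i x) h = (\<Sum>i\<in>I. l2_inner M (f i) h)"
  by (simp add: l2_inner_def sum_distrib_right L2_integrable_inner)

lemma l2_inner_commute: "l2_inner M f g = cnj (l2_inner M g f)"
proof -
  have "(\<lambda>x. f x * cnj (g x)) = (\<lambda>x. cnj (g x * cnj (f x)))" by (auto simp: mult.commute)
  then show ?thesis by (simp only: l2_inner_def Bochner_Integration.integral_cnj)
qed

lemma l2_inner_add_right: "f \<in> L2 M \<Longrightarrow> g \<in> L2 M \<Longrightarrow> h \<in> L2 M \<Longrightarrow>
    l2_inner M h (\<lambda>x. f x + g x) = l2_inner M h f + l2_inner M h g"
  by (simp add: l2_inner_def distrib_left L2_integrable_inner)

lemma l2_inner_diff_right: "f \<in> L2 M \<Longrightarrow> g \<in> L2 M \<Longrightarrow> h \<in> L2 M \<Longrightarrow>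
    l2_inner M h (\<lambda>x. f x - g x) = l2_inner M h f - l2_inner M h g"
  by (simp add: l2_inner_def right_diff_distrib L2_integrable_inner)

lemma l2_inner_cmult_right: "l2_inner M h (\<lambda>x. c * f x) = cnj c * l2_inner M h f"
  by (simp add: l2_inner_def mult.left_commute)

lemma l2_inner_scaleR_right: "l2_inner M h (\<lambda>x. c *\<^sub>R f x) = c *\<^sub>R l2_inner M h f"
  by (simp add: l2_inner_def)

lemma l2_inner_sum_right: "(\<And>i. i \<in> I \<Longrightarrow> f i \<in> L2 M) \<Longrightarrow> h \<in> L2 M \<Longrightarrow>
    l2_inner M h (\<lambda>x. \<Sum>i\<in>I. f i x) = (\<Sum>i\<in>I. l2_inner M h (f i))"
  by (simp add: l2_inner_def sum_distrib_left L2_integrable_inner)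

lemma l2_inner_cong:
  assumes "AE x in M. f x = f' x" "AE x in M. g x = g' x"
    and "f \<in> L2 M" "f' \<in> L2 M" "g \<in> L2 M" "g' \<in> L2 M"
  shows "l2_inner M f g = l2_inner M f' g'"
  unfolding l2_inner_def
  by (rule integral_cong_AE) (use assms in \<open>auto simp: L2_def\<close>)

lemma l2_norm_nonneg: "l2_norm M f \<ge> 0"
  by (simp add: l2_norm_def)

lemma l2_norm_square: "(l2_norm M f)\<^sup>2 = (LINT x|M. (cmod (f x))\<^sup>2)"
  by (simp add: l2_norm_def)

lemma l2_inner_self: "l2_inner M f f = of_real ((l2_norm M f)\<^sup>2)"
  by (simp add: l2_norm_square l2_inner_def complex_norm_square[symmetric] del: of_real_power)

lemma l2_norm_eq_0_iff: "f \<in> L2 M \<Longrightarrow> l2_norm M f = 0 \<longleftrightarrow> (AE x in M. f x = 0)"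
  by (simp add: l2_norm_def integral_nonneg_eq_0_iff_AE L2_integrable)

lemma l2_norm_cong:
  assumes "AE x in M. f x = f' x" "f \<in> L2 M" "f' \<in> L2 M" shows "l2_norm M f = l2_norm M f'"
  unfolding l2_norm_def
  by (rule arg_cong[where f=sqrt], rule integral_cong_AE) (use assms in \<open>auto simp: L2_def\<close>)

lemma l2_norm_cmult: "l2_norm M (\<lambda>x. c * f x) = cmod c * l2_norm M f"
  by (simp add: l2_norm_def norm_mult power_mult_distrib real_sqrt_mult)

lemma l2_norm_minus_commute: "l2_norm M (\<lambda>x. f x - g x) = l2_norm M (\<lambda>x. g x - f x)"
  by (simp add: l2_norm_def norm_minus_commute)

lemma l2_norm_diff_square:
  assumes "f \<in> L2 M" "g \<in> L2 M"
  shows "of_real ((l2_norm M (\<lambda>x. f x - g x))\<^sup>2)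
    = l2_inner M f f - l2_inner M f g - l2_inner M g f + l2_inner M g g"
  using assms by (simp add: l2_inner_self[symmetric] l2_inner_diff_left l2_inner_diff_right L2_diff
      del: of_real_power)

lemma AE_eq_iff_l2_norm:
  assumes "f \<in> L2 M" "g \<in> L2 M"
  shows "(AE x in M. f x = g x) \<longleftrightarrow> l2_norm M (\<lambda>x. f x - g x) = 0"
  using l2_norm_eq_0_iff[OF L2_diff[OF assms]] by simp

text \<open>Turns an almost everywhere identity into an identity of four inner products; for
  spectral integrals of simple functions these are explicit integrals.\<close>

lemma AE_eq_iff_inner:
  assumes "f \<in> L2 M" "g \<in> L2 M"
  shows "(AE x in M. f x = g x) \<longleftrightarrow>
    l2_inner M f f - l2_inner M f g - l2_inner M g f + l2_inner M g g = 0"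
  using AE_eq_iff_l2_norm[OF assms] l2_norm_diff_square[OF assms, symmetric] by simp

lemma AE_eqI_inner:
  assumes "f \<in> L2 M" "g \<in> L2 M" "\<And>h. h \<in> L2 M \<Longrightarrow> l2_inner M f h = l2_inner M g h"
  shows "AE x in M. f x = g x"
  using assms by (subst AE_eq_iff_inner) auto

lemma l2_Cauchy_Schwarz:
  assumes f: "f \<in> L2 M" and g: "g \<in> L2 M"
  shows "cmod (l2_inner M f g) \<le> l2_norm M f * l2_norm M g"
proof (cases "l2_norm M g = 0")
  case True
  then have "AE x in M. g x = 0" using g by (simp add: l2_norm_eq_0_iff)
  then have "l2_inner M f g = l2_inner M f (\<lambda>_. 0)"
    using f g by (intro l2_inner_cong) (auto simp: L2_zero)
  then show ?thesis using True by (simp add: l2_inner_def)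
next
  case False
  define n where "n = (l2_norm M g)\<^sup>2"
  \<comment> \<open>The choice of \<open>c\<close> makes \<open>c * g\<close> the orthogonal
    projection of \<open>f\<close> onto the line through \<open>g\<close>; nonnegativity of the
    remaining squared norm is the inequality.\<close>
  define c where "c = l2_inner M f g / of_real n"
  have n: "n > 0" using False l2_norm_nonneg[of M g] by (simp add: n_def)
  have "of_real ((l2_norm M (\<lambda>x. f x - c * g x))\<^sup>2)
      = l2_inner M f f - cnj c * l2_inner M f g - c * (l2_inner M g f - cnj c * l2_inner M g g)"
    by (subst l2_norm_diff_square) (auto simp: f g L2_cmult l2_inner_cmult_left l2_inner_cmult_right algebra_simps)
  also have "l2_inner M g f - cnj c * l2_inner M g g = 0"
    using n l2_inner_commute[of M g f] by (simp add: c_def l2_inner_self n_def del: of_real_power)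
  also have "l2_inner M f f - cnj c * l2_inner M f g - c * 0
      = of_real ((l2_norm M f)\<^sup>2 - (cmod (l2_inner M f g))\<^sup>2 / n)"
    using complex_norm_square[of "l2_inner M f g"]
    by (simp add: c_def l2_inner_self mult.commute)
  finally have "(l2_norm M (\<lambda>x. f x - c * g x))\<^sup>2 = (l2_norm M f)\<^sup>2 - (cmod (l2_inner M f g))\<^sup>2 / n"
    by (simp only: of_real_eq_iff)
  then have "(cmod (l2_inner M f g))\<^sup>2 / n \<le> (l2_norm M f)\<^sup>2"
    by (metis diff_ge_0_iff_ge zero_le_power2)
  then have "(cmod (l2_inner M f g))\<^sup>2 \<le> (l2_norm M f * l2_norm M g)\<^sup>2"
    using n by (simp add: n_def power_mult_distrib divide_le_eq)
  then show ?thesis by (rule power2_le_imp_le) (simp add: l2_norm_nonneg)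
qed

lemma l2_norm_triangle:
  assumes f: "f \<in> L2 M" and g: "g \<in> L2 M"
  shows "l2_norm M (\<lambda>x. f x + g x) \<le> l2_norm M f + l2_norm M g"
proof -
  have "of_real ((l2_norm M (\<lambda>x. f x + g x))\<^sup>2)
      = of_real ((l2_norm M f)\<^sup>2 + (l2_norm M g)\<^sup>2) + (l2_inner M f g + cnj (l2_inner M f g))"
    using f g by (simp add: l2_inner_self[symmetric] l2_inner_add_left l2_inner_add_right L2_add
        l2_inner_commute[of M g f] del: of_real_power)
  also have "\<dots> = of_real ((l2_norm M f)\<^sup>2 + (l2_norm M g)\<^sup>2 + 2 * Re (l2_inner M f g))"
    by (simp add: complex_add_cnj)
  finally have "(l2_norm M (\<lambda>x. f x + g x))\<^sup>2 = (l2_norm M f)\<^sup>2 + (l2_norm M g)\<^sup>2 + 2 * Re (l2_inner M f g)"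
    by (simp only: of_real_eq_iff)
  also have "\<dots> \<le> (l2_norm M f + l2_norm M g)\<^sup>2"
    using l2_Cauchy_Schwarz[OF f g] complex_Re_le_cmod[of "l2_inner M f g"]
    by (simp add: power2_sum)
  finally show ?thesis by (rule power2_le_imp_le) (simp add: l2_norm_nonneg)
qed

lemma l2_norm_triangle_diff:
  assumes "f \<in> L2 M" "g \<in> L2 M" "h \<in> L2 M"
  shows "l2_norm M (\<lambda>x. f x - h x) \<le> l2_norm M (\<lambda>x. f x - g x) + l2_norm M (\<lambda>x. g x - h x)"
  using l2_norm_triangle[of "\<lambda>x. f x - g x" M "\<lambda>x. g x - h x"] assms by (simp add: L2_diff)

lemma l2_norm_abs_diff:
  assumes "f \<in> L2 M" "g \<in> L2 M"
  shows "\<bar>l2_norm M f - l2_norm M g\<bar> \<le> l2_norm M (\<lambda>x. f x - g x)"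
  using l2_norm_triangle_diff[of f M g "\<lambda>_. 0"] l2_norm_triangle_diff[of g M f "\<lambda>_. 0"] assms
    l2_norm_minus_commute[of M f g] by (simp add: L2_zero)

lemma l2_norm_add_square_le:
  assumes "f \<in> L2 M" "g \<in> L2 M"
  shows "(l2_norm M (\<lambda>x. f x + g x))\<^sup>2 \<le> 2 * (l2_norm M f)\<^sup>2 + 2 * (l2_norm M g)\<^sup>2"
proof -
  have "(l2_norm M (\<lambda>x. f x + g x))\<^sup>2 \<le> (l2_norm M f + l2_norm M g)\<^sup>2"
    by (intro power_mono l2_norm_triangle assms l2_norm_nonneg)
  also have "\<dots> \<le> 2 * (l2_norm M f)\<^sup>2 + 2 * (l2_norm M g)\<^sup>2"
    using zero_le_power2[of "l2_norm M f - l2_norm M g"] by (simp add: power2_eq_square algebra_simps)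
  finally show ?thesis .
qed

lemma l2_tendsto_norm:
  assumes "\<And>n. f n \<in> L2 M" "u \<in> L2 M" "(\<lambda>n. l2_norm M (\<lambda>x. f n x - u x)) \<longlonglongrightarrow> 0"
  shows "(\<lambda>n. l2_norm M (f n)) \<longlonglongrightarrow> l2_norm M u"
proof (rule LIM_zero_cancel, rule Lim_null_comparison[OF _ assms(3)])
  show "\<forall>\<^sub>F n in sequentially. norm (l2_norm M (f n) - l2_norm M u) \<le> l2_norm M (\<lambda>x. f n x - u x)"
    using l2_norm_abs_diff assms by (auto intro!: always_eventually)
qed

text \<open>Riesz-Fischer for rapidly Cauchy sequences. The squared increments, weighted by
  \<open>2 ^ n\<close>, still have summable integrals, since
  \<open>2 ^ n * ((1/2) ^ n)\<^sup>2 = (1/2) ^ n\<close>; hence the weighted series is finite almost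
  everywhere. As \<open>cmod d \<le> 2 ^ n * (cmod d)\<^sup>2 + (1/2) ^ n\<close>, the increments
  themselves are then absolutely summable.\<close>

lemma l2_complete:
  assumes f: "\<And>n. f n \<in> L2 M"
    and d: "\<And>n. l2_norm M (\<lambda>x. f (Suc n) x - f n x) \<le> (1/2) ^ n"
  shows "\<exists>u\<in>L2 M. (\<lambda>n. l2_norm M (\<lambda>x. f n x - u x)) \<longlonglongrightarrow> 0"
proof -
  note [measurable] = L2_measurable[OF f]
  define D where "D n x = f (Suc n) x - f n x" for n x
  have D_eq: "D n = (\<lambda>x. f (Suc n) x - f n x)" for n by (simp add: D_def fun_eq_iff)
  have D_L2: "D n \<in> L2 M" for n unfolding D_def by (intro L2_diff f)
  note [measurable] = L2_measurable[OF D_L2]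
  define G where "G x = (\<Sum>n. ennreal (2 ^ n * (cmod (D n x))\<^sup>2))" for x
  have nnD: "(\<integral>\<^sup>+x. ennreal (2 ^ n * (cmod (D n x))\<^sup>2) \<partial>M) \<le> ennreal ((1/2) ^ n)" for n
  proof -
    have "(\<integral>\<^sup>+x. ennreal (2 ^ n * (cmod (D n x))\<^sup>2) \<partial>M) = ennreal (LINT x|M. 2 ^ n * (cmod (D n x))\<^sup>2)"
      by (intro nn_integral_eq_integral) (auto simp: L2_integrable D_L2)
    also have "(LINT x|M. 2 ^ n * (cmod (D n x))\<^sup>2) = 2 ^ n * (l2_norm M (D n))\<^sup>2"
      by (simp add: l2_norm_square)
    also have "\<dots> \<le> 2 ^ n * ((1/2) ^ n)\<^sup>2"
      using d[of n] D_eq by (intro mult_left_mono power_mono) (auto simp: l2_norm_nonneg)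
    also have "\<dots> = (1/2) ^ n" by (simp add: power2_eq_square power_divide)
    finally show ?thesis by (simp add: ennreal_leI)
  qed
  have "(\<integral>\<^sup>+x. G x \<partial>M) = (\<Sum>n. \<integral>\<^sup>+x. ennreal (2 ^ n * (cmod (D n x))\<^sup>2) \<partial>M)"
    unfolding G_def by (intro nn_integral_suminf) auto
  also have "\<dots> \<le> (\<Sum>n. ennreal ((1/2) ^ n))" by (intro suminf_le nnD) auto
  also have "\<dots> = ennreal (\<Sum>n. (1/2) ^ n)" by (intro suminf_ennreal2 summable_geometric) auto
  also have "\<dots> < \<infinity>" by simp
  finally have "AE x in M. G x \<noteq> \<infinity>"
    by (intro nn_integral_noteq_infinite) (auto simp: G_def less_top)
  then have conv: "AE x in M. convergent (\<lambda>n. f n x)"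
  proof eventually_elim
    fix x assume "G x \<noteq> \<infinity>"
    then have s2: "summable (\<lambda>n. 2 ^ n * (cmod (D n x))\<^sup>2)"
      unfolding G_def by (intro summable_suminf_not_top) (auto simp: infinity_ennreal_def)
    have s3: "summable (\<lambda>n. (1/2) ^ n :: real)" by (intro summable_geometric) simp
    have "summable (\<lambda>n. D n x)"
    proof (rule summable_comparison_test'[OF summable_add[OF s2 s3], of 0])
      fix n
      define a where "a = (2::real) ^ n"
      have a: "a > 0" "(1/2) ^ n = 1 / a" by (auto simp: a_def power_divide)
      have "0 \<le> (a * cmod (D n x) - 1)\<^sup>2 / a" using a by simp
      also have "\<dots> = a * (cmod (D n x))\<^sup>2 - 2 * cmod (D n x) + 1 / a"
        using a by (simp add: field_simps power2_eq_square)
      finally show "norm (D n x) \<le> 2 ^ n * (cmod (D n x))\<^sup>2 + (1/2) ^ n"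
        using a norm_ge_zero[of "D n x"] unfolding a_def[symmetric] by linarith
    qed
    then have "convergent (\<lambda>n. \<Sum>i<n. D i x)" by (simp add: summable_iff_convergent)
    then have "convergent (\<lambda>n. (\<Sum>i<n. D i x) + f 0 x)" by (intro convergent_add convergent_const)
    moreover have "(\<Sum>i<n. D i x) + f 0 x = f n x" for n
      by (induction n) (auto simp: D_def algebra_simps)
    ultimately show "convergent (\<lambda>n. f n x)" by simp
  qed
  define u where "u x = lim (\<lambda>n. f n x)" for x
  have um[measurable]: "u \<in> borel_measurable M" unfolding u_def by measurable
  have lim: "AE x in M. (\<lambda>n. f n x) \<longlonglongrightarrow> u x"
    using conv by eventually_elim (simp add: u_def convergent_LIMSEQ_iff)
  \<comment> \<open>The subtracted term is what lets the induction close: one more increment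
    \<open>(1/2) ^ (m + k)\<close> is exactly the change of
    \<open>- 2 * (1/2) ^ (m + k)\<close>.\<close>
  have dist_le: "l2_norm M (\<lambda>x. f (m + k) x - f m x) \<le> 2 * (1/2) ^ m - 2 * (1/2) ^ (m + k)" for m k
  proof (induction k)
    case 0 then show ?case by (simp add: l2_norm_def)
  next
    case (Suc k)
    have "l2_norm M (\<lambda>x. f (m + Suc k) x - f m x)
      \<le> l2_norm M (\<lambda>x. f (Suc (m + k)) x - f (m + k) x) + l2_norm M (\<lambda>x. f (m + k) x - f m x)"
      using l2_norm_triangle_diff[OF f[of "m + Suc k"] f[of "m + k"] f[of m]] by simp
    also have "\<dots> \<le> (1/2) ^ (m + k) + (2 * (1/2) ^ m - 2 * (1/2) ^ (m + k))"
      using Suc d by (intro add_mono)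
    finally show ?case by simp
  qed
  \<comment> \<open>Fatou's lemma along \<open>k\<close>: \<open>f (m + k) - f m\<close> tends
    pointwise to \<open>u - f m\<close>, and all its norms obey the telescoped bound. Membership of
    \<open>u\<close> in L2 comes out of the same estimate.\<close>
  have bound: "(\<integral>\<^sup>+x. ennreal ((cmod (f m x - u x))\<^sup>2) \<partial>M) \<le> ennreal ((2 * (1/2) ^ m)\<^sup>2)" for m
  proof -
    have "(\<integral>\<^sup>+x. ennreal ((cmod (f m x - u x))\<^sup>2) \<partial>M)
        = (\<integral>\<^sup>+x. liminf (\<lambda>k. ennreal ((cmod (f (m + k) x - f m x))\<^sup>2)) \<partial>M)"
    proof (rule nn_integral_cong_AE, use lim in eventually_elim)
      fix x assume "(\<lambda>n. f n x) \<longlonglongrightarrow> u x"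
      then have "(\<lambda>k. f (k + m) x) \<longlonglongrightarrow> u x" by (rule LIMSEQ_ignore_initial_segment)
      then have "(\<lambda>k. ennreal ((cmod (f (m + k) x - f m x))\<^sup>2)) \<longlonglongrightarrow> ennreal ((cmod (u x - f m x))\<^sup>2)"
        by (intro tendsto_ennrealI tendsto_intros) (simp add: add.commute)
      from lim_imp_Liminf[OF sequentially_bot this]
      show "ennreal ((cmod (f m x - u x))\<^sup>2) = liminf (\<lambda>k. ennreal ((cmod (f (m + k) x - f m x))\<^sup>2))"
        by (simp only: norm_minus_commute[of "f m x" "u x"])
    qed
    also have "\<dots> \<le> liminf (\<lambda>k. \<integral>\<^sup>+x. ennreal ((cmod (f (m + k) x - f m x))\<^sup>2) \<partial>M)"
      by (intro nn_integral_liminf) auto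
    also have "\<dots> \<le> liminf (\<lambda>k::nat. ennreal ((2 * (1/2) ^ m)\<^sup>2))"
    proof (intro Liminf_mono always_eventually allI)
      fix k
      have "(\<integral>\<^sup>+x. ennreal ((cmod (f (m + k) x - f m x))\<^sup>2) \<partial>M)
        = ennreal ((l2_norm M (\<lambda>x. f (m + k) x - f m x))\<^sup>2)"
        unfolding l2_norm_square by (intro nn_integral_eq_integral) (auto intro!: L2_integrable L2_diff f)
      also have "\<dots> \<le> ennreal ((2 * (1/2) ^ m)\<^sup>2)"
      proof (intro ennreal_leI power_mono l2_norm_nonneg)
        have "0 \<le> 2 * (1/2::real) ^ (m + k)" by simp
        then show "l2_norm M (\<lambda>x. f (m + k) x - f m x) \<le> 2 * (1/2) ^ m"
          using dist_le[of m k] by linarith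
      qed
      finally show "(\<integral>\<^sup>+x. ennreal ((cmod (f (m + k) x - f m x))\<^sup>2) \<partial>M) \<le> ennreal ((2 * (1/2) ^ m)\<^sup>2)" .
    qed
    finally show ?thesis by (simp add: Liminf_const)
  qed
  have du: "(\<lambda>x. f m x - u x) \<in> L2 M" for m
  proof -
    have "(\<integral>\<^sup>+x. ennreal (norm ((cmod (f m x - u x))\<^sup>2)) \<partial>M) < \<infinity>"
      using bound[of m] by (simp add: le_less_trans ennreal_less_top)
    then show ?thesis unfolding L2_def by (auto intro!: integrableI_bounded)
  qed
  have "u \<in> L2 M" using L2_diff[OF f[of 0] du[of 0]] by simp
  have "l2_norm M (\<lambda>x. f m x - u x) \<le> 2 * (1/2) ^ m" for m
  proof (rule power2_le_imp_le)
    have "ennreal ((l2_norm M (\<lambda>x. f m x - u x))\<^sup>2) \<le> ennreal ((2 * (1/2) ^ m)\<^sup>2)"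
      unfolding l2_norm_square using bound[of m]
      by (subst nn_integral_eq_integral[symmetric]) (auto intro!: L2_integrable du)
    then show "(l2_norm M (\<lambda>x. f m x - u x))\<^sup>2 \<le> (2 * (1/2) ^ m)\<^sup>2" by (simp add: ennreal_le_iff)
  qed simp
  then have "\<forall>\<^sub>F m in sequentially. norm (l2_norm M (\<lambda>x. f m x - u x)) \<le> 2 * (1/2) ^ m"
    by (auto simp: l2_norm_nonneg intro!: always_eventually)
  moreover have "(\<lambda>m. 2 * (1/2) ^ m :: real) \<longlonglongrightarrow> 0"
    by (intro tendsto_mult_right_zero LIMSEQ_power_zero) simp
  ultimately have "(\<lambda>m. l2_norm M (\<lambda>x. f m x - u x)) \<longlonglongrightarrow> 0"
    by (rule Lim_null_comparison)
  with \<open>u \<in> L2 M\<close> show ?thesis by blast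
qed

section \<open>Spectral integrals\<close>

lemma simple_function_sum_indicator:
  fixes s :: "real \<Rightarrow> real"
  assumes "finite (range s)"
  shows "s l = (\<Sum>c\<in>range s. c * indicator (s -` {c}) l)"
proof -
  have "(\<Sum>c\<in>range s. c * indicator (s -` {c}) l) = (\<Sum>c\<in>range s. if s l = c then c else 0)"
    by (intro sum.cong) (auto simp: indicator_def)
  also have "\<dots> = s l" using assms by simp
  finally show ?thesis by simp
qed

lemma simple_function_borelD:
  fixes s :: "real \<Rightarrow> real"
  assumes "simple_function borel s"
  shows "finite (range s)" "s -` {c} \<in> sets borel" "s \<in> borel_measurable borel"
  using simple_functionD[OF assms] assms by (auto intro: borel_measurable_simple_function)

lemma integrable_simple_mult:
  fixes s t :: "real \<Rightarrow> real" and M :: "real measure"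
  assumes fin: "finite_measure M" and sets: "sets M = sets borel" and s: "simple_function borel s"
    and t: "simple_function borel t" and C: "C \<in> sets borel"
  shows "integrable M (\<lambda>l. indicator C l * s l * t l)"
proof -
  interpret finite_measure M by (rule fin)
  obtain a b where a: "\<And>l. \<bar>s l\<bar> \<le> a" and b: "\<And>l. \<bar>t l\<bar> \<le> b"
    using finite_imp_bounded[OF simple_function_borelD(1)[OF s]]
      finite_imp_bounded[OF simple_function_borelD(1)[OF t]]
    unfolding bounded_iff by auto
  note [measurable] = simple_function_borelD(3)[OF s] simple_function_borelD(3)[OF t] C
  have "(\<lambda>l. indicator C l * s l * t l) \<in> borel_measurable borel" by measurable
  then have m: "(\<lambda>l. indicator C l * s l * t l) \<in> borel_measurable M"
    using measurable_cong_sets[OF sets refl, of borel] by blast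
  show ?thesis
  proof (rule integrable_const_bound[of _ "a * b"])
    have "\<bar>indicator C l * s l * t l\<bar> \<le> a * b" for l
    proof -
      have "\<bar>s l\<bar> * \<bar>t l\<bar> \<le> a * b" by (intro mult_mono a b) (auto intro: order_trans[OF _ a])
      moreover have "0 \<le> a * b" by (rule order_trans[OF _ calculation]) simp
      ultimately show ?thesis by (auto simp: indicator_def abs_mult)
    qed
    then show "AE l in M. norm (indicator C l * s l * t l) \<le> a * b" by simp
  qed (rule m)
qed

lemma integrable_square_diff:
  fixes f g :: "real \<Rightarrow> real"
  assumes "integrable M (\<lambda>l. (f l)\<^sup>2)" "integrable M (\<lambda>l. (g l)\<^sup>2)"
    "f \<in> borel_measurable M" "g \<in> borel_measurable M"
  shows "integrable M (\<lambda>l. (f l - g l)\<^sup>2)"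
  by (rule Bochner_Integration.integrable_bound[where f="\<lambda>l. 2 * (f l)\<^sup>2 + 2 * (g l)\<^sup>2"])
    (use assms norm_add_square_le[of "f _" "- g _"] in auto)

text \<open>A fixed sequence of simple functions, dominated by \<open>2\<bar>\<phi>\<bar>\<close>, that approximates \<open>\<phi>\<close> in every
  \<open>L\<^sup>2(\<mu>)\<close> simultaneously; this makes spectral integrals linear.\<close>

definition simple_approx :: "(real \<Rightarrow> real) \<Rightarrow> nat \<Rightarrow> real \<Rightarrow> real" where
  "simple_approx \<phi> = (SOME c. (\<forall>n. simple_function borel (c n)) \<and>
     (\<forall>l. (\<lambda>n. c n l) \<longlonglongrightarrow> \<phi> l) \<and> (\<forall>n l. \<bar>c n l\<bar> \<le> 2 * \<bar>\<phi> l\<bar>))"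

lemma simple_approx:
  assumes "\<phi> \<in> borel_measurable borel"
  shows "simple_function borel (simple_approx \<phi> n)" "(\<lambda>n. simple_approx \<phi> n l) \<longlonglongrightarrow> \<phi> l"
    "\<bar>simple_approx \<phi> n l\<bar> \<le> 2 * \<bar>\<phi> l\<bar>"
proof -
  have "\<exists>c. (\<forall>n. simple_function borel (c n)) \<and>
     (\<forall>l. (\<lambda>n. c n l) \<longlonglongrightarrow> \<phi> l) \<and> (\<forall>n l. \<bar>c n l\<bar> \<le> 2 * \<bar>\<phi> l\<bar>)"
    using borel_measurable_implies_sequence_metric[OF assms, of 0] by (auto simp: dist_real_def)
  from someI_ex[OF this, folded simple_approx_def]
  show "simple_function borel (simple_approx \<phi> n)" "(\<lambda>n. simple_approx \<phi> n l) \<longlonglongrightarrow> \<phi> l"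
    "\<bar>simple_approx \<phi> n l\<bar> \<le> 2 * \<bar>\<phi> l\<bar>" by blast+
qed

lemma simple_approx_diff_le:
  assumes "\<phi> \<in> borel_measurable borel"
  shows "(simple_approx \<phi> n l - \<phi> l)\<^sup>2 \<le> 9 * (\<phi> l)\<^sup>2"
proof -
  have "\<bar>simple_approx \<phi> n l - \<phi> l\<bar> \<le> 3 * \<bar>\<phi> l\<bar>" using simple_approx(3)[OF assms, of n l] by linarith
  then have "\<bar>simple_approx \<phi> n l - \<phi> l\<bar>\<^sup>2 \<le> (3 * \<bar>\<phi> l\<bar>)\<^sup>2" by (rule power_mono) simp
  then show ?thesis by (simp add: power_mult_distrib)
qed

text \<open>Dominated convergence, with \<open>9 * (\<phi> l)\<^sup>2\<close> for the differences
  and \<open>4 * (\<phi> l)\<^sup>2\<close> for the products. The third limit, localized to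
  \<open>C\<close>, is what later measures the component of a spectral integral in the range of
  \<open>E C\<close>.\<close>

lemma simple_approx_L2:
  assumes \<phi>: "\<phi> \<in> borel_measurable borel" and N: "sets N = sets borel" and i: "integrable N (\<lambda>l. (\<phi> l)\<^sup>2)"
  shows "integrable N (\<lambda>l. (simple_approx \<phi> n l - \<phi> l)\<^sup>2)"
    "(\<lambda>n. LINT l|N. (simple_approx \<phi> n l - \<phi> l)\<^sup>2) \<longlonglongrightarrow> 0"
    "C \<in> sets borel \<Longrightarrow> (\<lambda>n. LINT l|N. indicator C l * simple_approx \<phi> n l * simple_approx \<phi> n l)
       \<longlonglongrightarrow> (LINT l|N. indicator C l * (\<phi> l)\<^sup>2)"
proof -
  note meq = measurable_cong_sets[OF N refl]
  have [measurable]: "\<phi> \<in> borel_measurable N" "simple_approx \<phi> n \<in> borel_measurable N" for n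
    unfolding meq using \<phi> simple_function_borelD(3)[OF simple_approx(1)[OF \<phi>]] by auto
  note i9 = integrable_mult_right[OF i, of 9] and i4 = integrable_mult_right[OF i, of 4]
  show "integrable N (\<lambda>l. (simple_approx \<phi> n l - \<phi> l)\<^sup>2)"
    by (rule Bochner_Integration.integrable_bound[OF i9]) (auto simp: simple_approx_diff_le[OF \<phi>])
  have "(\<lambda>n. LINT l|N. (simple_approx \<phi> n l - \<phi> l)\<^sup>2) \<longlonglongrightarrow> (LINT l|N. 0)"
  proof (rule integral_dominated_convergence[OF _ _ i9])
    show "AE l in N. (\<lambda>n. (simple_approx \<phi> n l - \<phi> l)\<^sup>2) \<longlonglongrightarrow> 0"
      using tendsto_power[OF LIM_zero[OF simple_approx(2)[OF \<phi>]], where n=2] by (intro AE_I2) simp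
  qed (auto simp: simple_approx_diff_le[OF \<phi>])
  then show "(\<lambda>n. LINT l|N. (simple_approx \<phi> n l - \<phi> l)\<^sup>2) \<longlonglongrightarrow> 0" by simp
  assume "C \<in> sets borel"
  then have [measurable]: "C \<in> sets N" using N by simp
  show "(\<lambda>n. LINT l|N. indicator C l * simple_approx \<phi> n l * simple_approx \<phi> n l)
       \<longlonglongrightarrow> (LINT l|N. indicator C l * (\<phi> l)\<^sup>2)"
  proof (rule integral_dominated_convergence[OF _ _ i4])
    show "AE l in N. (\<lambda>n. indicator C l * simple_approx \<phi> n l * simple_approx \<phi> n l) \<longlonglongrightarrow> indicator C l * (\<phi> l)\<^sup>2"
      unfolding power2_eq_square mult.assoc
      by (intro AE_I2 tendsto_mult tendsto_const simple_approx(2)[OF \<phi>])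
    have "norm (indicator C l * simple_approx \<phi> n l * simple_approx \<phi> n l) \<le> 4 * (\<phi> l)\<^sup>2" for n l
    proof -
      have "\<bar>simple_approx \<phi> n l\<bar>\<^sup>2 \<le> (2 * \<bar>\<phi> l\<bar>)\<^sup>2" by (rule power_mono[OF simple_approx(3)[OF \<phi>]]) simp
      then show ?thesis by (auto simp: indicator_def abs_mult power2_eq_square algebra_simps)
    qed
    then show "\<And>n. AE l in N. norm (indicator C l * simple_approx \<phi> n l * simple_approx \<phi> n l) \<le> 4 * (\<phi> l)\<^sup>2"
      by simp
  qed auto
qed

section \<open>Projection-valued measures, their diagonal measures and the spectral isometry\<close>

locale pvm =
  fixes M :: "'a measure" and E :: "real set \<Rightarrow> ('a \<Rightarrow> complex) \<Rightarrow> ('a \<Rightarrow> complex)"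
  assumes pvm: "projection_valued_measure M E"
begin

lemma E_L2: "B \<in> sets borel \<Longrightarrow> f \<in> L2 M \<Longrightarrow> E B f \<in> L2 M"
  and E_sym: "B \<in> sets borel \<Longrightarrow> f \<in> L2 M \<Longrightarrow> g \<in> L2 M \<Longrightarrow>
    l2_inner M (E B f) g = l2_inner M f (E B g)"
  and E_comp: "B \<in> sets borel \<Longrightarrow> C \<in> sets borel \<Longrightarrow> f \<in> L2 M \<Longrightarrow>
    AE x in M. E B (E C f) x = E (B \<inter> C) f x"
  and E_UNIV: "f \<in> L2 M \<Longrightarrow> AE x in M. E UNIV f x = f x"
  using pvm unfolding projection_valued_measure_def by simp_all

lemma E_sums: "range B \<subseteq> sets borel \<Longrightarrow> disjoint_family B \<Longrightarrow> f \<in> L2 M \<Longrightarrow> g \<in> L2 M \<Longrightarrow>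
    (\<lambda>n. l2_inner M (E (B n) f) g) sums l2_inner M (E (\<Union>n. B n) f) g" for B :: "nat \<Rightarrow> real set"
  using pvm unfolding projection_valued_measure_def by blast

lemma E_inner: "B \<in> sets borel \<Longrightarrow> C \<in> sets borel \<Longrightarrow> f \<in> L2 M \<Longrightarrow> g \<in> L2 M \<Longrightarrow>
    l2_inner M (E B f) (E C g) = l2_inner M (E (C \<inter> B) f) g"
  using E_sym[of C "E B f" g] l2_inner_cong[OF E_comp[of C B f], of g g] by (simp add: E_L2)

text \<open>Symmetry moves \<open>E B\<close> to the test vector, and an inner product sees
  \<open>f\<close> only up to null sets. Additivity and homogeneity of \<open>E B\<close> are
  derived in the same way.\<close>

lemma E_cong:
  assumes "B \<in> sets borel" "f \<in> L2 M" "g \<in> L2 M" "AE x in M. f x = g x"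
  shows "AE x in M. E B f x = E B g x"
proof (rule AE_eqI_inner)
  fix h assume "h \<in> L2 M"
  then show "l2_inner M (E B f) h = l2_inner M (E B g) h"
    using assms l2_inner_cong[OF assms(4), of "E B h" "E B h"] by (simp add: E_sym E_L2)
qed (use assms in \<open>auto simp: E_L2\<close>)

lemma E_add:
  assumes "B \<in> sets borel" "f \<in> L2 M" "g \<in> L2 M"
  shows "AE x in M. E B (\<lambda>x. f x + g x) x = E B f x + E B g x"
  by (rule AE_eqI_inner) (use assms in \<open>auto simp: E_L2 L2_add E_sym l2_inner_add_left\<close>)

lemma E_diff:
  assumes "B \<in> sets borel" "f \<in> L2 M" "g \<in> L2 M"
  shows "AE x in M. E B (\<lambda>x. f x - g x) x = E B f x - E B g x"
  by (rule AE_eqI_inner) (use assms in \<open>auto simp: E_L2 L2_diff E_sym l2_inner_diff_left\<close>)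

lemma E_cmult:
  assumes "B \<in> sets borel" "f \<in> L2 M"
  shows "AE x in M. E B (\<lambda>x. c * f x) x = c * E B f x"
  by (rule AE_eqI_inner) (use assms in \<open>auto simp: E_L2 L2_cmult E_sym l2_inner_cmult_left\<close>)

lemma E_diag: "B \<in> sets borel \<Longrightarrow> f \<in> L2 M \<Longrightarrow> l2_inner M (E B f) f = of_real ((l2_norm M (E B f))\<^sup>2)"
  using E_inner[of B B f f] by (simp add: l2_inner_self)

lemma E_norm_le:
  assumes "B \<in> sets borel" "f \<in> L2 M" shows "l2_norm M (E B f) \<le> l2_norm M f"
proof -
  have "(l2_norm M (E B f))\<^sup>2 = cmod (l2_inner M (E B f) f)" using assms by (simp add: E_diag norm_power)
  also have "\<dots> \<le> l2_norm M (E B f) * l2_norm M f" using assms by (intro l2_Cauchy_Schwarz E_L2)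
  finally show ?thesis using l2_norm_nonneg[of M "E B f"] l2_norm_nonneg[of M f]
    by (metis mult_le_cancel_left_pos order_le_less power2_eq_square)
qed

text \<open>The empty set is a disjoint union of infinitely many copies of itself, and a constant
  series converges only if its terms vanish.\<close>

lemma E_empty:
  assumes "f \<in> L2 M" "g \<in> L2 M" shows "l2_inner M (E {} f) g = 0"
proof -
  have "(\<lambda>n::nat. l2_inner M (E {} f) g) sums l2_inner M (E (\<Union>n::nat. {}) f) g"
    using assms by (intro E_sums) (auto simp: disjoint_family_on_def)
  then show ?thesis by (metis sums_summable summable_const_iff)
qed

abbreviation "\<mu> \<equiv> diagonal_measure M E"

lemma sets_diagonal [simp]: "sets (\<mu> f) = sets borel"
  and space_diagonal [simp]: "space (\<mu> f) = UNIV"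
  using sets.sigma_sets_eq[of "borel :: real measure"] by (simp_all add: diagonal_measure_def)

lemma measurable_diagonal [simp]: "borel_measurable (\<mu> f) = borel_measurable borel"
  by (rule measurable_cong_sets) auto

text \<open>\<open>measure_of\<close> takes the prescribed values only if the set function is a
  measure. Countable additivity comes from the series for \<open>l2_inner M (E B f) f\<close>, whose
  terms are nonnegative because \<open>E_diag\<close> identifies them with squared norms.\<close>

lemma emeasure_diagonal:
  assumes f: "f \<in> L2 M" and B: "B \<in> sets borel"
  shows "emeasure (\<mu> f) B = ennreal ((l2_norm M (E B f))\<^sup>2)"
proof -
  have "emeasure (\<mu> f) B = ennreal (Re (l2_inner M (E B f) f))"
  proof (rule emeasure_measure_of[OF diagonal_measure_def])
    show "positive (sets (\<mu> f)) (\<lambda>B. ennreal (Re (l2_inner M (E B f) f)))"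
      using E_empty[OF f f] by (simp add: positive_def)
    show "countably_additive (sets (\<mu> f)) (\<lambda>B. ennreal (Re (l2_inner M (E B f) f)))"
    proof (rule countably_additiveI)
      fix A :: "nat \<Rightarrow> real set"
      assume A: "range A \<subseteq> sets (\<mu> f)" "disjoint_family A"
      have nn: "0 \<le> Re (l2_inner M (E (A i) f) f)" for i
        using A f by (subst E_diag) auto
      show "(\<Sum>i. ennreal (Re (l2_inner M (E (A i) f) f))) = ennreal (Re (l2_inner M (E (\<Union>i. A i) f) f))"
        using A f by (intro suminf_ennreal_eq[OF nn] sums_Re E_sums) auto
    qed
  qed (use B in auto)
  then show ?thesis using f B by (simp add: E_diag)
qed

lemma finite_measure_diagonal: "f \<in> L2 M \<Longrightarrow> finite_measure (\<mu> f)"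
  by (rule finite_measureI) (simp add: emeasure_diagonal)

lemma measure_diagonal: "f \<in> L2 M \<Longrightarrow> B \<in> sets borel \<Longrightarrow> measure (\<mu> f) B = (l2_norm M (E B f))\<^sup>2"
  by (simp add: measure_def emeasure_diagonal)

abbreviation "S \<equiv> simple_spectral_integral E"

lemma S_eq: "S s f = (\<lambda>x. \<Sum>c\<in>range s. c *\<^sub>R E (s -` {c}) f x)"
  by (simp add: simple_spectral_integral_def fun_eq_iff)

lemma S_L2: "simple_function borel s \<Longrightarrow> f \<in> L2 M \<Longrightarrow> S s f \<in> L2 M"
  unfolding S_eq by (intro L2_sum L2_scaleR E_L2 simple_function_borelD)

text \<open>The projections multiply by intersecting sets, so the double sum over levels collapses
  to diagonal measures of intersections of level sets. \<open>C = UNIV\<close> gives the isometry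
  behind spectral integrals; general \<open>C\<close> describes how the projections act on
  them.\<close>

lemma E_S_inner:
  assumes s: "simple_function borel s" and t: "simple_function borel t" and C: "C \<in> sets borel"
    and f: "f \<in> L2 M"
  shows "l2_inner M (E C (S s f)) (S t f) = of_real (LINT l|\<mu> f. indicator C l * s l * t l)"
proof -
  interpret finite_measure "\<mu> f" by (rule finite_measure_diagonal[OF f])
  note sD = simple_function_borelD[OF s] and tD = simple_function_borelD[OF t]
  have E1: "l2_inner M (E C (S s f)) h = (\<Sum>c\<in>range s. c *\<^sub>R l2_inner M (E (C \<inter> s -` {c}) f) h)"
    if h: "h \<in> L2 M" for h
  proof -
    have "l2_inner M (E C (S s f)) h = l2_inner M (S s f) (E C h)"
      by (intro E_sym C S_L2 s f h)
    also have "\<dots> = (\<Sum>c\<in>range s. c *\<^sub>R l2_inner M (E (s -` {c}) f) (E C h))"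
      unfolding S_eq using sD f h C
      by (subst l2_inner_sum_left) (auto simp: l2_inner_scaleR_left L2_scaleR E_L2)
    also have "\<dots> = (\<Sum>c\<in>range s. c *\<^sub>R l2_inner M (E (C \<inter> s -` {c}) f) h)"
      using sD f h C by (intro sum.cong refl arg_cong2[where f="(*\<^sub>R)"] E_inner) auto
    finally show ?thesis .
  qed
  have E2: "l2_inner M (E (C \<inter> s -` {c}) f) (S t f)
    = (\<Sum>d\<in>range t. d *\<^sub>R of_real (measure (\<mu> f) (t -` {d} \<inter> (C \<inter> s -` {c}))))" for c
  proof -
    have B: "C \<inter> s -` {c} \<in> sets borel" using C sD by auto
    have "l2_inner M (E (C \<inter> s -` {c}) f) (S t f)
      = (\<Sum>d\<in>range t. d *\<^sub>R l2_inner M (E (C \<inter> s -` {c}) f) (E (t -` {d}) f))"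
      unfolding S_eq using tD f B
      by (subst l2_inner_sum_right) (auto simp: l2_inner_scaleR_right L2_scaleR E_L2)
    also have "\<dots> = (\<Sum>d\<in>range t. d *\<^sub>R of_real (measure (\<mu> f) (t -` {d} \<inter> (C \<inter> s -` {c}))))"
    proof (intro sum.cong refl arg_cong2[where f="(*\<^sub>R)"])
      fix d
      have "t -` {d} \<inter> (C \<inter> s -` {c}) \<in> sets borel" using tD B by auto
      then show "l2_inner M (E (C \<inter> s -` {c}) f) (E (t -` {d}) f)
        = of_real (measure (\<mu> f) (t -` {d} \<inter> (C \<inter> s -` {c})))"
        using E_inner[OF B tD(2) f f] f by (simp only: E_diag measure_diagonal)
    qed
    finally show ?thesis .
  qed
  have "(\<lambda>l. indicator C l * s l * t l)
    = (\<lambda>l. \<Sum>c\<in>range s. \<Sum>d\<in>range t. (c * d) * indicator (t -` {d} \<inter> (C \<inter> s -` {c})) l)"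
  proof
    fix l
    have "indicator C l * s l * t l = indicator C l * (\<Sum>c\<in>range s. c * indicator (s -` {c}) l)
        * (\<Sum>d\<in>range t. d * indicator (t -` {d}) l)"
      using simple_function_sum_indicator[OF sD(1), of l] simple_function_sum_indicator[OF tD(1), of l]
      by presburger
    also have "\<dots> = (\<Sum>c\<in>range s. \<Sum>d\<in>range t. (c * d) * indicator (t -` {d} \<inter> (C \<inter> s -` {c})) l)"
      unfolding sum_distrib_left sum_distrib_right sum_product
      by (subst sum.swap) (auto simp: indicator_inter_arith mult_ac intro!: sum.cong)
    finally show "indicator C l * s l * t l = (\<Sum>c\<in>range s. \<Sum>d\<in>range t. (c * d) * indicator (t -` {d} \<inter> (C \<inter> s -` {c})) l)" .
  qed
  then have "(LINT l|\<mu> f. indicator C l * s l * t l)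
    = (LINT l|\<mu> f. (\<Sum>c\<in>range s. \<Sum>d\<in>range t. (c * d) * indicator (t -` {d} \<inter> (C \<inter> s -` {c})) l))"
    by simp
  also have "\<dots> = (\<Sum>c\<in>range s. \<Sum>d\<in>range t. (c * d) * measure (\<mu> f) (t -` {d} \<inter> (C \<inter> s -` {c})))"
  proof -
    have m: "t -` {d} \<inter> (C \<inter> s -` {c}) \<in> sets (\<mu> f)" for c d using C sD tD by auto
    then have i: "integrable (\<mu> f) (\<lambda>l. (c * d) * indicator (t -` {d} \<inter> (C \<inter> s -` {c})) l :: real)" for c d
      by (intro integrable_mult_right integrable_real_indicator) (auto simp: less_top[symmetric])
    show ?thesis using i m by (simp add: Bochner_Integration.integral_sum)
  qed
  finally show ?thesis
    using E1[OF S_L2[OF t f]] by (simp add: E2 sum_distrib_left scaleR_conv_of_real mult.assoc scaleR_sum_right)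
qed

lemma S_inner:
  assumes s: "simple_function borel s" and t: "simple_function borel t" and f: "f \<in> L2 M"
  shows "l2_inner M (S s f) (S t f) = of_real (LINT l|\<mu> f. s l * t l)"
  using E_S_inner[OF s t, of UNIV f] f l2_inner_cong[OF E_UNIV[OF S_L2[OF s f]], of "S t f" "S t f"]
  by (simp add: S_L2 s t E_L2)

lemma S_diff_norm:
  assumes s: "simple_function borel s" and t: "simple_function borel t" and f: "f \<in> L2 M"
  shows "(l2_norm M (\<lambda>x. S s f x - S t f x))\<^sup>2 = (LINT l|\<mu> f. (s l - t l)\<^sup>2)"
proof -
  note i = integrable_simple_mult[OF finite_measure_diagonal[OF f] sets_diagonal, of _ _ UNIV, simplified]
  have "complex_of_real ((l2_norm M (\<lambda>x. S s f x - S t f x))\<^sup>2)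
    = of_real ((LINT l|\<mu> f. s l * s l) - (LINT l|\<mu> f. s l * t l) - (LINT l|\<mu> f. t l * s l) + (LINT l|\<mu> f. t l * t l))"
    by (subst l2_norm_diff_square) (simp_all only: S_L2 s t f S_inner of_real_diff of_real_add)
  also have "(LINT l|\<mu> f. s l * s l) - (LINT l|\<mu> f. s l * t l) - (LINT l|\<mu> f. t l * s l) + (LINT l|\<mu> f. t l * t l)
    = (LINT l|\<mu> f. s l * s l - s l * t l - t l * s l + t l * t l)"
    using i s t by (simp add: mult.commute)
  also have "\<dots> = (LINT l|\<mu> f. (s l - t l)\<^sup>2)"
    by (simp add: power2_eq_square algebra_simps)
  finally show ?thesis by (simp only: of_real_eq_iff)
qed

lemma S_diff_norm_le:
  assumes s: "simple_function borel s" and t: "simple_function borel t" and f: "f \<in> L2 M"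
    and i: "integrable (\<mu> f) (\<lambda>l. (s l - \<phi> l)\<^sup>2)" "integrable (\<mu> f) (\<lambda>l. (t l - \<phi> l)\<^sup>2)"
  shows "(l2_norm M (\<lambda>x. S s f x - S t f x))\<^sup>2
    \<le> 2 * (LINT l|\<mu> f. (s l - \<phi> l)\<^sup>2) + 2 * (LINT l|\<mu> f. (t l - \<phi> l)\<^sup>2)"
proof -
  have "(LINT l|\<mu> f. (s l - t l)\<^sup>2) \<le> (LINT l|\<mu> f. 2 * (s l - \<phi> l)\<^sup>2 + 2 * (t l - \<phi> l)\<^sup>2)"
  proof (rule integral_mono')
    show "integrable (\<mu> f) (\<lambda>l. 2 * (s l - \<phi> l)\<^sup>2 + 2 * (t l - \<phi> l)\<^sup>2)" using i by simp
    fix l show "(s l - t l)\<^sup>2 \<le> 2 * (s l - \<phi> l)\<^sup>2 + 2 * (t l - \<phi> l)\<^sup>2"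
      using norm_add_square_le[of "s l - \<phi> l" "\<phi> l - t l"] by (simp add: power2_commute[of "\<phi> l"])
  qed auto
  then show ?thesis using i by (simp add: S_diff_norm[OF s t f])
qed

lemma E_S_norm:
  assumes s: "simple_function borel s" and C: "C \<in> sets borel" and f: "f \<in> L2 M"
  shows "(l2_norm M (E C (S s f)))\<^sup>2 = (LINT l|\<mu> f. indicator C l * s l * s l)"
proof -
  have "complex_of_real ((l2_norm M (E C (S s f)))\<^sup>2) = of_real (LINT l|\<mu> f. indicator C l * s l * s l)"
    using E_diag[OF C S_L2[OF s f]] E_S_inner[OF s s C f] by simp
  then show ?thesis by (simp only: of_real_eq_iff)
qed

text \<open>Replaces the existentially quantified sequence by one that depends on \<phi> alone: any
  admissible sequence and \<open>simple_approx\<close> are both close to \<phi> in the diagonal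
  measure, and the isometry carries this over to the operators. Only now can spectral integrals at
  different vectors be added.\<close>

lemma spectral_integral_simple_approx:
  assumes \<phi>: "\<phi> \<in> borel_measurable borel"
  shows "spectral_integral M E \<phi> f u \<longleftrightarrow> f \<in> L2 M \<and> u \<in> L2 M \<and> integrable (\<mu> f) (\<lambda>l. (\<phi> l)\<^sup>2) \<and>
    (\<lambda>n. l2_norm M (\<lambda>x. S (simple_approx \<phi> n) f x - u x)) \<longlonglongrightarrow> 0" (is "?L \<longleftrightarrow> ?R")
proof
  assume ?R
  then show ?L unfolding spectral_integral_def
    using simple_approx(1)[OF \<phi>] simple_approx_L2[OF \<phi> sets_diagonal] by blast
next
  assume ?L
  then obtain s where f: "f \<in> L2 M" and u: "u \<in> L2 M" and s: "\<And>n. simple_function borel (s n)"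
    and si: "\<And>n. integrable (\<mu> f) (\<lambda>l. (s n l - \<phi> l)\<^sup>2)"
    and l1: "(\<lambda>n. LINT l|\<mu> f. (s n l - \<phi> l)\<^sup>2) \<longlonglongrightarrow> 0"
    and l2: "(\<lambda>n. l2_norm M (\<lambda>x. S (s n) f x - u x)) \<longlonglongrightarrow> 0"
    unfolding spectral_integral_def by blast
  have sm: "s n \<in> borel_measurable borel" for n by (rule simple_function_borelD[OF s])
  \<comment> \<open>\<phi> is the difference of the bounded function \<open>s 0\<close> and the
    error \<open>s 0 - \<phi>\<close>, both square integrable.\<close>
  have "integrable (\<mu> f) (\<lambda>l. (s 0 l)\<^sup>2)"
    using integrable_simple_mult[OF finite_measure_diagonal[OF f] sets_diagonal s[of 0] s[of 0], of UNIV]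
    by (simp add: power2_eq_square)
  from integrable_square_diff[OF this si[of 0]]
  have "integrable (\<mu> f) (\<lambda>l. (s 0 l - (s 0 l - \<phi> l))\<^sup>2)" using \<phi> sm[of 0] by simp
  then have i: "integrable (\<mu> f) (\<lambda>l. (\<phi> l)\<^sup>2)" by simp
  note c = simple_approx(1)[OF \<phi>] and ca = simple_approx_L2[OF \<phi> sets_diagonal i]
  let ?c = "simple_approx \<phi>"
  have "(\<lambda>n. sqrt (2 * (LINT l|\<mu> f. (?c n l - \<phi> l)\<^sup>2) + 2 * (LINT l|\<mu> f. (s n l - \<phi> l)\<^sup>2))
      + l2_norm M (\<lambda>x. S (s n) f x - u x)) \<longlonglongrightarrow> sqrt (2 * 0 + 2 * 0) + 0"
    by (intro tendsto_intros ca(2) l1 l2)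
  then have lim: "(\<lambda>n. sqrt (2 * (LINT l|\<mu> f. (?c n l - \<phi> l)\<^sup>2) + 2 * (LINT l|\<mu> f. (s n l - \<phi> l)\<^sup>2))
      + l2_norm M (\<lambda>x. S (s n) f x - u x)) \<longlonglongrightarrow> 0" by simp
  have "norm (l2_norm M (\<lambda>x. S (?c n) f x - u x))
    \<le> sqrt (2 * (LINT l|\<mu> f. (?c n l - \<phi> l)\<^sup>2) + 2 * (LINT l|\<mu> f. (s n l - \<phi> l)\<^sup>2))
      + l2_norm M (\<lambda>x. S (s n) f x - u x)" for n
  proof -
    have "l2_norm M (\<lambda>x. S (?c n) f x - S (s n) f x)
      \<le> sqrt (2 * (LINT l|\<mu> f. (?c n l - \<phi> l)\<^sup>2) + 2 * (LINT l|\<mu> f. (s n l - \<phi> l)\<^sup>2))"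
      by (rule real_le_rsqrt) (rule S_diff_norm_le[OF c s f ca(1) si])
    then show ?thesis
      using l2_norm_triangle_diff[OF S_L2[OF c f] S_L2[OF s f] u, of n n]
      by (simp add: l2_norm_nonneg)
  qed
  then have "(\<lambda>n. l2_norm M (\<lambda>x. S (?c n) f x - u x)) \<longlonglongrightarrow> 0"
    by (intro Lim_null_comparison[OF _ lim] always_eventually) blast
  with f u i show ?R by blast
qed

lemma spectral_integral_unique:
  assumes \<phi>: "\<phi> \<in> borel_measurable borel"
    and u: "spectral_integral M E \<phi> f u" and w: "spectral_integral M E \<phi> f w"
  shows "AE x in M. u x = w x"
proof -
  note U = u[unfolded spectral_integral_simple_approx[OF \<phi>]] w[unfolded spectral_integral_simple_approx[OF \<phi>]]
  let ?c = "simple_approx \<phi>"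
  have c: "S (?c n) f \<in> L2 M" for n using U by (intro S_L2 simple_approx(1)[OF \<phi>]) auto
  have "l2_norm M (\<lambda>x. u x - w x) \<le> l2_norm M (\<lambda>x. S (?c n) f x - u x) + l2_norm M (\<lambda>x. S (?c n) f x - w x)" for n
    using l2_norm_triangle_diff[of u M "S (?c n) f" w] U c l2_norm_minus_commute[of M u "S (?c n) f"]
    by simp
  moreover have "(\<lambda>n. l2_norm M (\<lambda>x. S (?c n) f x - u x) + l2_norm M (\<lambda>x. S (?c n) f x - w x)) \<longlonglongrightarrow> 0"
    using tendsto_add[of _ 0 sequentially _ 0] U by auto
  ultimately have "l2_norm M (\<lambda>x. u x - w x) \<le> 0"
    by (intro LIMSEQ_le_const) auto
  then have "l2_norm M (\<lambda>x. u x - w x) = 0" using l2_norm_nonneg[of M] by (simp add: antisym)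
  then show ?thesis using U by (simp add: AE_eq_iff_l2_norm)
qed

text \<open>Passage to the limit in \<open>E_S_norm\<close>, possible because \<open>E C\<close> is
  a contraction. This formula supplies both bounds of the growth argument for uniqueness.\<close>

lemma E_spectral_integral_norm:
  assumes \<phi>: "\<phi> \<in> borel_measurable borel" and u: "spectral_integral M E \<phi> f u" and C: "C \<in> sets borel"
  shows "(l2_norm M (E C u))\<^sup>2 = (LINT l|\<mu> f. indicator C l * (\<phi> l)\<^sup>2)"
proof -
  note U = u[unfolded spectral_integral_simple_approx[OF \<phi>]]
  let ?c = "simple_approx \<phi>"
  have f: "f \<in> L2 M" and uL: "u \<in> L2 M" using U by auto
  have c: "S (?c n) f \<in> L2 M" for n using U by (intro S_L2 simple_approx(1)[OF \<phi>]) auto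
  have "(\<lambda>n. l2_norm M (\<lambda>x. E C (S (?c n) f) x - E C u x)) \<longlonglongrightarrow> 0"
  proof (rule Lim_null_comparison)
    have "l2_norm M (\<lambda>x. E C (S (?c n) f) x - E C u x) \<le> l2_norm M (\<lambda>x. S (?c n) f x - u x)" for n
      using E_norm_le[OF C L2_diff[OF c uL], of n] l2_norm_cong[OF E_diff[OF C c uL, of n]] C c uL
      by (simp add: E_L2 L2_diff)
    then show "\<forall>\<^sub>F n in sequentially. norm (l2_norm M (\<lambda>x. E C (S (?c n) f) x - E C u x))
      \<le> l2_norm M (\<lambda>x. S (?c n) f x - u x)" by (simp add: l2_norm_nonneg)
  qed (use U in simp)
  then have "(\<lambda>n. (l2_norm M (E C (S (?c n) f)))\<^sup>2) \<longlonglongrightarrow> (l2_norm M (E C u))\<^sup>2"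
    by (intro tendsto_power l2_tendsto_norm E_L2 C c uL)
  moreover have "(\<lambda>n. (l2_norm M (E C (S (?c n) f)))\<^sup>2) \<longlonglongrightarrow> (LINT l|\<mu> f. indicator C l * (\<phi> l)\<^sup>2)"
    unfolding E_S_norm[OF simple_approx(1)[OF \<phi>] C f]
    using U by (intro simple_approx_L2(3)[OF \<phi> sets_diagonal _ C]) auto
  ultimately show ?thesis by (rule LIMSEQ_unique)
qed

lemma spectral_integral_exists:
  assumes \<phi>: "\<phi> \<in> borel_measurable borel" and f: "f \<in> L2 M" and i: "integrable (\<mu> f) (\<lambda>l. (\<phi> l)\<^sup>2)"
  shows "\<exists>u. spectral_integral M E \<phi> f u"
proof -
  let ?c = "simple_approx \<phi>"
  note ca = simple_approx_L2[OF \<phi> sets_diagonal i]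
  \<comment> \<open>The factor \<open>1/4\<close> absorbs the two factors 2 of
    \<open>S_diff_norm_le\<close>, so that consecutive terms of the subsequence differ by at most
    \<open>(1/2) ^ k\<close>.\<close>
  have "\<exists>n. \<forall>m\<ge>n. (LINT l|\<mu> f. (?c m l - \<phi> l)\<^sup>2) \<le> (1/4) * ((1/2) ^ k)\<^sup>2" for k
  proof -
    have "\<forall>\<^sub>F n in sequentially. (LINT l|\<mu> f. (?c n l - \<phi> l)\<^sup>2) < (1/4) * ((1/2) ^ k)\<^sup>2"
      by (rule order_tendstoD(2)[OF ca(2)]) simp
    then show ?thesis unfolding eventually_sequentially by (meson less_imp_le)
  qed
  then obtain N where N: "\<And>k m. m \<ge> N k \<Longrightarrow> (LINT l|\<mu> f. (?c m l - \<phi> l)\<^sup>2) \<le> (1/4) * ((1/2) ^ k)\<^sup>2"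
    by metis
  \<comment> \<open>The partial sums make both \<open>r k\<close> and \<open>r (Suc k)\<close>
    exceed \<open>N k\<close>; the summand \<open>k\<close> makes \<open>r\<close> tend to
    infinity.\<close>
  define r where "r = (\<lambda>k. (\<Sum>i\<le>k. N i) + k)"
  have rN: "r k \<ge> N k" for k unfolding r_def using member_le_sum[of k "{..k}" N] by simp
  have rS: "r (Suc k) \<ge> N k" for k
    using rN[of k] by (simp add: r_def)
  have rk: "r k \<ge> k" for k by (simp add: r_def)
  have d: "l2_norm M (\<lambda>x. S (?c (r (Suc k))) f x - S (?c (r k)) f x) \<le> (1/2) ^ k" for k
  proof (rule power2_le_imp_le)
    have "(l2_norm M (\<lambda>x. S (?c (r (Suc k))) f x - S (?c (r k)) f x))\<^sup>2
      \<le> 2 * (LINT l|\<mu> f. (?c (r (Suc k)) l - \<phi> l)\<^sup>2) + 2 * (LINT l|\<mu> f. (?c (r k) l - \<phi> l)\<^sup>2)"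
      by (intro S_diff_norm_le simple_approx(1)[OF \<phi>] f ca)
    also have "\<dots> \<le> ((1/2) ^ k)\<^sup>2" using N[OF rN[of k]] N[OF rS[of k]] by linarith
    finally show "(l2_norm M (\<lambda>x. S (?c (r (Suc k))) f x - S (?c (r k)) f x))\<^sup>2 \<le> ((1/2) ^ k)\<^sup>2" .
  qed simp
  obtain u where u: "u \<in> L2 M" "(\<lambda>k. l2_norm M (\<lambda>x. S (?c (r k)) f x - u x)) \<longlonglongrightarrow> 0"
    using l2_complete[of "\<lambda>k. S (?c (r k)) f", OF S_L2[OF simple_approx(1)[OF \<phi>] f] d] by blast
  have "(\<lambda>k. LINT l|\<mu> f. (?c (r k) l - \<phi> l)\<^sup>2) \<longlonglongrightarrow> 0"
  proof (rule filterlim_compose[OF ca(2)])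
    show "filterlim r sequentially sequentially"
      using rk by (intro filterlim_at_top_mono[OF filterlim_ident]) auto
  qed
  then have "spectral_integral M E \<phi> f u"
    unfolding spectral_integral_def
    by (intro conjI exI[of _ "\<lambda>k. ?c (r k)"] allI simple_approx(1)[OF \<phi>] ca(1) f u)
  then show "\<exists>u. spectral_integral M E \<phi> f u" by blast
qed

end

section \<open>Uniqueness and transport of spectral measures\<close>

context pvm begin

lemma diagonal_eqI:
  assumes "f \<in> L2 M" "pvm M' F" "g \<in> L2 M'" "\<And>B. B \<in> sets borel \<Longrightarrow> l2_norm M (E B f) = l2_norm M' (F B g)"
  shows "\<mu> f = diagonal_measure M' F g"
  by (rule measure_eqI)
    (use assms in \<open>auto simp: emeasure_diagonal pvm.sets_diagonal pvm.emeasure_diagonal\<close>)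

lemma S_cong:
  assumes s: "simple_function borel s" and f: "f \<in> L2 M" and g: "g \<in> L2 M" and fg: "AE x in M. f x = g x"
  shows "AE x in M. S s f x = S s g x"
proof -
  have "AE x in M. \<forall>c\<in>range s. E (s -` {c}) f x = E (s -` {c}) g x"
    using simple_function_borelD[OF s] f g fg by (intro AE_finite_allI E_cong) auto
  then show ?thesis by eventually_elim (auto simp: S_eq intro!: sum.cong)
qed

lemma S_add:
  assumes s: "simple_function borel s" and f: "f \<in> L2 M" and g: "g \<in> L2 M"
  shows "AE x in M. S s (\<lambda>x. f x + g x) x = S s f x + S s g x"
proof -
  have "AE x in M. \<forall>c\<in>range s. E (s -` {c}) (\<lambda>x. f x + g x) x = E (s -` {c}) f x + E (s -` {c}) g x"
    using simple_function_borelD[OF s] f g by (intro AE_finite_allI E_add) auto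
  then show ?thesis by eventually_elim (auto simp: S_eq sum.distrib[symmetric] scaleR_add_right[symmetric] intro!: sum.cong)
qed

lemma S_cmult:
  assumes s: "simple_function borel s" and f: "f \<in> L2 M"
  shows "AE x in M. S s (\<lambda>x. k * f x) x = k * S s f x"
proof -
  have "AE x in M. \<forall>c\<in>range s. E (s -` {c}) (\<lambda>x. k * f x) x = k * E (s -` {c}) f x"
    using simple_function_borelD[OF s] f by (intro AE_finite_allI E_cmult) auto
  then show ?thesis by eventually_elim (auto simp: S_eq sum_distrib_left intro!: sum.cong)
qed

lemma spectral_integral_cong:
  assumes \<phi>: "\<phi> \<in> borel_measurable borel" and u: "spectral_integral M E \<phi> f u"
    and f': "f' \<in> L2 M" "AE x in M. f x = f' x" and u': "u' \<in> L2 M" "AE x in M. u x = u' x"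
  shows "spectral_integral M E \<phi> f' u'"
proof -
  note U = u[unfolded spectral_integral_simple_approx[OF \<phi>]]
  note c = simple_approx(1)[OF \<phi>]
  have "\<mu> f = \<mu> f'"
    using U f' pvm_axioms by (intro diagonal_eqI l2_norm_cong E_cong E_L2) auto
  moreover have "l2_norm M (\<lambda>x. S (simple_approx \<phi> n) f x - u x) = l2_norm M (\<lambda>x. S (simple_approx \<phi> n) f' x - u' x)" for n
  proof (rule l2_norm_cong)
    show "AE x in M. S (simple_approx \<phi> n) f x - u x = S (simple_approx \<phi> n) f' x - u' x"
      using S_cong[OF c _ f'(1) f'(2), of n] U u'(2) by auto
  qed (use U u' f' c in \<open>auto intro!: L2_diff S_L2\<close>)
  ultimately show ?thesis unfolding spectral_integral_simple_approx[OF \<phi>] using U f' u' by simp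
qed

text \<open>The diagonal measure is quadratic in the vector, so it is only subadditive up to the
  factor 2. The inequality for sets passes to simple functions and then to integrals; it makes the
  domain of a spectral integral closed under addition.\<close>

lemma nn_integral_diagonal_add:
  assumes f: "f \<in> L2 M" and g: "g \<in> L2 M"
  shows "nn_integral (\<mu> (\<lambda>x. f x + g x)) h \<le> 2 * nn_integral (\<mu> f) h + 2 * nn_integral (\<mu> g) h"
proof -
  have em: "emeasure (\<mu> (\<lambda>x. f x + g x)) B \<le> 2 * emeasure (\<mu> f) B + 2 * emeasure (\<mu> g) B"
    if B: "B \<in> sets borel" for B
  proof -
    have "(l2_norm M (E B (\<lambda>x. f x + g x)))\<^sup>2 = (l2_norm M (\<lambda>x. E B f x + E B g x))\<^sup>2"
      using B f g by (intro arg_cong[where f="\<lambda>x. x\<^sup>2"] l2_norm_cong E_add E_L2 L2_add) auto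
    also have "\<dots> \<le> 2 * (l2_norm M (E B f))\<^sup>2 + 2 * (l2_norm M (E B g))\<^sup>2"
      using B f g by (intro l2_norm_add_square_le E_L2)
    finally have "ennreal ((l2_norm M (E B (\<lambda>x. f x + g x)))\<^sup>2)
      \<le> ennreal (2 * (l2_norm M (E B f))\<^sup>2 + 2 * (l2_norm M (E B g))\<^sup>2)" by (rule ennreal_leI)
    then show ?thesis using B f g by (simp add: emeasure_diagonal L2_add ennreal_plus ennreal_mult)
  qed
  have sf: "simple_function (\<mu> p) s \<longleftrightarrow> simple_function borel s" for p :: "'a \<Rightarrow> complex" and s :: "real \<Rightarrow> ennreal"
    by (simp add: simple_function_def)
  show ?thesis
    unfolding nn_integral_def[of "\<mu> (\<lambda>x. f x + g x)"]
  proof (rule SUP_least)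
    fix s assume "s \<in> {s. simple_function (\<mu> (\<lambda>x. f x + g x)) s \<and> s \<le> h}"
    then have s: "simple_function borel s" "s \<le> h" by (auto simp: sf)
    have up: "integral\<^sup>S (\<mu> p) s \<le> nn_integral (\<mu> p) h" for p
      unfolding nn_integral_def by (rule SUP_upper) (use s in \<open>auto simp: sf\<close>)
    have "integral\<^sup>S (\<mu> (\<lambda>x. f x + g x)) s
      \<le> (\<Sum>y\<in>range s. y * (2 * emeasure (\<mu> f) (s -` {y}) + 2 * emeasure (\<mu> g) (s -` {y})))"
      unfolding simple_integral_def using simple_functionD(2)[OF s(1)]
      by (auto intro!: sum_mono mult_left_mono em)
    also have "\<dots> = 2 * integral\<^sup>S (\<mu> f) s + 2 * integral\<^sup>S (\<mu> g) s"
      unfolding simple_integral_def by (simp add: distrib_left sum.distrib sum_distrib_left mult.left_commute)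
    also have "\<dots> \<le> 2 * nn_integral (\<mu> f) h + 2 * nn_integral (\<mu> g) h"
      by (intro add_mono mult_left_mono up) auto
    finally show "integral\<^sup>S (\<mu> (\<lambda>x. f x + g x)) s \<le> 2 * nn_integral (\<mu> f) h + 2 * nn_integral (\<mu> g) h" .
  qed
qed

lemma spectral_integral_add:
  assumes \<phi>: "\<phi> \<in> borel_measurable borel"
    and u: "spectral_integral M E \<phi> f u" and w: "spectral_integral M E \<phi> g w"
  shows "spectral_integral M E \<phi> (\<lambda>x. f x + g x) (\<lambda>x. u x + w x)"
proof -
  note U = u[unfolded spectral_integral_simple_approx[OF \<phi>]] w[unfolded spectral_integral_simple_approx[OF \<phi>]]
  let ?c = "simple_approx \<phi>"
  note c = simple_approx(1)[OF \<phi>]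
  have L: "f \<in> L2 M" "g \<in> L2 M" "u \<in> L2 M" "w \<in> L2 M" using U by auto
  have "integrable (\<mu> (\<lambda>x. f x + g x)) (\<lambda>l. (\<phi> l)\<^sup>2)"
  proof (rule integrableI_bounded)
    have "nn_integral (\<mu> (\<lambda>x. f x + g x)) (\<lambda>l. ennreal (norm ((\<phi> l)\<^sup>2)))
      \<le> 2 * nn_integral (\<mu> f) (\<lambda>l. ennreal (norm ((\<phi> l)\<^sup>2))) + 2 * nn_integral (\<mu> g) (\<lambda>l. ennreal (norm ((\<phi> l)\<^sup>2)))"
      by (rule nn_integral_diagonal_add[OF L(1,2)])
    also have "\<dots> < \<infinity>" using U by (simp add: integrable_iff_bounded ennreal_mult_less_top)
    finally show "nn_integral (\<mu> (\<lambda>x. f x + g x)) (\<lambda>l. ennreal (norm ((\<phi> l)\<^sup>2))) < \<infinity>" .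
  qed (use \<phi> in simp)
  moreover have "(\<lambda>n. l2_norm M (\<lambda>x. S (?c n) (\<lambda>x. f x + g x) x - (u x + w x))) \<longlonglongrightarrow> 0"
  proof (rule Lim_null_comparison)
    show "(\<lambda>n. l2_norm M (\<lambda>x. S (?c n) f x - u x) + l2_norm M (\<lambda>x. S (?c n) g x - w x)) \<longlonglongrightarrow> 0"
      using tendsto_add[of _ 0 sequentially _ 0] U by auto
    have "l2_norm M (\<lambda>x. S (?c n) (\<lambda>x. f x + g x) x - (u x + w x))
       = l2_norm M (\<lambda>x. (S (?c n) f x - u x) + (S (?c n) g x - w x))" for n
      using S_add[OF c L(1,2), of n] L c by (intro l2_norm_cong L2_diff L2_add S_L2) auto
    then show "\<forall>\<^sub>F n in sequentially. norm (l2_norm M (\<lambda>x. S (?c n) (\<lambda>x. f x + g x) x - (u x + w x)))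
      \<le> l2_norm M (\<lambda>x. S (?c n) f x - u x) + l2_norm M (\<lambda>x. S (?c n) g x - w x)"
      using L c by (auto intro!: always_eventually l2_norm_triangle L2_diff S_L2 simp: l2_norm_nonneg)
  qed
  ultimately show ?thesis unfolding spectral_integral_simple_approx[OF \<phi>] using L by (simp add: L2_add)
qed

lemma spectral_integral_cmult:
  assumes \<phi>: "\<phi> \<in> borel_measurable borel" and u: "spectral_integral M E \<phi> f u"
  shows "spectral_integral M E \<phi> (\<lambda>x. k * f x) (\<lambda>x. k * u x)"
proof -
  note U = u[unfolded spectral_integral_simple_approx[OF \<phi>]]
  let ?c = "simple_approx \<phi>"
  note c = simple_approx(1)[OF \<phi>]
  have L: "f \<in> L2 M" "u \<in> L2 M" using U by auto
  have "\<mu> (\<lambda>x. k * f x) = density (\<mu> f) (\<lambda>_. ennreal ((cmod k)\<^sup>2))"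
  proof (rule measure_eqI)
    fix B assume "B \<in> sets (\<mu> (\<lambda>x. k * f x))"
    then have B: "B \<in> sets borel" by simp
    have "l2_norm M (E B (\<lambda>x. k * f x)) = l2_norm M (\<lambda>x. k * E B f x)"
      using L B by (intro l2_norm_cong E_cmult E_L2 L2_cmult)
    then have "emeasure (\<mu> (\<lambda>x. k * f x)) B = ennreal ((cmod k)\<^sup>2 * (l2_norm M (E B f))\<^sup>2)"
      using L B by (simp add: emeasure_diagonal L2_cmult l2_norm_cmult power_mult_distrib)
    also have "\<dots> = emeasure (density (\<mu> f) (\<lambda>_. ennreal ((cmod k)\<^sup>2))) B"
      using L B by (simp add: emeasure_density_const emeasure_diagonal ennreal_mult)
    finally show "emeasure (\<mu> (\<lambda>x. k * f x)) B = \<dots>" .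
  qed simp
  then have "integrable (\<mu> (\<lambda>x. k * f x)) (\<lambda>l. (\<phi> l)\<^sup>2)"
    using U \<phi> by (simp add: integrable_density)
  moreover have "l2_norm M (\<lambda>x. S (?c n) (\<lambda>x. k * f x) x - k * u x) = cmod k * l2_norm M (\<lambda>x. S (?c n) f x - u x)" for n
  proof -
    have "l2_norm M (\<lambda>x. S (?c n) (\<lambda>x. k * f x) x - k * u x) = l2_norm M (\<lambda>x. k * (S (?c n) f x - u x))"
      using S_cmult[OF c L(1), of n k] L c
      by (intro l2_norm_cong L2_diff L2_cmult S_L2) (auto simp: algebra_simps)
    then show ?thesis by (simp add: l2_norm_cmult)
  qed
  ultimately show ?thesis unfolding spectral_integral_simple_approx[OF \<phi>]
    using L U by (simp add: L2_cmult tendsto_mult_right_zero)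
qed

lemma spectral_integral_sum:
  assumes \<phi>: "\<phi> \<in> borel_measurable borel" and I: "finite I" "I \<noteq> {}"
    and u: "\<And>i. i \<in> I \<Longrightarrow> spectral_integral M E \<phi> (f i) (u i)"
  shows "spectral_integral M E \<phi> (\<lambda>x. \<Sum>i\<in>I. f i x) (\<lambda>x. \<Sum>i\<in>I. u i x)"
  using I u by (induction I rule: finite_ne_induct) (auto intro!: spectral_integral_add[OF \<phi>])

text \<open>The level sets of \<open>s - t\<close> are unrelated to those of \<open>s\<close> and
  \<open>t\<close>, so a termwise comparison is awkward; instead the squared norm of the difference
  is evaluated by the isometry.\<close>

lemma S_diff:
  assumes s: "simple_function borel s" and t: "simple_function borel t" and f: "f \<in> L2 M"
  shows "AE x in M. S (\<lambda>l. s l - t l) f x = S s f x - S t f x"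
proof -
  have st: "simple_function borel (\<lambda>l. s l - t l)" using s t by simp
  note i = integrable_simple_mult[OF finite_measure_diagonal[OF f] sets_diagonal, of _ _ UNIV, simplified]
  let ?I = "\<lambda>s t. LINT l|\<mu> f. s l * t l"
  have 1: "?I (\<lambda>l. s l - t l) r = ?I s r - ?I t r" "?I r (\<lambda>l. s l - t l) = ?I r s - ?I r t"
    if "simple_function borel r" for r
    using i s t that by (simp_all add: left_diff_distrib right_diff_distrib)
  show ?thesis
    using s t st f
    by (subst AE_eq_iff_inner)
      (auto simp: S_L2 L2_diff l2_inner_diff_left l2_inner_diff_right S_inner 1)
qed

lemma S_const:
  assumes f: "f \<in> L2 M" shows "AE x in M. S (\<lambda>_. c) f x = c *\<^sub>R f x"
  using E_UNIV[OF f] by eventually_elim (simp add: S_eq vimage_def)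

lemma spectral_integral_shift:
  assumes "spectral_integral M E \<phi> f u"
  shows "spectral_integral M E (\<lambda>l. \<phi> l - c) f (\<lambda>x. u x - c *\<^sub>R f x)"
proof -
  obtain s where f: "f \<in> L2 M" and u: "u \<in> L2 M" and s: "\<And>n. simple_function borel (s n)"
    and si: "\<And>n. integrable (\<mu> f) (\<lambda>l. (s n l - \<phi> l)\<^sup>2)"
    and l1: "(\<lambda>n. LINT l|\<mu> f. (s n l - \<phi> l)\<^sup>2) \<longlonglongrightarrow> 0"
    and l2: "(\<lambda>n. l2_norm M (\<lambda>x. S (s n) f x - u x)) \<longlonglongrightarrow> 0"
    using assms unfolding spectral_integral_def by blast
  have eq: "l2_norm M (\<lambda>x. S (\<lambda>l. s n l - c) f x - (u x - c *\<^sub>R f x)) = l2_norm M (\<lambda>x. S (s n) f x - u x)" for n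
    using S_diff[OF s[of n], of "\<lambda>_. c" f] S_const[OF f, of c] f u s
    by (intro l2_norm_cong L2_diff S_L2 L2_scaleR) auto
  show ?thesis unfolding spectral_integral_def
    by (intro conjI f L2_diff u L2_scaleR exI[of _ "\<lambda>n l. s n l - c"]) (use s si l1 l2 eq in simp_all)
qed

lemma E_Compl:
  assumes B: "B \<in> sets borel" and f: "f \<in> L2 M" and g: "g \<in> L2 M"
  shows "l2_inner M (E (- B) f) g = l2_inner M f g - l2_inner M (E B f) g"
proof -
  have "(\<lambda>n. l2_inner M (E (binaryset B (- B) n) f) g) sums l2_inner M (E (\<Union>n. binaryset B (- B) n) f) g"
    using B f g by (intro E_sums) (auto simp: binaryset_def disjoint_family_on_def)
  moreover have "(\<Union>n. binaryset B (- B) n) = UNIV" by (simp add: UN_binaryset_eq)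
  moreover have "(\<lambda>n. l2_inner M (E (binaryset B (- B) n) f) g) sums (l2_inner M (E B f) g + l2_inner M (E (- B) f) g)"
    by (rule binaryset_sums) (rule E_empty[OF f g])
  ultimately have "l2_inner M (E B f) g + l2_inner M (E (- B) f) g = l2_inner M (E UNIV f) g"
    using sums_unique2 by metis
  also have "\<dots> = l2_inner M f g" using f g E_UNIV by (intro l2_inner_cong E_L2) auto
  finally show ?thesis by (simp add: algebra_simps)
qed

lemma E_fix_iff:
  assumes B: "B \<in> sets borel" and f: "f \<in> L2 M"
  shows "(AE x in M. E B f x = f x) \<longleftrightarrow> l2_norm M (E (- B) f) = 0"
proof -
  have "(AE x in M. E B f x = f x) \<longleftrightarrow> l2_norm M (\<lambda>x. E B f x - f x) = 0"
    by (intro AE_eq_iff_l2_norm E_L2 B f)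
  also have "l2_norm M (\<lambda>x. E B f x - f x) = l2_norm M (E (- B) f)"
  proof -
    have "AE x in M. E (- B) f x = f x - E B f x"
    proof (rule AE_eqI_inner)
      fix h assume "h \<in> L2 M"
      then show "l2_inner M (E (- B) f) h = l2_inner M (\<lambda>x. f x - E B f x) h"
        using B f by (simp add: E_Compl l2_inner_diff_left E_L2)
    qed (use B f in \<open>auto intro!: L2_diff E_L2\<close>)
    then have "l2_norm M (E (- B) f) = l2_norm M (\<lambda>x. f x - E B f x)"
      using B f by (intro l2_norm_cong L2_diff E_L2) auto
    then show ?thesis by (simp only: l2_norm_minus_commute)
  qed
  finally show ?thesis .
qed

text \<open>A vector fixed by the projection has its diagonal measure concentrated on the interval,
  where the multiplier is at most \<open>a\<close> in absolute value. The image lies in the same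
  subspace, so the estimate can be iterated.\<close>

lemma spectral_integral_bounded:
  assumes a: "a \<ge> 0" and f: "f \<in> L2 M" and fix_: "AE x in M. E {c - a..c + a} f x = f x"
  shows "\<exists>u. spectral_integral M E (\<lambda>l. l - c) f u \<and> (AE x in M. E {c - a..c + a} u x = u x) \<and>
    (l2_norm M u)\<^sup>2 \<le> a\<^sup>2 * (l2_norm M f)\<^sup>2"
proof -
  interpret fm: finite_measure "\<mu> f" by (rule finite_measure_diagonal[OF f])
  let ?C = "{c - a..c + a}"
  have C: "?C \<in> sets borel" "- ?C \<in> sets borel" by auto
  have \<phi>: "(\<lambda>l. l - c) \<in> borel_measurable borel" by simp
  have "emeasure (\<mu> f) (- ?C) = 0"
    using fix_ f C by (simp add: emeasure_diagonal E_fix_iff)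
  then have ae: "AE l in \<mu> f. l \<in> ?C"
    using C by (intro AE_I[of _ _ "- ?C"]) auto
  have b: "(l - c)\<^sup>2 \<le> a\<^sup>2" if "l \<in> ?C" for l
  proof -
    have "\<bar>l - c\<bar> \<le> a" using that by auto
    then have "\<bar>l - c\<bar>\<^sup>2 \<le> a\<^sup>2" by (intro power_mono) auto
    then show ?thesis by simp
  qed
  have i: "integrable (\<mu> f) (\<lambda>l. (l - c)\<^sup>2)"
    by (rule fm.integrable_const_bound[of _ "a\<^sup>2"]) (use ae b in auto)
  obtain u where u: "spectral_integral M E (\<lambda>l. l - c) f u"
    using spectral_integral_exists[OF \<phi> f i] by blast
  then have uL: "u \<in> L2 M" by (simp add: spectral_integral_def)
  have "(l2_norm M (E (- ?C) u))\<^sup>2 = (LINT l|\<mu> f. indicator (- ?C) l * (l - c)\<^sup>2)"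
    by (rule E_spectral_integral_norm[OF \<phi> u C(2)])
  also have "\<dots> = (LINT l|\<mu> f. 0)"
  proof (rule integral_cong_AE)
    show "AE l in \<mu> f. indicator (- ?C) l * (l - c)\<^sup>2 = 0"
      using ae by eventually_elim (auto simp: indicator_def)
  qed (use C in auto)
  finally have "AE x in M. E ?C u x = u x" using uL C by (simp add: E_fix_iff)
  moreover have "(l2_norm M u)\<^sup>2 \<le> a\<^sup>2 * (l2_norm M f)\<^sup>2"
  proof -
    have UN: "l2_norm M (E UNIV h) = l2_norm M h" if "h \<in> L2 M" for h
      using that E_UNIV by (intro l2_norm_cong E_L2) auto
    have "(l2_norm M u)\<^sup>2 = (LINT l|\<mu> f. (l - c)\<^sup>2)"
      using E_spectral_integral_norm[OF \<phi> u, of UNIV] UN[OF uL] by simp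
    also have "\<dots> \<le> (LINT l|\<mu> f. a\<^sup>2)"
      by (rule integral_mono_AE) (use i ae b in auto)
    also have "\<dots> = a\<^sup>2 * (l2_norm M f)\<^sup>2"
      using measure_diagonal[OF f, of UNIV] UN[OF f] by simp
    finally show ?thesis .
  qed
  ultimately show ?thesis using u by blast
qed

text \<open>Counterpart of the preceding bound: beyond distance \<open>b\<close> from
  \<open>c\<close>, the operator minus \<open>c\<close> enlarges components at least by the factor
  \<open>b\<close>.\<close>

lemma spectral_integral_lower:
  assumes b: "b \<ge> 0" and u: "spectral_integral M E (\<lambda>l. l - c) f u"
  shows "b\<^sup>2 * (l2_norm M (E {l. \<bar>l - c\<bar> > b} f))\<^sup>2 \<le> (l2_norm M (E {l. \<bar>l - c\<bar> > b} u))\<^sup>2"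
proof -
  let ?D = "{l. \<bar>l - c\<bar> > b}"
  have \<phi>: "(\<lambda>l. l - c) \<in> borel_measurable borel" by simp
  have D: "?D \<in> sets borel" by measurable
  have U: "f \<in> L2 M" "integrable (\<mu> f) (\<lambda>l. (l - c)\<^sup>2)"
    using u[unfolded spectral_integral_simple_approx[OF \<phi>]] by auto
  interpret fm: finite_measure "\<mu> f" by (rule finite_measure_diagonal[OF U(1)])
  have i: "integrable (\<mu> f) (\<lambda>l. indicator ?D l * (l - c)\<^sup>2)"
    using integrable_real_mult_indicator[of ?D "\<mu> f" "\<lambda>l. (l - c)\<^sup>2"] D U(2) by (simp add: mult.commute)
  have "b\<^sup>2 * (l2_norm M (E ?D f))\<^sup>2 = (LINT l|\<mu> f. b\<^sup>2 * indicator ?D l)"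
    using measure_diagonal[OF U(1) D] D by simp
  also have "\<dots> \<le> (LINT l|\<mu> f. indicator ?D l * (l - c)\<^sup>2)"
  proof (rule integral_mono)
    show "integrable (\<mu> f) (\<lambda>l. b\<^sup>2 * indicator ?D l :: real)"
      using D by (intro integrable_mult_right integrable_real_indicator) (auto simp: less_top[symmetric])
    fix l
    have "b\<^sup>2 \<le> (l - c)\<^sup>2" if "\<bar>l - c\<bar> > b"
      using that b power_mono[of b "\<bar>l - c\<bar>" 2] by simp
    then show "b\<^sup>2 * indicator ?D l \<le> indicator ?D l * (l - c)\<^sup>2"
      by (auto simp: indicator_def)
  qed (rule i)
  also have "\<dots> = (l2_norm M (E ?D u))\<^sup>2" by (rule E_spectral_integral_norm[OF \<phi> u D, symmetric])
  finally show ?thesis .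
qed

end

lemma spectral_integral_id_shift:
  assumes E: "pvm M E"
  shows "spectral_integral M E (\<lambda>l. l) f u \<longleftrightarrow>
    spectral_integral M E (\<lambda>l. l - c) f (\<lambda>x. u x - c *\<^sub>R f x)"
  using pvm.spectral_integral_shift[OF E, of "\<lambda>l. l" f u c]
    pvm.spectral_integral_shift[OF E, of "\<lambda>l. l - c" f "\<lambda>x. u x - c *\<^sub>R f x" "- c"] by auto

text \<open>If \<open>f\<close> lies in the spectral subspace of \<open>{c - a..c + a}\<close> for \<open>E\<close>, then
  \<open>\<parallel>(A - c)\<^sup>n f\<parallel> \<le> a\<^sup>n \<parallel>f\<parallel>\<close>, whereas the component of \<open>f\<close> in the spectral subspace of
  \<open>{l. \<bar>l - c\<bar> > b}\<close> for \<open>F\<close> grows at least like \<open>b\<^sup>n\<close>.\<close>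

lemma spectral_subspace_subset:
  assumes E: "pvm M E" and F: "pvm M F"
    and EF: "\<And>f u. spectral_integral M E (\<lambda>l. l) f u \<longleftrightarrow> spectral_integral M F (\<lambda>l. l) f u"
    and f: "f \<in> L2 M" and fix_: "AE x in M. E {p..q} f x = f x" and pq: "p \<le> q"
  shows "AE x in M. F {p..q} f x = f x"
proof -
  interpret E: pvm M E by (rule E)
  interpret F: pvm M F by (rule F)
  define c a where "c = (p + q) / 2" and "a = (q - p) / 2"
  have C: "{p..q} = {c - a..c + a}" "a \<ge> 0" using pq by (auto simp: c_def a_def field_simps)
  have EF': "spectral_integral M F (\<lambda>l. l - c) f u" if u: "spectral_integral M E (\<lambda>l. l - c) f u" for f u
    using that spectral_integral_id_shift[OF E, of f "\<lambda>x. u x + c *\<^sub>R f x" c]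
      spectral_integral_id_shift[OF F, of f "\<lambda>x. u x + c *\<^sub>R f x" c] EF by simp
  have null: "l2_norm M (F {l. \<bar>l - c\<bar> > b} f) = 0" if b: "b > a" for b
  proof -
    let ?D = "{l. \<bar>l - c\<bar> > b}"
    have D: "?D \<in> sets borel" by measurable
    have bp: "b > 0" using b C by simp
    \<comment> \<open>Replacing \<open>f\<close> by its image \<open>u\<close> gains
      \<open>b\<^sup>2\<close> in the lower bound for \<open>F\<close> and costs
      \<open>a\<^sup>2\<close> in the upper bound for \<open>E\<close>. Each induction step, for
      varying \<open>f\<close>, thus contributes the ratio \<open>r < 1\<close>.\<close>
    define r where "r = a\<^sup>2 / b\<^sup>2"
    have r: "0 \<le> r" "r < 1" using b C bp by (auto simp: r_def power_strict_mono)
    have "(l2_norm M (F ?D f))\<^sup>2 \<le> r ^ n * (l2_norm M f)\<^sup>2" for n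
      using f fix_
    proof (induction n arbitrary: f)
      case 0
      then show ?case using F.E_norm_le[OF D] by (simp add: power_mono l2_norm_nonneg)
    next
      case (Suc n)
      obtain u where u: "spectral_integral M E (\<lambda>l. l - c) f u" "AE x in M. E {p..q} u x = u x"
        "(l2_norm M u)\<^sup>2 \<le> a\<^sup>2 * (l2_norm M f)\<^sup>2"
        using E.spectral_integral_bounded[OF C(2) Suc.prems(1), of c] Suc.prems(2) C(1) by auto
      have "b\<^sup>2 * (l2_norm M (F ?D f))\<^sup>2 \<le> (l2_norm M (F ?D u))\<^sup>2"
        using bp by (intro F.spectral_integral_lower EF' u(1)) simp
      also have "\<dots> \<le> r ^ n * (l2_norm M u)\<^sup>2"
        using u by (intro Suc.IH) (auto simp: spectral_integral_def)
      also have "\<dots> \<le> r ^ n * (a\<^sup>2 * (l2_norm M f)\<^sup>2)"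
        using r u(3) by (intro mult_left_mono) auto
      also have "\<dots> = b\<^sup>2 * (r ^ Suc n * (l2_norm M f)\<^sup>2)" using bp by (simp add: r_def)
      finally show ?case using bp by (simp add: mult_le_cancel_left_pos)
    qed
    moreover have "(\<lambda>n. r ^ n * (l2_norm M f)\<^sup>2) \<longlonglongrightarrow> 0"
      using r by (intro tendsto_mult_left_zero LIMSEQ_power_zero) auto
    ultimately have "(l2_norm M (F ?D f))\<^sup>2 \<le> 0"
      by (intro LIMSEQ_le_const) auto
    then show ?thesis by simp
  qed
  \<comment> \<open>The components are known to vanish only for radii strictly larger than
    \<open>a\<close>, so the complement is exhausted by countably many such sets.\<close>
  have "- {p..q} = (\<Union>n::nat. {l. \<bar>l - c\<bar> > a + 1 / real (Suc n)})"
  proof -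
    have "\<exists>n::nat. \<bar>l - c\<bar> > a + 1 / real (Suc n)" if "\<bar>l - c\<bar> > a" for l
      using reals_Archimedean[of "\<bar>l - c\<bar> - a"] that by (auto simp: inverse_eq_divide algebra_simps)
    moreover have "\<bar>l - c\<bar> > a" if "\<bar>l - c\<bar> > a + 1 / real (Suc n)" for l n
      using that by (smt (verit) zero_less_divide_1_iff of_nat_0_less_iff zero_less_Suc)
    moreover have "l \<in> - {p..q} \<longleftrightarrow> \<bar>l - c\<bar> > a" for l unfolding C by auto
    ultimately show ?thesis by blast
  qed
  moreover have "(\<Union>n::nat. {l. \<bar>l - c\<bar> > a + 1 / real (Suc n)}) \<in> null_sets (F.\<mu> f)"
  proof (intro null_sets_UN null_setsI)
    fix n :: nat
    have D: "{l. \<bar>l - c\<bar> > a + 1 / real (Suc n)} \<in> sets borel" by measurable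
    then show "{l. \<bar>l - c\<bar> > a + 1 / real (Suc n)} \<in> sets (F.\<mu> f)" by simp
    show "emeasure (F.\<mu> f) {l. \<bar>l - c\<bar> > a + 1 / real (Suc n)} = 0"
      using D f null[of "a + 1 / real (Suc n)"] by (simp add: F.emeasure_diagonal)
  qed
  ultimately have "emeasure (F.\<mu> f) (- {p..q}) = 0" by (metis null_setsD1)
  then have "l2_norm M (F (- {p..q}) f) = 0" using f by (simp add: F.emeasure_diagonal)
  then show ?thesis using f by (simp add: F.E_fix_iff)
qed

text \<open>For closed intervals the inclusion of spectral subspaces holds in both directions, so
  each projection fixes the range of the other; symmetry then forces them to be equal. Closed
  intervals are an intersection-stable generator, and equality of all inner products is preserved by
  complements and disjoint countable unions.\<close>

theorem spectral_measure_unique: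
  assumes E: "is_spectral_measure_of M E A" and F: "is_spectral_measure_of M F A"
    and f: "f \<in> L2 M" and B: "B \<in> sets borel"
  shows "AE x in M. E B f x = F B f x"
proof -
  have pE: "pvm M E" and pF: "pvm M F" using E F by (auto simp: is_spectral_measure_of_def pvm_def)
  have EF: "spectral_integral M E (\<lambda>l. l) f u \<longleftrightarrow> spectral_integral M F (\<lambda>l. l) f u" for f u
    using E F unfolding is_spectral_measure_of_def by metis
  interpret E: pvm M E by (rule pE)
  interpret F: pvm M F by (rule pF)
  have intv: "l2_inner M (E {p..q} f) g = l2_inner M (F {p..q} f) g"
    if f: "f \<in> L2 M" and g: "g \<in> L2 M" for p q :: real and f g
  proof (cases "p \<le> q")
    case False
    then show ?thesis using E.E_empty[OF f g] F.E_empty[OF f g] by simp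
  next
    case True
    let ?C = "{p..q}"
    have C: "?C \<in> sets borel" by simp
    have FE: "AE x in M. F ?C (E ?C f) x = E ?C f x"
      using E.E_comp[OF C C f] E.E_L2[OF C f] by (intro spectral_subspace_subset[OF pE pF EF _ _ True]) auto
    have EF': "AE x in M. E ?C (F ?C g) x = F ?C g x"
      using F.E_comp[OF C C g] F.E_L2[OF C g] by (intro spectral_subspace_subset[OF pF pE EF[symmetric] _ _ True]) auto
    have "l2_inner M (E ?C f) g = l2_inner M (F ?C (E ?C f)) g"
      using FE f g by (intro l2_inner_cong) (auto simp: E.E_L2 F.E_L2)
    also have "\<dots> = l2_inner M f (E ?C (F ?C g))"
      using f g by (simp add: E.E_sym F.E_sym E.E_L2 F.E_L2)
    also have "\<dots> = l2_inner M f (F ?C g)"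
      using EF' f g by (intro l2_inner_cong) (auto simp: E.E_L2 F.E_L2)
    also have "\<dots> = l2_inner M (F ?C f) g" using f g by (simp add: F.E_sym)
    finally show ?thesis .
  qed
  let ?G = "range (\<lambda>(a, b). {a..b::real})"
  have borel: "sets (borel :: real measure) = sigma_sets UNIV ?G"
    using borel_eq_atLeastAtMost[where 'a=real] by (simp add: borel_eq_atLeastAtMost)
  have "\<forall>f\<in>L2 M. \<forall>g\<in>L2 M. l2_inner M (E B f) g = l2_inner M (F B f) g"
  proof (rule sigma_sets_induct_disjoint[where G="?G" and \<Omega>=UNIV and A=B])
    show "Int_stable ?G"
    proof (rule Int_stableI)
      fix A B assume "A \<in> ?G" "B \<in> ?G"
      then obtain a b c d where "A = {a..b}" "B = {c..d}" by auto
      then have "A \<inter> B = (\<lambda>(a, b). {a..b}) (max a c, min b d)" by (simp add: Int_atLeastAtMost)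
      then show "A \<inter> B \<in> ?G" by blast
    qed
    show "B \<in> sigma_sets UNIV ?G" using B borel by simp
  next
    fix A assume "A \<in> ?G"
    then show "\<forall>f\<in>L2 M. \<forall>g\<in>L2 M. l2_inner M (E A f) g = l2_inner M (F A f) g" using intv by auto
  next
    fix A assume "A \<in> sigma_sets UNIV ?G" "\<forall>f\<in>L2 M. \<forall>g\<in>L2 M. l2_inner M (E A f) g = l2_inner M (F A f) g"
    then show "\<forall>f\<in>L2 M. \<forall>g\<in>L2 M. l2_inner M (E (UNIV - A) f) g = l2_inner M (F (UNIV - A) f) g"
      using E.E_Compl F.E_Compl borel by (simp add: Compl_eq_Diff_UNIV[symmetric])
  next
    fix A :: "nat \<Rightarrow> real set"
    assume A: "disjoint_family A" "range A \<subseteq> sigma_sets UNIV ?G"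
      "\<And>i. \<forall>f\<in>L2 M. \<forall>g\<in>L2 M. l2_inner M (E (A i) f) g = l2_inner M (F (A i) f) g"
    show "\<forall>f\<in>L2 M. \<forall>g\<in>L2 M. l2_inner M (E (\<Union>i. A i) f) g = l2_inner M (F (\<Union>i. A i) f) g"
    proof (intro ballI)
      fix f g assume f: "f \<in> L2 M" and g: "g \<in> L2 M"
      have "(\<lambda>n. l2_inner M (E (A n) f) g) sums l2_inner M (E (\<Union>n. A n) f) g"
        using A f g borel by (intro E.E_sums) auto
      moreover have "(\<lambda>n. l2_inner M (F (A n) f) g) sums l2_inner M (F (\<Union>n. A n) f) g"
        using A f g borel by (intro F.E_sums) auto
      ultimately show "l2_inner M (E (\<Union>i. A i) f) g = l2_inner M (F (\<Union>i. A i) f) g"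
        using A(3) f g by (simp add: sums_unique2)
    qed
  qed (auto simp: E.E_empty F.E_empty)
  then show ?thesis using f B by (intro AE_eqI_inner) (auto simp: E.E_L2 F.E_L2)
qed

lemma spectral_integral_cong_pvm:
  assumes E: "pvm M E" and F: "pvm M F" and \<phi>: "\<phi> \<in> borel_measurable borel"
    and eq: "\<And>B f. B \<in> sets borel \<Longrightarrow> f \<in> L2 M \<Longrightarrow> AE x in M. E B f x = F B f x"
    and u: "spectral_integral M E \<phi> f u"
  shows "spectral_integral M F \<phi> f u"
proof -
  interpret E: pvm M E by (rule E)
  interpret F: pvm M F by (rule F)
  note U = u[unfolded E.spectral_integral_simple_approx[OF \<phi>]]
  let ?c = "simple_approx \<phi>"
  have f: "f \<in> L2 M" and uL: "u \<in> L2 M" using U by auto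
  have "E.\<mu> f = F.\<mu> f"
    using f F eq by (intro E.diagonal_eqI l2_norm_cong) (auto simp: E.E_L2 F.E_L2)
  moreover have "l2_norm M (\<lambda>x. E.S (?c n) f x - u x) = l2_norm M (\<lambda>x. F.S (?c n) f x - u x)" for n
  proof (rule l2_norm_cong)
    note s = simple_approx(1)[OF \<phi>, of n]
    have "AE x in M. \<forall>c\<in>range (?c n). E (?c n -` {c}) f x = F (?c n -` {c}) f x"
      using simple_function_borelD[OF s] f by (intro AE_finite_allI eq) auto
    then show "AE x in M. E.S (?c n) f x - u x = F.S (?c n) f x - u x"
      by eventually_elim (auto simp: E.S_eq F.S_eq intro!: sum.cong)
    show "(\<lambda>x. E.S (?c n) f x - u x) \<in> L2 M" "(\<lambda>x. F.S (?c n) f x - u x) \<in> L2 M"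
      using s f uL by (auto intro!: L2_diff E.S_L2 F.S_L2)
  qed
  ultimately show ?thesis unfolding F.spectral_integral_simple_approx[OF \<phi>] using U by simp
qed

text \<open>Uniqueness removes the existential quantifier in \<open>exp_operator\<close>: any one
  spectral measure of the operator may be used.\<close>

lemma exp_operator_spectral:
  assumes E: "is_spectral_measure_of M E A"
  shows "exp_operator M A t f u \<longleftrightarrow> spectral_integral M E (\<lambda>l. exp (- t * l)) f u"
proof
  have pE: "pvm M E" using E by (simp add: is_spectral_measure_of_def pvm_def)
  assume "exp_operator M A t f u"
  then obtain F where F: "is_spectral_measure_of M F A" "spectral_integral M F (\<lambda>l. exp (- t * l)) f u"
    by (auto simp: exp_operator_def)
  have pF: "pvm M F" using F by (simp add: is_spectral_measure_of_def pvm_def)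
  show "spectral_integral M E (\<lambda>l. exp (- t * l)) f u"
    by (rule spectral_integral_cong_pvm[OF pF pE _ _ F(2)]) (auto intro: spectral_measure_unique[OF F(1) E])
qed (use E in \<open>auto simp: exp_operator_def\<close>)

lemma exp_operator_unique:
  assumes "exp_operator M A t f u" "exp_operator M A t f w"
  shows "AE x in M. u x = w x"
proof -
  obtain E where E: "is_spectral_measure_of M E A" using assms(1) by (auto simp: exp_operator_def)
  then interpret pvm M E by (simp add: is_spectral_measure_of_def pvm_def)
  show ?thesis using assms unfolding exp_operator_spectral[OF E]
    by (intro spectral_integral_unique[of "\<lambda>l. exp (- t * l)" f]) auto
qed

text \<open>Used in two instances: \<open>J\<close> composition with a group element,
  \<open>P\<close> composition with its inverse and \<open>c = 1\<close>, which shows that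
  \<open>E\<close> commutes with the group; and \<open>J\<close> the equivariant extension,
  \<open>P\<close> the identity on functions and \<open>c\<close> the group order. Assumption
  \<open>P_J\<close> says that the range of \<open>J\<close> is invariant under the
  projections.\<close>

locale spectral_transport = pvm M E for M :: "'a measure" and E +
  fixes M' :: "'b measure" and J :: "('b \<Rightarrow> complex) \<Rightarrow> 'a \<Rightarrow> complex"
    and P :: "('a \<Rightarrow> complex) \<Rightarrow> 'b \<Rightarrow> complex" and c :: real
  assumes J_L2: "f \<in> L2 M' \<Longrightarrow> J f \<in> L2 M" and P_L2: "h \<in> L2 M \<Longrightarrow> P h \<in> L2 M'"
    and c_pos: "c > 0"
    and J_inner: "f \<in> L2 M' \<Longrightarrow> g \<in> L2 M' \<Longrightarrow> l2_inner M (J f) (J g) = of_real c * l2_inner M' f g"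
    and J_diff: "J (\<lambda>x. f x - g x) = (\<lambda>x. J f x - J g x)"
    and J_scaleR: "J (\<lambda>x. k *\<^sub>R f x) = (\<lambda>x. k *\<^sub>R J f x)"
    and P_J: "B \<in> sets borel \<Longrightarrow> f \<in> L2 M' \<Longrightarrow> AE x in M. J (P (E B (J f))) x = E B (J f) x"
begin

lemma J_zero: "J (\<lambda>x. 0) = (\<lambda>x. 0)"
  using J_scaleR[of 0 "\<lambda>_. 0"] by simp

lemma J_add: "J (\<lambda>x. f x + g x) = (\<lambda>x. J f x + J g x)"
  using J_diff[of f "\<lambda>x. 0 - g x"] J_diff[of "\<lambda>_. 0" g] by (simp add: J_zero)

lemma J_sum: "J (\<lambda>x. \<Sum>i\<in>I. f i x) = (\<lambda>x. \<Sum>i\<in>I. J (f i) x)"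
  by (induction I rule: infinite_finite_induct) (simp_all add: J_zero J_add)

definition E' where "E' B f = P (E B (J f))"

lemma E'_L2: "B \<in> sets borel \<Longrightarrow> f \<in> L2 M' \<Longrightarrow> E' B f \<in> L2 M'"
  unfolding E'_def by (intro P_L2 E_L2 J_L2)

lemma J_norm: "f \<in> L2 M' \<Longrightarrow> l2_norm M (J f) = sqrt c * l2_norm M' f"
proof -
  assume f: "f \<in> L2 M'"
  have "complex_of_real ((l2_norm M (J f))\<^sup>2) = of_real (c * (l2_norm M' f)\<^sup>2)"
    using J_inner[OF f f] by (simp add: l2_inner_self)
  then have "(l2_norm M (J f))\<^sup>2 = c * (l2_norm M' f)\<^sup>2" by (simp only: of_real_eq_iff)
  then have "sqrt ((l2_norm M (J f))\<^sup>2) = sqrt (c * (l2_norm M' f)\<^sup>2)" by simp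
  then show ?thesis by (simp add: real_sqrt_mult l2_norm_nonneg)
qed

lemma J_AE_eq:
  assumes "f \<in> L2 M'" "g \<in> L2 M'"
  shows "(AE x in M. J f x = J g x) \<longleftrightarrow> (AE x in M'. f x = g x)"
  using c_pos assms by (simp add: AE_eq_iff_l2_norm J_L2 J_diff[symmetric] J_norm L2_diff)

lemma E'_inner:
  assumes B: "B \<in> sets borel" and f: "f \<in> L2 M'" and g: "g \<in> L2 M'"
  shows "of_real c * l2_inner M' (E' B f) g = l2_inner M (E B (J f)) (J g)"
proof -
  have "of_real c * l2_inner M' (E' B f) g = l2_inner M (J (E' B f)) (J g)"
    by (intro J_inner[symmetric] E'_L2 B f g)
  also have "\<dots> = l2_inner M (E B (J f)) (J g)"
    unfolding E'_def using P_J[OF B f] B f g by (intro l2_inner_cong J_L2 P_L2 E_L2) auto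
  finally show ?thesis .
qed

text \<open>Each axiom is checked after applying \<open>J\<close>, which multiplies inner products
  by \<open>c\<close> and detects almost everywhere equality.\<close>

lemma pvm': "pvm M' E'"
proof
  have c0: "complex_of_real c \<noteq> 0" using c_pos by simp
  note mc = mult_left_cancel[OF c0]
  show "projection_valued_measure M' E'"
    unfolding projection_valued_measure_def
  proof (intro conjI ballI allI impI)
    fix B :: "real set" and f assume "B \<in> sets borel" "f \<in> L2 M'"
    then show "E' B f \<in> L2 M'" by (rule E'_L2)
  next
    fix B :: "real set" and f g assume B: "B \<in> sets borel" and f: "f \<in> L2 M'" and g: "g \<in> L2 M'"
    have "of_real c * l2_inner M' (E' B f) g = cnj (l2_inner M (E B (J g)) (J f))"
      using E'_inner[OF B f g] E_sym[OF B J_L2[OF f] J_L2[OF g]] l2_inner_commute[of M "J f"] by simp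
    also have "\<dots> = of_real c * cnj (l2_inner M' (E' B g) f)"
      unfolding E'_inner[OF B g f, symmetric] by simp
    also have "\<dots> = of_real c * l2_inner M' f (E' B g)" unfolding l2_inner_commute[of M' f] ..
    finally have "of_real c * l2_inner M' (E' B f) g = of_real c * l2_inner M' f (E' B g)" .
    then show "l2_inner M' (E' B f) g = l2_inner M' f (E' B g)" by (simp only: mc)
  next
    fix B C :: "real set" and f assume B: "B \<in> sets borel" and C: "C \<in> sets borel" and f: "f \<in> L2 M'"
    have Cf: "E' C f \<in> L2 M'" by (rule E'_L2[OF C f])
    have BC: "B \<inter> C \<in> sets borel" using B C by simp
    have "AE x in M. J (E' B (E' C f)) x = E B (J (E' C f)) x"
      unfolding E'_def[of B] by (rule P_J[OF B Cf])
    moreover have "AE x in M. E B (J (E' C f)) x = E B (E C (J f)) x"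
      using P_J[OF C f] by (intro E_cong B J_L2 Cf E_L2 C f) (simp add: E'_def)
    moreover have "AE x in M. E B (E C (J f)) x = E (B \<inter> C) (J f) x"
      by (intro E_comp B C J_L2 f)
    moreover have "AE x in M. J (E' (B \<inter> C) f) x = E (B \<inter> C) (J f) x"
      unfolding E'_def by (rule P_J[OF BC f])
    ultimately have "AE x in M. J (E' B (E' C f)) x = J (E' (B \<inter> C) f) x"
      by eventually_elim simp
    then show "AE x in M'. E' B (E' C f) x = E' (B \<inter> C) f x"
      using B C f BC by (simp add: J_AE_eq E'_L2)
  next
    fix f assume f: "f \<in> L2 M'"
    have "AE x in M. J (E' UNIV f) x = J f x"
      using P_J[OF _ f, of UNIV] E_UNIV[OF J_L2[OF f]] by (auto simp: E'_def)
    then show "AE x in M'. E' UNIV f x = f x" using f by (simp add: J_AE_eq E'_L2)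
  next
    fix B :: "nat \<Rightarrow> real set" and f g
    assume B: "range B \<subseteq> sets borel \<and> disjoint_family B" and f: "f \<in> L2 M'" and g: "g \<in> L2 M'"
    have Bi: "B n \<in> sets borel" "(\<Union>n. B n) \<in> sets borel" for n using B by auto
    have eq: "l2_inner M' (E' C f) g = l2_inner M (E C (J f)) (J g) / of_real c" if "C \<in> sets borel" for C
      using E'_inner[OF that f g] c0 by (simp add: field_simps)
    show "(\<lambda>n. l2_inner M' (E' (B n) f) g) sums l2_inner M' (E' (\<Union>n. B n) f) g"
      unfolding eq[OF Bi(1)] eq[OF Bi(2)] using B f g by (intro sums_divide E_sums J_L2) auto
  qed
qed

lemma diagonal': 
  assumes f: "f \<in> L2 M'"
  shows "\<mu> (J f) = density (diagonal_measure M' E' f) (\<lambda>_. ennreal c)"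
proof (rule measure_eqI)
  interpret E': pvm M' E' by (rule pvm')
  fix B assume "B \<in> sets (\<mu> (J f))"
  then have B: "B \<in> sets borel" by simp
  have "l2_norm M (E B (J f)) = l2_norm M (J (E' B f))"
    unfolding E'_def using P_J[OF B f] B f by (intro l2_norm_cong J_L2 P_L2 E_L2) auto
  then have "(l2_norm M (E B (J f)))\<^sup>2 = c * (l2_norm M' (E' B f))\<^sup>2"
    using c_pos by (simp add: J_norm E'_L2 B f power_mult_distrib)
  then show "emeasure (\<mu> (J f)) B = emeasure (density (diagonal_measure M' E' f) (\<lambda>_. ennreal c)) B"
    using B f c_pos
    by (simp add: emeasure_diagonal J_L2 E'.emeasure_diagonal emeasure_density_const ennreal_mult)
qed (simp add: pvm.sets_diagonal[OF pvm'])

text \<open>On the range of \<open>J\<close> the diagonal measure is multiplied by \<open>c\<close>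
  and the norms by \<open>sqrt c\<close>; integrability and convergence to zero are insensitive to
  such factors.\<close>

lemma spectral_integral':
  assumes \<phi>: "\<phi> \<in> borel_measurable borel" and f: "f \<in> L2 M'" and u: "u \<in> L2 M'"
  shows "spectral_integral M' E' \<phi> f u \<longleftrightarrow> spectral_integral M E \<phi> (J f) (J u)"
proof -
  interpret E': pvm M' E' by (rule pvm')
  let ?c = "simple_approx \<phi>"
  have "integrable (\<mu> (J f)) (\<lambda>l. (\<phi> l)\<^sup>2) \<longleftrightarrow> integrable (E'.\<mu> f) (\<lambda>l. (\<phi> l)\<^sup>2)"
    unfolding diagonal'[OF f] using c_pos \<phi> by (subst integrable_density) auto
  moreover have "l2_norm M (\<lambda>x. S (?c n) (J f) x - J u x) = sqrt c * l2_norm M' (\<lambda>x. E'.S (?c n) f x - u x)" for n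
  proof -
    note s = simple_approx(1)[OF \<phi>, of n]
    have "AE x in M. \<forall>k\<in>range (?c n). J (E' (?c n -` {k}) f) x = E (?c n -` {k}) (J f) x"
      unfolding E'_def using simple_function_borelD[OF s] f by (intro AE_finite_allI P_J) auto
    then have "AE x in M. J (E'.S (?c n) f) x = S (?c n) (J f) x"
      by eventually_elim (auto simp: E'.S_eq S_eq J_sum J_scaleR intro!: sum.cong)
    then have "l2_norm M (\<lambda>x. S (?c n) (J f) x - J u x) = l2_norm M (J (\<lambda>x. E'.S (?c n) f x - u x))"
      using s f u unfolding J_diff
      by (intro l2_norm_cong L2_diff S_L2 J_L2 E'.S_L2) auto
    then show ?thesis using s f u by (simp add: J_norm L2_diff E'.S_L2)
  qed
  moreover have "(\<lambda>n. sqrt c * l2_norm M' (\<lambda>x. E'.S (?c n) f x - u x)) \<longlonglongrightarrow> 0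
    \<longleftrightarrow> (\<lambda>n. l2_norm M' (\<lambda>x. E'.S (?c n) f x - u x)) \<longlonglongrightarrow> 0"
    using tendsto_mult_left_iff[of "sqrt c" "\<lambda>n. l2_norm M' (\<lambda>x. E'.S (?c n) f x - u x)" 0] c_pos by simp
  ultimately show ?thesis
    unfolding spectral_integral_simple_approx[OF \<phi>] E'.spectral_integral_simple_approx[OF \<phi>]
    using f u J_L2 by simp
qed

lemma is_spectral_measure':
  assumes A: "is_spectral_measure_of M E A"
    and A': "\<And>f u. A' f u \<Longrightarrow> f \<in> L2 M' \<and> u \<in> L2 M'"
    and AA': "\<And>f u. f \<in> L2 M' \<Longrightarrow> u \<in> L2 M' \<Longrightarrow> A' f u \<longleftrightarrow> A (J f) (J u)"
  shows "is_spectral_measure_of M' E' A'"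
  unfolding is_spectral_measure_of_def
proof (intro conjI allI)
  show "projection_valued_measure M' E'" using pvm' by (simp add: pvm_def)
  fix f u
  show "A' f u \<longleftrightarrow> spectral_integral M' E' (\<lambda>l. l) f u"
  proof (cases "f \<in> L2 M' \<and> u \<in> L2 M'")
    case True
    then have "A' f u \<longleftrightarrow> A (J f) (J u)" using AA' by blast
    also have "\<dots> \<longleftrightarrow> spectral_integral M E (\<lambda>l. l) (J f) (J u)"
      using A by (simp add: is_spectral_measure_of_def)
    also have "\<dots> \<longleftrightarrow> spectral_integral M' E' (\<lambda>l. l) f u"
      using True by (intro spectral_integral'[symmetric]) auto
    finally show ?thesis .
  next
    case False
    then show ?thesis using A' by (auto simp: spectral_integral_def)
  qed
qed

end

section \<open>Reflection groups and chambers\<close>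

lemma linear_reflection: "linear (reflection \<alpha>)"
  by (rule linearI) (auto simp: reflection_def algebra_simps inner_add_right)

lemma reflection_inner:
  assumes "norm \<alpha> = 1"
  shows "reflection \<alpha> x \<bullet> reflection \<alpha> y = x \<bullet> y"
proof -
  have "\<alpha> \<bullet> \<alpha> = 1" using assms by (simp add: norm_eq_1)
  then show ?thesis
    by (simp add: reflection_def inner_diff_left inner_diff_right inner_commute)
qed

lemma orthogonal_transformation_reflection:
  "norm \<alpha> = 1 \<Longrightarrow> orthogonal_transformation (reflection \<alpha>)"
  by (simp add: orthogonal_transformation_def linear_reflection reflection_inner)

lemma reflection_reflection:
  assumes "norm \<alpha> = 1" shows "reflection \<alpha> (reflection \<alpha> x) = x"
proof -
  have "\<alpha> \<bullet> \<alpha> = 1" using assms by (simp add: norm_eq_1)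
  then show ?thesis by (simp add: reflection_def inner_diff_right algebra_simps)
qed

lemma reflection_self: "norm \<alpha> = 1 \<Longrightarrow> reflection \<alpha> \<alpha> = - \<alpha>"
  by (simp add: reflection_def norm_eq_1 scaleR_2)

lemma reflection_conjugate:
  assumes "orthogonal_transformation g"
  shows "g (reflection \<alpha> x) = reflection (g \<alpha>) (g x)"
  using assms by (simp add: reflection_def orthogonal_transformation_def linear_diff linear_cmul)

locale root_system =
  fixes R :: "(real^'n) set" and v :: "real^'n"
  assumes roots: "normalized_root_system R" and generic: "\<forall>\<alpha>\<in>R. \<alpha> \<bullet> v \<noteq> 0"
begin

abbreviation "W \<equiv> reflection_group R"
abbreviation "Rp \<equiv> positive_roots R v"

lemma finite_R: "finite R" and norm_root: "\<alpha> \<in> R \<Longrightarrow> norm \<alpha> = 1"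
  and reflection_root: "\<alpha> \<in> R \<Longrightarrow> \<beta> \<in> R \<Longrightarrow> reflection \<alpha> \<beta> \<in> R"
  using roots by (auto simp: normalized_root_system_def)

lemma uminus_root: "\<alpha> \<in> R \<Longrightarrow> - \<alpha> \<in> R"
  using reflection_root[of \<alpha> \<alpha>] by (simp add: norm_root reflection_self)

lemma Rp_subset: "\<alpha> \<in> Rp \<Longrightarrow> \<alpha> \<in> R" and Rp_pos: "\<alpha> \<in> Rp \<Longrightarrow> \<alpha> \<bullet> v > 0"
  by (auto simp: positive_roots_def)

lemma Rp_cases: "\<alpha> \<in> R \<Longrightarrow> \<alpha> \<in> Rp \<or> - \<alpha> \<in> Rp"
  using generic uminus_root by (fastforce simp: positive_roots_def)

lemma Rp_not_both: "\<alpha> \<in> Rp \<Longrightarrow> - \<alpha> \<notin> Rp"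
  by (auto simp: positive_roots_def)

lemma finite_Rp: "finite Rp"
  using finite_R by (simp add: positive_roots_def)

lemma W_orth: "g \<in> W \<Longrightarrow> orthogonal_transformation g"
  by (induction rule: reflection_group.induct)
    (use orthogonal_transformation_id in \<open>auto simp: id_def[symmetric] orthogonal_transformation_reflection norm_root
      orthogonal_transformation_compose[unfolded o_def] orthogonal_transformation_inv o_def\<close>)

lemma W_bij: "g \<in> W \<Longrightarrow> bij g"
  by (simp add: W_orth orthogonal_transformation_bij)

lemma W_linear: "g \<in> W \<Longrightarrow> linear g"
  by (simp add: W_orth orthogonal_transformation_linear)

lemma W_inner: "g \<in> W \<Longrightarrow> g x \<bullet> g y = x \<bullet> y"
  using W_orth by (auto simp: orthogonal_transformation_def)

lemma W_image:
  assumes "\<And>\<alpha>. \<alpha> \<in> R \<Longrightarrow> reflection \<alpha> ` X = X"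
  shows "g \<in> W \<Longrightarrow> g ` X = X"
proof (induction rule: reflection_group.induct)
  case (inv g)
  have "inv g ` g ` X = X"
    by (simp add: image_comp W_bij[OF inv.hyps] bij_is_inj)
  then show ?case by (simp add: inv.IH)
qed (simp_all only: assms image_comp[symmetric] image_id id_def image_ident)

lemma W_root: "g \<in> W \<Longrightarrow> \<alpha> \<in> R \<Longrightarrow> g \<alpha> \<in> R"
  using W_image[of R] reflection_root roots by (auto simp: normalized_root_system_def)

lemma W_diff_span: "g \<in> W \<Longrightarrow> g x - x \<in> span R"
proof (induction arbitrary: x rule: reflection_group.induct)
  case one then show ?case by (simp add: span_0)
next
  case (gen \<alpha>)
  have "reflection \<alpha> x - x = (- (2 * (\<alpha> \<bullet> x))) *\<^sub>R \<alpha>" by (simp add: reflection_def)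
  then show ?case using gen by (simp only: span_base span_scale)
next
  case (mult g h)
  have "(g \<circ> h) x - x = (g (h x) - h x) + (h x - x)" by simp
  then show ?case using mult span_add by metis
next
  case (inv g)
  have "inv g x - x = - (g (inv g x) - inv g x)"
    using W_bij[OF inv.hyps] by (simp add: bij_is_surj surj_f_inv_f)
  then show ?case using inv.IH span_neg by metis
qed

text \<open>The roots need not span the space, so linearity alone is not enough:
  \<open>g x - x\<close> lies in the span of the roots and is also orthogonal to all of
  them.\<close>

lemma W_eq_id_on_roots:
  assumes g: "g \<in> W" and fix_: "\<And>\<alpha>. \<alpha> \<in> R \<Longrightarrow> g \<alpha> = \<alpha>"
  shows "g = id"
proof
  fix x
  have "orthogonal (g x - x) \<alpha>" if "\<alpha> \<in> R" for \<alpha>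
    using W_inner[OF g, of x \<alpha>] fix_[OF that] by (simp add: orthogonal_def inner_diff_left)
  then have "orthogonal (g x - x) (g x - x)"
    using orthogonal_to_span[OF W_diff_span[OF g]] by blast
  then show "g x = id x" by (simp add: orthogonal_self)
qed

lemma W_inv_comp: "g \<in> W \<Longrightarrow> h \<in> W \<Longrightarrow> inv g \<circ> h = id \<Longrightarrow> h = g"
  by (metis W_bij bij_is_surj comp_id fun.map_comp id_comp surj_iff)

text \<open>The group acts faithfully on the finite set of roots.\<close>

lemma finite_W: "finite W"
proof -
  have "inj_on (\<lambda>g. restrict g R) W"
  proof (rule inj_onI)
    fix g h assume g: "g \<in> W" and h: "h \<in> W" and eq: "restrict g R = restrict h R"
    have "inv g \<circ> h = id"
    proof (rule W_eq_id_on_roots)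
      show "inv g \<circ> h \<in> W" using g h by (intro reflection_group.mult reflection_group.inv)
      fix \<alpha> assume "\<alpha> \<in> R"
      then have "h \<alpha> = g \<alpha>" using eq by (metis restrict_apply')
      then show "(inv g \<circ> h) \<alpha> = \<alpha>" using W_bij[OF g] by (simp add: bij_is_inj)
    qed
    then show "g = h" using W_inv_comp g h by metis
  qed
  moreover have "(\<lambda>g. restrict g R) ` W \<subseteq> (\<Pi>\<^sub>E x\<in>R. R)"
    using W_root by auto
  moreover have "finite (\<Pi>\<^sub>E x\<in>R. R)" by (intro finite_PiE finite_R)
  ultimately show ?thesis by (metis finite_imageD finite_subset)
qed

text \<open>A point of the orbit with maximal inner product with \<open>v\<close> lies in the
  chamber: if it had negative inner product with a positive root, reflecting in that root would
  increase the product with \<open>v\<close>. Zero is excluded because the group permutes the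
  roots.\<close>

lemma W_transitive:
  assumes x: "\<forall>\<alpha>\<in>R. x \<bullet> \<alpha> \<noteq> 0"
  shows "\<exists>g\<in>W. \<forall>\<alpha>\<in>Rp. g x \<bullet> \<alpha> > 0"
proof -
  define m where "m = Max ((\<lambda>g. g x \<bullet> v) ` W)"
  have ne: "W \<noteq> {}" using reflection_group.one by blast
  have "m \<in> (\<lambda>g. g x \<bullet> v) ` W" unfolding m_def using finite_W ne by (intro Max_in) auto
  then obtain g where g: "g \<in> W" "m = g x \<bullet> v" by auto
  have "g x \<bullet> \<alpha> > 0" if a: "\<alpha> \<in> Rp" for \<alpha>
  proof -
    have "reflection \<alpha> \<circ> g \<in> W"
      using a g Rp_subset by (intro reflection_group.mult reflection_group.gen) auto
    then have "(reflection \<alpha> \<circ> g) x \<bullet> v \<le> m" unfolding m_def using finite_W by (intro Max_ge finite_imageI imageI)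
    then have "(\<alpha> \<bullet> g x) * (\<alpha> \<bullet> v) \<ge> 0" using g by (simp add: reflection_def inner_diff_left mult.commute)
    then have "\<alpha> \<bullet> g x \<ge> 0" using Rp_pos[OF a] by (simp add: zero_le_mult_iff)
    moreover have "\<alpha> \<bullet> g x \<noteq> 0"
    proof -
      have "inv g \<alpha> \<in> R" using W_root reflection_group.inv g a Rp_subset by blast
      moreover have "\<alpha> \<bullet> g x = inv g \<alpha> \<bullet> x"
        using W_inner[OF g(1), of "inv g \<alpha>" x] W_bij[OF g(1)] by (simp add: bij_is_surj surj_f_inv_f)
      ultimately show ?thesis using x by (metis inner_commute)
    qed
    ultimately show ?thesis by (simp add: inner_commute)
  qed
  then show ?thesis using g by blast
qed

text \<open>Simple roots, encoded by the property that the exchange argument uses: the reflection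
  changes the sign of no other positive root. That there are enough of them is then a theorem,
  \<open>nonpos_on_simple_imp_nonpos\<close>.\<close>

definition "simple_roots = {\<alpha>\<in>Rp. \<forall>\<beta>\<in>Rp. \<beta> \<noteq> \<alpha> \<longrightarrow> reflection \<alpha> \<beta> \<in> Rp}"

text \<open>If the reflection in \<alpha> makes \<beta> negative, then the negative of the reflected
  vector is a positive root \<gamma>, and \<open>\<beta> + \<gamma> = (2 * (\<alpha> \<bullet>
  \<beta>)) *\<^sub>R \<alpha>\<close>. Pairing with \<open>v\<close> shows that the coefficient is
  positive.\<close>

lemma not_simple_decompose:
  assumes a: "\<alpha> \<in> Rp" and ns: "\<alpha> \<notin> simple_roots"
  obtains \<beta> \<gamma> c where "\<beta> \<in> Rp" "\<gamma> \<in> Rp" "\<beta> \<noteq> \<alpha>" "c > 0" "\<alpha> = c *\<^sub>R (\<beta> + \<gamma>)"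
proof -
  obtain \<beta> where b: "\<beta> \<in> Rp" "\<beta> \<noteq> \<alpha>" "reflection \<alpha> \<beta> \<notin> Rp"
    using a ns by (auto simp: simple_roots_def)
  define \<gamma> where "\<gamma> = - reflection \<alpha> \<beta>"
  have g: "\<gamma> \<in> Rp"
    unfolding \<gamma>_def using Rp_cases[OF reflection_root[of \<alpha> \<beta>]] a b Rp_subset by auto
  have sum: "\<beta> + \<gamma> = (2 * (\<alpha> \<bullet> \<beta>)) *\<^sub>R \<alpha>" by (simp add: \<gamma>_def reflection_def)
  have "(\<beta> + \<gamma>) \<bullet> v > 0" using Rp_pos b(1) g by (simp add: inner_add_left add_pos_pos)
  then have "(2 * (\<alpha> \<bullet> \<beta>)) * (\<alpha> \<bullet> v) > 0" by (simp add: sum)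
  then have pos: "2 * (\<alpha> \<bullet> \<beta>) > 0" using Rp_pos[OF a] by (simp add: zero_less_mult_iff)
  have "\<alpha> = (1 / (2 * (\<alpha> \<bullet> \<beta>))) *\<^sub>R (\<beta> + \<gamma>)" using pos by (simp add: sum)
  then show thesis using that[of \<beta> \<gamma> "1 / (2 * (\<alpha> \<bullet> \<beta>))"] b g pos by simp
qed

text \<open>Among the roots maximizing \<open>\<langle>x, \<alpha>\<rangle> / \<langle>\<alpha>, v\<rangle>\<close>, the one for which \<open>\<alpha> / \<langle>\<alpha>, v\<rangle>\<close>
  has the largest norm is not a proper convex combination of others, hence simple.\<close>

lemma nonpos_on_simple_imp_nonpos:
  assumes simple: "\<And>\<gamma>. \<gamma> \<in> simple_roots \<Longrightarrow> x \<bullet> \<gamma> \<le> 0" and a: "\<alpha> \<in> Rp"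
  shows "x \<bullet> \<alpha> \<le> 0"
proof -
  define q where "q \<alpha> = (x \<bullet> \<alpha>) / (\<alpha> \<bullet> v)" for \<alpha>
  define n where "n \<alpha> = \<alpha> /\<^sub>R (\<alpha> \<bullet> v)" for \<alpha>
  define m where "m = Max (q ` Rp)"
  have ne: "Rp \<noteq> {}" using a by blast
  have m_ge: "q \<beta> \<le> m" if "\<beta> \<in> Rp" for \<beta> unfolding m_def using finite_Rp that by auto
  define F where "F = {\<beta>\<in>Rp. q \<beta> = m}"
  have "m \<in> q ` Rp" unfolding m_def using finite_Rp ne by (intro Max_in) auto
  then have F: "finite F" "F \<noteq> {}" using finite_Rp by (auto simp: F_def)
  define k where "k = Max ((\<lambda>\<beta>. norm (n \<beta>)) ` F)"
  have "k \<in> (\<lambda>\<beta>. norm (n \<beta>)) ` F" unfolding k_def using F by (intro Max_in) auto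
  then obtain \<delta> where d: "\<delta> \<in> F" "norm (n \<delta>) = k" by auto
  have k_ge: "norm (n \<beta>) \<le> k" if "\<beta> \<in> F" for \<beta> unfolding k_def using F that by auto
  have "\<delta> \<in> simple_roots"
  proof (rule ccontr)
    assume ns: "\<delta> \<notin> simple_roots"
    have dR: "\<delta> \<in> Rp" using d by (simp add: F_def)
    obtain \<beta> \<gamma> c where bc: "\<beta> \<in> Rp" "\<gamma> \<in> Rp" "\<beta> \<noteq> \<delta>" "c > 0" and sum: "\<delta> = c *\<^sub>R (\<beta> + \<gamma>)"
      using not_simple_decompose[OF dR ns] by metis
    note pos = Rp_pos[OF bc(1)] Rp_pos[OF bc(2)] Rp_pos[OF dR]
    have dv: "\<delta> \<bullet> v = c * (\<beta> \<bullet> v) + c * (\<gamma> \<bullet> v)" by (subst sum) (simp add: inner_add_left algebra_simps)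
    have dx: "x \<bullet> \<delta> = c * (x \<bullet> \<beta>) + c * (x \<bullet> \<gamma>)" by (subst sum) (simp add: inner_add_right algebra_simps)
    \<comment> \<open>With weights \<open>s\<close> and \<open>r\<close>, both \<open>q\<close> and
      \<open>n\<close> at \<delta> are convex combinations of their values at \<beta> and \<gamma>.
      Maximality of \<open>q\<close> puts \<beta> and \<gamma> into \<open>F\<close>; strict
      convexity of the norm and maximality of \<open>k\<close> then give
      \<open>n \<beta> = n \<gamma>\<close>, so \<delta> is a positive multiple of the unit vector
      \<beta>.\<close>
    define s where "s = c * (\<beta> \<bullet> v) / (\<delta> \<bullet> v)"
    define r where "r = c * (\<gamma> \<bullet> v) / (\<delta> \<bullet> v)"
    have s: "s > 0" and r: "r > 0" using pos bc by (auto simp: s_def r_def)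
    have rs: "s + r = 1" unfolding s_def r_def using dv pos by (simp add: add_divide_distrib[symmetric])
    have "q \<delta> = s * q \<beta> + r * q \<gamma>"
      using pos by (simp add: q_def s_def r_def dx add_divide_distrib)
    moreover have "q \<delta> = m" using d by (simp add: F_def)
    moreover have "s * m + r * m = m" using rs by (metis distrib_right mult_1)
    ultimately have "s * (m - q \<beta>) + r * (m - q \<gamma>) = 0" unfolding right_diff_distrib by linarith
    moreover have "s * (m - q \<beta>) \<ge> 0" "r * (m - q \<gamma>) \<ge> 0"
      using m_ge bc s r by auto
    ultimately have "s * (m - q \<beta>) = 0" "r * (m - q \<gamma>) = 0" by linarith+
    then have "\<beta> \<in> F" "\<gamma> \<in> F" using s r bc by (auto simp: F_def)
    then have nb: "norm (n \<beta>) \<le> k" "norm (n \<gamma>) \<le> k" using k_ge by auto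
    have nd: "n \<delta> = s *\<^sub>R n \<beta> + r *\<^sub>R n \<gamma>"
    proof -
      have "n \<delta> = (c / (\<delta> \<bullet> v)) *\<^sub>R (\<beta> + \<gamma>)"
        unfolding n_def by (subst (2) sum) (simp add: divide_inverse_commute)
      also have "\<dots> = s *\<^sub>R n \<beta> + r *\<^sub>R n \<gamma>"
        using pos by (simp add: n_def s_def r_def scaleR_add_right inverse_eq_divide)
      finally show ?thesis .
    qed
    have "n \<beta> = n \<gamma>"
    proof (rule ccontr)
      assume "n \<beta> \<noteq> n \<gamma>"
      then have "norm ((1 - r) *\<^sub>R n \<beta> + r *\<^sub>R n \<gamma>) < k"
      proof -
        define z where "z = n \<beta> - n \<gamma>"
        have "(norm (s *\<^sub>R n \<beta> + r *\<^sub>R n \<gamma>))\<^sup>2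
          = s * (norm (n \<beta>))\<^sup>2 + r * (norm (n \<gamma>))\<^sup>2 - s * r * (norm z)\<^sup>2"
        proof -
          have r': "r = 1 - s" using rs by simp
          show ?thesis
            unfolding z_def power2_norm_eq_inner r'
            by (simp add: inner_add_left inner_add_right inner_diff_left inner_diff_right
                inner_commute algebra_simps)
        qed
        also have "\<dots> < s * k\<^sup>2 + r * k\<^sup>2"
        proof -
          have "s * (norm (n \<beta>))\<^sup>2 \<le> s * k\<^sup>2" "r * (norm (n \<gamma>))\<^sup>2 \<le> r * k\<^sup>2"
            using s r nb by (auto intro!: mult_left_mono power_mono)
          moreover have "s * r * (norm z)\<^sup>2 > 0"
            using \<open>n \<beta> \<noteq> n \<gamma>\<close> s r by (simp add: z_def)
          ultimately show ?thesis by linarith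
        qed
        also have "\<dots> = k\<^sup>2" using rs by (metis distrib_right mult_1)
        finally have "norm (s *\<^sub>R n \<beta> + r *\<^sub>R n \<gamma>) < k"
          using d(2) norm_ge_zero power_less_imp_less_base by blast
        then show ?thesis using rs by (simp add: eq_diff_eq[symmetric])
      qed
      moreover have "1 - r = s" using rs by simp
      ultimately show False using nd d(2) by simp
    qed
    then have "n \<delta> = n \<beta>" using nd rs by (simp add: scaleR_add_left[symmetric])
    have "\<delta> = (\<delta> \<bullet> v) *\<^sub>R n \<delta>" using pos by (simp add: n_def)
    also have "\<dots> = ((\<delta> \<bullet> v) / (\<beta> \<bullet> v)) *\<^sub>R \<beta>"
      unfolding \<open>n \<delta> = n \<beta>\<close> by (simp add: n_def divide_inverse)
    finally have eq: "\<delta> = ((\<delta> \<bullet> v) / (\<beta> \<bullet> v)) *\<^sub>R \<beta>" .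
    have "norm \<delta> = \<bar>(\<delta> \<bullet> v) / (\<beta> \<bullet> v)\<bar> * norm \<beta>" by (subst eq) simp
    then have "(\<delta> \<bullet> v) / (\<beta> \<bullet> v) = 1" using pos norm_root Rp_subset dR bc(1) by simp
    then show False using eq bc(3) by simp
  qed
  then have "x \<bullet> \<delta> \<le> 0" using simple by blast
  then have "m \<le> 0" using d Rp_pos by (auto simp: F_def q_def intro!: divide_nonpos_pos)
  then have "q \<alpha> \<le> 0" using m_ge[OF a] by linarith
  then show ?thesis using Rp_pos[OF a] by (simp add: q_def divide_le_0_iff)
qed

definition word :: "(real^'n) list \<Rightarrow> real^'n \<Rightarrow> real^'n" where
  "word l = foldr (\<lambda>\<alpha> g. reflection \<alpha> \<circ> g) l id"

lemma word_simps: "word [] = id" "word (\<alpha> # l) = reflection \<alpha> \<circ> word l"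
  by (auto simp: word_def)

lemma word_append: "word (l @ m) = word l \<circ> word m"
  by (induction l) (auto simp: word_simps)

lemma word_in_W: "set l \<subseteq> R \<Longrightarrow> word l \<in> W"
  by (induction l) (auto simp: word_simps intro: reflection_group.intros)

lemma simple_subset: "\<alpha> \<in> simple_roots \<Longrightarrow> \<alpha> \<in> Rp"
  by (simp add: simple_roots_def)

lemma simple_subset_R: "simple_roots \<subseteq> R"
  using simple_subset Rp_subset by blast

lemma word_rev: "set l \<subseteq> R \<Longrightarrow> word (rev l) \<circ> word l = id"
proof (induction l)
  case (Cons \<alpha> l)
  have "word (rev (\<alpha> # l)) \<circ> word (\<alpha> # l) = word (rev l) \<circ> (reflection \<alpha> \<circ> reflection \<alpha>) \<circ> word l"
    by (simp add: word_append word_simps comp_assoc)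
  also have "reflection \<alpha> \<circ> reflection \<alpha> = id"
    using Cons.prems norm_root by (auto simp: fun_eq_iff reflection_reflection)
  finally show ?case using Cons by simp
qed (simp add: word_simps)

text \<open>Descent on the height \<open>\<gamma> \<bullet> v\<close>. A positive \<gamma> has
  positive product with some simple \<delta>, since otherwise
  \<open>\<gamma> \<bullet> \<gamma> \<le> 0\<close>; if \<gamma> is not simple, reflecting it in
  \<delta> keeps it positive and lowers its height.\<close>

lemma root_conjugate_simple:
  assumes b: "\<beta> \<in> R"
  shows "\<exists>l. set l \<subseteq> simple_roots \<and> word l \<beta> \<in> simple_roots"
proof -
  define P where "P = {\<gamma>\<in>Rp. \<exists>l. set l \<subseteq> simple_roots \<and> (word l \<beta> = \<gamma> \<or> word l \<beta> = - \<gamma>)}"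
  have "finite P" using finite_Rp by (simp add: P_def)
  moreover have "P \<noteq> {}"
  proof -
    have "word [] \<beta> = \<beta>" "word [] \<beta> = - (- \<beta>)" by (simp_all add: word_simps)
    moreover have "set [] \<subseteq> simple_roots" by simp
    ultimately show ?thesis using Rp_cases[OF b] unfolding P_def by blast
  qed
  ultimately obtain \<gamma> where g: "\<gamma> \<in> P" and min: "\<And>\<delta>. \<delta> \<in> P \<Longrightarrow> \<gamma> \<bullet> v \<le> \<delta> \<bullet> v"
    using arg_min_if_finite[of P "\<lambda>\<gamma>. \<gamma> \<bullet> v"] by (metis linorder_not_less)
  obtain l where l: "set l \<subseteq> simple_roots" "word l \<beta> = \<gamma> \<or> word l \<beta> = - \<gamma>" and gR: "\<gamma> \<in> Rp"
    using g by (auto simp: P_def)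
  have gs: "\<gamma> \<in> simple_roots"
  proof (rule ccontr)
    assume ns: "\<gamma> \<notin> simple_roots"
    have "\<gamma> \<bullet> \<gamma> > 0" using norm_root[OF Rp_subset[OF gR]] by (simp add: norm_eq_1)
    then obtain \<delta> where d: "\<delta> \<in> simple_roots" "\<gamma> \<bullet> \<delta> > 0"
      using nonpos_on_simple_imp_nonpos[of \<gamma> \<gamma>] gR by (meson linorder_not_less)
    have "\<delta> \<noteq> \<gamma>" using d ns by auto
    then have r: "reflection \<delta> \<gamma> \<in> Rp" using d(1) gR by (auto simp: simple_roots_def)
    have "word (\<delta> # l) \<beta> = reflection \<delta> \<gamma> \<or> word (\<delta> # l) \<beta> = - reflection \<delta> \<gamma>"
      using l(2) by (auto simp: word_simps linear_neg[OF linear_reflection])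
    moreover have "set (\<delta> # l) \<subseteq> simple_roots" using d l by simp
    ultimately have "reflection \<delta> \<gamma> \<in> P" using r unfolding P_def by blast
    from min[OF this] have "2 * (\<delta> \<bullet> \<gamma>) * (\<delta> \<bullet> v) \<le> 0" by (simp add: reflection_def inner_diff_left)
    moreover have "\<delta> \<bullet> v > 0" using Rp_pos simple_subset d by blast
    ultimately show False using d(2) by (simp add: inner_commute mult_le_0_iff)
  qed
  show ?thesis
  \<comment> \<open>The descent controls the image of \<beta> only up to sign; one more reflection,
    in \<gamma> itself, corrects the sign.\<close>
  proof (cases "word l \<beta> = \<gamma>")
    case True then show ?thesis using l gs by blast
  next
    case False
    then have "word (\<gamma> # l) \<beta> = \<gamma>"
      using l(2) norm_root[OF Rp_subset[OF gR]]
      by (simp add: word_simps linear_neg[OF linear_reflection] reflection_self)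
    then show ?thesis using l gs by (metis insert_subset list.simps(15))
  qed
qed

text \<open>Only the generators matter: if a word takes \<beta> to a simple root, the reflection in
  \<beta> is the conjugate of that simple reflection by the word.\<close>

lemma W_word: "g \<in> W \<Longrightarrow> \<exists>l. set l \<subseteq> simple_roots \<and> g = word l"
proof (induction rule: reflection_group.induct)
  case one
  show ?case by (rule exI[of _ "[]"]) (simp add: word_simps)
next
  case (gen \<beta>)
  obtain l where l: "set l \<subseteq> simple_roots" "word l \<beta> \<in> simple_roots"
    using root_conjugate_simple[OF gen] by blast
  have "reflection \<beta> = word (rev l @ [word l \<beta>] @ l)"
  proof
    fix x
    have lR: "set l \<subseteq> R" using l simple_subset_R by blast
    have "word (rev l @ [word l \<beta>] @ l) x = word (rev l) (reflection (word l \<beta>) (word l x))"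
      by (simp only: word_append) (simp add: word_simps)
    also have "\<dots> = word (rev l) (word l (reflection \<beta> x))"
      by (simp add: reflection_conjugate[OF W_orth[OF word_in_W[OF lR]]])
    also have "\<dots> = reflection \<beta> x" using word_rev[OF lR] by (metis comp_apply id_apply)
    finally show "reflection \<beta> x = word (rev l @ [word l \<beta>] @ l) x" by simp
  qed
  moreover have "set (rev l @ [word l \<beta>] @ l) \<subseteq> simple_roots" using l by simp
  ultimately show ?case by blast
next
  case (mult g h)
  then obtain l m where "set l \<subseteq> simple_roots" "g = word l" "set m \<subseteq> simple_roots" "h = word m"
    by blast
  then show ?case by (intro exI[of _ "l @ m"]) (simp add: word_append)
next
  case (inv g)
  then obtain l where l: "set l \<subseteq> simple_roots" "g = word l" by blast
  have "inv g = word (rev l)"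
    using word_rev[of l] word_rev[of "rev l"] l simple_subset_R by (intro inv_unique_comp) auto
  then show ?case using l by (intro exI[of _ "rev l"]) simp
qed

text \<open>The letters act from the right. Somewhere the image of \<beta> passes from positive to
  negative, and a simple reflection does this only to its own root, so at that moment the image
  equals the letter.\<close>

lemma word_sign_change:
  assumes "set l \<subseteq> simple_roots" "\<beta> \<in> Rp" "word l \<beta> \<notin> Rp"
  shows "\<exists>p \<gamma> q. l = p @ [\<gamma>] @ q \<and> word q \<beta> = \<gamma>"
  using assms
proof (induction l)
  case (Cons \<delta> l)
  show ?case
  proof (cases "word l \<beta> \<in> Rp")
    case True
    then have "word l \<beta> = \<delta>" using Cons.prems by (auto simp: word_simps simple_roots_def)
    then show ?thesis by (intro exI[of _ "[]"] exI[of _ \<delta>] exI[of _ l]) simp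
  next
    case False
    then obtain p \<gamma> q where "l = p @ [\<gamma>] @ q" "word q \<beta> = \<gamma>" using Cons by auto
    then show ?thesis by (intro exI[of _ "\<delta> # p"] exI[of _ \<gamma>] exI[of _ q]) simp
  qed
qed (simp add: word_simps)

text \<open>Exchange argument: if a nonempty word maps the chamber to itself, two of its letters cancel.\<close>

lemma W_preserving_chamber:
  assumes g: "g \<in> W" and pos: "\<And>\<beta>. \<beta> \<in> Rp \<Longrightarrow> g \<beta> \<in> Rp"
  shows "g = id"
proof -
  define Q where "Q l \<longleftrightarrow> set l \<subseteq> simple_roots \<and> g = word l" for l
  have "\<exists>l. Q l" using W_word[OF g] by (simp add: Q_def)
  then obtain l where l: "Q l" and min: "\<And>m. Q m \<Longrightarrow> length l \<le> length m"
    using ex_has_least_nat[of Q _ length] by metis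
  have "l = []"
  proof (rule ccontr)
    assume "l \<noteq> []"
    then obtain m \<alpha> where m: "l = m @ [\<alpha>]" by (metis rev_exhaust)
    have S: "set m \<subseteq> simple_roots" "\<alpha> \<in> simple_roots" and gw: "g = word l" using l m by (auto simp: Q_def)
    have aR: "\<alpha> \<in> Rp" "\<alpha> \<in> R" using S simple_subset simple_subset_R by auto
    have mR: "set m \<subseteq> R" using S simple_subset_R by blast
    \<comment> \<open>The last letter turns \<alpha> into its negative, so the remaining word
      \<open>m\<close> must make \<alpha> negative again for \<open>g\<close> to keep it positive.
      The letter where this happens cancels against the last one, contradicting minimal
      length.\<close>
    have "g \<alpha> = - word m \<alpha>"
      using norm_root[OF aR(2)] linear_neg[OF W_linear[OF word_in_W[OF mR]]]
      by (simp add: gw m word_append word_simps reflection_self)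
    then have "word m \<alpha> \<notin> Rp" using pos[OF aR(1)] Rp_not_both by auto
    then obtain p \<gamma> q where pq: "m = p @ [\<gamma>] @ q" "word q \<alpha> = \<gamma>"
      using word_sign_change[OF S(1) aR(1)] by blast
    have qR: "set q \<subseteq> R" using mR pq by simp
    have conj: "reflection \<gamma> \<circ> word q = word q \<circ> reflection \<alpha>"
      using reflection_conjugate[OF W_orth[OF word_in_W[OF qR]], of \<alpha>] pq by (auto simp: fun_eq_iff)
    have "g = word p \<circ> (reflection \<gamma> \<circ> word q) \<circ> reflection \<alpha>"
      by (simp add: gw m pq(1) word_append word_simps comp_assoc)
    also have "\<dots> = word (p @ q)"
      using reflection_reflection[OF norm_root[OF aR(2)]]
      by (auto simp: conj word_append fun_eq_iff)
    finally have "Q (p @ q)" using S pq by (auto simp: Q_def)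
    from min[OF this] show False using m pq by simp
  qed
  then show ?thesis using l by (simp add: Q_def word_simps)
qed

text \<open>Since \<open>g x \<bullet> g \<beta> = x \<bullet> \<beta> > 0\<close> and
  \<open>g x\<close> lies in the chamber, \<open>g \<beta>\<close> cannot be a negative root; thus
  \<open>g\<close> preserves the positive roots.\<close>

lemma W_free:
  assumes g: "g \<in> W" and x: "\<forall>\<alpha>\<in>Rp. x \<bullet> \<alpha> > 0" and gx: "\<forall>\<alpha>\<in>Rp. g x \<bullet> \<alpha> > 0"
  shows "g = id"
proof (rule W_preserving_chamber[OF g])
  fix \<beta> assume b: "\<beta> \<in> Rp"
  have "g \<beta> \<in> R" using W_root[OF g Rp_subset[OF b]] .
  moreover have "g x \<bullet> g \<beta> > 0" using x b by (simp add: W_inner[OF g])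
  ultimately show "g \<beta> \<in> Rp" using Rp_cases[of "g \<beta>"] gx by force
qed

end

lemma sgn_det_compose:
  assumes "linear g" "linear h" shows "sgn_det (g \<circ> h) = sgn_det g * sgn_det h"
  using assms by (simp add: sgn_det_def matrix_compose det_mul)

text \<open>An orthogonal map taking a coordinate vector to \<alpha> conjugates the two reflections,
  and the reflection in a coordinate vector is diagonal with a single entry -1.\<close>

lemma sgn_det_reflection:
  fixes \<alpha> :: "real^'n" assumes "norm \<alpha> = 1" shows "sgn_det (reflection \<alpha>) = -1"
proof -
  fix k :: 'n
  define e where "e = (axis k 1 :: real^'n)"
  have "norm e = 1" by (simp add: e_def)
  then obtain f where f: "orthogonal_transformation f" "f e = \<alpha>"
    using orthogonal_transformation_exists_1[of e \<alpha>] assms by auto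
  have lf: "linear f" using f orthogonal_transformation_linear by blast
  have "f \<circ> reflection e = reflection \<alpha> \<circ> f"
    using reflection_conjugate[OF f(1)] f(2) by auto
  then have "sgn_det f * sgn_det (reflection e) = sgn_det (reflection \<alpha>) * sgn_det f"
    by (metis lf linear_reflection sgn_det_compose)
  moreover have "sgn_det f \<noteq> 0"
    unfolding sgn_det_def using orthogonal_transformation_matrix det_orthogonal_matrix f(1)
    by (metis one_neq_zero zero_neq_neg_one)
  ultimately have "sgn_det (reflection \<alpha>) = sgn_det (reflection e)" by simp
  also have "\<dots> = -1"
  proof -
    have ent: "matrix (reflection e) $ i $ j = (if i = j then (if i = k then -1 else 1) else 0)" for i j
      by (auto simp: matrix_def reflection_def e_def inner_axis_axis) (auto simp: axis_def)
    then have "det (matrix (reflection e)) = (\<Prod>i\<in>UNIV. matrix (reflection e) $ i $ i)"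
      by (intro det_diagonal) simp
    also have "\<dots> = (\<Prod>i\<in>UNIV. if i = k then -1 else 1)"
      by (simp add: ent)
    also have "\<dots> = -1" by (simp add: prod.delta)
    finally show ?thesis by (simp add: sgn_det_def)
  qed
  finally show ?thesis .
qed

lemma (in root_system) sgn_det_sign_homs: "sgn_det \<in> sign_homs R"
proof -
  have "sgn_det g \<in> {1, -1}" if "g \<in> W" for g
    using det_orthogonal_matrix[of "matrix g"] W_orth[OF that] orthogonal_transformation_matrix
    unfolding sgn_det_def by blast
  moreover have "sgn_det (g \<circ> h) = sgn_det g * sgn_det h" if "g \<in> W" "h \<in> W" for g h
    using that by (intro sgn_det_compose W_linear)
  ultimately show ?thesis by (simp add: sign_homs_def)
qed

section \<open>Smooth functions and test functions\<close>

text \<open>The flat function \<open>exp (- 1 / s)\<close> divided by powers of \<open>s\<close>.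
  Derivatives stay in the linear span of this family, so smoothness needs no formula for higher
  derivatives; \<open>k = 0\<close> is the cutoff profile.\<close>

definition bump :: "nat \<Rightarrow> real \<Rightarrow> real" where
  "bump k s = (if s > 0 then exp (- 1 / s) / s ^ k else 0)"

lemma power_le_fact_exp:
  assumes "z \<ge> (0::real)" shows "z ^ m \<le> fact m * exp z"
proof -
  have "z ^ m /\<^sub>R fact m \<le> (\<Sum>n. z ^ n /\<^sub>R fact n)"
    using sum_le_suminf[of "\<lambda>n. z ^ n /\<^sub>R fact n" "{m}"] assms summable_exp_generic[of z] by simp
  then have "z ^ m / fact m \<le> exp z" by (simp add: exp_def field_simps)
  then show ?thesis by (simp add: field_simps)
qed

lemma bump_nonneg: "0 \<le> bump k s" by (simp add: bump_def)

lemma bump_eq_0: "s \<le> 0 \<Longrightarrow> bump k s = 0" by (simp add: bump_def)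

text \<open>With \<open>z = 1 / s\<close>, a single term of the exponential series gives
  \<open>z ^ k \<le> fact k * exp z\<close>. These explicit bounds later serve as dominating
  constants.\<close>

lemma bump_le: "bump k s \<le> fact k"
proof (cases "s > 0")
  case True
  have "(1 / s) ^ k \<le> fact k * exp (1 / s)" using True by (intro power_le_fact_exp) simp
  then have "(1 / s) ^ k / exp (1 / s) \<le> fact k" by (simp only: pos_divide_le_eq[OF exp_gt_zero])
  then show ?thesis using True by (simp add: bump_def power_divide exp_minus divide_inverse power_inverse mult.commute)
qed (simp add: bump_def)

lemma bump_0_le: "bump 0 s \<le> 1"
  using bump_le[of 0 s] by simp

lemma bump_shift: "bump k s = s * bump (Suc k) s" "bump k s = s\<^sup>2 * bump (k + 2) s"
  by (auto simp: bump_def power2_eq_square)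

lemma has_derivative_bump:
  "(bump k has_real_derivative (bump (k + 2) s - real k * bump (Suc k) s)) (at s)"
proof -
  consider "s > 0" | "s < 0" | "s = 0" by linarith
  then show ?thesis
  proof cases
    case 1
    have "((\<lambda>s. exp (- 1 / s) / s ^ k) has_real_derivative (bump (k + 2) s - real k * bump (Suc k) s)) (at s)"
    proof (cases k)
      case 0
      with 1 show ?thesis
        by (auto intro!: derivative_eq_intros simp: bump_def field_simps power2_eq_square)
    next
      case (Suc j)
      with 1 show ?thesis
        by (auto intro!: derivative_eq_intros simp: bump_def field_simps power2_eq_square, cases j, auto)
    qed
    then show ?thesis
      by (rule has_field_derivative_transform_within_open[of _ _ _ "{0<..}"]) (use 1 in \<open>auto simp: bump_def\<close>)
  next
    case 2
    have "((\<lambda>s. 0) has_real_derivative (bump (k + 2) s - real k * bump (Suc k) s)) (at s)"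
      using 2 by (simp add: bump_def)
    then show ?thesis
      by (rule has_field_derivative_transform_within_open[of _ _ _ "{..<0}"]) (use 2 in \<open>auto simp: bump_def\<close>)
  next
    case 3
    \<comment> \<open>At the origin \<open>bump k y = y\<^sup>2 * bump (k + 2) y\<close>, so the
      difference quotient is bounded by a multiple of the absolute value of
      \<open>y\<close>.\<close>
    have "((\<lambda>y. (bump k y - bump k 0) / (y - 0)) \<longlongrightarrow> 0) (at 0)"
    proof (rule Lim_null_comparison)
      show "\<forall>\<^sub>F y in at 0. norm ((bump k y - bump k 0) / (y - 0)) \<le> fact (k + 2) * \<bar>y\<bar>"
      proof (rule always_eventually, rule allI)
        fix y :: real
        have "\<bar>bump k y / y\<bar> = bump (k + 2) y * \<bar>y\<bar>"
          unfolding bump_shift(2)[of k y] using bump_nonneg[of "k + 2" y]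
          by (simp add: abs_mult power2_eq_square)
        also have "\<dots> \<le> fact (k + 2) * \<bar>y\<bar>" by (intro mult_right_mono bump_le) simp
        finally show "norm ((bump k y - bump k 0) / (y - 0)) \<le> fact (k + 2) * \<bar>y\<bar>"
          by (simp add: bump_eq_0)
      qed
      show "((\<lambda>y. fact (k + 2) * \<bar>y\<bar>) \<longlongrightarrow> (0::real)) (at 0)"
        by (intro tendsto_mult_right_zero) (auto intro!: tendsto_eq_intros)
    qed
    then show ?thesis unfolding has_field_derivative_iff 3 by (simp add: bump_eq_0)
  qed
qed

lemma bump_0_tendsto:
  assumes "s > 0" shows "(\<lambda>n. bump 0 (real n * s)) \<longlonglongrightarrow> 1"
proof -
  have "filterlim (\<lambda>n. real n * s) at_top sequentially"
    using assms by (intro filterlim_at_top_mult_tendsto_pos[OF tendsto_const _ filterlim_real_sequentially])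
      (auto simp: mult.commute) 
  then have "(\<lambda>n. exp (- 1 / (real n * s))) \<longlonglongrightarrow> exp 0"
    by (intro tendsto_exp real_tendsto_divide_at_top[OF tendsto_const])
  then have "(\<lambda>n. exp (- 1 / (real n * s))) \<longlonglongrightarrow> 1" by simp
  then show ?thesis
    by (rule Lim_transform_eventually) (use assms in \<open>auto simp: bump_def eventually_sequentially intro!: exI[of _ 1]\<close>)
qed

section \<open>Smooth functions and their closure properties\<close>

abbreviation smooth :: "(real^'n \<Rightarrow> complex) \<Rightarrow> bool" where "smooth \<equiv> smooth_on UNIV"

lemma smooth_differentiable: "smooth f \<Longrightarrow> f differentiable at x"
  unfolding smooth_on_def by (drule spec[of _ "[]"]) simp

lemma smooth_dir_deriv:
  fixes f :: "real^'n \<Rightarrow> complex"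
  shows "smooth f \<Longrightarrow> b \<in> Basis \<Longrightarrow> smooth (dir_deriv b f)"
  unfolding smooth_on_def
proof (intro allI impI ballI)
  fix bs :: "(real^'n) list" and x
  assume f: "\<forall>bs. set bs \<subseteq> Basis \<longrightarrow> (\<forall>x\<in>UNIV. foldr dir_deriv bs f differentiable at x)"
    and b: "b \<in> Basis" "set bs \<subseteq> Basis"
  then show "foldr dir_deriv bs (dir_deriv b f) differentiable at x"
    using f[rule_format, of "bs @ [b]" x] by simp
qed

text \<open>Smoothness is shown by exhibiting a class of differentiable functions stable under
  coordinate derivatives, which replaces reasoning about iterated derivatives of a particular
  function.\<close>

lemma smooth_coinduct:
  assumes "f \<in> F" "\<And>f x. f \<in> F \<Longrightarrow> f differentiable at x" "\<And>f b. f \<in> F \<Longrightarrow> b \<in> Basis \<Longrightarrow> dir_deriv b f \<in> F"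
  shows "smooth f"
proof -
  have "set bs \<subseteq> Basis \<Longrightarrow> foldr dir_deriv bs f \<in> F" for bs
    using assms by (induction bs) auto
  then show ?thesis using assms by (simp add: smooth_on_def)
qed

lemma dir_deriv_eq: "(f has_derivative D) (at x) \<Longrightarrow> dir_deriv b f x = D b"
  unfolding dir_deriv_def using frechet_derivative_at by metis

lemma dir_deriv_has_derivative: "f differentiable at x \<Longrightarrow> (f has_derivative (\<lambda>b. dir_deriv b f x)) (at x)"
  unfolding dir_deriv_def using frechet_derivative_works by auto

lemma axis_in_Basis_real: "(axis j (1::real) :: real^'n) \<in> Basis"
  by (auto simp: Basis_vec_def)

lemma dir_deriv_partial:
  fixes f :: "real^'n \<Rightarrow> complex"
  assumes "f differentiable at x"
  shows "dir_deriv v f x = (\<Sum>j\<in>UNIV. of_real (v $ j) * partial j f x)"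
proof -
  interpret bounded_linear "\<lambda>b. dir_deriv b f x"
    using dir_deriv_has_derivative[OF assms] by (rule has_derivative_bounded_linear)
  have "v = (\<Sum>j\<in>UNIV. (v $ j) *\<^sub>R axis j 1)"
    by (vector axis_def) (simp add: if_distrib cong: if_cong)
  then have "dir_deriv v f x = dir_deriv (\<Sum>j\<in>UNIV. (v $ j) *\<^sub>R axis j 1) f x" by simp
  also have "\<dots> = (\<Sum>j\<in>UNIV. (v $ j) *\<^sub>R dir_deriv (axis j 1) f x)" by (simp add: sum scaleR)
  finally show ?thesis by (simp add: scaleR_conv_of_real)
qed

text \<open>An algebra closed under partial derivatives, hence consisting of smooth functions.\<close>

inductive_set smooth_alg :: "(real^'n \<Rightarrow> complex) set" where
  lin: "smooth f \<Longrightarrow> linear g \<Longrightarrow> (\<lambda>x. f ((g :: real^'n \<Rightarrow> real^'n) x)) \<in> smooth_alg"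
| bmp: "(\<lambda>x. of_real (bump k (a \<bullet> x + c))) \<in> smooth_alg"
| const: "(\<lambda>x. c) \<in> smooth_alg"
| add: "f \<in> smooth_alg \<Longrightarrow> g \<in> smooth_alg \<Longrightarrow> (\<lambda>x. f x + g x) \<in> smooth_alg"
| mult: "f \<in> smooth_alg \<Longrightarrow> g \<in> smooth_alg \<Longrightarrow> (\<lambda>x. f x * g x) \<in> smooth_alg"

lemma smooth_alg_sum: "finite I \<Longrightarrow> (\<And>i. i \<in> I \<Longrightarrow> f i \<in> smooth_alg) \<Longrightarrow> (\<lambda>x. \<Sum>i\<in>I. f i x) \<in> smooth_alg"
  by (induction I rule: finite_induct) (auto intro: smooth_alg.intros)

lemma has_derivative_bump_affine:
  "((\<lambda>x. complex_of_real (bump k (a \<bullet> x + c))) has_derivative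
    (\<lambda>v. of_real ((a \<bullet> v) * (bump (k + 2) (a \<bullet> x + c) - real k * bump (Suc k) (a \<bullet> x + c))))) (at x)"
proof -
  have "((\<lambda>x. a \<bullet> x + c) has_derivative (\<lambda>v. a \<bullet> v)) (at x)"
    by (auto intro!: derivative_eq_intros)
  from has_derivative_compose[OF this has_derivative_bump[unfolded has_field_derivative_def]]
  have "((\<lambda>x. bump k (a \<bullet> x + c)) has_derivative
    (\<lambda>v. (bump (k + 2) (a \<bullet> x + c) - real k * bump (Suc k) (a \<bullet> x + c)) * (a \<bullet> v))) (at x)" .
  from has_derivative_of_real[OF this] show ?thesis by (simp only: mult.commute)
qed

lemma smooth_alg_deriv:
  fixes f :: "real^'n \<Rightarrow> complex"
  assumes "f \<in> smooth_alg"
  shows "(\<forall>x. f differentiable at x) \<and> (\<forall>v. dir_deriv v f \<in> smooth_alg)"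
  using assms
proof induction
  case (lin f g)
  have d: "((\<lambda>x. f (g x)) has_derivative (\<lambda>v. dir_deriv (g v) f (g x))) (at x)" for x
    using has_derivative_compose[OF linear_imp_has_derivative[OF lin(2)]
      dir_deriv_has_derivative[OF smooth_differentiable[OF lin(1)]]] .
  have "dir_deriv v (\<lambda>x. f (g x)) = (\<lambda>x. \<Sum>j\<in>UNIV. of_real (g v $ j) * partial j f (g x))" for v
    by (rule ext, subst dir_deriv_eq[OF d], rule dir_deriv_partial[OF smooth_differentiable[OF lin(1)]])
  moreover have "(\<lambda>x. \<Sum>j\<in>UNIV. of_real (g v $ j) * partial j f (g x)) \<in> smooth_alg" for v
    using lin by (intro smooth_alg_sum smooth_alg.mult smooth_alg.const smooth_alg.lin smooth_dir_deriv axis_in_Basis_real) auto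
  ultimately show ?case using d unfolding differentiable_def by metis
next
  case (bmp k a c)
  have "(\<lambda>x. of_real ((a \<bullet> v) * (bump (k + 2) (a \<bullet> x + c) - real k * bump (Suc k) (a \<bullet> x + c))))
    = (\<lambda>x. of_real (a \<bullet> v) * (of_real (bump (k + 2) (a \<bullet> x + c)) + of_real (- real k) * of_real (bump (Suc k) (a \<bullet> x + c))))"
    for v by (auto simp: fun_eq_iff)
  moreover have "\<dots> v \<in> smooth_alg" for v by (intro smooth_alg.intros)
  ultimately show ?case
    using has_derivative_bump_affine dir_deriv_eq[OF has_derivative_bump_affine] unfolding differentiable_def
    by (metis (no_types, lifting) ext)
next
  case (const c)
  have "((\<lambda>x. c) has_derivative (\<lambda>v. 0)) (at x)" for x :: "real^'n" by simp
  then have "dir_deriv v (\<lambda>x. c) = (\<lambda>x. 0)" for v :: "real^'n" using dir_deriv_eq by (metis ext)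
  then show ?case by (auto intro: smooth_alg.const)
next
  case (add f g)
  have d: "((\<lambda>x. f x + g x) has_derivative (\<lambda>v. dir_deriv v f x + dir_deriv v g x)) (at x)" for x
    using add by (intro has_derivative_add dir_deriv_has_derivative) auto
  have "dir_deriv v (\<lambda>x. f x + g x) = (\<lambda>x. dir_deriv v f x + dir_deriv v g x)" for v
    using dir_deriv_eq[OF d] by (simp add: fun_eq_iff)
  then show ?case using add d by (auto intro: smooth_alg.add simp: differentiable_def)
next
  case (mult f g)
  have d: "((\<lambda>x. f x * g x) has_derivative (\<lambda>v. f x * dir_deriv v g x + dir_deriv v f x * g x)) (at x)" for x
    using mult by (intro has_derivative_mult dir_deriv_has_derivative) auto
  have "dir_deriv v (\<lambda>x. f x * g x) = (\<lambda>x. f x * dir_deriv v g x + dir_deriv v f x * g x)" for v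
    using dir_deriv_eq[OF d] by (simp add: fun_eq_iff)
  moreover have "(\<lambda>x. f x * dir_deriv v g x + dir_deriv v f x * g x) \<in> smooth_alg" for v
    using mult by (intro smooth_alg.add smooth_alg.mult) auto
  ultimately show ?case using d by (auto simp: differentiable_def)
qed

text \<open>The generator \<open>lin\<close> with the identity map already contains every smooth
  function, so the closure rules of the algebra become closure rules for smoothness.\<close>

lemma smooth_iff_alg: "smooth f \<longleftrightarrow> f \<in> smooth_alg"
  using smooth_coinduct[of f smooth_alg] smooth_alg_deriv smooth_alg.lin[of f "\<lambda>x. x"] linear_id
  by (auto simp: id_def)

lemma smooth_add: "smooth f \<Longrightarrow> smooth g \<Longrightarrow> smooth (\<lambda>x. f x + g x)"
  and smooth_mult: "smooth f \<Longrightarrow> smooth g \<Longrightarrow> smooth (\<lambda>x. f x * g x)"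
  and smooth_const: "smooth (\<lambda>x. c)"
  and smooth_bump: "smooth (\<lambda>x. of_real (bump k (a \<bullet> x + d)))"
  by (auto simp: smooth_iff_alg intro: smooth_alg.intros)

lemma smooth_linear:
  fixes g :: "real^'n \<Rightarrow> real^'n"
  shows "smooth f \<Longrightarrow> linear g \<Longrightarrow> smooth (\<lambda>x. f (g x))"
  by (rule smooth_iff_alg[THEN iffD2], rule smooth_alg.lin)

lemma smooth_prod: "(\<And>i. i \<in> I \<Longrightarrow> smooth (f i)) \<Longrightarrow> smooth (\<lambda>x. \<Prod>i\<in>I. f i x)"
  by (induction I rule: infinite_finite_induct) (auto intro: smooth_const smooth_mult)

lemma smooth_partial: "smooth f \<Longrightarrow> smooth (partial j f)"
  by (intro smooth_dir_deriv axis_in_Basis_real)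

lemma smooth_continuous: "smooth f \<Longrightarrow> continuous_on S f"
  using smooth_differentiable differentiable_imp_continuous_within
  by (metis continuous_at_imp_continuous_on)

lemma smooth_measurable: "smooth f \<Longrightarrow> f \<in> borel_measurable borel"
  by (intro borel_measurable_continuous_onI smooth_continuous)

lemma partial_mult:
  assumes "smooth f" "smooth g"
  shows "partial j (\<lambda>x. f x * g x) x = f x * partial j g x + partial j f x * g x"
  using assms by (intro dir_deriv_eq[OF has_derivative_mult[OF dir_deriv_has_derivative dir_deriv_has_derivative]] smooth_differentiable)

lemma partial_diff:
  assumes "smooth f" "smooth g"
  shows "partial j (\<lambda>x. f x - g x) x = partial j f x - partial j g x"
  using assms by (intro dir_deriv_eq[OF has_derivative_diff[OF dir_deriv_has_derivative dir_deriv_has_derivative]] smooth_differentiable)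

lemma partial_linear:
  assumes "smooth f" "linear g"
  shows "partial j (\<lambda>x. f (g x)) x = (\<Sum>i\<in>UNIV. of_real (g (axis j 1) $ i) * partial i f (g x))"
  unfolding dir_deriv_partial[OF smooth_differentiable[OF assms(1)], symmetric]
  by (rule dir_deriv_eq[OF has_derivative_compose[OF linear_imp_has_derivative[OF assms(2)]
        dir_deriv_has_derivative[OF smooth_differentiable[OF assms(1)]]]])

section \<open>Test functions: localization, symmetry and Lipschitz bounds\<close>

lemma test_functions_smooth: "\<phi> \<in> test_functions U \<Longrightarrow> smooth \<phi>"
  by (simp add: test_functions_def)

lemma test_functionsI:
  assumes "smooth \<phi>" "compact K" "K \<subseteq> U" "\<And>x. x \<notin> K \<Longrightarrow> \<phi> x = 0"
  shows "\<phi> \<in> test_functions U"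
proof -
  have "closure {x. \<phi> x \<noteq> 0} \<subseteq> K"
    using assms by (intro closure_minimal compact_imp_closed) auto
  moreover have "compact (closure {x. \<phi> x \<noteq> 0})"
    using calculation assms(2) by (meson bounded_subset closed_closure compact_eq_bounded_closed)
  ultimately show ?thesis using assms by (auto simp: test_functions_def)
qed

lemma test_functionsE:
  assumes "\<phi> \<in> test_functions U"
  obtains K where "compact K" "K \<subseteq> U" "\<And>x. x \<notin> K \<Longrightarrow> \<phi> x = 0"
proof (rule that[of "closure {x. \<phi> x \<noteq> 0}"])
  fix x assume "x \<notin> closure {x. \<phi> x \<noteq> 0}"
  then show "\<phi> x = 0" using closure_subset[of "{x. \<phi> x \<noteq> 0}"] by blast
qed (use assms in \<open>auto simp: test_functions_def\<close>)

lemma test_functions_mono: "U \<subseteq> V \<Longrightarrow> \<phi> \<in> test_functions U \<Longrightarrow> \<phi> \<in> test_functions V"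
  by (auto simp: test_functions_def)

lemma test_functions_outside: "\<phi> \<in> test_functions U \<Longrightarrow> x \<notin> U \<Longrightarrow> \<phi> x = 0"
  by (metis test_functionsE subsetD)

lemma test_functions_mult: "\<phi> \<in> test_functions U \<Longrightarrow> smooth \<psi> \<Longrightarrow> (\<lambda>x. \<psi> x * \<phi> x) \<in> test_functions U"
  by (rule test_functionsE, assumption, rule test_functionsI) (auto intro: smooth_mult test_functions_smooth)

lemma test_functions_add:
  assumes "\<phi> \<in> test_functions U" "\<psi> \<in> test_functions U"
  shows "(\<lambda>x. \<phi> x + \<psi> x) \<in> test_functions U"
proof -
  obtain K L where "compact K" "K \<subseteq> U" "\<And>x. x \<notin> K \<Longrightarrow> \<phi> x = 0" "compact L" "L \<subseteq> U" "\<And>x. x \<notin> L \<Longrightarrow> \<psi> x = 0"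
    using assms by (metis test_functionsE)
  then show ?thesis using assms
    by (intro test_functionsI[of _ "K \<union> L"]) (auto intro: smooth_add test_functions_smooth)
qed

lemma test_functions_zero: "(\<lambda>x. 0) \<in> test_functions U"
  by (rule test_functionsI[of _ "{}"]) (auto intro: smooth_const)

lemma test_functions_cmult: "\<phi> \<in> test_functions U \<Longrightarrow> (\<lambda>x. c * \<phi> x) \<in> test_functions U"
  by (intro test_functions_mult smooth_const)

lemma test_functions_sum: "(\<And>i. i \<in> I \<Longrightarrow> \<phi> i \<in> test_functions U) \<Longrightarrow> (\<lambda>x. \<Sum>i\<in>I. \<phi> i x) \<in> test_functions U"
  by (induction I rule: infinite_finite_induct) (auto intro: test_functions_zero test_functions_add)

lemma partial_zero_outside:
  assumes "\<And>x. x \<notin> K \<Longrightarrow> \<phi> x = 0" "closed K" "x \<notin> K"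
  shows "partial j \<phi> x = 0"
proof (rule dir_deriv_eq)
  show "(\<phi> has_derivative (\<lambda>_. 0)) (at x)"
    by (rule has_derivative_transform_within_open[of "\<lambda>_. 0" _ _ _ "- K"]) (use assms in auto)
qed

lemma test_functions_partial:
  assumes "\<phi> \<in> test_functions U" shows "partial j \<phi> \<in> test_functions U"
proof -
  obtain K where "compact K" "K \<subseteq> U" "\<And>x. x \<notin> K \<Longrightarrow> \<phi> x = 0" using test_functionsE[OF assms] by metis
  then show ?thesis using assms
    by (intro test_functionsI[of _ K]) (auto intro: smooth_partial test_functions_smooth partial_zero_outside compact_imp_closed)
qed

lemma test_functions_orthogonal:
  fixes g :: "real^'n \<Rightarrow> real^'n"
  assumes \<phi>: "\<phi> \<in> test_functions V" and g: "orthogonal_transformation g" and U: "\<And>x. g x \<in> V \<Longrightarrow> x \<in> U"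
  shows "(\<lambda>x. \<phi> (g x)) \<in> test_functions U"
proof -
  obtain K where K: "compact K" "K \<subseteq> V" "\<And>x. x \<notin> K \<Longrightarrow> \<phi> x = 0" using test_functionsE[OF \<phi>] by metis
  have b: "bij g" using g by (rule orthogonal_transformation_bij)
  have i: "orthogonal_transformation (inv g)" using g by (rule orthogonal_transformation_inv)
  have eq: "g -` K = inv g ` K" using b by (simp add: bij_vimage_eq_inv_image)
  have "compact (inv g ` K)"
    using K(1) i by (intro compact_continuous_image linear_continuous_on
        linear_linear[THEN iffD2] orthogonal_transformation_linear)
  then show ?thesis using K U test_functions_smooth[OF \<phi>] g
    by (intro test_functionsI[of _ "g -` K"]) (auto simp: eq[symmetric] intro: smooth_linear orthogonal_transformation_linear)
qed

lemma test_functions_bounded: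
  assumes "\<phi> \<in> test_functions U" obtains B where "B \<ge> 0" "\<And>x. cmod (\<phi> x) \<le> B"
proof -
  obtain K where K: "compact K" "K \<subseteq> U" "\<And>x. x \<notin> K \<Longrightarrow> \<phi> x = 0" using test_functionsE[OF assms] by metis
  have "bounded (\<phi> ` K)"
    using K(1) assms by (intro compact_imp_bounded compact_continuous_image smooth_continuous test_functions_smooth)
  then obtain B where "\<And>x. x \<in> K \<Longrightarrow> cmod (\<phi> x) \<le> B" by (auto simp: bounded_iff)
  then have "cmod (\<phi> x) \<le> max B 0" for x using K(3)[of x] by (cases "x \<in> K") (auto simp: le_max_iff_disj)
  then show thesis by (intro that[of "max B 0"]) auto
qed

text \<open>The partial derivatives are test functions and hence bounded. The constant is used both
  to dominate difference quotients and to make antisymmetric functions vanish linearly at the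
  walls.\<close>

lemma test_functions_lipschitz:
  assumes \<phi>: "\<phi> \<in> test_functions U" obtains L where "L \<ge> 0" "\<And>x y. cmod (\<phi> x - \<phi> y) \<le> L * norm (x - y)"
proof -
  have "\<exists>B. \<forall>x. cmod (partial j \<phi> x) \<le> B" for j
    using test_functions_bounded[OF test_functions_partial[OF \<phi>, of j]] by metis
  then obtain B where B: "\<And>j x. cmod (partial j \<phi> x) \<le> B j" by metis
  have Bn: "B j \<ge> 0" for j using B[of j] norm_ge_zero order_trans by blast
  show thesis
  proof (rule that[of "\<Sum>j\<in>UNIV. B j"])
    fix x y
    note d = smooth_differentiable[OF test_functions_smooth[OF \<phi>]]
    show "cmod (\<phi> x - \<phi> y) \<le> (\<Sum>j\<in>UNIV. B j) * norm (x - y)"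
    proof (rule differentiable_bound[of UNIV \<phi> "\<lambda>x v. dir_deriv v \<phi> x"])
      fix x
      show "onorm (\<lambda>v. dir_deriv v \<phi> x) \<le> (\<Sum>j\<in>UNIV. B j)"
      proof (rule onorm_le)
        fix v
        have "cmod (dir_deriv v \<phi> x) \<le> (\<Sum>j\<in>UNIV. cmod (of_real (v $ j) * partial j \<phi> x))"
          by (subst dir_deriv_partial[OF d]) (rule norm_sum)
        also have "\<dots> \<le> (\<Sum>j\<in>UNIV. norm v * B j)"
          unfolding norm_mult by (intro sum_mono mult_mono B) (auto simp: component_le_norm_cart)
        finally show "cmod (dir_deriv v \<phi> x) \<le> (\<Sum>j\<in>UNIV. B j) * norm v"
          by (simp add: sum_distrib_left mult.commute)
      qed
      next
      fix x show "(\<phi> has_derivative (\<lambda>v. dir_deriv v \<phi> x)) (at x within UNIV)"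
        using dir_deriv_has_derivative[OF d] by simp
    qed auto
  qed (simp add: sum_nonneg Bn)
qed

section \<open>Lebesgue measure\<close>

text \<open>For translation invariant \<open>\<nu>\<close>, Fubini's theorem and \<open>y \<mapsto> -y\<close> give
  \<open>(\<integral>f d\<nu>) (\<integral>h dx) = (\<integral>f dx) (\<integral>h d\<nu>)\<close>. Here \<open>\<nu>\<close> is the image of Lebesgue measure, and \<open>h\<close> is
  taken to be the indicator function of the unit ball, which \<open>g\<close> preserves.\<close>

lemma lborel_distr_orthogonal:
  fixes g :: "'a::euclidean_space \<Rightarrow> 'a"
  assumes g: "orthogonal_transformation g"
  shows "distr lborel borel g = lborel"
proof -
  have lin: "linear g" using g by (rule orthogonal_transformation_linear)
  have gm[measurable]: "g \<in> borel_measurable borel"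
    using lin by (intro borel_measurable_continuous_onI linear_continuous_on) (simp add: linear_linear)
  define \<nu> where "\<nu> = distr lborel borel g"
  have sets_\<nu>[measurable_cong]: "sets \<nu> = sets borel" by (simp add: \<nu>_def)
  have ball: "emeasure \<nu> (ball 0 1) = emeasure lborel (ball (0::'a) 1)"
  proof -
    have "g -` ball 0 1 = ball 0 1" using orthogonal_transformation_norm[OF g] by auto
    then show ?thesis by (simp add: \<nu>_def emeasure_distr)
  qed
  define \<beta> where "\<beta> = emeasure lborel (ball (0::'a) 1)"
  have \<beta>: "\<beta> \<noteq> 0" "\<beta> \<noteq> \<infinity>"
  proof -
    show "\<beta> \<noteq> \<infinity>" unfolding \<beta>_def using emeasure_lborel_ball_finite[of 0 1] by (auto simp: less_top[symmetric])
    show "\<beta> \<noteq> 0"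
    proof
      assume "\<beta> = 0"
      then have "ball (0::'a) 1 \<in> null_sets lborel" by (auto simp: \<beta>_def null_sets_def)
      then have "negligible (ball (0::'a) 1)"
        by (simp add: negligible_iff_null_sets null_sets_completionI)
      then show False using open_not_negligible[of "ball (0::'a) 1"] by simp
    qed
  qed
  \<comment> \<open>By linearity, translating the image by \<open>c\<close> amounts to translating
    before applying \<open>g\<close> by a preimage \<open>d\<close> of \<open>c\<close>.\<close>
  have trans: "distr \<nu> borel (\<lambda>x. x + c) = \<nu>" for c
  proof -
    obtain d where d: "g d = c" using orthogonal_transformation_surj[OF g] by (metis surjD)
    have "distr \<nu> borel (\<lambda>x. x + c) = distr lborel borel ((\<lambda>x. x + c) \<circ> g)"
      unfolding \<nu>_def by (subst distr_distr) auto
    also have "(\<lambda>x. x + c) \<circ> g = g \<circ> ((+) d)"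
      using linear_add[OF lin] by (auto simp: d add.commute)
    also have "distr lborel borel (g \<circ> ((+) d)) = distr (distr lborel borel ((+) d)) borel g"
      by (subst distr_distr) auto
    also have "\<dots> = \<nu>" by (simp only: lborel_distr_plus \<nu>_def)
    finally show ?thesis .
  qed
  have nn_trans: "(\<integral>\<^sup>+x. f (x + c) \<partial>\<nu>) = (\<integral>\<^sup>+x. f x \<partial>\<nu>)" if [measurable]: "f \<in> borel_measurable borel" for f c
    by (subst (2) trans[of c, symmetric]) (simp add: nn_integral_distr)
  have nn_trans': "(\<integral>\<^sup>+x. f (x + c) \<partial>lborel) = (\<integral>\<^sup>+x. f x \<partial>lborel)"
    if [measurable]: "f \<in> borel_measurable borel" for f and c :: 'a
    by (subst (2) lborel_distr_plus[of c, symmetric]) (simp add: nn_integral_distr add.commute)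
  have nn_neg: "(\<integral>\<^sup>+x. f (- x) \<partial>lborel) = (\<integral>\<^sup>+x. f x \<partial>lborel)"
    if [measurable]: "f \<in> borel_measurable borel" for f :: "'a \<Rightarrow> ennreal"
    by (subst (2) lborel_affine[of "-1" 0]) (simp_all add: nn_integral_density nn_integral_distr)
  have sf: "sigma_finite_measure \<nu>"
  proof
    \<comment> \<open>Fubini's theorem requires \<sigma>-finiteness of \<nu>; balls around the
      origin are their own preimages under \<open>g\<close> and so have finite measure.\<close>
    define A where "A = range (\<lambda>n::nat. ball (0::'a) (real n))"
    have "emeasure \<nu> (ball 0 r) \<noteq> \<infinity>" for r
    proof -
      have "g -` ball 0 r = ball 0 r" using orthogonal_transformation_norm[OF g] by auto
      then show ?thesis using emeasure_lborel_ball_finite[of "0::'a" r] by (auto simp: \<nu>_def emeasure_distr)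
    qed
    moreover have "\<Union>A = UNIV" unfolding A_def using reals_Archimedean2 by (auto simp: dist_norm)
    ultimately show "\<exists>A. countable A \<and> A \<subseteq> sets \<nu> \<and> \<Union>A = space \<nu> \<and> (\<forall>a\<in>A. emeasure \<nu> a \<noteq> \<infinity>)"
      by (intro exI[of _ A]) (auto simp: A_def \<nu>_def)
  qed
  interpret P: pair_sigma_finite lborel \<nu>
    by (simp add: pair_sigma_finite_def sf sigma_finite_lborel)
  have key: "(\<integral>\<^sup>+x. f x \<partial>\<nu>) * (\<integral>\<^sup>+y. h y \<partial>lborel) = (\<integral>\<^sup>+x. f x \<partial>lborel) * (\<integral>\<^sup>+y. h y \<partial>\<nu>)"
    if [measurable]: "f \<in> borel_measurable borel" "h \<in> borel_measurable borel" for f h :: "'a \<Rightarrow> ennreal"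
  proof -
    have "(\<integral>\<^sup>+x. f x \<partial>\<nu>) * (\<integral>\<^sup>+y. h y \<partial>lborel) = (\<integral>\<^sup>+x. (\<integral>\<^sup>+y. f x * h (y + x) \<partial>lborel) \<partial>\<nu>)"
      by (simp add: nn_integral_cmult nn_trans' nn_integral_multc)
    also have "\<dots> = (\<integral>\<^sup>+y. (\<integral>\<^sup>+x. f x * h (y + x) \<partial>\<nu>) \<partial>lborel)"
      by (rule P.Fubini') measurable
    also have "\<dots> = (\<integral>\<^sup>+y. (\<integral>\<^sup>+x. f (x + - y) * h x \<partial>\<nu>) \<partial>lborel)"
    proof (rule nn_integral_cong)
      fix y
      have "(\<integral>\<^sup>+x. f x * h (y + x) \<partial>\<nu>) = (\<integral>\<^sup>+x. f ((x + y) + - y) * h (x + y) \<partial>\<nu>)"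
        by (simp add: add.commute)
      also have "\<dots> = (\<integral>\<^sup>+x. f (x + - y) * h x \<partial>\<nu>)"
        by (rule nn_trans[of "\<lambda>x. f (x + - y) * h x" y]) measurable
      finally show "(\<integral>\<^sup>+x. f x * h (y + x) \<partial>\<nu>) = (\<integral>\<^sup>+x. f (x + - y) * h x \<partial>\<nu>)" .
    qed
    also have "\<dots> = (\<integral>\<^sup>+x. (\<integral>\<^sup>+y. f (x + - y) * h x \<partial>lborel) \<partial>\<nu>)"
      by (rule P.Fubini'[symmetric]) measurable
    also have "\<dots> = (\<integral>\<^sup>+x. (\<integral>\<^sup>+y. f y \<partial>lborel) * h x \<partial>\<nu>)"
    proof (rule nn_integral_cong)
      fix x
      have "(\<integral>\<^sup>+y. f (x + - y) * h x \<partial>lborel) = (\<integral>\<^sup>+y. f (x + - y) \<partial>lborel) * h x"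
        by (simp add: nn_integral_multc)
      also have "(\<integral>\<^sup>+y. f (x + - y) \<partial>lborel) = (\<integral>\<^sup>+y. f (y + x) \<partial>lborel)"
        using nn_neg[of "\<lambda>y. f (y + x)"] by (simp add: add.commute)
      also have "\<dots> = (\<integral>\<^sup>+y. f y \<partial>lborel)" by (rule nn_trans') measurable
      finally show "(\<integral>\<^sup>+y. f (x + - y) * h x \<partial>lborel) = (\<integral>\<^sup>+y. f y \<partial>lborel) * h x" .
    qed
    also have "\<dots> = (\<integral>\<^sup>+x. f x \<partial>lborel) * (\<integral>\<^sup>+y. h y \<partial>\<nu>)" by (simp add: nn_integral_cmult)
    finally show ?thesis .
  qed
  have "\<nu> = lborel"
  proof (rule measure_eqI)
    fix A assume "A \<in> sets \<nu>"
    then have [measurable]: "A \<in> sets borel" by (simp add: sets_\<nu>)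
    have "emeasure \<nu> A * \<beta> = emeasure lborel A * \<beta>"
      using key[of "indicator A" "indicator (ball 0 1)", OF borel_measurable_indicator borel_measurable_indicator] ball by (simp add: \<beta>_def sets_\<nu>)
    then show "emeasure \<nu> A = emeasure lborel A"
      using \<beta> ennreal_mult_cancel_left[of \<beta> "emeasure \<nu> A" "emeasure lborel A"] by (simp add: mult.commute)
  qed (simp add: sets_\<nu>)
  then show ?thesis by (simp add: \<nu>_def)
qed

text \<open>Borel measurability does not suffice for the completed measure: preimages of subsets of
  null sets must be measurable too, and they are because \<open>g\<close> preserves Borel-Lebesgue
  measure.\<close>

lemma lebesgue_measurable_orthogonal:
  fixes g :: "'a::euclidean_space \<Rightarrow> 'a"
  assumes g: "orthogonal_transformation g"
  shows "g \<in> lebesgue \<rightarrow>\<^sub>M lebesgue"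
proof -
  have gm[measurable]: "g \<in> borel_measurable borel"
    using orthogonal_transformation_linear[OF g]
    by (intro borel_measurable_continuous_onI linear_continuous_on) (simp add: linear_linear)
  show ?thesis
  proof (rule measurableI)
    fix A :: "'a set" assume "A \<in> sets lebesgue"
    then obtain S N N' where A: "A = S \<union> N" "N \<subseteq> N'" "N' \<in> null_sets lborel" "S \<in> sets lborel"
      by (rule sets_completionE)
    have N': "N' \<in> sets borel" using A by auto
    have "emeasure lborel (g -` N') = emeasure (distr lborel borel g) N'"
      using N' by (simp add: emeasure_distr)
    also have "\<dots> = 0" using A by (simp add: lborel_distr_orthogonal[OF g] null_sets_def)
    finally have "g -` N' \<in> null_sets lborel"
      using measurable_sets[OF gm N'] by (auto simp: null_sets_def)
    then have "g -` N \<in> sets lebesgue"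
      using A(2) by (intro sets_completionI_sub) auto
    moreover have "g -` S \<in> sets lebesgue"
      using A measurable_sets[OF gm, of S] by (auto intro: sets_completionI_sets)
    ultimately show "g -` A \<inter> space lebesgue \<in> sets lebesgue"
      by (simp add: A(1) vimage_Un)
  qed auto
qed

lemma lebesgue_distr_orthogonal:
  fixes g :: "'a::euclidean_space \<Rightarrow> 'a"
  assumes g: "orthogonal_transformation g"
  shows "distr lebesgue lebesgue g = lebesgue"
proof (rule measure_eqI)
  note gm = lebesgue_measurable_orthogonal[OF g]
  have gb[measurable]: "g \<in> borel_measurable borel"
    using orthogonal_transformation_linear[OF g]
    by (intro borel_measurable_continuous_onI linear_continuous_on) (simp add: linear_linear)
  fix A assume "A \<in> sets (distr lebesgue lebesgue g)"
  then have Al: "A \<in> sets lebesgue" by simp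
  then obtain S N N' where A: "A = S \<union> N" "N \<subseteq> N'" "N' \<in> null_sets lborel" "S \<in> sets lborel"
    by (rule sets_completionE)
  have S: "S \<in> sets borel" using A by simp
  have N: "N \<in> null_sets lebesgue" using A null_sets_completion_subset null_sets_completionI by blast
  have N'2: "N' \<in> sets borel" using A by auto
  have "emeasure lborel (g -` N') = emeasure (distr lborel borel g) N'"
    using N'2 by (simp add: emeasure_distr)
  also have "\<dots> = 0" using A by (simp add: lborel_distr_orthogonal[OF g] null_sets_def)
  finally have "g -` N' \<in> null_sets lborel"
    using measurable_sets[OF gb N'2] by (auto simp: null_sets_def)
  then have gN: "g -` N \<in> null_sets lebesgue"
    using A(2) null_sets_completion_subset null_sets_completionI by (metis vimage_mono)
  have gS: "g -` S \<in> sets borel" using measurable_sets[OF gb S] by simp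
  have "emeasure (distr lebesgue lebesgue g) A = emeasure lebesgue (g -` S \<union> g -` N)"
    using Al gm by (simp add: emeasure_distr A(1) vimage_Un)
  also have "\<dots> = emeasure lebesgue (g -` S)"
    using gS gN by (intro emeasure_Un_null_set) auto
  also have "\<dots> = emeasure (distr lborel borel g) S"
    using gS S by (simp add: emeasure_distr)
  also have "\<dots> = emeasure lebesgue S" using S by (simp add: lborel_distr_orthogonal[OF g])
  also have "\<dots> = emeasure lebesgue A"
    unfolding A(1) using S N by (intro emeasure_Un_null_set[symmetric]) auto
  finally show "emeasure (distr lebesgue lebesgue g) A = emeasure lebesgue A" .
qed simp

lemma lebesgue_on_measurable_orthogonal:
  fixes g :: "'a::euclidean_space \<Rightarrow> 'a"
  assumes g: "orthogonal_transformation g" and UV: "\<And>x. x \<in> U \<Longrightarrow> g x \<in> V"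
  shows "g \<in> lebesgue_on U \<rightarrow>\<^sub>M lebesgue_on V"
  using measurable_restrict_space3[OF lebesgue_measurable_orthogonal[OF g], of U V] UV by blast

lemma lebesgue_on_distr_orthogonal:
  fixes g :: "'a::euclidean_space \<Rightarrow> 'a"
  assumes g: "orthogonal_transformation g" and UV: "\<And>x. x \<in> U \<longleftrightarrow> g x \<in> V"
    and U: "U \<in> sets lebesgue" and V: "V \<in> sets lebesgue"
  shows "distr (lebesgue_on U) (lebesgue_on V) g = lebesgue_on V"
proof (rule measure_eqI)
  fix A assume "A \<in> sets (distr (lebesgue_on U) (lebesgue_on V) g)"
  then have A: "A \<in> sets lebesgue" "A \<subseteq> V" using V by (auto simp: sets_restrict_space_iff)
  have m: "g \<in> lebesgue_on U \<rightarrow>\<^sub>M lebesgue_on V"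
    using UV by (intro lebesgue_on_measurable_orthogonal[OF g]) auto
  have "emeasure (distr (lebesgue_on U) (lebesgue_on V) g) A = emeasure (lebesgue_on U) (g -` A \<inter> U)"
    using A V m by (subst emeasure_distr) (auto simp: sets_restrict_space_iff)
  also have "g -` A \<inter> U = g -` A" using A UV by auto
  also have "emeasure (lebesgue_on U) (g -` A) = emeasure lebesgue (g -` A)"
    using U UV A by (subst emeasure_restrict_space) auto
  also have "\<dots> = emeasure (distr lebesgue lebesgue g) A"
    using A lebesgue_measurable_orthogonal[OF g] by (simp add: emeasure_distr)
  also have "\<dots> = emeasure (lebesgue_on V) A"
    using A V by (simp add: lebesgue_distr_orthogonal[OF g] emeasure_restrict_space)
  finally show "emeasure (distr (lebesgue_on U) (lebesgue_on V) g) A = emeasure (lebesgue_on V) A" .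
qed simp

text \<open>Corners of a countable, intersection-stable family of boxes that generates the Borel
  sets; countability allows the exceptional null sets of all boxes to be united.\<close>

definition rational_pairs :: "('a::euclidean_space \<times> 'a) set" where
  "rational_pairs = {(a, b). \<forall>i\<in>Basis. a \<bullet> i \<in> \<rat> \<and> b \<bullet> i \<in> \<rat>}"

lemma countable_rational_pairs: "countable (rational_pairs :: ('a::euclidean_space \<times> 'a) set)"
proof -
  let ?V = "(\<lambda>f. \<Sum>i\<in>Basis. f i *\<^sub>R i) ` (PiE Basis (\<lambda>_. \<rat>)) :: 'a set"
  have "countable ?V" by (intro countable_image countable_PiE countable_rat) auto
  moreover have "rational_pairs \<subseteq> ?V \<times> ?V"
  proof -
    have "a \<in> ?V" if "\<forall>i\<in>Basis. a \<bullet> i \<in> \<rat>" for a :: 'a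
      using that by (intro image_eqI[of _ _ "\<lambda>i\<in>Basis. a \<bullet> i"]) (auto simp: euclidean_representation)
    then show ?thesis by (auto simp: rational_pairs_def)
  qed
  ultimately show ?thesis by (meson countable_SIGMA countable_subset)
qed

abbreviation rational_boxes_set :: "'a::euclidean_space set set" where
  "rational_boxes_set \<equiv> (\<lambda>(a, b). box a b) ` rational_pairs"

lemma sets_borel_rational_boxes:
  "sets (borel :: 'a::euclidean_space measure) = sigma_sets UNIV rational_boxes_set"
proof -
  have "topological_basis (rational_boxes_set :: 'a set set)"
  proof (rule topological_basisI)
    fix B' :: "'a set" assume "B' \<in> rational_boxes_set" then show "open B'" by auto
  next
    fix O' :: "'a set" and x assume "open O'" "x \<in> O'"
    then obtain e where e: "e > 0" "ball x e \<subseteq> O'" using openE by blast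
    then show "\<exists>B'\<in>rational_boxes_set. x \<in> B' \<and> B' \<subseteq> O'"
      using rational_boxes[OF e(1), of x] by (fastforce simp: rational_pairs_def)
  qed
  then have "(borel :: 'a measure) = sigma UNIV rational_boxes_set"
    by (intro borel_eq_countable_basis countable_image countable_rational_pairs)
  then have "sets (borel :: 'a measure) = sets (sigma UNIV rational_boxes_set)" by (rule arg_cong)
  also have "\<dots> = sigma_sets UNIV rational_boxes_set" by (rule sets_measure_of) simp
  finally show ?thesis .
qed

lemma rational_boxes_Int:
  assumes "(a, b) \<in> rational_pairs" "(c, d) \<in> rational_pairs"
  obtains p q where "(p, q) \<in> rational_pairs" "box a b \<inter> box c d = box p q" "cbox p q \<subseteq> cbox a b"
proof (rule that)
  let ?p = "\<Sum>i\<in>Basis. max (a\<bullet>i) (c\<bullet>i) *\<^sub>R i" and ?q = "\<Sum>i\<in>Basis. min (b\<bullet>i) (d\<bullet>i) *\<^sub>R i"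
  show "(?p, ?q) \<in> rational_pairs" using assms by (auto simp: rational_pairs_def max_def min_def)
  show "box a b \<inter> box c d = box ?p ?q" by (rule box_Int_box)
  show "cbox ?p ?q \<subseteq> cbox a b" by (auto simp: mem_box)
qed

lemma sigma_finite_lebesgue: "sigma_finite_measure (lebesgue :: 'a::euclidean_space measure)"
proof
  define A where "A = range (\<lambda>n::nat. ball (0::'a) (real n))"
  have "\<Union>A = UNIV" unfolding A_def using reals_Archimedean2 by (auto simp: dist_norm)
  moreover have "emeasure lebesgue (ball (0::'a) r) \<noteq> \<infinity>" for r
    using emeasure_lborel_ball_finite[of "0::'a" r] by auto
  ultimately show "\<exists>A. countable A \<and> A \<subseteq> sets lebesgue \<and> \<Union>A = space (lebesgue :: 'a measure)
      \<and> (\<forall>a\<in>A. emeasure lebesgue a \<noteq> \<infinity>)"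
    by (intro exI[of _ A]) (auto simp: A_def)
qed

text \<open>The sets over which \<open>k\<close> integrates to zero are stable under disjoint
  countable unions and, because the total integral vanishes, under complements. So they include all
  Borel sets, and Lebesgue sets differ from these by null sets.\<close>

lemma AE_zero_of_integral_rational_boxes:
  fixes k :: "'a::euclidean_space \<Rightarrow> complex"
  assumes i: "integrable lebesgue k" and z: "(LINT x|lebesgue. k x) = 0"
    and B: "\<And>a b. (a, b) \<in> rational_pairs \<Longrightarrow> (LINT x:box a b|lebesgue. k x) = 0"
  shows "AE x in lebesgue. k x = 0"
proof (rule sigma_finite_measure.density_zero[OF sigma_finite_lebesgue i])
  have si: "set_integrable lebesgue A k" if "A \<in> sets lebesgue" for A
    using integrable_mult_indicator[OF that i] by (simp add: set_integrable_def)
  have borel: "(LINT x:A|lebesgue. k x) = 0" if A: "A \<in> sets borel" for A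
  proof (rule sigma_sets_induct_disjoint[where G=rational_boxes_set and \<Omega>=UNIV])
    show "A \<in> sigma_sets UNIV rational_boxes_set" using A sets_borel_rational_boxes by blast
    show "Int_stable (rational_boxes_set :: 'a set set)"
    proof (rule Int_stableI)
      fix A B :: "'a set" assume "A \<in> rational_boxes_set" "B \<in> rational_boxes_set"
      then obtain a b c d where ab: "A = box a b" "B = box c d" "(a, b) \<in> rational_pairs" "(c, d) \<in> rational_pairs"
        by auto
      then obtain p q where "(p, q) \<in> rational_pairs" "A \<inter> B = box p q"
        using rational_boxes_Int[OF ab(3,4)] by metis
      then show "A \<inter> B \<in> rational_boxes_set" by (intro image_eqI[of _ _ "(p, q)"]) auto
    qed
  next
    fix A assume "A \<in> sigma_sets UNIV rational_boxes_set" and 0: "(LINT x:A|lebesgue. k x) = 0"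
    then have A: "A \<in> sets lebesgue" using sets_borel_rational_boxes[where 'a='a] by auto
    have "(LINT x:A \<union> (UNIV - A)|lebesgue. k x) = (LINT x:A|lebesgue. k x) + (LINT x:UNIV - A|lebesgue. k x)"
      using A by (intro set_integral_Un si) auto
    then show "(LINT x:UNIV - A|lebesgue. k x) = 0" using 0 z by (simp add: set_lebesgue_integral_def)
  next
    fix A :: "nat \<Rightarrow> 'a set"
    assume A: "disjoint_family A" "range A \<subseteq> sigma_sets UNIV rational_boxes_set"
      "\<And>i. (LINT x:A i|lebesgue. k x) = 0"
    then have "A i \<in> sets borel" for i using sets_borel_rational_boxes[where 'a='a] by blast
    then have Al: "A i \<in> sets lebesgue" for i by simp
    have "(LINT x:(\<Union>i. A i)|lebesgue. k x) = (\<Sum>i. (LINT x:A i|lebesgue. k x))"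
      using A Al by (intro lebesgue_integral_countable_add si) (auto simp: disjoint_family_on_def)
    then show "(LINT x:(\<Union>i. A i)|lebesgue. k x) = 0" using A(3) by simp
  qed (auto simp: B, simp add: set_lebesgue_integral_def)
  fix A :: "'a set" assume "A \<in> sets lebesgue"
  then obtain S N N' where A: "A = S \<union> N" "N \<subseteq> N'" "N' \<in> null_sets lborel" "S \<in> sets lborel" and Al: "A \<in> sets lebesgue"
    using sets_completionE by metis
  have N': "N' \<in> null_sets lebesgue" using A by (intro null_sets_completionI)
  have "(LINT x:A|lebesgue. k x) = (LINT x:S|lebesgue. k x)"
    unfolding set_lebesgue_integral_def
  proof (rule integral_cong_AE)
    show "AE x in lebesgue. indicator A x *\<^sub>R k x = indicator S x *\<^sub>R k x"
      using AE_not_in[OF N'] by eventually_elim (use A in \<open>auto simp: indicator_def\<close>)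
    show "(\<lambda>x. indicator A x *\<^sub>R k x) \<in> borel_measurable lebesgue" "(\<lambda>x. indicator S x *\<^sub>R k x) \<in> borel_measurable lebesgue"
      using si[of A] si[of S] Al A(4) by (auto simp: set_integrable_def)
  qed
  then show "(LINT x:A|lebesgue. k x) = 0" using borel[of S] A(4) by simp
qed

text \<open>The preceding lemma is applied to \<open>h\<close> cut off by one box at a time;
  intersecting with another rational box gives again a rational box whose closed box lies in
  \<open>U\<close>. Countably many such boxes cover \<open>U\<close>. Only integrability against
  boxes is assumed because nothing more is known for a kernel in its second variable.\<close>

lemma AE_zero_of_local_boxes:
  fixes h :: "'a::euclidean_space \<Rightarrow> complex"
  assumes U: "open U"
    and i: "\<And>a b. (a, b) \<in> rational_pairs \<Longrightarrow> cbox a b \<subseteq> U \<Longrightarrow> integrable (lebesgue_on U) (\<lambda>x. indicator (box a b) x *\<^sub>R h x)"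
    and z: "\<And>a b. (a, b) \<in> rational_pairs \<Longrightarrow> cbox a b \<subseteq> U \<Longrightarrow> (LINT x|lebesgue_on U. indicator (box a b) x *\<^sub>R h x) = 0"
  shows "AE x in lebesgue_on U. h x = 0"
proof -
  have Us: "U \<inter> space lebesgue \<in> sets lebesgue" using U by (auto intro: sets_completionI_sets)
  define I where "I = {(a, b)\<in>rational_pairs. cbox a b \<subseteq> U}"
  have I: "countable I" by (rule countable_subset[OF _ countable_rational_pairs]) (auto simp: I_def)
  have ext: "(\<lambda>x. indicator U x *\<^sub>R (indicator (box a b) x *\<^sub>R h x)) = (\<lambda>x. indicator (box a b) x *\<^sub>R h x)"
    if "cbox a b \<subseteq> U" for a b
    using that box_subset_cbox[of a b] by (auto simp: fun_eq_iff indicator_def)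
  have zero: "AE x in lebesgue. indicator (box a b) x *\<^sub>R h x = 0" if ab: "(a, b) \<in> I" for a b
  proof (rule AE_zero_of_integral_rational_boxes)
    have r: "(a, b) \<in> rational_pairs" "cbox a b \<subseteq> U" using ab by (auto simp: I_def)
    show "integrable lebesgue (\<lambda>x. indicator (box a b) x *\<^sub>R h x)"
      using i[OF r] ext[OF r(2)] by (simp add: integrable_restrict_space[OF Us])
    show "(LINT x|lebesgue. indicator (box a b) x *\<^sub>R h x) = 0"
      using z[OF r] ext[OF r(2)] by (simp add: integral_restrict_space[OF Us])
    fix c d :: 'a assume "(c, d) \<in> rational_pairs"
    then obtain p q where pq: "(p, q) \<in> rational_pairs" "box a b \<inter> box c d = box p q" "cbox p q \<subseteq> cbox a b"
      using rational_boxes_Int[OF r(1)] by metis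
    then have "cbox p q \<subseteq> U" using r by blast
    have "(LINT x:box c d|lebesgue. indicator (box a b) x *\<^sub>R h x) = (LINT x|lebesgue. indicator (box p q) x *\<^sub>R h x)"
      unfolding set_lebesgue_integral_def pq(2)[symmetric] by (simp add: indicator_inter_arith mult.commute)
    also have "\<dots> = 0"
      using z[OF pq(1) \<open>cbox p q \<subseteq> U\<close>] ext[OF \<open>cbox p q \<subseteq> U\<close>] by (simp add: integral_restrict_space[OF Us])
    finally show "(LINT x:box c d|lebesgue. indicator (box a b) x *\<^sub>R h x) = 0" .
  qed
  then have "AE x in lebesgue. \<forall>(a, b)\<in>I. indicator (box a b) x *\<^sub>R h x = 0"
    using I by (subst AE_ball_countable) auto
  then have "AE x in lebesgue. x \<in> U \<longrightarrow> h x = 0"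
  proof eventually_elim
    fix x assume *: "\<forall>(a, b)\<in>I. indicator (box a b) x *\<^sub>R h x = 0"
    show "x \<in> U \<longrightarrow> h x = 0"
    proof
      assume "x \<in> U"
      then obtain e where e: "e > 0" "cball x e \<subseteq> U" using U open_contains_cball by blast
      then obtain a b where ab: "\<forall>i\<in>Basis. a \<bullet> i \<in> \<rat> \<and> b \<bullet> i \<in> \<rat>" "x \<in> box a b" "box a b \<subseteq> ball x e"
        using rational_boxes[OF e(1), of x] by blast
      have "cbox a b = closure (box a b)" using ab(2) by (metis closure_box empty_iff)
      also have "\<dots> \<subseteq> cball x e" using ab(3) by (metis closed_cball closure_minimal ball_subset_cball order_trans)
      finally have "(a, b) \<in> I" using e ab by (auto simp: I_def rational_pairs_def)
      then show "h x = 0" using * ab(2) by (auto simp: indicator_def)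
    qed
  qed
  then show ?thesis using Us by (simp add: AE_restrict_space_iff)
qed

section \<open>Weak derivatives\<close>

lemma open_sets_lebesgue: "open U \<Longrightarrow> U \<in> sets lebesgue" for U :: "'a::euclidean_space set"
  by simp

lemma smooth_measurable_lebesgue_on: "smooth f \<Longrightarrow> f \<in> borel_measurable (lebesgue_on U)"
  by (intro measurable_restrict_space1 measurable_completion) (simp add: smooth_measurable)

lemma integrable_indicator_lebesgue_on:
  assumes "S \<in> sets lebesgue" "emeasure lebesgue S < \<infinity>" "U \<in> sets lebesgue"
  shows "integrable (lebesgue_on U) (indicator S :: _ \<Rightarrow> real)"
proof -
  have "emeasure lebesgue (U \<inter> S) \<le> emeasure lebesgue S" by (rule emeasure_mono) (use assms in auto)
  then have "integrable lebesgue (indicator (U \<inter> S) :: _ \<Rightarrow> real)"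
    using assms by (intro integrable_real_indicator) auto
  then show ?thesis using assms(3)
    by (subst integrable_restrict_space) (auto simp: indicator_inter_arith[symmetric])
qed

lemma L2_bounded_support:
  assumes f: "f \<in> borel_measurable (lebesgue_on U)" and U: "U \<in> sets lebesgue"
    and K: "K \<in> sets lebesgue" "emeasure lebesgue K < \<infinity>"
    and b: "\<And>x. x \<in> U \<Longrightarrow> cmod (f x) \<le> B * indicator K x"
  shows "f \<in> L2 (lebesgue_on U)"
proof (rule L2_bound[OF f])
  show "integrable (lebesgue_on U) (\<lambda>x. B\<^sup>2 * indicator K x)"
    by (intro integrable_mult_right integrable_indicator_lebesgue_on K U)
  show "AE x in lebesgue_on U. (cmod (f x))\<^sup>2 \<le> B\<^sup>2 * indicator K x"
  proof (rule AE_I2)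
    fix x assume "x \<in> space (lebesgue_on U)"
    then have "x \<in> U" by simp
    then have "(cmod (f x))\<^sup>2 \<le> (B * indicator K x)\<^sup>2" by (intro power_mono b) auto
    then show "(cmod (f x))\<^sup>2 \<le> B\<^sup>2 * indicator K x" by (auto simp: indicator_def power_mult_distrib split: if_splits)
  qed
qed

lemma indicator_L2:
  assumes K: "K \<in> sets lebesgue" "emeasure lebesgue K < \<infinity>" and U: "U \<in> sets lebesgue"
  shows "(\<lambda>x. indicator K x :: complex) \<in> L2 (lebesgue_on U)"
proof (rule L2_bounded_support[OF _ U K])
  show "(\<lambda>x. indicator K x :: complex) \<in> borel_measurable (lebesgue_on U)"
    using K(1) by (intro measurable_restrict_space1 borel_measurable_indicator)
  show "cmod (indicator K x) \<le> 1 * indicator K x" for x by (simp add: indicator_def)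
qed

lemma compact_lebesgue_finite: "compact K \<Longrightarrow> K \<in> sets lebesgue \<and> emeasure lebesgue K < \<infinity>"
  using emeasure_compact_finite[of K] by (auto dest: compact_imp_closed)

lemma test_functions_L2:
  assumes \<phi>: "\<phi> \<in> test_functions V" and U: "U \<in> sets lebesgue"
  shows "\<phi> \<in> L2 (lebesgue_on U)"
proof -
  obtain K where K: "compact K" "K \<subseteq> V" "\<And>x. x \<notin> K \<Longrightarrow> \<phi> x = 0" using test_functionsE[OF \<phi>] by metis
  obtain B where B: "B \<ge> 0" "\<And>x. cmod (\<phi> x) \<le> B" using test_functions_bounded[OF \<phi>] by metis
  show ?thesis
  proof (rule L2_bounded_support[OF _ U, of _ K B])
    show "\<phi> \<in> borel_measurable (lebesgue_on U)"
      by (intro smooth_measurable_lebesgue_on test_functions_smooth[OF \<phi>])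
    fix x show "cmod (\<phi> x) \<le> B * indicator K x" using B K(3)[of x] by (auto simp: indicator_def)
  qed (use compact_lebesgue_finite[OF K(1)] in auto)
qed

lemma integral_lebesgue_on_subset:
  fixes g :: "'a::euclidean_space \<Rightarrow> 'b::{banach, second_countable_topology}"
  assumes "V \<subseteq> U" "U \<in> sets lebesgue" "V \<in> sets lebesgue" "\<And>x. x \<in> U - V \<Longrightarrow> g x = 0"
  shows "(LINT x|lebesgue_on U. g x) = (LINT x|lebesgue_on V. g x)"
proof -
  have "(\<lambda>x. indicator U x *\<^sub>R g x) = (\<lambda>x. indicator V x *\<^sub>R g x)"
    using assms by (auto simp: fun_eq_iff indicator_def)
  then show ?thesis using assms by (simp add: integral_restrict_space)
qed

lemma lebesgue_translation:
  fixes f :: "'a::euclidean_space \<Rightarrow> 'b::{banach, second_countable_topology}"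
  assumes f: "f \<in> borel_measurable borel"
  shows "(LINT x|lborel. f (x + c)) = (LINT x|lborel. f x)"
proof -
  have "(LINT x|lborel. f x) = (LINT x|distr lborel borel ((+) c). f x)" by (simp only: lborel_distr_plus)
  also have "\<dots> = (LINT x|lborel. f (c + x))" using f by (subst integral_distr) auto
  finally show ?thesis by (simp add: add.commute)
qed

text \<open>Difference quotients integrate to zero by translation invariance, and they converge to
  the partial derivative.\<close>

lemma integral_partial_test_function:
  assumes \<phi>: "\<phi> \<in> test_functions UNIV"
  shows "(LINT x|lebesgue. partial j \<phi> x) = 0"
proof -
  obtain K where K: "compact K" "\<And>x. x \<notin> K \<Longrightarrow> \<phi> x = 0" using test_functionsE[OF \<phi>] by metis
  obtain L where L: "L \<ge> 0" "\<And>x y. cmod (\<phi> x - \<phi> y) \<le> L * norm (x - y)" using test_functions_lipschitz[OF \<phi>] by metis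
  obtain r where r: "\<And>x. x \<in> K \<Longrightarrow> norm x \<le> r" using compact_imp_bounded[OF K(1)] by (auto simp: bounded_iff)
  note s = test_functions_smooth[OF \<phi>]
  have [measurable]: "\<phi> \<in> borel_measurable borel" using s by (rule smooth_measurable)
  have pm[measurable]: "partial j \<phi> \<in> borel_measurable borel" using s by (intro smooth_measurable smooth_partial)
  \<comment> \<open>Increments of at most 1 keep the supports of all quotients in the ball of radius
    \<open>r + 1\<close>, where the Lipschitz constant dominates them.\<close>
  define h where "h n = 1 / real (Suc n)" for n
  have h: "h n > 0" "h n \<le> 1" for n by (auto simp: h_def)
  let ?e = "axis j 1 :: real^'a"
  define q where "q n x = (1 / h n) *\<^sub>R (\<phi> (x + h n *\<^sub>R ?e) - \<phi> x)" for n x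
  have [measurable]: "q n \<in> borel_measurable borel" for n unfolding q_def by measurable
  have i: "integrable lborel \<phi>"
  proof -
    have "\<phi> \<in> L2 (lebesgue_on UNIV)" by (rule test_functions_L2[OF \<phi>]) simp
    moreover have "(\<lambda>x. indicator K x :: complex) \<in> L2 (lebesgue_on UNIV)"
      using compact_lebesgue_finite[OF K(1)] by (intro indicator_L2) auto
    ultimately have "integrable (lebesgue_on UNIV) (\<lambda>x. \<phi> x * indicator K x)" by (rule L2_integrable_mult)
    moreover have "(\<lambda>x. \<phi> x * indicator K x) = \<phi>" using K(2) by (auto simp: fun_eq_iff indicator_def)
    ultimately have "integrable lebesgue \<phi>" by (simp add: lebesgue_on_UNIV_eq)
    then show ?thesis by (simp add: integrable_completion)
  qed
  have zero: "(LINT x|lborel. q n x) = 0" for n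
  proof -
    have "integrable (distr lborel borel ((+) (h n *\<^sub>R ?e))) \<phi>" using i by (simp only: lborel_distr_plus)
    then have "integrable lborel (\<lambda>x. \<phi> (x + h n *\<^sub>R ?e))"
      by (subst (asm) integrable_distr_eq) (auto simp: add.commute)
    then show ?thesis using i lebesgue_translation[of \<phi> "h n *\<^sub>R ?e"] by (simp add: q_def)
  qed
  have "(\<lambda>n. LINT x|lborel. q n x) \<longlonglongrightarrow> (LINT x|lborel. partial j \<phi> x)"
  proof (rule integral_dominated_convergence[where w="\<lambda>x. L * indicator (cball 0 (r + 1)) x"])
    show "integrable lborel (\<lambda>x::real^'a. L * indicator (cball 0 (r + 1)) x)"
      using emeasure_lborel_cball_finite[of "0::real^'a" "r + 1"]
      by (intro integrable_mult_right integrable_real_indicator) auto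
    show "AE x in lborel. (\<lambda>n. q n x) \<longlonglongrightarrow> partial j \<phi> x"
    proof (rule AE_I2)
      fix x
      have d: "(\<phi> has_derivative (\<lambda>b. dir_deriv b \<phi> x)) (at x)"
        by (rule dir_deriv_has_derivative[OF smooth_differentiable[OF s]])
      have "((\<lambda>t. \<phi> (x + t *\<^sub>R ?e)) has_derivative (\<lambda>t. dir_deriv (t *\<^sub>R ?e) \<phi> x)) (at 0)"
        by (rule has_derivative_compose[of "\<lambda>t. x + t *\<^sub>R ?e", where g=\<phi>])
          (use d in \<open>auto intro!: derivative_eq_intros\<close>)
      moreover have "(\<lambda>t. dir_deriv (t *\<^sub>R ?e) \<phi> x) = (\<lambda>t. t *\<^sub>R partial j \<phi> x)"
        using linear_cmul[OF has_derivative_linear[OF d]] by auto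
      ultimately have "((\<lambda>t. norm (\<phi> (x + t *\<^sub>R ?e) - \<phi> x - t *\<^sub>R partial j \<phi> x) / \<bar>t\<bar>) \<longlongrightarrow> 0) (at 0)"
        by (simp add: has_derivative_iff_norm)
      then have "((\<lambda>t. norm ((\<phi> (x + t *\<^sub>R ?e) - \<phi> x) /\<^sub>R t - partial j \<phi> x)) \<longlongrightarrow> 0) (at 0)"
      proof (rule Lim_transform_eventually)
        have "norm (z - t *\<^sub>R p) / \<bar>t\<bar> = norm (z /\<^sub>R t - p)" if "t \<noteq> 0" for t and z p :: complex
        proof -
          have "z /\<^sub>R t - p = (z - t *\<^sub>R p) /\<^sub>R t" using that by (simp add: scaleR_diff_right)
          then show ?thesis by (simp add: divide_inverse mult.commute)
        qed
        then show "\<forall>\<^sub>F t in at 0. norm (\<phi> (x + t *\<^sub>R ?e) - \<phi> x - t *\<^sub>R partial j \<phi> x) / \<bar>t\<bar>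
            = norm ((\<phi> (x + t *\<^sub>R ?e) - \<phi> x) /\<^sub>R t - partial j \<phi> x)"
          by (auto simp: eventually_at_filter)
      qed
      then have lim: "((\<lambda>t. (\<phi> (x + t *\<^sub>R ?e) - \<phi> x) /\<^sub>R t) \<longlongrightarrow> partial j \<phi> x) (at 0)"
        by (rule LIM_zero_cancel[OF tendsto_norm_zero_cancel])
      have "h = (\<lambda>n. inverse (real (Suc n)))" by (simp add: h_def fun_eq_iff inverse_eq_divide)
      then have "h \<longlonglongrightarrow> 0" using LIMSEQ_inverse_real_of_nat by simp
      then have "filterlim h (at 0) sequentially"
        unfolding filterlim_at using h(1) by (auto simp: less_imp_neq[THEN not_sym])
      from filterlim_compose[OF lim this] show "(\<lambda>n. q n x) \<longlonglongrightarrow> partial j \<phi> x"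
        by (simp add: q_def inverse_eq_divide)
    qed
    fix n
    show "AE x in lborel. norm (q n x) \<le> L * indicator (cball 0 (r + 1)) x"
    proof (rule AE_I2)
      fix x :: "real^'a"
      show "norm (q n x) \<le> L * indicator (cball 0 (r + 1)) x"
      proof (cases "x \<in> cball 0 (r + 1)")
        case True
        have "norm (q n x) \<le> (1 / h n) * (L * norm (h n *\<^sub>R ?e))"
          unfolding q_def norm_scaleR using L(2)[of "x + h n *\<^sub>R ?e" x] h(1)[of n]
          by (simp add: pos_divide_le_eq)
        also have "\<dots> = L" using h(1)[of n] by simp
        finally show ?thesis using True by simp
      next
        case False
        then have nx: "norm x > r + 1" by simp
        have "norm x \<le> norm (x + h n *\<^sub>R ?e) + norm (h n *\<^sub>R ?e)"
          using norm_triangle_ineq4[of "x + h n *\<^sub>R ?e" "h n *\<^sub>R ?e"] by simp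
        moreover have "norm (h n *\<^sub>R ?e) \<le> 1" using h[of n] by simp
        ultimately have "norm (x + h n *\<^sub>R ?e) > r" using nx by linarith
        then have "\<phi> (x + h n *\<^sub>R ?e) = 0" "\<phi> x = 0" using K(2) r nx by (metis not_less, smt (verit))
        then show ?thesis using False by (simp add: q_def)
      qed
    qed
  qed auto
  then have "(LINT x|lborel. partial j \<phi> x) = 0" using zero by (simp add: LIMSEQ_const_iff)
  then show ?thesis using pm by (simp add: integral_completion)
qed

text \<open>Integration by parts: the derivative of the product \<open>f * \<phi>\<close>, itself a
  test function, has integral zero.\<close>

lemma is_weak_partial_smooth:
  assumes f: "smooth f" and U: "open U" shows "is_weak_partial U j f (partial j f)"
  unfolding is_weak_partial_def
proof
  fix \<phi> assume \<phi>: "\<phi> \<in> test_functions U"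
  note s = test_functions_smooth[OF \<phi>]
  note Us = open_sets_lebesgue[OF U]
  have p: "(\<lambda>x. f x * \<phi> x) \<in> test_functions U" by (rule test_functions_mult[OF \<phi> f])
  have L: "(\<lambda>x. f x * partial j \<phi> x) \<in> test_functions U" "(\<lambda>x. partial j f x * \<phi> x) \<in> test_functions U"
    using f \<phi> by (auto intro: test_functions_mult test_functions_partial smooth_partial)
  have i: "integrable (lebesgue_on U) \<psi>" if \<psi>: "\<psi> \<in> test_functions U" for \<psi>
  proof -
    obtain K where K: "compact K" "\<And>x. x \<notin> K \<Longrightarrow> \<psi> x = 0" using test_functionsE[OF \<psi>] by metis
    have "(\<lambda>x. indicator K x :: complex) \<in> L2 (lebesgue_on U)"
      using compact_lebesgue_finite[OF K(1)] by (intro indicator_L2 Us) auto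
    then have "integrable (lebesgue_on U) (\<lambda>x. \<psi> x * indicator K x)"
      by (intro L2_integrable_mult test_functions_L2[OF \<psi>] Us)
    moreover have "(\<lambda>x. \<psi> x * indicator K x) = \<psi>" using K(2) by (auto simp: fun_eq_iff indicator_def)
    ultimately show ?thesis by simp
  qed
  have "0 = (LINT x|lebesgue_on UNIV. partial j (\<lambda>x. f x * \<phi> x) x)"
    using integral_partial_test_function[OF test_functions_mono[OF subset_UNIV p]] by (simp add: lebesgue_on_UNIV_eq)
  also have "\<dots> = (LINT x|lebesgue_on U. partial j (\<lambda>x. f x * \<phi> x) x)"
    using test_functions_outside[OF test_functions_partial[OF p]] Us
    by (intro integral_lebesgue_on_subset) auto
  also have "\<dots> = (LINT x|lebesgue_on U. f x * partial j \<phi> x + partial j f x * \<phi> x)"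
    by (simp only: partial_mult[OF f s])
  also have "\<dots> = (LINT x|lebesgue_on U. f x * partial j \<phi> x) + (LINT x|lebesgue_on U. partial j f x * \<phi> x)"
    using i[OF L(1)] i[OF L(2)] by (rule Bochner_Integration.integral_add)
  finally show "(LINT x|lebesgue_on U. f x * partial j \<phi> x) = - (LINT x|lebesgue_on U. partial j f x * \<phi> x)"
    by (simp add: eq_neg_iff_add_eq_0)
qed

text \<open>Products of \<open>exp (- 1 / s)\<close> in the coordinates approximate the indicator function of a box.\<close>

definition box_bump :: "nat \<Rightarrow> real^'n \<Rightarrow> real^'n \<Rightarrow> real^'n \<Rightarrow> real" where
  "box_bump n a b x = (\<Prod>i\<in>UNIV. bump 0 (real n * (x $ i - a $ i)) * bump 0 (real n * (b $ i - x $ i)))"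

lemma box_bump_bounds: "0 \<le> box_bump n a b x" "box_bump n a b x \<le> 1"
  unfolding box_bump_def
  by (auto intro!: prod_nonneg prod_le_1 mult_nonneg_nonneg mult_le_one bump_nonneg bump_0_le)

lemma box_bump_outside: "x \<notin> box a b \<Longrightarrow> box_bump n a b x = 0"
proof -
  assume "x \<notin> box a b"
  then obtain i where "x $ i \<le> a $ i \<or> b $ i \<le> x $ i" by (auto simp: mem_box_cart not_less)
  then have "bump 0 (real n * (x $ i - a $ i)) * bump 0 (real n * (b $ i - x $ i)) = 0"
    by (auto simp: bump_eq_0 mult_nonneg_nonpos)
  then show ?thesis unfolding box_bump_def by (intro prod_zero) auto
qed

lemma box_bump_tendsto:
  fixes x :: "real^'n"
  shows "(\<lambda>n. box_bump n a b x) \<longlonglongrightarrow> indicator (box a b) x"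
proof (cases "x \<in> box a b")
  case True
  have "(\<lambda>n. box_bump n a b x) \<longlonglongrightarrow> (\<Prod>i\<in>(UNIV::'n set). 1 * 1)"
    unfolding box_bump_def using True
    by (intro tendsto_prod tendsto_mult bump_0_tendsto) (auto simp: mem_box_cart)
  then show ?thesis using True by simp
qed (simp add: box_bump_outside)

lemma smooth_box_bump: "smooth (\<lambda>x. of_real (box_bump n a b x))"
proof -
  have "smooth (\<lambda>x. \<Prod>i\<in>UNIV. of_real (bump 0 ((real n *\<^sub>R axis i 1) \<bullet> x + - real n * a $ i))
      * of_real (bump 0 ((- real n *\<^sub>R axis i 1) \<bullet> x + real n * b $ i)))"
    by (intro smooth_prod smooth_mult smooth_bump)
  moreover have "(\<lambda>x. \<Prod>i\<in>UNIV. of_real (bump 0 ((real n *\<^sub>R axis i 1) \<bullet> x + - real n * a $ i))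
      * of_real (bump 0 ((- real n *\<^sub>R axis i 1) \<bullet> x + real n * b $ i)))
    = (\<lambda>x. complex_of_real (box_bump n a b x))"
    unfolding box_bump_def of_real_prod of_real_mult
    by (intro ext prod.cong refl arg_cong2[where f="(*)"] arg_cong[where f="\<lambda>x. of_real (bump 0 x)"])
      (simp_all add: inner_axis' algebra_simps)
  ultimately show ?thesis by simp
qed

text \<open>Fundamental lemma of the calculus of variations. The box bumps are test functions
  bounded by the indicator function of the box and converge to it pointwise, so the integrals of
  \<open>d\<close> over boxes vanish.\<close>

lemma L2_zero_of_test_functions:
  assumes U: "open U" and d: "d \<in> L2 (lebesgue_on U)"
    and z: "\<And>\<phi>. \<phi> \<in> test_functions U \<Longrightarrow> (LINT x|lebesgue_on U. d x * \<phi> x) = 0"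
  shows "AE x in lebesgue_on U. d x = 0"
proof (rule AE_zero_of_local_boxes[OF U])
  fix a b :: "real^'a" assume ab: "cbox a b \<subseteq> U"
  note Us = open_sets_lebesgue[OF U]
  have ib: "(\<lambda>x. indicator (box a b) x :: complex) \<in> L2 (lebesgue_on U)"
    using emeasure_lborel_box_finite[of a b] by (intro indicator_L2 Us) auto
  have i: "integrable (lebesgue_on U) (\<lambda>x. d x * indicator (box a b) x)"
    by (rule L2_integrable_mult[OF d ib])
  then show "integrable (lebesgue_on U) (\<lambda>x. indicator (box a b) x *\<^sub>R d x)"
    by (simp add: scaleR_conv_of_real mult.commute of_real_indicator)
  have [measurable]: "d \<in> borel_measurable (lebesgue_on U)" by (rule L2_measurable[OF d])
  have [measurable]: "(\<lambda>x. complex_of_real (box_bump n a b x)) \<in> borel_measurable (lebesgue_on U)" for n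
    by (intro smooth_measurable_lebesgue_on smooth_box_bump)
  have "(\<lambda>n. LINT x|lebesgue_on U. d x * of_real (box_bump n a b x)) \<longlonglongrightarrow> (LINT x|lebesgue_on U. d x * of_real (indicator (box a b) x))"
  proof (rule integral_dominated_convergence[where w="\<lambda>x. norm (d x * indicator (box a b) x)"])
    show "(\<lambda>x. d x * of_real (indicator (box a b) x)) \<in> borel_measurable (lebesgue_on U)"
      using borel_measurable_integrable[OF i] by (simp add: of_real_indicator)
    show "AE x in lebesgue_on U. norm (d x * of_real (box_bump n a b x)) \<le> norm (d x * indicator (box a b) x)" for n
      using box_bump_bounds[of n a b] box_bump_outside[of _ a b n]
      by (intro AE_I2) (auto simp: norm_mult indicator_def intro!: mult_left_le)
    show "AE x in lebesgue_on U. (\<lambda>n. d x * of_real (box_bump n a b x)) \<longlonglongrightarrow> d x * of_real (indicator (box a b) x)"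
      by (intro AE_I2 tendsto_intros box_bump_tendsto)
  qed (use i in auto)
  moreover have "(LINT x|lebesgue_on U. d x * of_real (box_bump n a b x)) = 0" for n
  proof (rule z, rule test_functionsI[of _ "cbox a b"])
    fix x assume "x \<notin> cbox a b"
    then have "x \<notin> box a b" using box_subset_cbox by blast
    then show "complex_of_real (box_bump n a b x) = 0" by (simp add: box_bump_outside)
  qed (auto simp: ab smooth_box_bump)
  ultimately have "(LINT x|lebesgue_on U. d x * of_real (indicator (box a b) x)) = 0"
    by (simp add: LIMSEQ_const_iff)
  then show "(LINT x|lebesgue_on U. indicator (box a b) x *\<^sub>R d x) = 0"
    by (simp add: scaleR_conv_of_real mult.commute)
qed

lemma L2_orthogonal:
  fixes g :: "'a::euclidean_space \<Rightarrow> 'a"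
  assumes g: "orthogonal_transformation g" and UV: "\<And>x. x \<in> U \<longleftrightarrow> g x \<in> V"
    and U: "U \<in> sets lebesgue" and V: "V \<in> sets lebesgue" and f: "f \<in> L2 (lebesgue_on V)"
  shows "(\<lambda>x. f (g x)) \<in> L2 (lebesgue_on U)"
proof -
  have m[measurable]: "g \<in> lebesgue_on U \<rightarrow>\<^sub>M lebesgue_on V"
    using UV by (intro lebesgue_on_measurable_orthogonal[OF g]) auto
  have "integrable (distr (lebesgue_on U) (lebesgue_on V) g) (\<lambda>x. (cmod (f x))\<^sup>2)"
    using f by (simp add: lebesgue_on_distr_orthogonal[OF g UV U V] L2_integrable)
  moreover note f[THEN L2_measurable, measurable]
  ultimately show ?thesis
    unfolding L2_def by (subst (asm) integrable_distr_eq) auto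
qed

lemma integral_orthogonal:
  fixes g :: "'a::euclidean_space \<Rightarrow> 'a" and f :: "'a \<Rightarrow> 'b::{banach, second_countable_topology}"
  assumes g: "orthogonal_transformation g" and UV: "\<And>x. x \<in> U \<longleftrightarrow> g x \<in> V"
    and U: "U \<in> sets lebesgue" and V: "V \<in> sets lebesgue" and f: "f \<in> borel_measurable (lebesgue_on V)"
  shows "(LINT x|lebesgue_on U. f (g x)) = (LINT x|lebesgue_on V. f x)"
proof -
  have m: "g \<in> lebesgue_on U \<rightarrow>\<^sub>M lebesgue_on V"
    using UV by (intro lebesgue_on_measurable_orthogonal[OF g]) auto
  have "(LINT x|lebesgue_on V. f x) = (LINT x|distr (lebesgue_on U) (lebesgue_on V) g. f x)"
    by (simp only: lebesgue_on_distr_orthogonal[OF g UV U V])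
  also have "\<dots> = (LINT x|lebesgue_on U. f (g x))" using m f by (rule integral_distr)
  finally show ?thesis by simp
qed

lemma AE_orthogonal:
  fixes g :: "'a::euclidean_space \<Rightarrow> 'a"
  assumes g: "orthogonal_transformation g" and UV: "\<And>x. x \<in> U \<longleftrightarrow> g x \<in> V"
    and U: "U \<in> sets lebesgue" and V: "V \<in> sets lebesgue" and P: "AE x in lebesgue_on V. P x"
  shows "AE x in lebesgue_on U. P (g x)"
proof -
  have m: "g \<in> lebesgue_on U \<rightarrow>\<^sub>M lebesgue_on V"
    using UV by (intro lebesgue_on_measurable_orthogonal[OF g]) auto
  have "AE x in distr (lebesgue_on U) (lebesgue_on V) g. P x"
    using P by (simp only: lebesgue_on_distr_orthogonal[OF g UV U V])
  then show ?thesis by (rule AE_distrD[OF m])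
qed

lemma L2_subset:
  assumes "V \<subseteq> U" "V \<in> sets lebesgue" "U \<in> sets lebesgue" "f \<in> L2 (lebesgue_on U)"
  shows "f \<in> L2 (lebesgue_on V)"
proof -
  have eq: "lebesgue_on V = restrict_space (lebesgue_on U) V"
    using assms by (simp add: restrict_restrict_space Int_absorb1)
  have V: "V \<inter> space (lebesgue_on U) \<in> sets (lebesgue_on U)"
    using assms by (auto simp: sets_restrict_space_iff)
  have "integrable (lebesgue_on U) (\<lambda>x. indicator V x *\<^sub>R (cmod (f x))\<^sup>2)"
    using assms V by (intro integrable_mult_indicator L2_integrable) (auto simp: Int_absorb2)
  then show ?thesis using assms V L2_measurable[OF assms(4)]
    unfolding L2_def eq by (auto simp: integrable_restrict_space intro: measurable_restrict_space1)
qed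

lemma is_weak_partial_integrable:
  assumes "open U" "f \<in> L2 (lebesgue_on U)" "\<phi> \<in> test_functions V"
  shows "integrable (lebesgue_on U) (\<lambda>x. f x * \<phi> x)" "integrable (lebesgue_on U) (\<lambda>x. f x * partial j \<phi> x)"
proof -
  have U: "U \<in> sets lebesgue" using assms(1) by simp
  show "integrable (lebesgue_on U) (\<lambda>x. f x * \<phi> x)"
    by (rule L2_integrable_mult[OF assms(2) test_functions_L2[OF assms(3) U]])
  show "integrable (lebesgue_on U) (\<lambda>x. f x * partial j \<phi> x)"
    by (rule L2_integrable_mult[OF assms(2) test_functions_L2[OF test_functions_partial[OF assms(3)] U]])
qed

lemma is_weak_partial_unique:
  assumes U: "open U" and u: "u \<in> L2 (lebesgue_on U)" "is_weak_partial U j f u"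
    and w: "w \<in> L2 (lebesgue_on U)" "is_weak_partial U j f w"
  shows "AE x in lebesgue_on U. u x = w x"
proof -
  have "AE x in lebesgue_on U. u x - w x = 0"
  proof (rule L2_zero_of_test_functions[OF U L2_diff[OF u(1) w(1)]])
    fix \<phi> assume \<phi>: "\<phi> \<in> test_functions U"
    then have "(LINT x|lebesgue_on U. u x * \<phi> x) = (LINT x|lebesgue_on U. w x * \<phi> x)"
      using u(2)[unfolded is_weak_partial_def, rule_format, OF \<phi>]
        w(2)[unfolded is_weak_partial_def, rule_format, OF \<phi>] by simp
    then show "(LINT x|lebesgue_on U. (u x - w x) * \<phi> x) = 0"
      using is_weak_partial_integrable(1)[OF U u(1) \<phi>] is_weak_partial_integrable(1)[OF U w(1) \<phi>]
      by (simp add: left_diff_distrib)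
  qed
  then show ?thesis by simp
qed

lemma is_weak_partial_add:
  assumes U: "open U" and L: "f \<in> L2 (lebesgue_on U)" "u \<in> L2 (lebesgue_on U)" "g \<in> L2 (lebesgue_on U)" "w \<in> L2 (lebesgue_on U)"
    and f: "is_weak_partial U j f u" and g: "is_weak_partial U j g w"
  shows "is_weak_partial U j (\<lambda>x. f x + g x) (\<lambda>x. u x + w x)"
  unfolding is_weak_partial_def
proof
  fix \<phi> assume \<phi>: "\<phi> \<in> test_functions U"
  show "(LINT x|lebesgue_on U. (f x + g x) * partial j \<phi> x) = - (LINT x|lebesgue_on U. (u x + w x) * \<phi> x)"
    using L is_weak_partial_integrable[OF U _ \<phi>] f g \<phi> by (simp add: distrib_right is_weak_partial_def)
qed

lemma is_weak_partial_cmult: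
  assumes "is_weak_partial U j f u" shows "is_weak_partial U j (\<lambda>x. c * f x) (\<lambda>x. c * u x)"
  using assms by (simp add: is_weak_partial_def mult.assoc)

lemma is_weak_partial_cong:
  assumes L: "f \<in> borel_measurable (lebesgue_on U)" "u \<in> borel_measurable (lebesgue_on U)" "g \<in> borel_measurable (lebesgue_on U)" "w \<in> borel_measurable (lebesgue_on U)"
    and ae: "AE x in lebesgue_on U. f x = g x" "AE x in lebesgue_on U. u x = w x"
    and f: "is_weak_partial U j f u"
  shows "is_weak_partial U j g w"
  unfolding is_weak_partial_def
proof
  fix \<phi> assume \<phi>: "\<phi> \<in> test_functions U"
  note [measurable] = L smooth_measurable_lebesgue_on[OF test_functions_smooth[OF \<phi>]]
    smooth_measurable_lebesgue_on[OF smooth_partial[OF test_functions_smooth[OF \<phi>]]]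
  have "(LINT x|lebesgue_on U. g x * partial j \<phi> x) = (LINT x|lebesgue_on U. f x * partial j \<phi> x)"
    by (rule integral_cong_AE) (use ae in auto)
  also have "\<dots> = - (LINT x|lebesgue_on U. u x * \<phi> x)" using f \<phi> by (simp add: is_weak_partial_def)
  also have "(LINT x|lebesgue_on U. u x * \<phi> x) = (LINT x|lebesgue_on U. w x * \<phi> x)"
    by (rule integral_cong_AE) (use ae in auto)
  finally show "(LINT x|lebesgue_on U. g x * partial j \<phi> x) = - (LINT x|lebesgue_on U. w x * \<phi> x)" .
qed

lemma is_weak_partial_subset:
  assumes "V \<subseteq> U" "open U" "open V" "is_weak_partial U j f u"
  shows "is_weak_partial V j f u"
  unfolding is_weak_partial_def
proof
  fix \<phi> assume \<phi>: "\<phi> \<in> test_functions V"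
  have "(LINT x|lebesgue_on V. f x * partial j \<phi> x) = (LINT x|lebesgue_on U. f x * partial j \<phi> x)"
    using assms test_functions_outside[OF test_functions_partial[OF \<phi>]]
    by (intro integral_lebesgue_on_subset[symmetric]) auto
  also have "\<dots> = - (LINT x|lebesgue_on U. u x * \<phi> x)"
    using assms(4) test_functions_mono[OF assms(1) \<phi>] by (simp add: is_weak_partial_def)
  also have "(LINT x|lebesgue_on U. u x * \<phi> x) = (LINT x|lebesgue_on V. u x * \<phi> x)"
    using assms test_functions_outside[OF \<phi>] by (intro integral_lebesgue_on_subset) auto
  finally show "(LINT x|lebesgue_on V. f x * partial j \<phi> x) = - (LINT x|lebesgue_on V. u x * \<phi> x)" .
qed

text \<open>The map is moved onto the test function: writing \<phi> as \<psi> composed with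
  \<open>g\<close>, the chain rule is needed only for the smooth \<psi>, and invariance of the
  measure removes \<open>g\<close> from the integrals.\<close>

lemma is_weak_partial_orthogonal:
  fixes g :: "real^'n \<Rightarrow> real^'n"
  assumes g: "orthogonal_transformation g" and gU: "\<And>x. x \<in> U \<longleftrightarrow> g x \<in> U" and U: "open U"
    and L: "f \<in> L2 (lebesgue_on U)" "\<And>i. u i \<in> L2 (lebesgue_on U)"
    and f: "\<And>i. is_weak_partial U i f (u i)"
  shows "is_weak_partial U j (\<lambda>x. f (g x)) (\<lambda>x. \<Sum>i\<in>UNIV. of_real (g (axis j 1) $ i) * u i (g x))"
  unfolding is_weak_partial_def
proof
  fix \<phi> assume \<phi>: "\<phi> \<in> test_functions U"
  note Us = open_sets_lebesgue[OF U]
  have lin: "linear g" by (rule orthogonal_transformation_linear[OF g])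
  have b: "bij g" by (rule orthogonal_transformation_bij[OF g])
  define \<psi> where "\<psi> = (\<lambda>x. \<phi> (inv g x))"
  have \<psi>: "\<psi> \<in> test_functions U"
    unfolding \<psi>_def
  proof (intro test_functions_orthogonal[OF \<phi>] orthogonal_transformation_inv g)
    fix x assume "inv g x \<in> U"
    then show "x \<in> U" using gU[of "inv g x"] b by (simp add: bij_is_surj surj_f_inv_f)
  qed
  have \<phi>_eq: "\<phi> = (\<lambda>x. \<psi> (g x))" using b by (simp add: \<psi>_def bij_is_inj)
  note \<psi>s = test_functions_smooth[OF \<psi>]
  let ?c = "\<lambda>i. complex_of_real (g (axis j 1) $ i)"
  note i = is_weak_partial_integrable[OF U _ \<psi>]
  have "(LINT x|lebesgue_on U. f (g x) * partial j \<phi> x)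
    = (LINT x|lebesgue_on U. (\<lambda>y. f y * (\<Sum>i\<in>UNIV. ?c i * partial i \<psi> y)) (g x))"
    unfolding \<phi>_eq partial_linear[OF \<psi>s lin] ..
  also have "\<dots> = (LINT x|lebesgue_on U. f x * (\<Sum>i\<in>UNIV. ?c i * partial i \<psi> x))"
    using L2_measurable[OF L(1)] smooth_measurable_lebesgue_on[OF smooth_partial[OF \<psi>s]]
    by (intro integral_orthogonal[OF g gU Us Us]) auto
  also have "\<dots> = (LINT x|lebesgue_on U. (\<Sum>i\<in>UNIV. ?c i * (f x * partial i \<psi> x)))"
    by (simp add: sum_distrib_left mult.left_commute)
  also have "\<dots> = (\<Sum>i\<in>UNIV. ?c i * (LINT x|lebesgue_on U. f x * partial i \<psi> x))"
    using i(2)[OF L(1)] by (simp add: Bochner_Integration.integral_sum)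
  also have "\<dots> = (\<Sum>i\<in>UNIV. ?c i * - (LINT x|lebesgue_on U. u i x * \<psi> x))"
    using f \<psi> by (simp add: is_weak_partial_def)
  also have "\<dots> = - (LINT x|lebesgue_on U. (\<Sum>i\<in>UNIV. ?c i * (u i x * \<psi> x)))"
    using i(1)[OF L(2)] by (simp add: Bochner_Integration.integral_sum sum_negf)
  also have "(LINT x|lebesgue_on U. (\<Sum>i\<in>UNIV. ?c i * (u i x * \<psi> x)))
    = (LINT x|lebesgue_on U. (\<lambda>y. (\<Sum>i\<in>UNIV. ?c i * u i y) * \<psi> y) x)"
    by (simp add: sum_distrib_right mult.assoc)
  also have "\<dots> = (LINT x|lebesgue_on U. (\<lambda>y. (\<Sum>i\<in>UNIV. ?c i * u i y) * \<psi> y) (g x))"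
    using L2_measurable[OF L(2)] smooth_measurable_lebesgue_on[OF \<psi>s]
    by (intro integral_orthogonal[OF g gU Us Us, symmetric]) auto
  finally show "(LINT x|lebesgue_on U. f (g x) * partial j \<phi> x)
    = - (LINT x|lebesgue_on U. (\<Sum>i\<in>UNIV. ?c i * u i (g x)) * \<phi> x)"
    by (simp add: \<phi>_eq)
qed

section \<open>Sobolev functions, weak gradients and the Dirichlet form\<close>

lemma H1_L2: "f \<in> H1 U \<Longrightarrow> f \<in> L2 (lebesgue_on U)"
  by (simp add: H1_def)

lemma weak_partial:
  assumes "f \<in> H1 U"
  shows "weak_partial U j f \<in> L2 (lebesgue_on U)" "is_weak_partial U j f (weak_partial U j f)"
proof -
  have "\<exists>u. u \<in> L2 (lebesgue_on U) \<and> is_weak_partial U j f u" using assms by (auto simp: H1_def)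
  from someI_ex[OF this] show "weak_partial U j f \<in> L2 (lebesgue_on U)" "is_weak_partial U j f (weak_partial U j f)"
    by (auto simp: weak_partial_def)
qed

lemma H1I:
  assumes "f \<in> L2 (lebesgue_on U)" "\<And>j. u j \<in> L2 (lebesgue_on U)" "\<And>j. is_weak_partial U j f (u j)"
  shows "f \<in> H1 U"
  using assms by (auto simp: H1_def)

text \<open>\<open>weak_partial\<close> is an arbitrary choice among almost everywhere equal
  functions; every rule for it is obtained by exhibiting a weak derivative and appealing to
  uniqueness.\<close>

lemma weak_partial_eq:
  assumes "open U" "f \<in> H1 U" "u \<in> L2 (lebesgue_on U)" "is_weak_partial U j f u"
  shows "AE x in lebesgue_on U. weak_partial U j f x = u x"
  by (rule is_weak_partial_unique[OF assms(1) weak_partial[OF assms(2)] assms(3,4)])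

lemma
  assumes U: "open U" and f: "f \<in> H1 U" and g: "g \<in> H1 U"
  shows H1_add: "(\<lambda>x. f x + g x) \<in> H1 U"
    and weak_partial_add: "AE x in lebesgue_on U.
      weak_partial U j (\<lambda>x. f x + g x) x = weak_partial U j f x + weak_partial U j g x"
proof -
  have w: "is_weak_partial U j (\<lambda>x. f x + g x) (\<lambda>x. weak_partial U j f x + weak_partial U j g x)" for j
    by (intro is_weak_partial_add U H1_L2 f g weak_partial)
  show h: "(\<lambda>x. f x + g x) \<in> H1 U"
    by (rule H1I[OF _ _ w]) (intro L2_add H1_L2 f g weak_partial)+
  show "AE x in lebesgue_on U. weak_partial U j (\<lambda>x. f x + g x) x = weak_partial U j f x + weak_partial U j g x"
    by (rule weak_partial_eq[OF U h _ w]) (intro L2_add f g weak_partial)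
qed

lemma
  assumes U: "open U" and f: "f \<in> H1 U"
  shows H1_cmult: "(\<lambda>x. c * f x) \<in> H1 U"
    and weak_partial_cmult: "AE x in lebesgue_on U.
      weak_partial U j (\<lambda>x. c * f x) x = c * weak_partial U j f x"
proof -
  have w: "is_weak_partial U j (\<lambda>x. c * f x) (\<lambda>x. c * weak_partial U j f x)" for j
    by (intro is_weak_partial_cmult f weak_partial)
  show h: "(\<lambda>x. c * f x) \<in> H1 U"
    by (rule H1I[OF _ _ w]) (intro L2_cmult H1_L2 f weak_partial)+
  show "AE x in lebesgue_on U. weak_partial U j (\<lambda>x. c * f x) x = c * weak_partial U j f x"
    by (rule weak_partial_eq[OF U h _ w]) (intro L2_cmult f weak_partial)
qed

lemma
  assumes U: "open U" and f: "f \<in> H1 U" and g: "g \<in> borel_measurable (lebesgue_on U)"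
    and ae: "AE x in lebesgue_on U. f x = g x"
  shows H1_cong: "g \<in> H1 U"
    and weak_partial_cong: "AE x in lebesgue_on U. weak_partial U j f x = weak_partial U j g x"
proof -
  have gL: "g \<in> L2 (lebesgue_on U)" using L2_cong_AE[OF H1_L2[OF f] g ae] .
  have w: "is_weak_partial U j g (weak_partial U j f)" for j
    by (rule is_weak_partial_cong[OF _ _ _ _ ae _ weak_partial(2)[OF f]])
      (auto intro: L2_measurable H1_L2 f weak_partial gL)
  show h: "g \<in> H1 U"
    by (rule H1I[OF gL _ w]) (intro f weak_partial)
  show "AE x in lebesgue_on U. weak_partial U j f x = weak_partial U j g x"
    using weak_partial_eq[OF U h weak_partial(1)[OF f] w, of j] by eventually_elim simp
qed

lemma
  assumes UV: "V \<subseteq> U" "open U" "open V" and f: "f \<in> H1 U"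
  shows H1_subset: "f \<in> H1 V"
    and weak_partial_subset: "AE x in lebesgue_on V. weak_partial V j f x = weak_partial U j f x"
proof -
  have w: "is_weak_partial V j f (weak_partial U j f)" for j
    by (intro is_weak_partial_subset[OF UV] weak_partial f)
  have L: "weak_partial U j f \<in> L2 (lebesgue_on V)" for j
    using UV by (intro L2_subset[OF UV(1)] weak_partial f) auto
  show h: "f \<in> H1 V"
    using UV by (intro H1I[OF _ L w] L2_subset[OF UV(1)] H1_L2 f) auto
  show "AE x in lebesgue_on V. weak_partial V j f x = weak_partial U j f x"
    by (rule weak_partial_eq[OF UV(3) h L w])
qed

lemma
  fixes g :: "real^'n \<Rightarrow> real^'n"
  assumes g: "orthogonal_transformation g" and gU: "\<And>x. x \<in> U \<longleftrightarrow> g x \<in> U" and U: "open U" and f: "f \<in> H1 U"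
  shows H1_orthogonal: "(\<lambda>x. f (g x)) \<in> H1 U"
    and weak_partial_orthogonal: "AE x in lebesgue_on U.
      weak_partial U j (\<lambda>x. f (g x)) x = (\<Sum>i\<in>UNIV. of_real (g (axis j 1) $ i) * weak_partial U i f (g x))"
proof -
  note Us = open_sets_lebesgue[OF U]
  have w: "is_weak_partial U j (\<lambda>x. f (g x)) (\<lambda>x. \<Sum>i\<in>UNIV. of_real (g (axis j 1) $ i) * weak_partial U i f (g x))" for j
    by (intro is_weak_partial_orthogonal[OF g gU U] H1_L2 f weak_partial)
  have L: "(\<lambda>x. \<Sum>i\<in>UNIV. of_real (g (axis j 1) $ i) * weak_partial U i f (g x)) \<in> L2 (lebesgue_on U)" for j
    by (intro L2_sum L2_cmult L2_orthogonal[OF g gU Us Us] weak_partial f)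
  show h: "(\<lambda>x. f (g x)) \<in> H1 U"
    by (intro H1I[OF _ L w] L2_orthogonal[OF g gU Us Us] H1_L2 f)
  show "AE x in lebesgue_on U.
      weak_partial U j (\<lambda>x. f (g x)) x = (\<Sum>i\<in>UNIV. of_real (g (axis j 1) $ i) * weak_partial U i f (g x))"
    by (rule weak_partial_eq[OF U h L w])
qed

lemma test_functions_H1:
  assumes "open U" "\<phi> \<in> test_functions V"
  shows "\<phi> \<in> H1 U" "AE x in lebesgue_on U. weak_partial U j \<phi> x = partial j \<phi> x"
proof -
  note w = is_weak_partial_smooth[OF test_functions_smooth[OF assms(2)] assms(1)]
  have L: "partial j \<phi> \<in> L2 (lebesgue_on U)" for j
    using assms by (intro test_functions_L2[OF test_functions_partial]) auto
  show h: "\<phi> \<in> H1 U"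
    using assms by (intro H1I[OF _ L w] test_functions_L2[OF assms(2)]) auto
  show "AE x in lebesgue_on U. weak_partial U j \<phi> x = partial j \<phi> x"
    by (rule weak_partial_eq[OF assms(1) h L w])
qed

lemma dirichlet_form_eq:
  assumes "f \<in> H1 U" "g \<in> H1 U"
  shows "dirichlet_form U f g = (\<Sum>j\<in>UNIV. l2_inner (lebesgue_on U) (weak_partial U j f) (weak_partial U j g))"
  unfolding dirichlet_form_def l2_inner_def
  by (intro Bochner_Integration.integral_sum L2_integrable_inner weak_partial assms)

lemma dirichlet_form_cong:
  assumes "open U" "f \<in> H1 U" "g \<in> H1 U"
    and "\<And>j. u j \<in> L2 (lebesgue_on U)" "\<And>j. AE x in lebesgue_on U. weak_partial U j f x = u j x"
    and "\<And>j. w j \<in> L2 (lebesgue_on U)" "\<And>j. AE x in lebesgue_on U. weak_partial U j g x = w j x"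
  shows "dirichlet_form U f g = (\<Sum>j\<in>UNIV. l2_inner (lebesgue_on U) (u j) (w j))"
  unfolding dirichlet_form_eq[OF assms(2,3)]
  by (intro sum.cong refl l2_inner_cong assms weak_partial)

lemma dirichlet_form_AE_cong:
  assumes U: "open U" and f: "f \<in> H1 U" "f' \<in> H1 U" "AE x in lebesgue_on U. f x = f' x"
    and g: "g \<in> H1 U" "g' \<in> H1 U" "AE x in lebesgue_on U. g x = g' x"
  shows "dirichlet_form U f g = dirichlet_form U f' g'"
  unfolding dirichlet_form_eq[OF f(2) g(2)]
  using weak_partial_cong[OF U f(1) L2_measurable[OF H1_L2[OF f(2)]] f(3)]
    weak_partial_cong[OF U g(1) L2_measurable[OF H1_L2[OF g(2)]] g(3)]
  by (intro dirichlet_form_cong U f(1) g(1) weak_partial f(2) g(2))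

lemma dirichlet_form_add_right:
  assumes "open U" "f \<in> H1 U" "g \<in> H1 U" "h \<in> H1 U"
  shows "dirichlet_form U f (\<lambda>x. g x + h x) = dirichlet_form U f g + dirichlet_form U f h"
proof -
  have "dirichlet_form U f (\<lambda>x. g x + h x) = (\<Sum>j\<in>UNIV. l2_inner (lebesgue_on U) (weak_partial U j f) (\<lambda>x. weak_partial U j g x + weak_partial U j h x))"
    by (intro dirichlet_form_cong H1_add assms weak_partial weak_partial_add L2_add) auto
  also have "\<dots> = dirichlet_form U f g + dirichlet_form U f h"
    using assms by (simp add: dirichlet_form_eq l2_inner_add_right weak_partial sum.distrib)
  finally show ?thesis .
qed

lemma dirichlet_form_cmult_right:
  assumes "open U" "f \<in> H1 U" "g \<in> H1 U"
  shows "dirichlet_form U f (\<lambda>x. c * g x) = cnj c * dirichlet_form U f g"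
proof -
  have "dirichlet_form U f (\<lambda>x. c * g x) = (\<Sum>j\<in>UNIV. l2_inner (lebesgue_on U) (weak_partial U j f) (\<lambda>x. c * weak_partial U j g x))"
    by (intro dirichlet_form_cong H1_cmult assms weak_partial weak_partial_cmult L2_cmult) auto
  also have "\<dots> = cnj c * dirichlet_form U f g"
    using assms by (simp add: dirichlet_form_eq l2_inner_cmult_right sum_distrib_left)
  finally show ?thesis .
qed

lemma dirichlet_form_cmult_left:
  assumes "open U" "f \<in> H1 U" "g \<in> H1 U"
  shows "dirichlet_form U (\<lambda>x. c * f x) g = c * dirichlet_form U f g"
proof -
  have "dirichlet_form U (\<lambda>x. c * f x) g = (\<Sum>j\<in>UNIV. l2_inner (lebesgue_on U) (\<lambda>x. c * weak_partial U j f x) (weak_partial U j g))"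
    by (intro dirichlet_form_cong H1_cmult assms weak_partial weak_partial_cmult L2_cmult) auto
  also have "\<dots> = c * dirichlet_form U f g"
    using assms by (simp add: dirichlet_form_eq l2_inner_cmult_left sum_distrib_left)
  finally show ?thesis .
qed

lemma H1_zero: "open U \<Longrightarrow> (\<lambda>x. 0) \<in> H1 U"
  using test_functions_H1(1)[OF _ test_functions_zero] by blast

lemma H1_sum: "open U \<Longrightarrow> (\<And>i. i \<in> I \<Longrightarrow> f i \<in> H1 U) \<Longrightarrow> (\<lambda>x. \<Sum>i\<in>I. f i x) \<in> H1 U"
  by (induction I rule: infinite_finite_induct) (auto intro: H1_zero H1_add)

lemma dirichlet_form_sum_right:
  assumes "open U" "f \<in> H1 U" "\<And>i. i \<in> I \<Longrightarrow> g i \<in> H1 U"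
  shows "dirichlet_form U f (\<lambda>x. \<Sum>i\<in>I. g i x) = (\<Sum>i\<in>I. dirichlet_form U f (g i))"
proof -
  have z: "dirichlet_form U f (\<lambda>x. 0) = 0"
    using dirichlet_form_cmult_right[OF assms(1,2) H1_zero[OF assms(1)], of 0] by simp
  show ?thesis using assms(3)
    by (induction I rule: infinite_finite_induct) (simp_all add: z dirichlet_form_add_right H1_sum assms(1,2))
qed

text \<open>The gradient of \<open>f \<circ> g\<close> is \<open>g\<^sup>T (\<nabla>f \<circ> g)\<close>, so the columns of the orthogonal matrix \<open>g\<close>
  drop out of inner products of gradients.\<close>

lemma orthogonal_sum_products:
  fixes g :: "real^'n \<Rightarrow> real^'n" and a b :: "'n \<Rightarrow> complex"
  assumes g: "orthogonal_transformation g"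
  shows "(\<Sum>j\<in>UNIV. (\<Sum>i\<in>UNIV. of_real (g (axis j 1) $ i) * a i) * cnj (\<Sum>i\<in>UNIV. of_real (g (axis j 1) $ i) * b i))
    = (\<Sum>i\<in>UNIV. a i * cnj (b i))"
proof -
  have rows: "(\<Sum>j\<in>UNIV. g (axis j 1) $ i * g (axis j 1) $ k) = (if i = k then 1 else 0)" for i k
  proof -
    have "matrix g ** transpose (matrix g) = mat 1"
      using g orthogonal_transformation_matrix orthogonal_matrix_def by blast
    then have "(matrix g ** transpose (matrix g)) $ i $ k = mat 1 $ i $ k" by simp
    then show ?thesis by (simp add: matrix_matrix_mult_def transpose_def matrix_def mat_def)
  qed
  have "(\<Sum>j\<in>UNIV. (\<Sum>i\<in>UNIV. of_real (g (axis j 1) $ i) * a i) * cnj (\<Sum>i\<in>UNIV. of_real (g (axis j 1) $ i) * b i))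
    = (\<Sum>j\<in>UNIV. \<Sum>i\<in>UNIV. \<Sum>k\<in>UNIV. of_real (g (axis j 1) $ i * g (axis j 1) $ k) * (a i * cnj (b k)))"
    by (simp add: sum_product mult_ac)
  also have "\<dots> = (\<Sum>i\<in>UNIV. \<Sum>k\<in>UNIV. \<Sum>j\<in>UNIV. of_real (g (axis j 1) $ i * g (axis j 1) $ k) * (a i * cnj (b k)))"
    by (subst sum.swap, rule sum.cong[OF refl], rule sum.swap)
  also have "\<dots> = (\<Sum>i\<in>UNIV. \<Sum>k\<in>UNIV. of_real (if i = k then 1 else 0) * (a i * cnj (b k)))"
    unfolding rows[symmetric] of_real_sum sum_distrib_right ..
  also have "\<dots> = (\<Sum>i\<in>UNIV. a i * cnj (b i))"
    by (simp add: if_distrib[of "\<lambda>x. of_real x * _"] cong: if_cong)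
  finally show ?thesis .
qed

lemma dirichlet_form_orthogonal:
  fixes g :: "real^'n \<Rightarrow> real^'n"
  assumes g: "orthogonal_transformation g" and gU: "\<And>x. x \<in> U \<longleftrightarrow> g x \<in> U" and U: "open U"
    and f: "f \<in> H1 U" and h: "h \<in> H1 U"
  shows "dirichlet_form U (\<lambda>x. f (g x)) (\<lambda>x. h (g x)) = dirichlet_form U f h"
proof -
  note Us = open_sets_lebesgue[OF U]
  let ?q = "\<lambda>x. \<Sum>i\<in>UNIV. weak_partial U i f x * cnj (weak_partial U i h x)"
  note [measurable] = L2_measurable[OF weak_partial(1)[OF f]] L2_measurable[OF weak_partial(1)[OF h]]
    L2_measurable[OF weak_partial(1)[OF H1_orthogonal[OF g gU U f]]]
    L2_measurable[OF weak_partial(1)[OF H1_orthogonal[OF g gU U h]]]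
    lebesgue_on_measurable_orthogonal[OF g, of U U, OF iffD1[OF gU]]
  have "dirichlet_form U (\<lambda>x. f (g x)) (\<lambda>x. h (g x)) = (LINT x|lebesgue_on U. ?q (g x))"
    unfolding dirichlet_form_def
  proof (rule integral_cong_AE)
    have "AE x in lebesgue_on U. \<forall>j. weak_partial U j (\<lambda>x. f (g x)) x = (\<Sum>i\<in>UNIV. of_real (g (axis j 1) $ i) * weak_partial U i f (g x))"
      using weak_partial_orthogonal[OF g gU U f] by (simp add: AE_all_countable)
    moreover have "AE x in lebesgue_on U. \<forall>j. weak_partial U j (\<lambda>x. h (g x)) x = (\<Sum>i\<in>UNIV. of_real (g (axis j 1) $ i) * weak_partial U i h (g x))"
      using weak_partial_orthogonal[OF g gU U h] by (simp add: AE_all_countable)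
    ultimately show "AE x in lebesgue_on U. (\<Sum>j\<in>UNIV. weak_partial U j (\<lambda>x. f (g x)) x * cnj (weak_partial U j (\<lambda>x. h (g x)) x)) = ?q (g x)"
      by eventually_elim (simp only: orthogonal_sum_products[OF g])
  qed measurable
  also have "\<dots> = (LINT x|lebesgue_on U. ?q x)"
    by (rule integral_orthogonal[OF g gU Us Us]) measurable
  finally show ?thesis by (simp add: dirichlet_form_def)
qed

text \<open>The square of the Sobolev norm, with the gradient part split into squared norms; it
  turns estimates into sums without square roots.\<close>

definition H1_sq :: "(real^'n) set \<Rightarrow> (real^'n \<Rightarrow> complex) \<Rightarrow> real" where
  "H1_sq U f = (l2_norm (lebesgue_on U) f)\<^sup>2 + (\<Sum>j\<in>UNIV. (l2_norm (lebesgue_on U) (weak_partial U j f))\<^sup>2)"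

lemma H1_sq_nonneg: "0 \<le> H1_sq U f"
  by (simp add: H1_sq_def sum_nonneg)

lemma H1_norm_eq: "f \<in> H1 U \<Longrightarrow> H1_norm U f = sqrt (H1_sq U f)"
  by (simp add: H1_norm_def H1_sq_def dirichlet_form_eq l2_inner_self del: of_real_power)

lemma H1_sq_cong:
  assumes "f \<in> H1 U" "\<And>j. u j \<in> L2 (lebesgue_on U)" "\<And>j. AE x in lebesgue_on U. weak_partial U j f x = u j x"
  shows "H1_sq U f = (l2_norm (lebesgue_on U) f)\<^sup>2 + (\<Sum>j\<in>UNIV. (l2_norm (lebesgue_on U) (u j))\<^sup>2)"
  unfolding H1_sq_def
  by (intro arg_cong2[where f="(+)"] refl sum.cong arg_cong[where f="\<lambda>x. x\<^sup>2"] l2_norm_cong assms weak_partial)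

lemma H1_sq_AE_cong:
  assumes U: "open U" and f: "f \<in> H1 U" "f' \<in> H1 U" "AE x in lebesgue_on U. f x = f' x"
  shows "H1_sq U f = H1_sq U f'"
  unfolding H1_sq_def
  using weak_partial_cong[OF U f(1) _ f(3)] l2_norm_cong[OF f(3)]
  by (intro arg_cong2[where f="(+)"] sum.cong refl arg_cong[where f="\<lambda>x. x\<^sup>2"] l2_norm_cong weak_partial f)
    (auto intro: f H1_L2 L2_measurable)

lemma H1_sq_add_le:
  assumes U: "open U" and f: "f \<in> H1 U" and g: "g \<in> H1 U"
  shows "H1_sq U (\<lambda>x. f x + g x) \<le> 2 * H1_sq U f + 2 * H1_sq U g"
proof -
  have "H1_sq U (\<lambda>x. f x + g x) = (l2_norm (lebesgue_on U) (\<lambda>x. f x + g x))\<^sup>2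
    + (\<Sum>j\<in>UNIV. (l2_norm (lebesgue_on U) (\<lambda>x. weak_partial U j f x + weak_partial U j g x))\<^sup>2)"
    by (intro H1_sq_cong H1_add weak_partial_add L2_add weak_partial U f g)
  also have "\<dots> \<le> (2 * (l2_norm (lebesgue_on U) f)\<^sup>2 + 2 * (l2_norm (lebesgue_on U) g)\<^sup>2)
    + (\<Sum>j\<in>UNIV. 2 * (l2_norm (lebesgue_on U) (weak_partial U j f))\<^sup>2 + 2 * (l2_norm (lebesgue_on U) (weak_partial U j g))\<^sup>2)"
    by (intro add_mono sum_mono l2_norm_add_square_le H1_L2 weak_partial f g)
  also have "\<dots> = 2 * H1_sq U f + 2 * H1_sq U g"
    by (simp add: H1_sq_def sum.distrib sum_distrib_left)
  finally show ?thesis .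
qed

lemma H1_sq_cmult:
  assumes U: "open U" and f: "f \<in> H1 U"
  shows "H1_sq U (\<lambda>x. c * f x) = (cmod c)\<^sup>2 * H1_sq U f"
proof -
  have "H1_sq U (\<lambda>x. c * f x) = (l2_norm (lebesgue_on U) (\<lambda>x. c * f x))\<^sup>2
    + (\<Sum>j\<in>UNIV. (l2_norm (lebesgue_on U) (\<lambda>x. c * weak_partial U j f x))\<^sup>2)"
    by (intro H1_sq_cong H1_cmult weak_partial_cmult L2_cmult weak_partial U f)
  then show ?thesis by (simp add: l2_norm_cmult power_mult_distrib H1_sq_def sum_distrib_left distrib_left)
qed

lemma H1_diff: "open U \<Longrightarrow> f \<in> H1 U \<Longrightarrow> g \<in> H1 U \<Longrightarrow> (\<lambda>x. f x - g x) \<in> H1 U"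
  using H1_add[OF _ _ H1_cmult, of U f g "-1"] by simp

lemma l2_norm_subset_le:
  assumes "V \<subseteq> U" "V \<in> sets lebesgue" "U \<in> sets lebesgue" "f \<in> L2 (lebesgue_on U)"
  shows "(l2_norm (lebesgue_on V) f)\<^sup>2 \<le> (l2_norm (lebesgue_on U) f)\<^sup>2"
proof -
  have i: "integrable lebesgue (\<lambda>x. indicator U x *\<^sub>R (cmod (f x))\<^sup>2)"
    using L2_integrable[OF assms(4)] assms(3) by (simp add: integrable_restrict_space)
  have i': "integrable lebesgue (\<lambda>x. indicator V x *\<^sub>R (cmod (f x))\<^sup>2)"
    using L2_integrable[OF L2_subset[OF assms]] assms(2) by (simp add: integrable_restrict_space)
  have "(LINT x|lebesgue. indicator V x *\<^sub>R (cmod (f x))\<^sup>2) \<le> (LINT x|lebesgue. indicator U x *\<^sub>R (cmod (f x))\<^sup>2)"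
    by (rule integral_mono[OF i' i]) (use assms(1) in \<open>auto simp: indicator_def\<close>)
  then show ?thesis using assms by (simp add: l2_norm_square integral_restrict_space)
qed

lemma H1_sq_subset_le:
  assumes "V \<subseteq> U" "open U" "open V" "f \<in> H1 U"
  shows "H1_sq V f \<le> H1_sq U f"
proof -
  have "H1_sq V f = (l2_norm (lebesgue_on V) f)\<^sup>2 + (\<Sum>j\<in>UNIV. (l2_norm (lebesgue_on V) (weak_partial U j f))\<^sup>2)"
    using assms by (intro H1_sq_cong H1_subset[OF assms] L2_subset[OF assms(1)] weak_partial weak_partial_subset) auto
  also have "\<dots> \<le> H1_sq U f"
    unfolding H1_sq_def using assms
    by (intro add_mono sum_mono l2_norm_subset_le[OF assms(1)] weak_partial H1_L2) auto
  finally show ?thesis .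
qed

lemma H1_sq_orthogonal:
  fixes g :: "real^'n \<Rightarrow> real^'n"
  assumes g: "orthogonal_transformation g" and gU: "\<And>x. x \<in> U \<longleftrightarrow> g x \<in> U" and U: "open U" and f: "f \<in> H1 U"
  shows "H1_sq U (\<lambda>x. f (g x)) = H1_sq U f"
proof -
  note Us = open_sets_lebesgue[OF U]
  have [measurable]: "f \<in> borel_measurable (lebesgue_on U)" by (intro L2_measurable H1_L2 f)
  have "(l2_norm (lebesgue_on U) (\<lambda>x. f (g x)))\<^sup>2 = (l2_norm (lebesgue_on U) f)\<^sup>2"
    unfolding l2_norm_square
    by (rule integral_orthogonal[OF g gU Us Us, of "\<lambda>x. (cmod (f x))\<^sup>2"]) measurable
  moreover have "of_real (\<Sum>j\<in>UNIV. (l2_norm (lebesgue_on U) (weak_partial U j h))\<^sup>2) = dirichlet_form U h h" if "h \<in> H1 U" for h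
    using that by (simp add: dirichlet_form_eq l2_inner_self)
  from this[OF f] this[OF H1_orthogonal[OF g gU U f]] dirichlet_form_orthogonal[OF g gU U f f]
  have "complex_of_real (\<Sum>j\<in>UNIV. (l2_norm (lebesgue_on U) (weak_partial U j (\<lambda>x. f (g x))))\<^sup>2)
    = of_real (\<Sum>j\<in>UNIV. (l2_norm (lebesgue_on U) (weak_partial U j f))\<^sup>2)" by simp
  then have "(\<Sum>j\<in>UNIV. (l2_norm (lebesgue_on U) (weak_partial U j (\<lambda>x. f (g x))))\<^sup>2)
    = (\<Sum>j\<in>UNIV. (l2_norm (lebesgue_on U) (weak_partial U j f))\<^sup>2)" by (simp only: of_real_eq_iff)
  ultimately show ?thesis by (simp add: H1_sq_def)
qed

section \<open>The closure of the test functions in the Sobolev space\<close>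

lemma H10_iff:
  assumes U: "open U"
  shows "f \<in> H10 U \<longleftrightarrow> f \<in> H1 U \<and> (\<forall>e>0. \<exists>\<phi>\<in>test_functions U. H1_sq U (\<lambda>x. \<phi> x - f x) < e)"
    (is "_ \<longleftrightarrow> ?R")
proof
  have nrm: "H1_norm U (\<lambda>x. \<phi> x - f x) = sqrt (H1_sq U (\<lambda>x. \<phi> x - f x))"
    if "f \<in> H1 U" "\<phi> \<in> test_functions U" for \<phi>
    using that by (intro H1_norm_eq H1_diff U test_functions_H1(1)[OF U that(2)])
  {
    assume "f \<in> H10 U"
    then obtain \<phi> where f: "f \<in> H1 U" and \<phi>: "\<And>n. \<phi> n \<in> test_functions U"
      and l: "(\<lambda>n. H1_norm U (\<lambda>x. \<phi> n x - f x)) \<longlonglongrightarrow> 0" by (auto simp: H10_def)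
    have "\<exists>\<phi>\<in>test_functions U. H1_sq U (\<lambda>x. \<phi> x - f x) < e" if "e > 0" for e
    proof -
      have "\<forall>\<^sub>F n in sequentially. H1_norm U (\<lambda>x. \<phi> n x - f x) < sqrt e"
        by (rule order_tendstoD(2)[OF l]) (use that in simp)
      then obtain n where "H1_norm U (\<lambda>x. \<phi> n x - f x) < sqrt e" by (auto simp: eventually_sequentially)
      then show ?thesis using \<phi>[of n] nrm[OF f \<phi>[of n]] by auto
    qed
    then show ?R using f by blast
  next
    assume R: ?R
    then have f: "f \<in> H1 U" by simp
    have "\<exists>\<phi>. \<phi> \<in> test_functions U \<and> H1_sq U (\<lambda>x. \<phi> x - f x) < 1 / real (Suc n)" for n
      using R by (metis of_nat_0_less_iff zero_less_Suc zero_less_divide_1_iff)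
    then obtain \<phi> where \<phi>: "\<And>n. \<phi> n \<in> test_functions U" "\<And>n. H1_sq U (\<lambda>x. \<phi> n x - f x) < 1 / real (Suc n)"
      by metis
    have "(\<lambda>n. H1_sq U (\<lambda>x. \<phi> n x - f x)) \<longlonglongrightarrow> 0"
    proof (rule Lim_null_comparison)
      show "\<forall>\<^sub>F n in sequentially. norm (H1_sq U (\<lambda>x. \<phi> n x - f x)) \<le> 1 / real (Suc n)"
        using \<phi>(2) by (auto simp: abs_of_nonneg[OF H1_sq_nonneg] less_imp_le intro!: always_eventually)
      show "(\<lambda>n. 1 / real (Suc n)) \<longlonglongrightarrow> 0" using LIMSEQ_inverse_real_of_nat by (simp add: inverse_eq_divide)
    qed
    from tendsto_real_sqrt[OF this] have "(\<lambda>n. H1_norm U (\<lambda>x. \<phi> n x - f x)) \<longlonglongrightarrow> 0"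
      by (simp add: nrm[OF f \<phi>(1)])
    then have "\<exists>\<phi>. (\<forall>n. \<phi> n \<in> test_functions U) \<and> (\<lambda>n. H1_norm U (\<lambda>x. \<phi> n x - f x)) \<longlonglongrightarrow> 0"
      by (intro exI[of _ \<phi>] conjI allI \<phi>(1))
    then show "f \<in> H10 U" using f by (simp add: H10_def)
  }
qed

lemma H10_H1: "f \<in> H10 U \<Longrightarrow> f \<in> H1 U"
  by (simp add: H10_def)

lemma test_functions_H10:
  assumes "open U" "\<phi> \<in> test_functions U" shows "\<phi> \<in> H10 U"
proof -
  have "H1_sq U (\<lambda>x. \<phi> x - \<phi> x) = 0"
    using H1_sq_cmult[OF assms(1) H1_zero[OF assms(1)], of 0] by simp
  then show ?thesis unfolding H10_iff[OF assms(1)] using assms by (auto intro: test_functions_H1 bexI[of _ \<phi>])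
qed

text \<open>A closure is closed: approximants need only lie in the closure themselves. The quarters
  of \<open>e\<close> compensate the factors 2 of \<open>H1_sq_add_le\<close>.\<close>

lemma H10_approx:
  assumes U: "open U" and f: "f \<in> H1 U" and a: "\<And>e. e > 0 \<Longrightarrow> \<exists>h\<in>H10 U. H1_sq U (\<lambda>x. h x - f x) < e"
  shows "f \<in> H10 U"
  unfolding H10_iff[OF U]
proof (intro conjI f allI impI)
  fix e :: real assume e: "e > 0"
  obtain h where h: "h \<in> H10 U" "H1_sq U (\<lambda>x. h x - f x) < e / 4" using a[of "e / 4"] e by auto
  obtain \<phi> where \<phi>: "\<phi> \<in> test_functions U" "H1_sq U (\<lambda>x. \<phi> x - h x) < e / 4"
    using h(1) e unfolding H10_iff[OF U] by (metis zero_less_divide_iff zero_less_numeral)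
  have "H1_sq U (\<lambda>x. (\<phi> x - h x) + (h x - f x)) \<le> 2 * H1_sq U (\<lambda>x. \<phi> x - h x) + 2 * H1_sq U (\<lambda>x. h x - f x)"
    by (intro H1_sq_add_le H1_diff U f H10_H1 h test_functions_H1[OF U \<phi>(1)])
  also have "\<dots> < e" using h \<phi> by simp
  finally show "\<exists>\<phi>\<in>test_functions U. H1_sq U (\<lambda>x. \<phi> x - f x) < e" using \<phi>(1) by auto
qed

lemma H10_add:
  assumes U: "open U" and f: "f \<in> H10 U" and g: "g \<in> H10 U" shows "(\<lambda>x. f x + g x) \<in> H10 U"
  unfolding H10_iff[OF U]
proof (intro conjI H1_add U H10_H1 f g allI impI)
  fix e :: real assume e: "e > 0"
  obtain \<phi> where \<phi>: "\<phi> \<in> test_functions U" "H1_sq U (\<lambda>x. \<phi> x - f x) < e / 4"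
    using f e unfolding H10_iff[OF U] by (metis zero_less_divide_iff zero_less_numeral)
  obtain \<psi> where \<psi>: "\<psi> \<in> test_functions U" "H1_sq U (\<lambda>x. \<psi> x - g x) < e / 4"
    using g e unfolding H10_iff[OF U] by (metis zero_less_divide_iff zero_less_numeral)
  have "H1_sq U (\<lambda>x. (\<phi> x - f x) + (\<psi> x - g x)) \<le> 2 * H1_sq U (\<lambda>x. \<phi> x - f x) + 2 * H1_sq U (\<lambda>x. \<psi> x - g x)"
    by (intro H1_sq_add_le H1_diff U f g H10_H1 test_functions_H1[OF U \<phi>(1)] test_functions_H1[OF U \<psi>(1)])
  also have "\<dots> < e" using \<phi> \<psi> by simp
  finally have "H1_sq U (\<lambda>x. (\<phi> x + \<psi> x) - (f x + g x)) < e" by (simp add: algebra_simps)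
  then show "\<exists>\<rho>\<in>test_functions U. H1_sq U (\<lambda>x. \<rho> x - (f x + g x)) < e"
    by (intro bexI[of _ "\<lambda>x. \<phi> x + \<psi> x"] test_functions_add[OF \<phi>(1) \<psi>(1)])
qed

lemma H10_cmult:
  assumes U: "open U" and f: "f \<in> H10 U" shows "(\<lambda>x. c * f x) \<in> H10 U"
  unfolding H10_iff[OF U]
proof (intro conjI H1_cmult U H10_H1 f allI impI)
  fix e :: real assume e: "e > 0"
  \<comment> \<open>The added 1 keeps the divisor positive when \<open>c\<close> is zero.\<close>
  define k where "k = (cmod c)\<^sup>2 + 1"
  have k: "k > 0" by (simp add: k_def add_nonneg_pos)
  obtain \<phi> where \<phi>: "\<phi> \<in> test_functions U" "H1_sq U (\<lambda>x. \<phi> x - f x) < e / k"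
    using f e k unfolding H10_iff[OF U] by (meson divide_pos_pos)
  have "H1_sq U (\<lambda>x. c * (\<phi> x - f x)) = (cmod c)\<^sup>2 * H1_sq U (\<lambda>x. \<phi> x - f x)"
    by (intro H1_sq_cmult H1_diff U f H10_H1 test_functions_H1[OF U \<phi>(1)])
  also have "\<dots> \<le> k * H1_sq U (\<lambda>x. \<phi> x - f x)" by (intro mult_right_mono H1_sq_nonneg) (simp add: k_def)
  also have "\<dots> < e" using \<phi>(2) k by (simp add: pos_less_divide_eq mult.commute)
  finally have "H1_sq U (\<lambda>x. c * \<phi> x - c * f x) < e" by (simp add: right_diff_distrib)
  then show "\<exists>\<rho>\<in>test_functions U. H1_sq U (\<lambda>x. \<rho> x - c * f x) < e"
    by (intro bexI[of _ "\<lambda>x. c * \<phi> x"] test_functions_cmult[OF \<phi>(1)])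
qed

lemma H10_orthogonal:
  fixes g :: "real^'n \<Rightarrow> real^'n"
  assumes g: "orthogonal_transformation g" and gU: "\<And>x. x \<in> U \<longleftrightarrow> g x \<in> U" and U: "open U" and f: "f \<in> H10 U"
  shows "(\<lambda>x. f (g x)) \<in> H10 U"
  unfolding H10_iff[OF U]
proof (intro conjI H1_orthogonal[OF g gU] U H10_H1 f allI impI)
  fix e :: real assume e: "e > 0"
  obtain \<phi> where \<phi>: "\<phi> \<in> test_functions U" "H1_sq U (\<lambda>x. \<phi> x - f x) < e"
    using f e unfolding H10_iff[OF U] by blast
  have "H1_sq U (\<lambda>x. \<phi> (g x) - f (g x)) = H1_sq U (\<lambda>x. \<phi> x - f x)"
    using H1_sq_orthogonal[OF g gU U, of "\<lambda>x. \<phi> x - f x"] H1_diff[OF U test_functions_H1(1)[OF U \<phi>(1)] H10_H1[OF f]]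
    by simp
  moreover have "(\<lambda>x. \<phi> (g x)) \<in> test_functions U" using gU by (intro test_functions_orthogonal[OF \<phi>(1) g]) auto
  ultimately show "\<exists>\<rho>\<in>test_functions U. H1_sq U (\<lambda>x. \<rho> x - f (g x)) < e"
    using \<phi>(2) by (intro bexI[of _ "\<lambda>x. \<phi> (g x)"]) auto
qed

lemma H10_cong:
  assumes U: "open U" and f: "f \<in> H10 U" and g: "g \<in> borel_measurable (lebesgue_on U)"
    and ae: "AE x in lebesgue_on U. f x = g x"
  shows "g \<in> H10 U"
proof (rule H10_approx[OF U])
  show g1: "g \<in> H1 U" by (rule H1_cong[OF U H10_H1[OF f] g ae])
  fix e :: real assume e: "e > 0"
  have "H1_sq U (\<lambda>x. f x - g x) = H1_sq U (\<lambda>x. 0)"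
    by (rule H1_sq_AE_cong[OF U]) (use ae in \<open>auto intro: H1_diff U H10_H1 f g1 H1_zero\<close>)
  also have "\<dots> = 0" using H1_sq_cmult[OF U H1_zero[OF U], of 0] by simp
  finally show "\<exists>h\<in>H10 U. H1_sq U (\<lambda>x. h x - g x) < e" using e by (intro bexI[OF _ f]) simp
qed

section \<open>Equivariant extension from the chamber\<close>

text \<open>Completeness of Lebesgue measure. Integrals against a kernel, and members of
  \<open>H1_eta\<close>, are known only to agree almost everywhere with a measurable
  function.\<close>

lemma borel_measurable_lebesgue_on_AE:
  fixes S :: "'a::euclidean_space set"
  assumes S: "S \<in> sets lebesgue" and g: "g \<in> borel_measurable (lebesgue_on S)"
    and ae: "AE x in lebesgue_on S. f x = g x"
  shows "f \<in> borel_measurable (lebesgue_on S)"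
proof (rule measurableI)
  fix A :: "'b set" assume A: "A \<in> sets borel"
  have "g -` A \<inter> space (lebesgue_on S) \<in> sets (lebesgue_on S)" using g A by (rule measurable_sets)
  then have 1: "g -` A \<inter> S \<in> sets lebesgue" using S by (simp add: sets_restrict_space_iff)
  have "AE x in lebesgue. x \<in> S \<longrightarrow> f x = g x" using ae S by (simp add: AE_restrict_space_iff)
  then have "AE x in lebesgue. x \<in> g -` A \<inter> S \<longleftrightarrow> x \<in> f -` A \<inter> S" by eventually_elim auto
  then have "f -` A \<inter> S \<in> sets lebesgue" using 1 by (rule completion.in_sets_AE) auto
  then show "f -` A \<inter> space (lebesgue_on S) \<in> sets (lebesgue_on S)"
    using S by (simp add: sets_restrict_space_iff)
qed auto

locale symmetric_domain = root_system R v for R :: "(real^'n) set" and v +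
  fixes \<Omega> :: "(real^'n) set" and \<eta> :: "(real^'n \<Rightarrow> real^'n) \<Rightarrow> real"
  assumes open_\<Omega>: "open \<Omega>" and sym_\<Omega>: "W_symmetric R \<Omega>" and hom: "\<eta> \<in> sign_homs R"
begin

abbreviation "\<Omega>p \<equiv> positive_part R v \<Omega>"
abbreviation "M \<equiv> lebesgue_on \<Omega>"
abbreviation "Mp \<equiv> lebesgue_on \<Omega>p"
abbreviation "N \<equiv> real (card W)"

lemma positive_part_subset: "\<Omega>p \<subseteq> \<Omega>" by (auto simp: positive_part_def)

lemma open_positive_part: "open \<Omega>p"
proof -
  have "\<Omega>p = \<Omega> \<inter> (\<Inter>\<alpha>\<in>Rp. {x. \<alpha> \<bullet> x > 0})" by (auto simp: positive_part_def inner_commute)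
  then show ?thesis using open_\<Omega> finite_Rp by (auto intro!: open_Int open_INT open_halfspace_gt)
qed

lemma sets_\<Omega>: "\<Omega> \<in> sets lebesgue" and sets_positive_part: "\<Omega>p \<in> sets lebesgue"
  using open_\<Omega> open_positive_part by auto

lemma W_\<Omega>: "g \<in> W \<Longrightarrow> x \<in> \<Omega> \<longleftrightarrow> g x \<in> \<Omega>"
  using W_image[of \<Omega> g] sym_\<Omega> W_bij[of g] unfolding W_symmetric_def by (metis bij_is_inj inj_image_mem_iff)

lemma W_inv: "g \<in> W \<Longrightarrow> inv g \<in> W" by (rule reflection_group.inv)

lemma W_inv_simps: "g \<in> W \<Longrightarrow> g (inv g x) = x" "g \<in> W \<Longrightarrow> inv g (g x) = x"
  using W_bij by (simp_all add: bij_is_surj surj_f_inv_f bij_is_inj)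

lemma W_comp_bij: "h \<in> W \<Longrightarrow> bij_betw (\<lambda>g. g \<circ> h) W W"
proof (rule bij_betwI[where g="\<lambda>g. g \<circ> inv h"])
  assume h: "h \<in> W"
  show "(\<lambda>g. g \<circ> h) \<in> W \<rightarrow> W" "(\<lambda>g. g \<circ> inv h) \<in> W \<rightarrow> W"
    using h by (auto intro: reflection_group.mult W_inv)
  show "(x \<circ> h) \<circ> inv h = x" "(x \<circ> inv h) \<circ> h = x" for x
    using W_inv_simps[OF h] by (auto simp: fun_eq_iff)
qed

lemma card_W_pos: "N > 0"
  using finite_W reflection_group.one[of R] by (simp add: card_gt_0_iff) blast

lemma W_nonempty: "W \<noteq> {}" using reflection_group.one by blast

lemma eta_mult: "g \<in> W \<Longrightarrow> h \<in> W \<Longrightarrow> \<eta> (g \<circ> h) = \<eta> g * \<eta> h"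
  and eta_cases: "g \<in> W \<Longrightarrow> \<eta> g = 1 \<or> \<eta> g = -1"
  using hom by (auto simp: sign_homs_def)

lemma eta_sq: "g \<in> W \<Longrightarrow> \<eta> g * \<eta> g = 1"
  using eta_cases by force

lemma eta_id: "\<eta> id = 1"
  using eta_mult[OF reflection_group.one reflection_group.one] eta_cases[OF reflection_group.one] by auto

text \<open>Simple transitivity: existence is \<open>W_transitive\<close>, and two such elements
  differ by one mapping a point of the chamber into the chamber, to which \<open>W_free\<close>
  applies.\<close>

lemma regular_in_chamber:
  assumes "x \<in> \<Omega>" "\<forall>\<alpha>\<in>R. x \<bullet> \<alpha> \<noteq> 0"
  shows "\<exists>!g. g \<in> W \<and> g x \<in> \<Omega>p"
proof -
  obtain g where g: "g \<in> W" "\<forall>\<alpha>\<in>Rp. g x \<bullet> \<alpha> > 0" using W_transitive[OF assms(2)] by blast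
  show ?thesis
  proof (rule ex1I[of _ g])
    show "g \<in> W \<and> g x \<in> \<Omega>p" using g iffD1[OF W_\<Omega>[OF g(1)] assms(1)] by (auto simp: positive_part_def)
    fix h assume h: "h \<in> W \<and> h x \<in> \<Omega>p"
    have "h \<circ> inv g \<in> W" using h g by (intro reflection_group.mult W_inv) auto
    then have "h \<circ> inv g = id"
      using h g by (intro W_free[of "h \<circ> inv g" "g x"]) (auto simp: positive_part_def W_inv_simps)
    then show "h = g" using W_inv_simps[OF g(1)] by (metis comp_apply id_apply ext)
  qed
qed

lemma regular_in_chamber':
  assumes "x \<in> \<Omega>" "\<forall>\<alpha>\<in>R. x \<bullet> \<alpha> \<noteq> 0"
  shows "\<exists>g\<in>W. g x \<in> \<Omega>p \<and> (\<forall>h\<in>W. h x \<in> \<Omega>p \<longrightarrow> h = g)"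
  using regular_in_chamber[OF assms] by blast

lemma in_chamber_unique: "g \<in> W \<Longrightarrow> x \<in> \<Omega>p \<Longrightarrow> g x \<in> \<Omega>p \<longleftrightarrow> g = id"
  using W_free[of g x] by (auto simp: positive_part_def)

lemma AE_regular: "AE x in M. \<forall>\<alpha>\<in>R. x \<bullet> \<alpha> \<noteq> 0"
proof -
  have "AE x in lebesgue. \<forall>\<alpha>\<in>R. x \<bullet> \<alpha> \<noteq> 0"
  proof (rule AE_finite_allI[OF finite_R])
    fix \<alpha> assume "\<alpha> \<in> R"
    then have "\<alpha> \<noteq> 0" using norm_root by force
    then have "negligible {x. \<alpha> \<bullet> x = 0}" by (intro negligible_hyperplane) simp
    then have "{x. \<alpha> \<bullet> x = 0} \<in> null_sets lebesgue" by (simp add: negligible_iff_null_sets)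
    from AE_not_in[OF this] show "AE x in lebesgue. x \<bullet> \<alpha> \<noteq> 0" by (simp add: inner_commute)
  qed
  then show ?thesis using sets_\<Omega> by (simp add: AE_restrict_space_iff) (auto elim: eventually_mono)
qed

text \<open>As a sum over the whole group the extension is defined everywhere and is exactly linear
  and equivariant. Off the walls at most one summand is active; on the walls none is.\<close>

definition J :: "(real^'n \<Rightarrow> complex) \<Rightarrow> real^'n \<Rightarrow> complex" where
  "J f y = (\<Sum>g\<in>W. \<eta> g *\<^sub>R (if g y \<in> \<Omega>p then f (g y) else 0))"

lemma sum_equivariant:
  assumes h: "h \<in> W"
  shows "(\<Sum>g\<in>W. \<eta> g *\<^sub>R (F (g (h y)) :: complex)) = \<eta> h *\<^sub>R (\<Sum>g\<in>W. \<eta> g *\<^sub>R F (g y))"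
proof -
  have "(\<Sum>g\<in>W. \<eta> g *\<^sub>R F (g y)) = (\<Sum>g\<in>W. \<eta> (g \<circ> h) *\<^sub>R F ((g \<circ> h) y))"
    using sum.reindex_bij_betw[OF W_comp_bij[OF h], of "\<lambda>g. \<eta> g *\<^sub>R F (g y)"] by simp
  also have "\<dots> = \<eta> h *\<^sub>R (\<Sum>g\<in>W. \<eta> g *\<^sub>R F (g (h y)))"
    using h by (simp add: eta_mult scaleR_sum_right mult.commute)
  finally have "\<eta> h *\<^sub>R (\<Sum>g\<in>W. \<eta> g *\<^sub>R F (g y)) = (\<eta> h * \<eta> h) *\<^sub>R (\<Sum>g\<in>W. \<eta> g *\<^sub>R F (g (h y)))"
    by (simp only: scaleR_scaleR)
  then show ?thesis using eta_sq[OF h] by simp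
qed

lemma J_equivariant: "h \<in> W \<Longrightarrow> J f (h y) = \<eta> h *\<^sub>R J f y"
  unfolding J_def by (rule sum_equivariant[of h "\<lambda>y. if y \<in> \<Omega>p then f y else 0"])

lemma J_eq_single:
  assumes "g \<in> W" "g y \<in> \<Omega>p" "\<And>h. h \<in> W \<Longrightarrow> h y \<in> \<Omega>p \<Longrightarrow> h = g"
  shows "J f y = \<eta> g *\<^sub>R f (g y)"
proof -
  have "J f y = (\<Sum>h\<in>W. if h = g then \<eta> g *\<^sub>R f (g y) else 0)"
    unfolding J_def
  proof (intro sum.cong refl)
    fix h assume "h \<in> W"
    then show "\<eta> h *\<^sub>R (if h y \<in> \<Omega>p then f (h y) else 0) = (if h = g then \<eta> g *\<^sub>R f (g y) else 0)"
      using assms(2) assms(3)[of h] by (cases "h y \<in> \<Omega>p") auto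
  qed
  then show ?thesis using assms(1) finite_W by simp
qed

lemma J_on_positive_part: "x \<in> \<Omega>p \<Longrightarrow> J f x = f x"
  using J_eq_single[of id x f] in_chamber_unique[of _ x] reflection_group.one[of R] by (simp add: eta_id)

text \<open>At almost every point a unique \<open>g\<close> leads into the chamber, where
  \<open>J F\<close> equals \<open>F\<close>; transporting back produces the factor
  \<open>\<eta> g\<close> twice, and it squares to 1. This recognizes the range of
  \<open>J\<close>.\<close>

lemma J_restrict:
  assumes "\<And>g. g \<in> W \<Longrightarrow> AE x in M. F (g x) = \<eta> g *\<^sub>R F x"
  shows "AE x in M. J F x = F x"
proof -
  have "AE x in M. \<forall>g\<in>W. F (g x) = \<eta> g *\<^sub>R F x"
    using assms by (intro AE_finite_allI finite_W)
  with AE_regular AE_space show ?thesis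
  proof eventually_elim
    case (elim x)
    then obtain g where g: "g \<in> W" "g x \<in> \<Omega>p" "\<And>h. h \<in> W \<Longrightarrow> h x \<in> \<Omega>p \<Longrightarrow> h = g"
      using regular_in_chamber'[of x] by auto
    have "J F x = \<eta> g *\<^sub>R F (g x)" by (rule J_eq_single[OF g])
    also have "\<dots> = F x" using elim(3) g(1) eta_sq by simp
    finally show ?case .
  qed
qed

lemma J_diff: "J (\<lambda>x. f x - g x) = (\<lambda>x. J f x - J g x)"
  unfolding J_def sum_subtractf[symmetric] by (intro ext sum.cong) (auto simp: scaleR_diff_right)

lemma J_scaleR: "J (\<lambda>x. k *\<^sub>R f x) = (\<lambda>x. k *\<^sub>R J f x)" for k :: real
  unfolding J_def scaleR_sum_right by (intro ext sum.cong) auto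

lemma L2_W: "g \<in> W \<Longrightarrow> f \<in> L2 M \<Longrightarrow> (\<lambda>x. f (g x)) \<in> L2 M"
  by (rule L2_orthogonal[OF W_orth W_\<Omega> sets_\<Omega> sets_\<Omega>])

lemma AE_W: "g \<in> W \<Longrightarrow> AE x in M. P x \<Longrightarrow> AE x in M. P (g x)"
  by (rule AE_orthogonal[OF W_orth W_\<Omega> sets_\<Omega> sets_\<Omega>])

lemma integral_W: "g \<in> W \<Longrightarrow> f \<in> borel_measurable M \<Longrightarrow> (LINT x|M. f (g x)) = (LINT x|M. f x)"
  for f :: "_ \<Rightarrow> 'c::{banach, second_countable_topology}"
  by (rule integral_orthogonal[OF W_orth W_\<Omega> sets_\<Omega> sets_\<Omega>])

lemma Mp_eq: "Mp = restrict_space M \<Omega>p"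
  using positive_part_subset by (simp add: restrict_restrict_space sets_\<Omega> sets_positive_part Int_absorb1)

lemma positive_part_in_M: "\<Omega>p \<inter> space M \<in> sets M" "\<Omega>p \<in> sets M"
  using positive_part_subset sets_\<Omega> sets_positive_part by (auto simp: sets_restrict_space_iff)

lemma integrable_Mp: "integrable Mp f \<longleftrightarrow> integrable M (\<lambda>x. indicator \<Omega>p x *\<^sub>R f x)"
  for f :: "_ \<Rightarrow> 'c::{banach, second_countable_topology}"
  unfolding Mp_eq by (rule integrable_restrict_space[OF positive_part_in_M(1)])

lemma integral_Mp: "integral\<^sup>L Mp f = (LINT x|M. indicator \<Omega>p x *\<^sub>R f x)"
  for f :: "_ \<Rightarrow> 'c::{banach, second_countable_topology}"
  unfolding Mp_eq by (rule integral_restrict_space[OF positive_part_in_M(1)])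

lemma AE_Mp: "(AE x in Mp. P x) \<longleftrightarrow> (AE x in M. x \<in> \<Omega>p \<longrightarrow> P x)"
  unfolding Mp_eq by (rule AE_restrict_space_iff[OF positive_part_in_M(1)])

definition ext0 :: "(real^'n \<Rightarrow> complex) \<Rightarrow> real^'n \<Rightarrow> complex" where
  "ext0 f x = (if x \<in> \<Omega>p then f x else 0)"

lemma ext0_indicator: "ext0 f x = indicator \<Omega>p x *\<^sub>R f x"
  by (simp add: ext0_def indicator_def)

lemma ext0_L2:
  assumes f: "f \<in> L2 Mp" shows "ext0 f \<in> L2 M"
proof -
  have "(\<lambda>x. indicator \<Omega>p x *\<^sub>R f x) \<in> borel_measurable M"
    using L2_measurable[OF f] unfolding Mp_eq borel_measurable_restrict_space_iff[OF positive_part_in_M(1)] .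
  moreover have "integrable M (\<lambda>x. indicator \<Omega>p x *\<^sub>R (cmod (f x))\<^sup>2)"
    using L2_integrable[OF f] unfolding integrable_Mp .
  ultimately show ?thesis unfolding L2_def
    by (auto simp: ext0_indicator[abs_def] power_mult_distrib indicator_def
        cong: if_cong elim!: back_subst[where P="integrable M"])
qed

lemma J_ext0: "J f = (\<lambda>x. \<Sum>g\<in>W. \<eta> g *\<^sub>R ext0 f (g x))"
  by (simp add: J_def ext0_def fun_eq_iff)

lemma J_L2: "f \<in> L2 Mp \<Longrightarrow> J f \<in> L2 M"
  unfolding J_ext0 by (rule L2_sum, rule L2_scaleR, rule L2_W[OF _ ext0_L2])

lemma restrict_L2: "F \<in> L2 M \<Longrightarrow> F \<in> L2 Mp"
  by (rule L2_subset[OF positive_part_subset sets_positive_part sets_\<Omega>])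

lemma J_AE:
  assumes "AE x in Mp. f x = f' x" shows "AE x in M. J f x = J f' x"
proof -
  have "AE x in M. ext0 f x = ext0 f' x" using assms unfolding AE_Mp by eventually_elim (simp add: ext0_def)
  then have "AE x in M. \<forall>g\<in>W. ext0 f (g x) = ext0 f' (g x)"
    by (intro AE_finite_allI[OF finite_W]) (rule AE_W[where P="\<lambda>x. ext0 f x = ext0 f' x"])
  then show ?thesis by eventually_elim (simp add: J_ext0)
qed

text \<open>Up to the walls, \<Omega> is the disjoint union of the images of the positive part under
  the group, and an invariant integrand contributes the same integral on each.\<close>

lemma integral_invariant:
  fixes q :: "real^'n \<Rightarrow> complex"
  assumes q: "integrable M q" and inv: "\<And>g. g \<in> W \<Longrightarrow> AE x in M. q (g x) = q x"
  shows "(LINT x|M. q x) = of_real N * (LINT x|Mp. q x)"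
proof -
  have [measurable]: "q \<in> borel_measurable M" using q by simp
  have [measurable]: "\<Omega>p \<in> sets M" by (rule positive_part_in_M)
  have gm[measurable]: "g \<in> M \<rightarrow>\<^sub>M M" if "g \<in> W" for g
    using W_\<Omega>[OF that] by (intro lebesgue_on_measurable_orthogonal W_orth that) auto
  have iq: "integrable M (\<lambda>x. indicator \<Omega>p x *\<^sub>R q x)" by (intro integrable_mult_indicator q positive_part_in_M)
  have ig: "integrable M (\<lambda>x. indicator \<Omega>p (g x) *\<^sub>R q (g x))" if g: "g \<in> W" for g
  proof -
    have "integrable (distr M M g) (\<lambda>x. indicator \<Omega>p x *\<^sub>R q x)"
      unfolding lebesgue_on_distr_orthogonal[OF W_orth[OF g] W_\<Omega>[OF g] sets_\<Omega> sets_\<Omega>] by (rule iq)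
    then show ?thesis by (subst (asm) integrable_distr_eq[OF gm[OF g]]) auto
  qed
  have "(LINT x|M. q x) = (LINT x|M. (\<Sum>g\<in>W. indicator \<Omega>p (g x) *\<^sub>R q (g x)))"
  proof (rule integral_cong_AE)
    have "AE x in M. \<forall>g\<in>W. q (g x) = q x" using inv by (intro AE_finite_allI finite_W)
    with AE_regular AE_space show "AE x in M. q x = (\<Sum>g\<in>W. indicator \<Omega>p (g x) *\<^sub>R q (g x))"
    proof eventually_elim
      case (elim x)
      then obtain g where g: "g \<in> W" "g x \<in> \<Omega>p" "\<And>h. h \<in> W \<Longrightarrow> h x \<in> \<Omega>p \<Longrightarrow> h = g"
        using regular_in_chamber'[of x] by auto
      have "(\<Sum>h\<in>W. indicator \<Omega>p (h x) *\<^sub>R q (h x)) = (\<Sum>h\<in>W. if h = g then q x else 0)"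
      proof (intro sum.cong refl)
        fix h assume "h \<in> W"
        then show "indicator \<Omega>p (h x) *\<^sub>R q (h x) = (if h = g then q x else 0)"
          using g(2) g(3)[of h] elim(3) by (cases "h x \<in> \<Omega>p") auto
      qed
      then show ?case using g(1) finite_W by simp
    qed
  qed (use ig in \<open>auto intro!: borel_measurable_integrable\<close>)
  also have "\<dots> = (\<Sum>g\<in>W. LINT x|M. indicator \<Omega>p (g x) *\<^sub>R q (g x))"
    using ig by (rule Bochner_Integration.integral_sum)
  also have "\<dots> = (\<Sum>g\<in>W. LINT x|M. indicator \<Omega>p x *\<^sub>R q x)"
    by (intro sum.cong refl integral_W[where f="\<lambda>x. indicator \<Omega>p x *\<^sub>R q x"]) auto
  finally show ?thesis by (simp add: integral_Mp)
qed

lemma J_inner: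
  assumes f: "f \<in> L2 Mp" and h: "h \<in> L2 Mp"
  shows "l2_inner M (J f) (J h) = of_real N * l2_inner Mp f h"
proof -
  have "l2_inner M (J f) (J h) = of_real N * (LINT x|Mp. J f x * cnj (J h x))"
    unfolding l2_inner_def
  proof (rule integral_invariant)
    show "integrable M (\<lambda>x. J f x * cnj (J h x))" by (intro L2_integrable_inner J_L2 f h)
    show "AE x in M. J f (g x) * cnj (J h (g x)) = J f x * cnj (J h x)" if "g \<in> W" for g
      using eta_sq[OF that] by (simp add: J_equivariant[OF that])
  qed
  also have "(LINT x|Mp. J f x * cnj (J h x)) = (LINT x|Mp. f x * cnj (h x))"
    by (intro Bochner_Integration.integral_cong refl) (simp add: J_on_positive_part)
  finally show ?thesis by (simp add: l2_inner_def)
qed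

abbreviation "A\<eta> \<equiv> symmetrization R \<eta>"

lemma sym_eq: "A\<eta> F = (\<lambda>y. of_real (1 / N) * (\<Sum>g\<in>W. of_real (\<eta> g) * F (g y)))"
  by (simp add: symmetrization_def fun_eq_iff scaleR_conv_of_real)

lemma sym_equivariant: "h \<in> W \<Longrightarrow> A\<eta> F (h y) = \<eta> h *\<^sub>R A\<eta> F y"
  unfolding symmetrization_def using sum_equivariant[of h F y] by (simp add: mult.commute)

lemma sym_J: "A\<eta> (J f) y = J f y"
proof -
  have "(\<Sum>g\<in>W. \<eta> g *\<^sub>R J f (g y)) = (\<Sum>g\<in>W. J f y)"
    by (intro sum.cong refl) (simp add: J_equivariant eta_sq)
  then show ?thesis using card_W_pos by (simp add: symmetrization_def scaleR_conv_of_real)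
qed

lemma J_sym: "AE x in M. J (A\<eta> F) x = A\<eta> F x"
  by (rule J_restrict) (simp add: sym_equivariant)

text \<open>The gradient of \<open>J f\<close> is equivariant up to the orthogonal matrix of
  \<open>g\<close>, so the product of two such gradients is an invariant function and its integral
  reduces to the chamber.\<close>

lemma dirichlet_form_J:
  assumes f: "f \<in> L2 Mp" "J f \<in> H1 \<Omega>" and h: "h \<in> L2 Mp" "J h \<in> H1 \<Omega>"
  shows "dirichlet_form \<Omega> (J f) (J h) = of_real N * dirichlet_form \<Omega>p f h"
proof -
  let ?w = "\<lambda>f j x. weak_partial \<Omega> j (J f) x"
  \<comment> \<open>Both sides are weak derivatives of the same function: \<open>J k\<close>
    composed with \<open>g\<close> by the chain rule, and \<open>\<eta> g\<close> times
    \<open>J k\<close> by equivariance.\<close>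
  have grad: "AE x in M. \<forall>j. \<eta> g *\<^sub>R ?w k j x = (\<Sum>i\<in>UNIV. of_real (g (axis j 1) $ i) * ?w k i (g x))"
    if g: "g \<in> W" and k: "J k \<in> H1 \<Omega>" for g k
  proof -
    have "AE x in M. \<eta> g *\<^sub>R ?w k j x = (\<Sum>i\<in>UNIV. of_real (g (axis j 1) $ i) * ?w k i (g x))" for j
    proof -
      have "(\<lambda>x. J k (g x)) = (\<lambda>x. of_real (\<eta> g) * J k x)"
        by (simp add: J_equivariant[OF g] scaleR_conv_of_real fun_eq_iff)
      then show ?thesis
        using weak_partial_orthogonal[OF W_orth[OF g] W_\<Omega>[OF g] open_\<Omega> k, of j]
          weak_partial_cmult[OF open_\<Omega> k, of j "of_real (\<eta> g)"]
        by (auto simp: scaleR_conv_of_real elim: eventually_elim2)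
    qed
    then show ?thesis by (simp add: AE_all_countable)
  qed
  have "dirichlet_form \<Omega> (J f) (J h) = of_real N * (LINT x|Mp. (\<Sum>j\<in>UNIV. ?w f j x * cnj (?w h j x)))"
    unfolding dirichlet_form_def
  proof (rule integral_invariant)
    show "integrable M (\<lambda>x. \<Sum>j\<in>UNIV. ?w f j x * cnj (?w h j x))"
      by (intro Bochner_Integration.integrable_sum L2_integrable_inner weak_partial f h)
    fix g assume g: "g \<in> W"
    show "AE x in M. (\<Sum>j\<in>UNIV. ?w f j (g x) * cnj (?w h j (g x))) = (\<Sum>j\<in>UNIV. ?w f j x * cnj (?w h j x))"
      using grad[OF g f(2)] grad[OF g h(2)]
    proof eventually_elim
      case (elim x)
      have "(\<Sum>j\<in>UNIV. ?w f j (g x) * cnj (?w h j (g x)))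
        = (\<Sum>j\<in>UNIV. (\<Sum>i\<in>UNIV. of_real (g (axis j 1) $ i) * ?w f i (g x))
            * cnj (\<Sum>i\<in>UNIV. of_real (g (axis j 1) $ i) * ?w h i (g x)))"
        by (rule orthogonal_sum_products[OF W_orth[OF g], symmetric])
      also have "\<dots> = (\<Sum>j\<in>UNIV. (\<eta> g *\<^sub>R ?w f j x) * cnj (\<eta> g *\<^sub>R ?w h j x))"
        using elim by (intro sum.cong) auto
      also have "\<dots> = (\<Sum>j\<in>UNIV. ?w f j x * cnj (?w h j x))" using eta_sq[OF g] by simp
      finally show ?case .
    qed
  qed
  also have "(LINT x|Mp. (\<Sum>j\<in>UNIV. ?w f j x * cnj (?w h j x))) = dirichlet_form \<Omega>p f h"
  proof -
    have sub: "J k \<in> H1 \<Omega>p" "AE x in Mp. weak_partial \<Omega>p j (J k) x = ?w k j x" if "J k \<in> H1 \<Omega>" for k j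
      using H1_subset[OF positive_part_subset open_\<Omega> open_positive_part that]
        weak_partial_subset[OF positive_part_subset open_\<Omega> open_positive_part that] by auto
    have ae: "AE x in Mp. J k x = k x" for k by (rule AE_I2) (simp add: J_on_positive_part)
    have kH: "k \<in> H1 \<Omega>p" if "k \<in> L2 Mp" "J k \<in> H1 \<Omega>" for k
      by (rule H1_cong[OF open_positive_part sub(1)[OF that(2)] L2_measurable[OF that(1)] ae])
    have wk: "AE x in Mp. weak_partial \<Omega>p j k x = ?w k j x" if "k \<in> L2 Mp" "J k \<in> H1 \<Omega>" for k j
      using weak_partial_cong[OF open_positive_part sub(1)[OF that(2)] L2_measurable[OF that(1)] ae, of j]
        sub(2)[OF that(2), of j] by eventually_elim simp
    have "dirichlet_form \<Omega>p f h = (\<Sum>j\<in>UNIV. l2_inner Mp (?w f j) (?w h j))"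
      by (rule dirichlet_form_cong[OF open_positive_part kH[OF f] kH[OF h] _ wk[OF f] _ wk[OF h]])
        (intro restrict_L2 weak_partial f h)+
    also have "\<dots> = (LINT x|Mp. (\<Sum>j\<in>UNIV. ?w f j x * cnj (?w h j x)))"
      unfolding l2_inner_def
      by (intro Bochner_Integration.integral_sum[symmetric] L2_integrable_inner restrict_L2 weak_partial f h)
    finally show ?thesis by simp
  qed
  finally show ?thesis .
qed

end

text \<open>Collects what the full Sobolev space and the closure of the test functions have in
  common, so that both kernel formulas are instances of one theorem.\<close>

locale invariant_form_domain = symmetric_domain R v \<Omega> \<eta>
  for R :: "(real^'n) set" and v \<Omega> \<eta> +
  fixes D :: "(real^'n \<Rightarrow> complex) set"
  assumes D_H1: "D \<subseteq> H1 \<Omega>" and D_add: "f \<in> D \<Longrightarrow> h \<in> D \<Longrightarrow> (\<lambda>x. f x + h x) \<in> D"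
    and D_cmult: "f \<in> D \<Longrightarrow> (\<lambda>x. c * f x) \<in> D" and D_nonempty: "D \<noteq> {}"
    and D_W: "g \<in> W \<Longrightarrow> f \<in> D \<Longrightarrow> (\<lambda>x. f (g x)) \<in> D"
    and D_cong: "f \<in> D \<Longrightarrow> h \<in> borel_measurable M \<Longrightarrow> AE x in M. f x = h x \<Longrightarrow> h \<in> D"
begin

abbreviation "t\<Omega> \<equiv> dirichlet_form \<Omega>"
abbreviation "op\<Omega> \<equiv> form_operator M D t\<Omega>"

text \<open>The form domain induced on the positive part; it is later identified with
  \<open>H1_eta\<close> and, for the sign character, with the closure of the test functions of the
  positive part.\<close>

definition "Dp = {f \<in> L2 Mp. J f \<in> D}"

abbreviation "op_plus \<equiv> form_operator Mp Dp (dirichlet_form \<Omega>p)"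

lemma D_L2: "f \<in> D \<Longrightarrow> f \<in> L2 M" using D_H1 H1_L2 by blast

lemma D_sum: "(\<And>i. i \<in> I \<Longrightarrow> f i \<in> D) \<Longrightarrow> (\<lambda>x. \<Sum>i\<in>I. f i x) \<in> D"
proof (induction I rule: infinite_finite_induct)
  case (infinite A)
  obtain h where "h \<in> D" using D_nonempty by blast
  from D_cmult[OF this, of 0] infinite show ?case by simp
next
  case empty
  obtain h where "h \<in> D" using D_nonempty by blast
  from D_cmult[OF this, of 0] show ?case by simp
qed (simp add: D_add)

lemma sym_D: "F \<in> D \<Longrightarrow> A\<eta> F \<in> D"
  unfolding sym_eq by (rule D_cmult, rule D_sum, rule D_cmult, rule D_W)

lemma form_W: "g \<in> W \<Longrightarrow> f \<in> D \<Longrightarrow> h \<in> D \<Longrightarrow> t\<Omega> (\<lambda>x. f (g x)) (\<lambda>x. h (g x)) = t\<Omega> f h"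
  using D_H1 by (intro dirichlet_form_orthogonal W_orth W_\<Omega> open_\<Omega>) auto

lemma inner_W:
  assumes g: "g \<in> W" and f: "f \<in> L2 M" and h: "h \<in> L2 M"
  shows "l2_inner M (\<lambda>x. f (g x)) (\<lambda>x. h (g x)) = l2_inner M f h"
  unfolding l2_inner_def
  by (rule integral_W[OF g, of "\<lambda>x. f x * cnj (h x)"]) (use L2_measurable[OF f] L2_measurable[OF h] in auto)

text \<open>A sesquilinear pairing invariant under the group only sees the equivariant part of its
  second argument if the first argument is equivariant.\<close>

lemma form_sym:
  assumes f: "J f \<in> D" and H: "H \<in> D" shows "t\<Omega> (J f) (A\<eta> H) = t\<Omega> (J f) H"
proof -
  have H1: "J f \<in> H1 \<Omega>" "H \<in> H1 \<Omega>" "\<And>g. g \<in> W \<Longrightarrow> (\<lambda>x. H (g x)) \<in> H1 \<Omega>"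
    using f H D_W[OF _ H] D_H1 by auto
  have e: "complex_of_real (\<eta> g) * t\<Omega> (J f) (\<lambda>x. H (g x)) = t\<Omega> (J f) H" if g: "g \<in> W" for g
  proof -
    have "t\<Omega> (J f) H = t\<Omega> (\<lambda>x. J f (g x)) (\<lambda>x. H (g x))" using form_W[OF g f H] by simp
    also have "\<dots> = t\<Omega> (\<lambda>x. of_real (\<eta> g) * J f x) (\<lambda>x. H (g x))"
      by (simp add: J_equivariant[OF g] scaleR_conv_of_real)
    also have "\<dots> = of_real (\<eta> g) * t\<Omega> (J f) (\<lambda>x. H (g x))"
      by (intro dirichlet_form_cmult_left open_\<Omega> H1 g)
    finally show ?thesis by simp
  qed
  have "t\<Omega> (J f) (A\<eta> H) = of_real (1 / N) * (\<Sum>g\<in>W. of_real (\<eta> g) * t\<Omega> (J f) (\<lambda>x. H (g x)))"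
    unfolding sym_eq
    by (simp add: dirichlet_form_cmult_right dirichlet_form_sum_right open_\<Omega> H1 H1_cmult H1_sum del: of_real_divide)
  also have "\<dots> = t\<Omega> (J f) H" using card_W_pos by (simp add: e)
  finally show ?thesis .
qed

lemma inner_sym:
  assumes f: "f \<in> L2 Mp" and H: "H \<in> L2 M" shows "l2_inner M (J f) (A\<eta> H) = l2_inner M (J f) H"
proof -
  note fL = J_L2[OF f]
  have e: "complex_of_real (\<eta> g) * l2_inner M (J f) (\<lambda>x. H (g x)) = l2_inner M (J f) H" if g: "g \<in> W" for g
  proof -
    have "l2_inner M (J f) H = l2_inner M (\<lambda>x. J f (g x)) (\<lambda>x. H (g x))" using inner_W[OF g fL H] by simp
    also have "\<dots> = l2_inner M (\<lambda>x. of_real (\<eta> g) * J f x) (\<lambda>x. H (g x))"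
      by (simp add: J_equivariant[OF g] scaleR_conv_of_real)
    finally show ?thesis by (simp add: l2_inner_cmult_left)
  qed
  have "l2_inner M (J f) (A\<eta> H) = of_real (1 / N) * (\<Sum>g\<in>W. of_real (\<eta> g) * l2_inner M (J f) (\<lambda>x. H (g x)))"
    unfolding sym_eq
    by (simp add: l2_inner_cmult_right l2_inner_sum_right L2_cmult L2_W H fL del: of_real_divide)
  also have "\<dots> = l2_inner M (J f) H" using card_W_pos by (simp add: e)
  finally show ?thesis .
qed

text \<open>The defining identity on the positive part is tested only with functions whose extension
  lies in \<open>D\<close>. An arbitrary \<open>H\<close> in \<open>D\<close> is first symmetrized,
  which changes neither side because \<open>J f\<close> and \<open>J u\<close> are
  equivariant.\<close>

lemma op_iff:
  assumes f: "f \<in> L2 Mp" and u: "u \<in> L2 Mp"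
  shows "op_plus f u \<longleftrightarrow> op\<Omega> (J f) (J u)"
proof
  assume L: "op_plus f u"
  then have fD: "J f \<in> D" by (simp add: form_operator_def Dp_def)
  have "t\<Omega> (J f) H = l2_inner M (J u) H" if H: "H \<in> D" for H
  proof -
    define h where "h = A\<eta> H"
    have hD: "h \<in> D" using sym_D[OF H] by (simp add: h_def)
    have hL: "h \<in> L2 Mp" by (rule restrict_L2[OF D_L2[OF hD]])
    have ae: "AE x in M. h x = J h x" using J_sym[of H] by (auto simp: h_def)
    have JhD: "J h \<in> D" by (rule D_cong[OF hD L2_measurable[OF J_L2[OF hL]] ae])
    then have "h \<in> Dp" using hL by (simp add: Dp_def)
    then have eq: "dirichlet_form \<Omega>p f h = l2_inner Mp u h" using L by (simp add: form_operator_def)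
    have "t\<Omega> (J f) H = t\<Omega> (J f) h" using form_sym[OF fD H] by (simp add: h_def)
    also have "\<dots> = t\<Omega> (J f) (J h)"
      using fD hD JhD D_H1 by (intro dirichlet_form_AE_cong open_\<Omega> ae) auto
    also have "\<dots> = of_real N * dirichlet_form \<Omega>p f h"
      using f fD hL JhD D_H1 by (intro dirichlet_form_J) auto
    also have "\<dots> = l2_inner M (J u) (J h)" unfolding eq by (rule J_inner[OF u hL, symmetric])
    also have "\<dots> = l2_inner M (J u) h"
      using ae by (intro l2_inner_cong J_L2 u hL D_L2 hD) auto
    also have "\<dots> = l2_inner M (J u) H" unfolding h_def by (rule inner_sym[OF u D_L2[OF H]])
    finally show ?thesis .
  qed
  then show "op\<Omega> (J f) (J u)" using fD J_L2[OF u] by (simp add: form_operator_def)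
next
  assume L: "op\<Omega> (J f) (J u)"
  then have fD: "J f \<in> D" by (simp add: form_operator_def)
  have "dirichlet_form \<Omega>p f h = l2_inner Mp u h" if h: "h \<in> Dp" for h
  proof -
    have hD: "J h \<in> D" "h \<in> L2 Mp" using h by (auto simp: Dp_def)
    have "of_real N * dirichlet_form \<Omega>p f h = t\<Omega> (J f) (J h)"
      using f fD hD D_H1 by (intro dirichlet_form_J[symmetric]) auto
    also have "\<dots> = l2_inner M (J u) (J h)" using L hD by (simp add: form_operator_def)
    also have "\<dots> = of_real N * l2_inner Mp u h" by (rule J_inner[OF u hD(2)])
    finally show ?thesis using card_W_pos by simp
  qed
  then show "op_plus f u" using f u fD by (simp add: form_operator_def Dp_def)
qed

lemma op_W:
  assumes g: "g \<in> W" and L: "op\<Omega> f u" shows "op\<Omega> (\<lambda>x. f (g x)) (\<lambda>x. u (g x))"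
  unfolding form_operator_def
proof (intro conjI ballI)
  have f: "f \<in> D" and u: "u \<in> L2 M" using L by (auto simp: form_operator_def)
  show "(\<lambda>x. f (g x)) \<in> D" by (rule D_W[OF g f])
  show "(\<lambda>x. u (g x)) \<in> L2 M" by (rule L2_W[OF g u])
  fix h assume h: "h \<in> D"
  define k where "k = (\<lambda>x. h (inv g x))"
  have k: "k \<in> D" unfolding k_def by (rule D_W[OF W_inv[OF g] h])
  have hk: "h = (\<lambda>x. k (g x))" by (simp add: k_def W_inv_simps[OF g])
  show "t\<Omega> (\<lambda>x. f (g x)) h = l2_inner M (\<lambda>x. u (g x)) h"
    unfolding hk form_W[OF g f k] inner_W[OF g u D_L2[OF k]] using L k by (simp add: form_operator_def)
qed

lemma op_W_iff: "g \<in> W \<Longrightarrow> op\<Omega> f u \<longleftrightarrow> op\<Omega> (\<lambda>x. f (g x)) (\<lambda>x. u (g x))"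
  using op_W[of g f u] op_W[of "inv g" "\<lambda>x. f (g x)" "\<lambda>x. u (g x)"] W_inv by (auto simp: W_inv_simps)

lemma op_L2: "op\<Omega> f u \<Longrightarrow> f \<in> L2 M \<and> u \<in> L2 M"
  using D_L2 by (auto simp: form_operator_def)

lemma op_plus_L2: "op_plus f u \<Longrightarrow> f \<in> L2 Mp \<and> u \<in> L2 Mp"
  by (auto simp: form_operator_def Dp_def)

context
  fixes E assumes E: "is_spectral_measure_of M E op\<Omega>"
begin

interpretation pvm M E using E by (simp add: is_spectral_measure_of_def pvm_def)

lemma transport_W:
  assumes g: "g \<in> W"
  shows "spectral_transport M E M (\<lambda>f x. f (g x)) (\<lambda>f x. f (inv g x)) 1"
proof
  fix f :: "real^'n \<Rightarrow> complex" assume f: "f \<in> L2 M"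
  show "(\<lambda>x. f (g x)) \<in> L2 M" by (rule L2_W[OF g f])
  show "(\<lambda>x. f (inv g x)) \<in> L2 M" by (rule L2_W[OF W_inv[OF g] f])
qed (auto simp: inner_W[OF g] W_inv_simps[OF g])

text \<open>Conjugating \<open>E\<close> by \<open>g\<close> gives a spectral measure of the
  conjugated operator, which is the same operator by \<open>op_W_iff\<close>; uniqueness of the
  spectral measure gives commutation.\<close>

lemma E_W:
  assumes g: "g \<in> W" and B: "B \<in> sets borel" and f: "f \<in> L2 M"
  shows "AE x in M. E B (\<lambda>x. f (g x)) x = E B f (g x)"
proof -
  interpret T: spectral_transport M E M "\<lambda>f x. f (g x)" "\<lambda>f x. f (inv g x)" 1 by (rule transport_W[OF g])
  have "is_spectral_measure_of M T.E' op\<Omega>"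
    using op_L2 op_W_iff[OF g] by (intro T.is_spectral_measure'[OF E]) auto
  then have "AE x in M. T.E' B f x = E B f x" by (rule spectral_measure_unique[OF _ E f B])
  from AE_W[OF g this] show ?thesis by (simp add: T.E'_def W_inv_simps[OF g])
qed

lemma spectral_integral_W:
  assumes g: "g \<in> W" and \<phi>: "\<phi> \<in> borel_measurable borel" and u: "spectral_integral M E \<phi> f u"
  shows "spectral_integral M E \<phi> (\<lambda>x. f (g x)) (\<lambda>x. u (g x))"
proof -
  interpret T: spectral_transport M E M "\<lambda>f x. f (g x)" "\<lambda>f x. f (inv g x)" 1 by (rule transport_W[OF g])
  have T: "is_spectral_measure_of M T.E' op\<Omega>"
    using op_L2 op_W_iff[OF g] by (intro T.is_spectral_measure'[OF E]) auto
  have "spectral_integral M T.E' \<phi> f u"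
    by (rule spectral_integral_cong_pvm[OF pvm_axioms T.pvm' \<phi> _ u]) (rule spectral_measure_unique[OF E T])
  then show ?thesis using u by (subst (asm) T.spectral_integral'[OF \<phi>]) (auto simp: spectral_integral_def)
qed

text \<open>The essential point is the invariance of the range of \<open>J\<close>: since
  \<open>E B\<close> commutes with the group and is homogeneous, \<open>E B (J f)\<close> is
  equivariant almost everywhere, and \<open>J_restrict\<close> applies.\<close>

lemma transport_J: "spectral_transport M E Mp J (\<lambda>F. F) N"
proof
  fix f :: "real^'n \<Rightarrow> complex" assume f: "f \<in> L2 Mp"
  then show "J f \<in> L2 M" by (rule J_L2)
  fix B :: "real set" assume B: "B \<in> sets borel"
  note L = J_L2[OF f]
  show "AE x in M. J (E B (J f)) x = E B (J f) x"
  proof (rule J_restrict)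
    fix g assume g: "g \<in> W"
    have "(\<lambda>x. J f (g x)) = (\<lambda>x. of_real (\<eta> g) * J f x)"
      by (simp add: J_equivariant[OF g] scaleR_conv_of_real fun_eq_iff)
    then have "AE x in M. E B (\<lambda>x. of_real (\<eta> g) * J f x) x = E B (J f) (g x)"
      using E_W[OF g B L] by simp
    with E_cmult[OF B L, of "of_real (\<eta> g)"] show "AE x in M. E B (J f) (g x) = \<eta> g *\<^sub>R E B (J f) x"
      by eventually_elim (simp add: scaleR_conv_of_real)
  qed
qed (use card_W_pos in \<open>auto simp: restrict_L2 J_inner J_diff J_scaleR\<close>)

end

theorem heat_kernel_plus:
  assumes p: "heat_kernel_at \<Omega> op\<Omega> t p"
  shows "heat_kernel_at \<Omega>p op_plus t (\<lambda>x y. \<Sum>g\<in>W. \<eta> g *\<^sub>R p (g x) y)"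
  unfolding heat_kernel_at_def has_integral_kernel_def
proof (intro ballI conjI)
  fix f assume f: "f \<in> L2 Mp"
  define h where "h = ext0 f"
  define w where "w x = (LINT y|M. p x y * h y)" for x
  have h: "h \<in> L2 M" unfolding h_def by (rule ext0_L2[OF f])
  have i: "AE x in M. integrable M (\<lambda>y. p x y * h y)" and e: "exp_operator M op\<Omega> t h w"
    using p h unfolding heat_kernel_at_def has_integral_kernel_def w_def[abs_def] by auto
  have ph: "p x y * h y = indicator \<Omega>p y *\<^sub>R (p x y * f y)" for x y
    by (simp add: h_def ext0_indicator)
  have ip: "AE x in Mp. \<forall>g\<in>W. integrable Mp (\<lambda>y. p (g x) y * f y)"
  proof -
    have "AE x in M. \<forall>g\<in>W. integrable M (\<lambda>y. p (g x) y * h y)"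
      using i by (intro AE_finite_allI[OF finite_W]) (rule AE_W[where P="\<lambda>x. integrable M (\<lambda>y. p x y * h y)"])
    then show ?thesis unfolding AE_Mp by eventually_elim (simp add: integrable_Mp ph)
  qed
  have ker: "(\<lambda>y. (\<Sum>g\<in>W. \<eta> g *\<^sub>R p (g x) y) * f y) = (\<lambda>y. \<Sum>g\<in>W. \<eta> g *\<^sub>R (p (g x) y * f y))" for x
    by (simp add: sum_distrib_right)
  show "AE x in Mp. integrable Mp (\<lambda>y. (\<Sum>g\<in>W. \<eta> g *\<^sub>R p (g x) y) * f y)"
    using ip unfolding ker by eventually_elim auto
  \<comment> \<open>A spectral measure is available because the kernel hypothesis includes that the
    semigroup is defined at \<open>h\<close>.\<close>
  obtain E where E: "is_spectral_measure_of M E op\<Omega>" "spectral_integral M E (\<lambda>l. exp (- t * l)) h w"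
    using e by (auto simp: exp_operator_def)
  interpret T: spectral_transport M E Mp J "\<lambda>F. F" N by (rule transport_J[OF E(1)])
  have \<phi>: "(\<lambda>l. exp (- t * l)) \<in> borel_measurable borel" by simp
  define V where "V = (\<lambda>x. \<Sum>g\<in>W. \<eta> g *\<^sub>R w (g x))"
  have wL: "w \<in> L2 M" using E(2) by (simp add: spectral_integral_def)
  have V: "V \<in> L2 M" unfolding V_def by (rule L2_sum, rule L2_scaleR, rule L2_W[OF _ wL])
  have "spectral_integral M E (\<lambda>l. exp (- t * l)) (\<lambda>x. \<Sum>g\<in>W. of_real (\<eta> g) * h (g x)) (\<lambda>x. \<Sum>g\<in>W. of_real (\<eta> g) * w (g x))"
    by (rule T.spectral_integral_sum[OF \<phi> finite_W W_nonempty], rule T.spectral_integral_cmult[OF \<phi>],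
        rule spectral_integral_W[OF E(1) _ \<phi> E(2)])
  then have SV: "spectral_integral M E (\<lambda>l. exp (- t * l)) (J f) V"
    by (simp add: J_ext0 h_def V_def scaleR_conv_of_real)
  \<comment> \<open>\<open>V\<close> is computed on all of \<Omega>, whereas the transport lemma
    speaks about the extension of its restriction to the chamber; equivariance makes them
    agree.\<close>
  have VJ: "AE x in M. V x = J V x"
  proof -
    have "AE x in M. J V x = V x"
      by (rule J_restrict) (simp add: V_def sum_equivariant)
    then show ?thesis by eventually_elim simp
  qed
  have "spectral_integral M E (\<lambda>l. exp (- t * l)) (J f) (J V)"
    by (rule T.spectral_integral_cong[OF \<phi> SV J_L2[OF f] _ J_L2[OF restrict_L2[OF V]] VJ]) simp
  then have sV: "spectral_integral Mp T.E' (\<lambda>l. exp (- t * l)) f V"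
    by (rule iffD2[OF T.spectral_integral'[OF \<phi> f restrict_L2[OF V]]])
  have E': "is_spectral_measure_of Mp T.E' op_plus"
    by (rule T.is_spectral_measure'[OF E(1) op_plus_L2 op_iff])
  have VK: "AE x in Mp. V x = (LINT y|Mp. (\<Sum>g\<in>W. \<eta> g *\<^sub>R p (g x) y) * f y)"
    using ip
  proof eventually_elim
    case (elim x)
    have "(LINT y|Mp. (\<Sum>g\<in>W. \<eta> g *\<^sub>R p (g x) y) * f y) = (\<Sum>g\<in>W. \<eta> g *\<^sub>R (LINT y|Mp. p (g x) y * f y))"
      unfolding ker using elim by (subst Bochner_Integration.integral_sum) auto
    also have "\<dots> = V x" by (simp add: V_def w_def ph integral_Mp)
    finally show ?case by simp
  qed
  \<comment> \<open>No joint measurability of \<open>p\<close> is assumed, so measurability of the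
    integral in \<open>x\<close> is inherited from \<open>V\<close> through almost everywhere
    equality.\<close>
  have KL: "(\<lambda>x. LINT y|Mp. (\<Sum>g\<in>W. \<eta> g *\<^sub>R p (g x) y) * f y) \<in> L2 Mp"
  proof (rule L2_cong_AE[OF restrict_L2[OF V] _ VK])
    show "(\<lambda>x. LINT y|Mp. (\<Sum>g\<in>W. \<eta> g *\<^sub>R p (g x) y) * f y) \<in> borel_measurable Mp"
      by (rule borel_measurable_lebesgue_on_AE[OF sets_positive_part L2_measurable[OF restrict_L2[OF V]]])
        (use VK in eventually_elim, simp)
  qed
  have "spectral_integral Mp T.E' (\<lambda>l. exp (- t * l)) f (\<lambda>x. LINT y|Mp. (\<Sum>g\<in>W. \<eta> g *\<^sub>R p (g x) y) * f y)"
    by (rule pvm.spectral_integral_cong[OF T.pvm' \<phi> sV f _ KL VK]) simp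
  then show "exp_operator Mp op_plus t f (\<lambda>x. LINT y|Mp. (\<Sum>g\<in>W. \<eta> g *\<^sub>R p (g x) y) * f y)"
    using E' by (auto simp: exp_operator_def)
qed

end

section \<open>Uniqueness of kernels and identification of the form domains\<close>

text \<open>Testing with indicator functions of countably many boxes produces a single null set of
  \<open>x\<close>, outside of which the two kernels have equal integrals over all rational boxes in
  \<open>y\<close>.\<close>

lemma integral_kernel_unique:
  fixes U :: "'a::euclidean_space set"
  assumes U: "open U" and T: "\<And>f u w. T f u \<Longrightarrow> T f w \<Longrightarrow> AE x in lebesgue_on U. u x = w x"
    and K: "has_integral_kernel (lebesgue_on U) T K" and L: "has_integral_kernel (lebesgue_on U) T L"
  shows "AE x in lebesgue_on U. AE y in lebesgue_on U. K x y = L x y"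
proof -
  let ?f = "\<lambda>a b x. indicator (box a b) x :: complex"
  let ?P = "\<lambda>x (a, b). integrable (lebesgue_on U) (\<lambda>y. K x y * ?f a b y) \<and> integrable (lebesgue_on U) (\<lambda>y. L x y * ?f a b y)
      \<and> (LINT y|lebesgue_on U. K x y * ?f a b y) = (LINT y|lebesgue_on U. L x y * ?f a b y)"
  have "AE x in lebesgue_on U. ?P x (a, b)" for a b :: 'a
  proof -
    have f: "?f a b \<in> L2 (lebesgue_on U)"
      using emeasure_lborel_box_finite[of a b] U by (intro indicator_L2) auto
    have "AE x in lebesgue_on U. integrable (lebesgue_on U) (\<lambda>y. K x y * ?f a b y)"
      and "AE x in lebesgue_on U. integrable (lebesgue_on U) (\<lambda>y. L x y * ?f a b y)"
      and "T (?f a b) (\<lambda>x. LINT y|lebesgue_on U. K x y * ?f a b y)"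
      and "T (?f a b) (\<lambda>x. LINT y|lebesgue_on U. L x y * ?f a b y)"
      using K L f unfolding has_integral_kernel_def by blast+
    with T[OF this(3,4)] show ?thesis by auto
  qed
  then have "AE x in lebesgue_on U. \<forall>ab\<in>rational_pairs. ?P x ab"
    by (subst AE_ball_countable[OF countable_rational_pairs]) auto
  then show ?thesis
  proof eventually_elim
    fix x assume P: "\<forall>ab\<in>rational_pairs. ?P x ab"
    have "AE y in lebesgue_on U. K x y - L x y = 0"
    proof (rule AE_zero_of_local_boxes[OF U])
      fix a b :: 'a assume "(a, b) \<in> rational_pairs"
      then have *: "?P x (a, b)" using P by blast
      have eq: "(\<lambda>y. indicator (box a b) y *\<^sub>R (K x y - L x y)) = (\<lambda>y. K x y * ?f a b y - L x y * ?f a b y)"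
        by (auto simp: indicator_def fun_eq_iff)
      show "integrable (lebesgue_on U) (\<lambda>y. indicator (box a b) y *\<^sub>R (K x y - L x y))"
        unfolding eq using * by auto
      show "(LINT y|lebesgue_on U. indicator (box a b) y *\<^sub>R (K x y - L x y)) = 0"
        unfolding eq using * by auto
    qed
    then show "AE y in lebesgue_on U. K x y = L x y" by simp
  qed
qed

lemma AE_open_ex:
  fixes U :: "'a::euclidean_space set"
  assumes U: "open U" and ae: "AE x in lebesgue_on U. P x" and A: "open A" "A \<subseteq> U" "A \<noteq> {}"
  shows "\<exists>x\<in>A. P x"
proof (rule ccontr)
  assume "\<not> ?thesis"
  moreover have "AE x in lebesgue. x \<in> U \<longrightarrow> P x" using ae U by (simp add: AE_restrict_space_iff)
  ultimately have "AE x in lebesgue. x \<notin> A" using A(2) by (auto elim!: eventually_mono)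
  then have "A \<in> null_sets lebesgue" using A(1) by (subst (asm) AE_iff_null_sets[symmetric]) auto
  then have "negligible A" by (simp add: negligible_iff_null_sets)
  then show False using open_not_negligible A by blast
qed

text \<open>Where the kernels differ they differ on a whole product of open sets. The iterated
  exceptional sets permit choosing first \<open>x'\<close> and then \<open>y'\<close> in it, without
  any measurability on the product.\<close>

lemma continuous_kernels_eq:
  fixes U :: "'a::euclidean_space set" and K L :: "'a \<Rightarrow> 'a \<Rightarrow> complex"
  assumes U: "open U" and ae: "AE x in lebesgue_on U. AE y in lebesgue_on U. K x y = L x y"
    and K: "continuous_on (U \<times> U) (\<lambda>(x, y). K x y)" and L: "continuous_on (U \<times> U) (\<lambda>(x, y). L x y)"
    and x: "x \<in> U" and y: "y \<in> U"
  shows "K x y = L x y"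
proof (rule ccontr)
  assume ne: "K x y \<noteq> L x y"
  define h where "h = (\<lambda>z. (\<lambda>(x, y). K x y) z - (\<lambda>(x, y). L x y) z)"
  have "continuous_on (U \<times> U) h" unfolding h_def by (intro continuous_on_diff K L)
  then have "open (h -` (- {0}) \<inter> (U \<times> U))"
    using continuous_on_open_vimage[OF open_Times[OF U U]] by blast
  moreover have "(x, y) \<in> h -` (- {0}) \<inter> (U \<times> U)" using ne x y by (simp add: h_def)
  ultimately obtain A B where AB: "open A" "open B" "x \<in> A" "y \<in> B" "A \<times> B \<subseteq> h -` (- {0}) \<inter> (U \<times> U)"
    by (rule open_prod_elim) auto
  have sub: "A \<subseteq> U" "B \<subseteq> U" using AB by auto
  obtain x' where x': "x' \<in> A" "AE y in lebesgue_on U. K x' y = L x' y"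
    using AE_open_ex[OF U ae AB(1) sub(1)] AB(3) by blast
  obtain y' where "y' \<in> B" "K x' y' = L x' y'"
    using AE_open_ex[OF U x'(2) AB(2) sub(2)] AB(4) by blast
  then show False using AB(5) x'(1) by (auto simp: h_def)
qed

lemma smooth_heat_kernel_continuous:
  assumes p: "smooth_heat_kernel U A p" and t: "t > 0"
  shows "continuous_on (U \<times> U) (\<lambda>(x, y). p t x y)"
proof -
  have "continuous_on ({0::real<..} \<times> U \<times> U) (\<lambda>(t, x, y). p t x y)"
  proof (rule continuous_at_imp_continuous_on, rule ballI)
    fix z assume "z \<in> {0::real<..} \<times> U \<times> U"
    then have "(\<lambda>(t, x, y). p t x y) differentiable (at z)"
      using p unfolding smooth_heat_kernel_def smooth_on_def
      by (metis (no_types, lifting) empty_subsetI foldr_Nil id_apply list.set(1))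
    then show "isCont (\<lambda>(t, x, y). p t x y) z" by (rule differentiable_imp_continuous_within)
  qed
  then have "continuous_on (U \<times> U) (\<lambda>z. (\<lambda>(t, x, y). p t x y) (t, z))"
    by (rule continuous_on_compose2[where f="\<lambda>z. (t, z)"]) (use t in \<open>auto intro!: continuous_intros\<close>)
  then show ?thesis by (simp add: case_prod_unfold)
qed

section \<open>Invariance of the form domains and identification of the symmetrized Sobolev
  space\<close>

context symmetric_domain
begin

lemma H1_form_domain: "invariant_form_domain R v \<Omega> \<eta> (H1 \<Omega>)"
proof
  show "H1 \<Omega> \<noteq> {}" using H1_zero[OF open_\<Omega>] by blast
  show "(\<lambda>x. f (g x)) \<in> H1 \<Omega>" if "g \<in> W" "f \<in> H1 \<Omega>" for f g
    by (rule H1_orthogonal[OF W_orth[OF that(1)] W_\<Omega>[OF that(1)] open_\<Omega> that(2)])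
qed (use open_\<Omega> in \<open>auto intro: H1_add H1_cmult H1_cong\<close>)

lemma H10_form_domain: "invariant_form_domain R v \<Omega> \<eta> (H10 \<Omega>)"
proof
  show "H10 \<Omega> \<noteq> {}" using test_functions_H10[OF open_\<Omega> test_functions_zero] by blast
  show "(\<lambda>x. f (g x)) \<in> H10 \<Omega>" if "g \<in> W" "f \<in> H10 \<Omega>" for f g
    by (rule H10_orthogonal[OF W_orth[OF that(1)] W_\<Omega>[OF that(1)] open_\<Omega> that(2)])
qed (use open_\<Omega> in \<open>auto intro: H10_add H10_cmult H10_cong H10_H1\<close>)

text \<open>A symmetrization is equivariant, so extending its restriction to the chamber gives it
  back almost everywhere; conversely, an extension is its own symmetrization.\<close>

lemma H1_eta_eq: "H1_eta R v \<eta> \<Omega> = invariant_form_domain.Dp R v \<Omega> \<eta> (H1 \<Omega>)"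
proof -
  interpret F: invariant_form_domain R v \<Omega> \<eta> "H1 \<Omega>" by (rule H1_form_domain)
  show ?thesis
  proof (intro equalityI subsetI)
    fix f assume "f \<in> H1_eta R v \<eta> \<Omega>"
    then obtain F where F: "F \<in> H1 \<Omega>" "AE x in Mp. f x = A\<eta> F x" by (auto simp: H1_eta_def)
    have SF: "A\<eta> F \<in> H1 \<Omega>" by (rule F.sym_D[OF F(1)])
    have SL: "A\<eta> F \<in> L2 Mp" by (rule restrict_L2[OF H1_L2[OF SF]])
    have ae: "AE x in Mp. A\<eta> F x = f x" using F(2) by eventually_elim simp
    have fm: "f \<in> borel_measurable Mp"
      by (rule borel_measurable_lebesgue_on_AE[OF sets_positive_part L2_measurable[OF SL] F(2)])
    have fL: "f \<in> L2 Mp" by (rule L2_cong_AE[OF SL fm ae])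
    have "AE x in M. A\<eta> F x = J f x" using J_sym[of F] J_AE[OF ae] by eventually_elim simp
    then have "J f \<in> H1 \<Omega>" by (rule H1_cong[OF open_\<Omega> SF L2_measurable[OF J_L2[OF fL]]])
    then show "f \<in> F.Dp" using fL by (simp add: F.Dp_def)
  next
    fix f assume f: "f \<in> F.Dp"
    then have "J f \<in> H1 \<Omega>" by (simp add: F.Dp_def)
    moreover have "AE x in Mp. f x = A\<eta> (J f) x"
      by (rule AE_I2) (simp add: sym_J J_on_positive_part)
    ultimately show "f \<in> H1_eta R v \<eta> \<Omega>" by (auto simp: H1_eta_def)
  qed
qed

section \<open>Extension by zero and symmetrization in Sobolev spaces\<close>

lemma ext0_norm: "l2_norm M (ext0 f) = l2_norm Mp f"
proof -
  have "(LINT x|M. (cmod (ext0 f x))\<^sup>2) = (LINT x|M. indicator \<Omega>p x *\<^sub>R (cmod (f x))\<^sup>2)"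
    by (intro Bochner_Integration.integral_cong) (auto simp: ext0_def indicator_def)
  then show ?thesis by (simp add: l2_norm_def integral_Mp)
qed

lemma integral_ext0: "(LINT x|M. ext0 f x * k x) = (LINT x|Mp. f x * k x)"
  by (simp add: integral_Mp ext0_indicator)

text \<open>Test functions on \<Omega> need not vanish near the walls, so the weak derivative on the
  positive part says nothing directly. For \<open>f\<close> itself a test function of the positive
  part the roles can be exchanged, and the identity survives Sobolev limits.\<close>

lemma is_weak_partial_ext0:
  assumes f: "f \<in> H10 \<Omega>p"
  shows "is_weak_partial \<Omega> j (ext0 f) (ext0 (weak_partial \<Omega>p j f))"
  unfolding is_weak_partial_def integral_ext0
proof
  fix \<psi> assume \<psi>: "\<psi> \<in> test_functions \<Omega>"
  note op = open_positive_part
  note f1 = H10_H1[OF f] 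
  note fL = H1_L2[OF f1] and wL = weak_partial(1)[OF f1, of j]
  let ?w = "weak_partial \<Omega>p j f"
  have pL: "\<psi> \<in> L2 Mp" "partial j \<psi> \<in> L2 Mp"
    using \<psi> sets_positive_part by (auto intro: test_functions_L2 test_functions_L2[OF test_functions_partial])
  have CS: "cmod (LINT x|Mp. a x * b x) \<le> l2_norm Mp a * l2_norm Mp b" if "a \<in> L2 Mp" "b \<in> L2 Mp" for a b
  proof -
    have "l2_norm Mp (\<lambda>x. cnj (b x)) = l2_norm Mp b" by (simp add: l2_norm_def)
    then show ?thesis using l2_Cauchy_Schwarz[OF that(1) L2_cnj[OF that(2)]] by (simp add: l2_inner_def)
  qed
  define z where "z = (LINT x|Mp. f x * partial j \<psi> x) + (LINT x|Mp. ?w x * \<psi> x)"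
  define C where "C = l2_norm Mp (partial j \<psi>) + l2_norm Mp \<psi>"
  have C: "C \<ge> 0" by (simp add: C_def l2_norm_nonneg)
  have "cmod z \<le> sqrt e * C" if e: "e > 0" for e
  proof -
    obtain \<phi> where \<phi>: "\<phi> \<in> test_functions \<Omega>p" and le: "H1_sq \<Omega>p (\<lambda>x. \<phi> x - f x) < e"
      using f e unfolding H10_iff[OF op] by blast
    note \<phi>1 = test_functions_H1(1)[OF op \<phi>]
    have qL: "\<phi> \<in> L2 Mp" "partial j \<phi> \<in> L2 Mp"
      by (rule test_functions_L2[OF \<phi> sets_positive_part],
          rule test_functions_L2[OF test_functions_partial[OF \<phi>] sets_positive_part])
    have d: "(\<lambda>x. \<phi> x - f x) \<in> H1 \<Omega>p" by (rule H1_diff[OF op \<phi>1 f1])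
    have wd: "AE x in Mp. weak_partial \<Omega>p j (\<lambda>x. \<phi> x - f x) x = partial j \<phi> x - ?w x"
      using weak_partial_add[OF op \<phi>1 H1_cmult[OF op f1, of "-1"], of j] weak_partial_cmult[OF op f1, of j "-1"]
        test_functions_H1(2)[OF op \<phi>, of j] by eventually_elim simp
    have n1: "l2_norm Mp (\<lambda>x. \<phi> x - f x) \<le> sqrt e"
    proof (rule real_le_rsqrt)
      have "(l2_norm Mp (\<lambda>x. \<phi> x - f x))\<^sup>2 \<le> H1_sq \<Omega>p (\<lambda>x. \<phi> x - f x)"
        by (simp add: H1_sq_def sum_nonneg)
      then show "(l2_norm Mp (\<lambda>x. \<phi> x - f x))\<^sup>2 \<le> e" using le by linarith
    qed
    have n2: "l2_norm Mp (\<lambda>x. partial j \<phi> x - ?w x) \<le> sqrt e"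
    proof (rule real_le_rsqrt)
      have "l2_norm Mp (\<lambda>x. partial j \<phi> x - ?w x) = l2_norm Mp (weak_partial \<Omega>p j (\<lambda>x. \<phi> x - f x))"
        using wd by (intro l2_norm_cong L2_diff qL wL weak_partial(1)[OF d]) (auto elim: eventually_mono)
      moreover have "(l2_norm Mp (weak_partial \<Omega>p j (\<lambda>x. \<phi> x - f x)))\<^sup>2 \<le> H1_sq \<Omega>p (\<lambda>x. \<phi> x - f x)"
        unfolding H1_sq_def
        using member_le_sum[of j UNIV "\<lambda>j. (l2_norm Mp (weak_partial \<Omega>p j (\<lambda>x. \<phi> x - f x)))\<^sup>2"]
        by (simp add: add_increasing)
      ultimately show "(l2_norm Mp (\<lambda>x. partial j \<phi> x - ?w x))\<^sup>2 \<le> e" using le by simp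
    qed
    \<comment> \<open>Here \<psi> is differentiated as a smooth function, and the compactly
      supported \<phi> is the test function.\<close>
    have "(LINT x|Mp. \<psi> x * partial j \<phi> x) = - (LINT x|Mp. partial j \<psi> x * \<phi> x)"
      using is_weak_partial_smooth[OF test_functions_smooth[OF \<psi>] op] \<phi> by (simp add: is_weak_partial_def)
    then have 0: "(LINT x|Mp. \<phi> x * partial j \<psi> x) + (LINT x|Mp. partial j \<phi> x * \<psi> x) = 0"
      by (simp add: mult.commute)
    have "- z = ((LINT x|Mp. \<phi> x * partial j \<psi> x) - (LINT x|Mp. f x * partial j \<psi> x))
        + ((LINT x|Mp. partial j \<phi> x * \<psi> x) - (LINT x|Mp. ?w x * \<psi> x))"
      using 0 unfolding z_def by (simp add: algebra_simps)
    also have "\<dots> = (LINT x|Mp. (\<phi> x - f x) * partial j \<psi> x) + (LINT x|Mp. (partial j \<phi> x - ?w x) * \<psi> x)"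
      by (simp add: left_diff_distrib L2_integrable_mult qL pL fL wL)
    finally have mz: "- z = (LINT x|Mp. (\<phi> x - f x) * partial j \<psi> x) + (LINT x|Mp. (partial j \<phi> x - ?w x) * \<psi> x)" .
    have "cmod z = cmod (- z)" by simp
    also have "\<dots> \<le> cmod (LINT x|Mp. (\<phi> x - f x) * partial j \<psi> x) + cmod (LINT x|Mp. (partial j \<phi> x - ?w x) * \<psi> x)"
      unfolding mz by (rule norm_triangle_ineq)
    also have "\<dots> \<le> l2_norm Mp (\<lambda>x. \<phi> x - f x) * l2_norm Mp (partial j \<psi>)
        + l2_norm Mp (\<lambda>x. partial j \<phi> x - ?w x) * l2_norm Mp \<psi>"
      by (intro add_mono CS L2_diff qL pL fL wL)
    also have "\<dots> \<le> sqrt e * l2_norm Mp (partial j \<psi>) + sqrt e * l2_norm Mp \<psi>"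
      by (intro add_mono mult_right_mono n1 n2 l2_norm_nonneg)
    finally show ?thesis by (simp add: C_def distrib_left)
  qed
  note bound = this
  have "cmod z \<le> 0"
  proof (rule field_le_epsilon)
    fix e :: real assume e: "e > 0"
    \<comment> \<open>Chosen so that \<open>sqrt d * C\<close> is at most \<open>e\<close>; adding 1
      to \<open>C\<close> avoids division by zero.\<close>
    define d where "d = (e / (C + 1))\<^sup>2"
    have "d > 0" "sqrt d = e / (C + 1)" using e C by (auto simp: d_def)
    then have "cmod z \<le> e / (C + 1) * C" using bound[of d] by simp
    also have "\<dots> \<le> e" using e C by (simp add: field_simps)
    finally show "cmod z \<le> 0 + e" by simp
  qed
  then have "z = 0" by simp
  then show "(LINT x|Mp. f x * partial j \<psi> x) = - (LINT x|Mp. ?w x * \<psi> x)"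
    by (simp add: z_def eq_neg_iff_add_eq_0)
qed

lemma ext0_H1:
  assumes f: "f \<in> H10 \<Omega>p"
  shows "ext0 f \<in> H1 \<Omega>" "H1_sq \<Omega> (ext0 f) = H1_sq \<Omega>p f"
proof -
  note f1 = H10_H1[OF f]
  have L: "ext0 (weak_partial \<Omega>p j f) \<in> L2 M" for j by (intro ext0_L2 weak_partial f1)
  show h: "ext0 f \<in> H1 \<Omega>" by (rule H1I[OF ext0_L2[OF H1_L2[OF f1]] L is_weak_partial_ext0[OF f]])
  have "H1_sq \<Omega> (ext0 f) = (l2_norm M (ext0 f))\<^sup>2 + (\<Sum>j\<in>UNIV. (l2_norm M (ext0 (weak_partial \<Omega>p j f)))\<^sup>2)"
    by (rule H1_sq_cong[OF h L weak_partial_eq[OF open_\<Omega> h L is_weak_partial_ext0[OF f]]])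
  then show "H1_sq \<Omega> (ext0 f) = H1_sq \<Omega>p f" by (simp add: ext0_norm H1_sq_def)
qed

lemma ext0_H10:
  assumes f: "f \<in> H10 \<Omega>p" shows "ext0 f \<in> H10 \<Omega>"
  unfolding H10_iff[OF open_\<Omega>]
proof (intro conjI ext0_H1 f allI impI)
  fix e :: real assume "e > 0"
  then obtain \<phi> where \<phi>: "\<phi> \<in> test_functions \<Omega>p" and le: "H1_sq \<Omega>p (\<lambda>x. \<phi> x - f x) < e"
    using f unfolding H10_iff[OF open_positive_part] by blast
  have "(\<lambda>x. \<phi> x - f x) \<in> H10 \<Omega>p"
    using H10_add[OF open_positive_part test_functions_H10[OF open_positive_part \<phi>] H10_cmult[OF open_positive_part f, of "-1"]]
    by simp
  from ext0_H1(2)[OF this] le have "H1_sq \<Omega> (ext0 (\<lambda>x. \<phi> x - f x)) < e" by simp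
  moreover have "ext0 (\<lambda>x. \<phi> x - f x) = (\<lambda>x. \<phi> x - ext0 f x)"
    using test_functions_outside[OF \<phi>] by (auto simp: ext0_def fun_eq_iff)
  moreover have "\<phi> \<in> test_functions \<Omega>" by (rule test_functions_mono[OF positive_part_subset \<phi>])
  ultimately show "\<exists>\<phi>\<in>test_functions \<Omega>. H1_sq \<Omega> (\<lambda>x. \<phi> x - ext0 f x) < e" by (intro bexI[of _ \<phi>]) simp_all
qed

lemma J_H10: "f \<in> H10 \<Omega>p \<Longrightarrow> J f \<in> H10 \<Omega>"
proof -
  assume f: "f \<in> H10 \<Omega>p"
  interpret F: invariant_form_domain R v \<Omega> \<eta> "H10 \<Omega>" by (rule H10_form_domain)
  show "J f \<in> H10 \<Omega>"
    unfolding J_ext0 scaleR_conv_of_real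
    by (rule F.D_sum, rule F.D_cmult, rule F.D_W[OF _ ext0_H10[OF f]])
qed

text \<open>The constant comes from iterating the two-term inequality; only its independence of the
  functions matters.\<close>

lemma H1_sq_sum_le:
  assumes "\<And>i. i \<in> I \<Longrightarrow> f i \<in> H1 \<Omega>" "finite I"
  shows "H1_sq \<Omega> (\<lambda>x. \<Sum>i\<in>I. f i x) \<le> 2 ^ card I * (\<Sum>i\<in>I. H1_sq \<Omega> (f i))"
  using assms(2,1)
proof (induction I rule: finite_induct)
  case empty
  then show ?case using H1_sq_cmult[OF open_\<Omega> H1_zero[OF open_\<Omega>], of 0] by simp
next
  case (insert i I)
  have "H1_sq \<Omega> (\<lambda>x. \<Sum>i\<in>insert i I. f i x) \<le> 2 * H1_sq \<Omega> (f i) + 2 * H1_sq \<Omega> (\<lambda>x. \<Sum>i\<in>I. f i x)"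
    using insert by (simp add: H1_sq_add_le open_\<Omega> H1_sum)
  also have "\<dots> \<le> 2 ^ card (insert i I) * H1_sq \<Omega> (f i) + 2 * (2 ^ card I * (\<Sum>i\<in>I. H1_sq \<Omega> (f i)))"
    using insert H1_sq_nonneg[of \<Omega> "f i"] one_le_power[of "2::real" "card I"]
    by (intro add_mono mult_right_mono mult_left_mono) auto
  also have "\<dots> = 2 ^ card (insert i I) * (\<Sum>i\<in>insert i I. H1_sq \<Omega> (f i))"
    using insert by (simp add: distrib_left mult.assoc)
  finally show ?case .
qed

text \<open>Continuity of symmetrization in the Sobolev norm: each translate has the same norm
  because the group is orthogonal and the signs have modulus 1.\<close>

lemma H1_sq_sym_le:
  obtains C where "C > 0" "\<And>h. h \<in> H1 \<Omega> \<Longrightarrow> H1_sq \<Omega> (A\<eta> h) \<le> C * H1_sq \<Omega> h"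
proof (rule that)
  let ?C = "(1 / N)\<^sup>2 * (2 ^ card W * N)"
  show "?C > 0" using card_W_pos by simp
  fix h assume h: "h \<in> H1 \<Omega>"
  have hg: "(\<lambda>x. of_real (\<eta> g) * h (g x)) \<in> H1 \<Omega>" "H1_sq \<Omega> (\<lambda>x. of_real (\<eta> g) * h (g x)) = H1_sq \<Omega> h"
    if g: "g \<in> W" for g
  proof -
    have o: "(\<lambda>x. h (g x)) \<in> H1 \<Omega>" by (rule H1_orthogonal[OF W_orth[OF g] W_\<Omega>[OF g] open_\<Omega> h])
    show "(\<lambda>x. of_real (\<eta> g) * h (g x)) \<in> H1 \<Omega>" by (rule H1_cmult[OF open_\<Omega> o])
    have "(cmod (of_real (\<eta> g)))\<^sup>2 = 1" using eta_cases[OF g] by auto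
    then show "H1_sq \<Omega> (\<lambda>x. of_real (\<eta> g) * h (g x)) = H1_sq \<Omega> h"
      using H1_sq_cmult[OF open_\<Omega> o] H1_sq_orthogonal[OF W_orth[OF g] W_\<Omega>[OF g] open_\<Omega> h] by simp
  qed
  have "H1_sq \<Omega> (A\<eta> h) = (cmod (of_real (1 / N)))\<^sup>2 * H1_sq \<Omega> (\<lambda>x. \<Sum>g\<in>W. of_real (\<eta> g) * h (g x))"
    unfolding sym_eq by (rule H1_sq_cmult[OF open_\<Omega> H1_sum[OF open_\<Omega> hg(1)]])
  also have "\<dots> \<le> (cmod (of_real (1 / N)))\<^sup>2 * (2 ^ card W * (\<Sum>g\<in>W. H1_sq \<Omega> (\<lambda>x. of_real (\<eta> g) * h (g x))))"
    by (intro mult_left_mono H1_sq_sum_le hg finite_W) auto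
  also have "(cmod (of_real (1 / N)))\<^sup>2 = (1 / N)\<^sup>2" using card_W_pos by (simp add: norm_divide)
  finally show "H1_sq \<Omega> (A\<eta> h) \<le> ?C * H1_sq \<Omega> h" by (simp add: hg(2) mult.assoc)
qed

end

section \<open>Cutting off near the walls\<close>

lemma bump_tendsto_1: "s > 0 \<Longrightarrow> (\<lambda>n. bump 0 (real (Suc n) * s - 1)) \<longlonglongrightarrow> 1"
  and bump_tendsto_0: "s > 0 \<Longrightarrow> (\<lambda>n. bump (Suc k) (real (Suc n) * s - 1)) \<longlonglongrightarrow> 0"
proof -
  assume s: "s > 0"
  have "filterlim (\<lambda>n. real n * s) at_top sequentially"
    using s by (intro filterlim_at_top_mult_tendsto_pos[OF tendsto_const _ filterlim_real_sequentially])
      (auto simp: mult.commute)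
  then have "filterlim (\<lambda>n. - 1 + real n * s) at_top sequentially"
    by (rule filterlim_tendsto_add_at_top[OF tendsto_const])
  then have "filterlim (\<lambda>n. real n * s - 1) at_top sequentially" by simp
  then have top: "filterlim (\<lambda>n. real (Suc n) * s - 1) at_top sequentially"
    by (rule filterlim_compose[OF _ filterlim_Suc])
  have ev: "\<forall>\<^sub>F n in sequentially. 0 < real (Suc n) * s - 1"
    using top by (simp only: filterlim_at_top_dense)
  have "(\<lambda>n. exp (- 1 / (real (Suc n) * s - 1))) \<longlonglongrightarrow> exp 0"
    by (intro tendsto_exp real_tendsto_divide_at_top[OF tendsto_const top])
  then have "(\<lambda>n. exp (- 1 / (real (Suc n) * s - 1))) \<longlonglongrightarrow> 1" by simp
  then show "(\<lambda>n. bump 0 (real (Suc n) * s - 1)) \<longlonglongrightarrow> 1"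
    by (rule Lim_transform_eventually) (use ev in eventually_elim, simp add: bump_def)
  show "(\<lambda>n. bump (Suc k) (real (Suc n) * s - 1)) \<longlonglongrightarrow> 0"
  proof (rule Lim_null_comparison)
    show "\<forall>\<^sub>F n in sequentially. norm (bump (Suc k) (real (Suc n) * s - 1)) \<le> fact k / (real (Suc n) * s - 1)"
      using ev
    proof eventually_elim
      case (elim n)
      \<comment> \<open>Multiplying by the argument lowers the index of \<open>bump\<close>, and the
        bound by a factorial then gives decay like the reciprocal of the argument.\<close>
      have "(real (Suc n) * s - 1) * bump (Suc k) (real (Suc n) * s - 1) \<le> fact k"
        unfolding bump_shift(1)[symmetric] by (rule bump_le)
      then show ?case using elim bump_nonneg[of "Suc k" "real (Suc n) * s - 1"]
        by (simp add: pos_le_divide_eq mult.commute)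
    qed
    show "(\<lambda>n. fact k / (real (Suc n) * s - 1)) \<longlonglongrightarrow> 0"
      by (intro real_tendsto_divide_at_top[OF tendsto_const top])
  qed
qed

text \<open>One factor per wall, a function of the distance measured in units of
  \<open>1 / (n + 1)\<close>. The shift by -1 makes it vanish in a full strip along the wall, as
  compact support inside the open chamber requires, and not only on the wall itself.\<close>

definition wall_cutoff :: "(real^'n) set \<Rightarrow> nat \<Rightarrow> real^'n \<Rightarrow> complex" where
  "wall_cutoff P n x = (\<Prod>\<alpha>\<in>P. of_real (bump 0 ((real (Suc n) *\<^sub>R \<alpha>) \<bullet> x + - 1)))"

lemma smooth_wall_cutoff: "smooth (wall_cutoff P n)"
  unfolding wall_cutoff_def[abs_def] by (intro smooth_prod smooth_bump)

lemma wall_cutoff_tendsto: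
  assumes "\<And>\<alpha>. \<alpha> \<in> P \<Longrightarrow> \<alpha> \<bullet> x > 0"
  shows "(\<lambda>n. wall_cutoff P n x) \<longlonglongrightarrow> 1"
proof -
  have "(\<lambda>n. wall_cutoff P n x) \<longlonglongrightarrow> (\<Prod>\<alpha>\<in>P. of_real 1)"
    unfolding wall_cutoff_def using assms
    by (intro tendsto_prod tendsto_of_real) (simp add: bump_tendsto_1 del: of_nat_Suc)
  then show ?thesis by simp
qed

lemma wall_cutoff_norm: "cmod (wall_cutoff P n x) \<le> 1"
  unfolding wall_cutoff_def prod_norm[symmetric]
  by (intro prod_le_1) (auto simp: bump_nonneg bump_0_le)

lemma wall_cutoff_eq_0:
  assumes "finite P" "\<alpha> \<in> P" "\<alpha> \<bullet> x < 1 / real (Suc n)" shows "wall_cutoff P n x = 0"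
proof -
  have "real (Suc n) * (\<alpha> \<bullet> x) < real (Suc n) * (1 / real (Suc n))"
    using assms(3) by (intro mult_strict_left_mono) auto
  then have "bump 0 ((real (Suc n) *\<^sub>R \<alpha>) \<bullet> x + - 1) = 0" by (intro bump_eq_0) simp
  then show ?thesis unfolding wall_cutoff_def using assms(1,2) by (intro prod_zero bexI[of _ \<alpha>]) auto
qed

text \<open>The factor \<open>1 / \<epsilon>\<close> with \<open>\<epsilon> = 1 / (n + 1)\<close> lost by differentiating the cutoff is
  compensated by \<open>\<langle>\<alpha>, x\<rangle>\<close>, because \<open>(1 + \<tau>) bump 2 \<tau> = bump 2 \<tau> + bump 1 \<tau>\<close>.\<close>

lemma wall_cutoff_partial:
  assumes norm: "\<And>\<alpha>. \<alpha> \<in> P \<Longrightarrow> norm \<alpha> = 1" and pos: "\<And>\<alpha>. \<alpha> \<in> P \<Longrightarrow> \<alpha> \<bullet> x > 0"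
    and w: "\<And>\<alpha>. \<alpha> \<in> P \<Longrightarrow> cmod w \<le> L * (\<alpha> \<bullet> x)"
  shows "cmod (w * partial j (wall_cutoff P n) x)
    \<le> (\<Sum>\<alpha>\<in>P. L * (bump 2 (real (Suc n) * (\<alpha> \<bullet> x) - 1) + bump 1 (real (Suc n) * (\<alpha> \<bullet> x) - 1)))"
proof -
  let ?\<tau> = "\<lambda>\<alpha>. (real (Suc n) *\<^sub>R \<alpha>) \<bullet> x + - 1"
  let ?b = "\<lambda>\<alpha>. complex_of_real (((real (Suc n) *\<^sub>R \<alpha>) \<bullet> axis j 1) * (bump (0 + 2) (?\<tau> \<alpha>) - real 0 * bump (Suc 0) (?\<tau> \<alpha>)))"
  have "partial j (wall_cutoff P n) x = (\<Sum>\<alpha>\<in>P. ?b \<alpha> * (\<Prod>\<beta>\<in>P - {\<alpha>}. of_real (bump 0 (?\<tau> \<beta>))))"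
    unfolding wall_cutoff_def[abs_def] by (rule dir_deriv_eq) (intro has_derivative_prod has_derivative_bump_affine)
  then have "cmod (w * partial j (wall_cutoff P n) x) \<le> (\<Sum>\<alpha>\<in>P. cmod (w * (?b \<alpha> * (\<Prod>\<beta>\<in>P - {\<alpha>}. of_real (bump 0 (?\<tau> \<beta>))))))"
    by (simp only: sum_distrib_left norm_sum)
  also have "\<dots> \<le> (\<Sum>\<alpha>\<in>P. L * (bump 2 (real (Suc n) * (\<alpha> \<bullet> x) - 1) + bump 1 (real (Suc n) * (\<alpha> \<bullet> x) - 1)))"
  proof (rule sum_mono)
    fix \<alpha> assume a: "\<alpha> \<in> P"
    define \<tau> where "\<tau> = real (Suc n) * (\<alpha> \<bullet> x) - 1"
    have \<tau>: "?\<tau> \<beta> = real (Suc n) * (\<beta> \<bullet> x) - 1" for \<beta> by simp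
    have p: "cmod (\<Prod>\<beta>\<in>P - {\<alpha>}. of_real (bump 0 (?\<tau> \<beta>))) \<le> 1"
      unfolding prod_norm[symmetric] by (intro prod_le_1) (auto simp: bump_nonneg bump_0_le)
    have "\<bar>\<alpha> \<bullet> axis j 1\<bar> \<le> 1" using Cauchy_Schwarz_ineq2[of \<alpha> "axis j 1"] norm[OF a] by simp
    then have "\<bar>\<alpha> \<bullet> axis j 1\<bar> * (real (Suc n) * bump 2 \<tau>) \<le> 1 * (real (Suc n) * bump 2 \<tau>)"
      using bump_nonneg[of 2 \<tau>] by (intro mult_right_mono mult_nonneg_nonneg) auto
    moreover have "?b \<alpha> = of_real ((\<alpha> \<bullet> axis j 1) * (real (Suc n) * bump 2 \<tau>))"
      by (simp add: \<tau>_def numeral_2_eq_2 del: of_nat_Suc)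
    then have "cmod (?b \<alpha>) = \<bar>\<alpha> \<bullet> axis j 1\<bar> * (real (Suc n) * bump 2 \<tau>)"
      using bump_nonneg[of 2 \<tau>] by (simp only: norm_of_real abs_mult)
    ultimately have b: "cmod (?b \<alpha>) \<le> real (Suc n) * bump 2 \<tau>" by simp
    have L: "0 \<le> L * (\<alpha> \<bullet> x)" using w[OF a] norm_ge_zero order_trans by blast
    have "cmod (w * (?b \<alpha> * (\<Prod>\<beta>\<in>P - {\<alpha>}. of_real (bump 0 (?\<tau> \<beta>))))) \<le> (L * (\<alpha> \<bullet> x)) * ((real (Suc n) * bump 2 \<tau>) * 1)"
      unfolding norm_mult[of w] norm_mult[of "?b \<alpha>"] using L bump_nonneg[of 2 \<tau>]
      by (intro mult_mono w[OF a] b p) auto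
    also have "\<dots> = L * ((1 + \<tau>) * bump 2 \<tau>)" by (simp add: \<tau>_def)
    also have "\<dots> = L * (bump 2 \<tau> + bump 1 \<tau>)"
      using bump_shift(1)[of 1 \<tau>] by (simp add: distrib_right numeral_2_eq_2)
    finally show "cmod (w * (?b \<alpha> * (\<Prod>\<beta>\<in>P - {\<alpha>}. of_real (bump 0 (?\<tau> \<beta>)))))
      \<le> L * (bump 2 (real (Suc n) * (\<alpha> \<bullet> x) - 1) + bump 1 (real (Suc n) * (\<alpha> \<bullet> x) - 1))"
      by (simp only: \<tau>_def)
  qed
  finally show ?thesis .
qed

locale symmetric_domain_sgn = symmetric_domain R v \<Omega> sgn_det for R :: "(real^'n) set" and v \<Omega>
begin

text \<open>The product with the cutoff is a test function of the chamber. The dangerous term of its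
  gradient, \<open>u\<close> times the gradient of the cutoff, stays bounded because
  \<open>u\<close> vanishes linearly, and it tends to zero pointwise, so dominated convergence gives
  Sobolev convergence.\<close>

lemma test_function_vanishing_on_walls:
  assumes u: "u \<in> test_functions \<Omega>" and L: "L \<ge> 0" "\<And>\<alpha> x. \<alpha> \<in> R \<Longrightarrow> cmod (u x) \<le> L * \<bar>\<alpha> \<bullet> x\<bar>"
  shows "u \<in> H10 \<Omega>p"
proof (rule H10_approx[OF open_positive_part test_functions_H1(1)[OF open_positive_part u]])
  fix e :: real assume e: "e > 0"
  note su = test_functions_smooth[OF u]
  obtain K where K: "compact K" "K \<subseteq> \<Omega>" "\<And>x. x \<notin> K \<Longrightarrow> u x = 0" using test_functionsE[OF u] by metis
  let ?c = "wall_cutoff Rp"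
  define w where "w n x = ?c n x * u x" for n x
  have w_eq: "w n = (\<lambda>x. ?c n x * u x)" for n by (simp add: w_def fun_eq_iff)
  \<comment> \<open>The cutoff vanishes wherever some \<open>\<alpha> \<bullet> x\<close> is below
    \<open>1 / (n + 1)\<close>, so the product is supported in \<open>K\<close> intersected with
    closed half-spaces strictly inside the chamber.\<close>
  have w_test: "w n \<in> test_functions \<Omega>p" for n
  proof (rule test_functionsI[of _ "K \<inter> (\<Inter>\<alpha>\<in>Rp. {x. \<alpha> \<bullet> x \<ge> 1 / real (Suc n)})"])
    show "smooth (w n)" unfolding w_eq by (intro smooth_mult smooth_wall_cutoff su)
    show "compact (K \<inter> (\<Inter>\<alpha>\<in>Rp. {x. \<alpha> \<bullet> x \<ge> 1 / real (Suc n)}))"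
      by (intro compact_Int_closed K(1) closed_INT ballI closed_halfspace_ge)
    show "K \<inter> (\<Inter>\<alpha>\<in>Rp. {x. \<alpha> \<bullet> x \<ge> 1 / real (Suc n)}) \<subseteq> \<Omega>p"
    proof
      fix x assume x: "x \<in> K \<inter> (\<Inter>\<alpha>\<in>Rp. {x. \<alpha> \<bullet> x \<ge> 1 / real (Suc n)})"
      have "x \<bullet> \<alpha> > 0" if "\<alpha> \<in> Rp" for \<alpha>
      proof -
        have "\<alpha> \<bullet> x \<ge> 1 / real (Suc n)" using x that by blast
        moreover have "1 / real (Suc n) > 0" by simp
        ultimately show ?thesis by (simp only: inner_commute[of x])
      qed
      then show "x \<in> \<Omega>p" using x K(2) by (auto simp: positive_part_def)
    qed
    fix x assume "x \<notin> K \<inter> (\<Inter>\<alpha>\<in>Rp. {x. \<alpha> \<bullet> x \<ge> 1 / real (Suc n)})"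
    then consider "x \<notin> K" | \<alpha> where "\<alpha> \<in> Rp" "\<alpha> \<bullet> x < 1 / real (Suc n)" by (auto simp: not_le)
    then show "w n x = 0" by cases (auto simp: w_def K(3) wall_cutoff_eq_0[OF finite_Rp])
  qed
  have pos: "\<alpha> \<bullet> x > 0" if "\<alpha> \<in> Rp" "x \<in> \<Omega>p" for \<alpha> x
    using that by (auto simp: positive_part_def inner_commute)
  have w_H1: "w n \<in> H1 \<Omega>p" "(\<lambda>x. w n x - u x) \<in> H1 \<Omega>p" for n
    using test_functions_H1(1)[OF open_positive_part w_test[of n]] test_functions_H1(1)[OF open_positive_part u]
    by (auto intro: H1_diff open_positive_part)
  have pd: "partial j (\<lambda>x. w n x - u x) x = (?c n x - 1) * partial j u x + u x * partial j (?c n) x" for j n x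
  proof -
    have "partial j (\<lambda>x. w n x - u x) x = partial j (w n) x - partial j u x"
      by (intro partial_diff test_functions_smooth[OF w_test] su)
    also have "partial j (w n) x = ?c n x * partial j u x + partial j (?c n) x * u x"
      unfolding w_eq by (intro partial_mult smooth_wall_cutoff su)
    finally show ?thesis by (simp add: algebra_simps)
  qed
  have wt: "(\<lambda>x. w n x - u x) \<in> test_functions \<Omega>" for n
    using test_functions_add[OF test_functions_mono[OF positive_part_subset w_test] test_functions_cmult[OF u, of "-1"]] by simp
  have wL: "(\<lambda>x. w n x - u x) \<in> L2 Mp" "partial j (\<lambda>x. w n x - u x) \<in> L2 Mp" for n j
    using test_functions_L2[OF wt sets_positive_part] test_functions_L2[OF test_functions_partial[OF wt] sets_positive_part] by auto
  have uL: "u \<in> L2 Mp" "partial j u \<in> L2 Mp" for j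
    using test_functions_L2[OF u sets_positive_part] test_functions_L2[OF test_functions_partial[OF u] sets_positive_part] by auto
  have sq: "H1_sq \<Omega>p (\<lambda>x. w n x - u x) = (l2_norm Mp (\<lambda>x. w n x - u x))\<^sup>2
      + (\<Sum>j\<in>UNIV. (l2_norm Mp (partial j (\<lambda>x. w n x - u x)))\<^sup>2)" for n
    by (rule H1_sq_cong[OF w_H1(2) wL(2) test_functions_H1(2)[OF open_positive_part wt]])
  have c_lim: "(\<lambda>n. ?c n x) \<longlonglongrightarrow> 1" if "x \<in> \<Omega>p" for x
    by (rule wall_cutoff_tendsto) (rule pos[OF _ that])
  have c1: "cmod (?c n x - 1) \<le> 2" for n x
    using norm_triangle_ineq4[of "?c n x" 1] wall_cutoff_norm[of Rp n x] by simp
  have lim1: "(\<lambda>n. (l2_norm Mp (\<lambda>x. w n x - u x))\<^sup>2) \<longlonglongrightarrow> 0"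
  proof -
    have "(\<lambda>n. LINT x|Mp. (cmod (w n x - u x))\<^sup>2) \<longlonglongrightarrow> (LINT x|Mp. 0)"
    proof (rule integral_dominated_convergence[where w="\<lambda>x. 4 * (cmod (u x))\<^sup>2"])
      show "AE x in Mp. (\<lambda>n. (cmod (w n x - u x))\<^sup>2) \<longlonglongrightarrow> 0"
      proof (rule AE_I2)
        fix x assume "x \<in> space Mp"
        then have "(\<lambda>n. (cmod (?c n x * u x - u x))\<^sup>2) \<longlonglongrightarrow> (cmod (1 * u x - u x))\<^sup>2"
          by (intro tendsto_intros c_lim) simp
        then show "(\<lambda>n. (cmod (w n x - u x))\<^sup>2) \<longlonglongrightarrow> 0" by (simp add: w_def)
      qed
      show "AE x in Mp. norm ((cmod (w n x - u x))\<^sup>2) \<le> 4 * (cmod (u x))\<^sup>2" for n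
      proof (rule AE_I2)
        fix x
        have "cmod (w n x - u x) = cmod (?c n x - 1) * cmod (u x)"
          by (simp add: w_def norm_mult[symmetric] left_diff_distrib)
        also have "\<dots> \<le> 2 * cmod (u x)" by (intro mult_right_mono c1) simp
        finally have "(cmod (w n x - u x))\<^sup>2 \<le> (2 * cmod (u x))\<^sup>2" by (intro power_mono) auto
        then show "norm ((cmod (w n x - u x))\<^sup>2) \<le> 4 * (cmod (u x))\<^sup>2" by (simp add: power_mult_distrib)
      qed
    qed (use L2_integrable[OF uL(1)] L2_integrable[OF wL(1)] in \<open>auto intro: borel_measurable_integrable\<close>)
    then show ?thesis by (simp add: l2_norm_square)
  qed
  let ?S = "\<lambda>n x. \<Sum>\<alpha>\<in>Rp. L * (bump 2 (real (Suc n) * (\<alpha> \<bullet> x) - 1) + bump 1 (real (Suc n) * (\<alpha> \<bullet> x) - 1))"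
  have uS: "cmod (u x * partial j (?c n) x) \<le> ?S n x" if x: "x \<in> \<Omega>p" for x j n
  proof (rule wall_cutoff_partial)
    fix \<alpha> assume a: "\<alpha> \<in> Rp"
    show "norm \<alpha> = 1" "\<alpha> \<bullet> x > 0" using norm_root[OF Rp_subset[OF a]] pos[OF a x] by auto
    then show "cmod (u x) \<le> L * (\<alpha> \<bullet> x)" using L(2)[OF Rp_subset[OF a], of x] by simp
  qed
  \<comment> \<open>The 3 is the sum of \<open>fact 2\<close> and \<open>fact 1\<close>, the bounds
    for the two bump terms.\<close>
  define C where "C = (\<Sum>\<alpha>\<in>Rp. L * 3)"
  have S_le: "?S n x \<le> C" for n x
    unfolding C_def
  proof (intro sum_mono mult_left_mono L(1))
    fix \<alpha>
    show "bump 2 (real (Suc n) * (\<alpha> \<bullet> x) - 1) + bump 1 (real (Suc n) * (\<alpha> \<bullet> x) - 1) \<le> 3"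
      using bump_le[of 2 "real (Suc n) * (\<alpha> \<bullet> x) - 1"] bump_le[of 1 "real (Suc n) * (\<alpha> \<bullet> x) - 1"] by (simp add: fact_numeral)
  qed
  have S_lim: "(\<lambda>n. ?S n x) \<longlonglongrightarrow> 0" if "x \<in> \<Omega>p" for x
  proof -
    have "(\<lambda>n. ?S n x) \<longlonglongrightarrow> (\<Sum>\<alpha>\<in>Rp. L * (0 + 0))"
      using bump_tendsto_0[of _ 1] bump_tendsto_0[of _ 0] pos[OF _ that]
      by (intro tendsto_sum tendsto_mult tendsto_add tendsto_const) (auto simp: numeral_2_eq_2)
    then show ?thesis by simp
  qed
  have lim2: "(\<lambda>n. (l2_norm Mp (partial j (\<lambda>x. w n x - u x)))\<^sup>2) \<longlonglongrightarrow> 0" for j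
  proof -
    \<comment> \<open>In the dominating function, 8 is twice the square of the bound 2 for
      \<open>?c n x - 1\<close>; the indicator function of \<open>K\<close>, off which
      \<open>u\<close> vanishes, makes the constant bound integrable.\<close>
    have "(\<lambda>n. LINT x|Mp. (cmod (partial j (\<lambda>x. w n x - u x) x))\<^sup>2) \<longlonglongrightarrow> (LINT x|Mp. 0)"
    proof (rule integral_dominated_convergence[where w="\<lambda>x. 8 * (cmod (partial j u x))\<^sup>2 + 2 * (C\<^sup>2 * indicator K x)"])
      have iK: "integrable Mp (indicator K :: _ \<Rightarrow> real)"
        using compact_lebesgue_finite[OF K(1)] sets_positive_part by (intro integrable_indicator_lebesgue_on) auto
      show "integrable Mp (\<lambda>x. 8 * (cmod (partial j u x))\<^sup>2 + 2 * (C\<^sup>2 * indicator K x))"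
        by (intro Bochner_Integration.integrable_add integrable_mult_right L2_integrable uL iK)
      show "AE x in Mp. (\<lambda>n. (cmod (partial j (\<lambda>x. w n x - u x) x))\<^sup>2) \<longlonglongrightarrow> 0"
      proof (rule AE_I2)
        fix x assume "x \<in> space Mp"
        then have x: "x \<in> \<Omega>p" by simp
        have "(\<lambda>n. u x * partial j (?c n) x) \<longlonglongrightarrow> 0"
          by (rule Lim_null_comparison[OF _ S_lim[OF x]]) (use uS[OF x] in auto)
        then have "(\<lambda>n. (cmod ((?c n x - 1) * partial j u x + u x * partial j (?c n) x))\<^sup>2) \<longlonglongrightarrow> (cmod ((1 - 1) * partial j u x + 0))\<^sup>2"
          by (intro tendsto_intros c_lim x)
        then show "(\<lambda>n. (cmod (partial j (\<lambda>x. w n x - u x) x))\<^sup>2) \<longlonglongrightarrow> 0" by (simp add: pd)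
      qed
      fix n
      show "AE x in Mp. norm ((cmod (partial j (\<lambda>x. w n x - u x) x))\<^sup>2) \<le> 8 * (cmod (partial j u x))\<^sup>2 + 2 * (C\<^sup>2 * indicator K x)"
      proof (rule AE_I2)
        fix x assume "x \<in> space Mp"
        then have x: "x \<in> \<Omega>p" by simp
        have "(cmod (partial j (\<lambda>x. w n x - u x) x))\<^sup>2
          \<le> 2 * (cmod ((?c n x - 1) * partial j u x))\<^sup>2 + 2 * (cmod (u x * partial j (?c n) x))\<^sup>2"
          unfolding pd by (rule norm_add_square_le)
        moreover have "(cmod ((?c n x - 1) * partial j u x))\<^sup>2 \<le> (2 * cmod (partial j u x))\<^sup>2"
          unfolding norm_mult by (intro power_mono mult_right_mono c1) auto
        moreover have "(cmod (u x * partial j (?c n) x))\<^sup>2 \<le> C\<^sup>2 * indicator K x"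
        proof (cases "x \<in> K")
          case True
          have "(cmod (u x * partial j (?c n) x))\<^sup>2 \<le> C\<^sup>2"
            by (intro power_mono order_trans[OF uS[OF x] S_le]) simp
          then show ?thesis using True by simp
        qed (simp add: K(3))
        ultimately show "norm ((cmod (partial j (\<lambda>x. w n x - u x) x))\<^sup>2) \<le> 8 * (cmod (partial j u x))\<^sup>2 + 2 * (C\<^sup>2 * indicator K x)"
          by (simp add: power_mult_distrib)
      qed
    qed (use L2_integrable[OF wL(2)] in \<open>auto intro: borel_measurable_integrable\<close>)
    then show ?thesis by (simp add: l2_norm_square)
  qed
  have "(\<lambda>n. H1_sq \<Omega>p (\<lambda>x. w n x - u x)) \<longlonglongrightarrow> 0 + (\<Sum>j\<in>(UNIV::'n set). 0)"
    unfolding sq by (intro tendsto_add lim1 tendsto_sum lim2)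
  then have "\<forall>\<^sub>F n in sequentially. H1_sq \<Omega>p (\<lambda>x. w n x - u x) < e"
    using e by (intro order_tendstoD(2)) auto
  then obtain n where "H1_sq \<Omega>p (\<lambda>x. w n x - u x) < e" by (auto simp: eventually_sequentially)
  then show "\<exists>h\<in>H10 \<Omega>p. H1_sq \<Omega>p (\<lambda>x. h x - u x) < e"
    using test_functions_H10[OF open_positive_part w_test[of n]] by blast
qed

text \<open>Reflection in \<alpha> moves \<open>x\<close> by twice the distance to the wall and
  changes \<open>u x\<close> to its negative, so the Lipschitz bound between the two points is the
  claim.\<close>

lemma antisymmetric_vanishes_linearly:
  assumes u: "u \<in> test_functions \<Omega>" and anti: "\<And>\<alpha> x. \<alpha> \<in> R \<Longrightarrow> u (reflection \<alpha> x) = - u x"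
  obtains L where "L \<ge> 0" "\<And>\<alpha> x. \<alpha> \<in> R \<Longrightarrow> cmod (u x) \<le> L * \<bar>\<alpha> \<bullet> x\<bar>"
proof -
  obtain L where L: "L \<ge> 0" "\<And>x y. cmod (u x - u y) \<le> L * norm (x - y)" using test_functions_lipschitz[OF u] by metis
  have "cmod (u x) \<le> L * \<bar>\<alpha> \<bullet> x\<bar>" if a: "\<alpha> \<in> R" for \<alpha> x
  proof -
    have "x - reflection \<alpha> x = (2 * (\<alpha> \<bullet> x)) *\<^sub>R \<alpha>" by (simp add: reflection_def)
    then have "norm (x - reflection \<alpha> x) = 2 * \<bar>\<alpha> \<bullet> x\<bar>" using norm_root[OF a] by (simp add: abs_mult)
    moreover have e: "u x - u (reflection \<alpha> x) = 2 * u x" by (simp add: anti[OF a])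
    have "cmod (u x - u (reflection \<alpha> x)) = 2 * cmod (u x)" unfolding e by (simp add: norm_mult)
    ultimately show ?thesis using L(2)[of x "reflection \<alpha> x"] by simp
  qed
  then show thesis using that L(1) by blast
qed

text \<open>A test function approximating \<open>J f\<close> on \<Omega> is made antisymmetric by
  averaging; it then belongs to the closure on the chamber by the cutoff argument, and restricting
  to the chamber does not increase the distance.\<close>

lemma H10_of_J_H10:
  assumes f: "f \<in> L2 Mp" and Jf: "J f \<in> H10 \<Omega>"
  shows "f \<in> H10 \<Omega>p"
proof (rule H10_approx[OF open_positive_part])
  have J1: "J f \<in> H1 \<Omega>" by (rule H10_H1[OF Jf])
  have Jp: "J f \<in> H1 \<Omega>p" by (rule H1_subset[OF positive_part_subset open_\<Omega> open_positive_part J1])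
  have ae: "AE x in Mp. J f x = f x" by (rule AE_I2) (simp add: J_on_positive_part)
  show f1: "f \<in> H1 \<Omega>p" by (rule H1_cong[OF open_positive_part Jp L2_measurable[OF f] ae])
  fix e :: real assume e: "e > 0"
  obtain C where C: "C > 0" "\<And>h. h \<in> H1 \<Omega> \<Longrightarrow> H1_sq \<Omega> (A\<eta> h) \<le> C * H1_sq \<Omega> h" using H1_sq_sym_le by metis
  obtain \<phi> where \<phi>: "\<phi> \<in> test_functions \<Omega>" "H1_sq \<Omega> (\<lambda>x. \<phi> x - J f x) < e / C"
    using Jf e C(1) unfolding H10_iff[OF open_\<Omega>] by (meson divide_pos_pos)
  \<comment> \<open>Symmetrization fixes \<open>J f\<close> and enlarges the squared norm of the
    error at most by the factor \<open>C\<close>, which is why \<phi> was chosen with error below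
    \<open>e / C\<close>.\<close>
  define u where "u = A\<eta> \<phi>"
  have "(\<lambda>x. \<phi> (g x)) \<in> test_functions \<Omega>" if g: "g \<in> W" for g
    by (rule test_functions_orthogonal[OF \<phi>(1) W_orth[OF g]]) (rule iffD2[OF W_\<Omega>[OF g]])
  then have u: "u \<in> test_functions \<Omega>"
    unfolding u_def sym_eq by (intro test_functions_cmult test_functions_sum)
  have anti: "u (reflection \<alpha> x) = - u x" if "\<alpha> \<in> R" for \<alpha> x
    unfolding u_def sym_equivariant[OF reflection_group.gen[OF that]]
    using sgn_det_reflection[OF norm_root[OF that]] by simp
  obtain L where "L \<ge> 0" "\<And>\<alpha> x. \<alpha> \<in> R \<Longrightarrow> cmod (u x) \<le> L * \<bar>\<alpha> \<bullet> x\<bar>"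
    using antisymmetric_vanishes_linearly[OF u anti] by metis
  then have uH: "u \<in> H10 \<Omega>p" using test_function_vanishing_on_walls[OF u] by blast
  have u1: "u \<in> H1 \<Omega>" "u \<in> H1 \<Omega>p"
    using test_functions_H1(1)[OF open_\<Omega> u] H10_H1[OF uH] by auto
  have d: "(\<lambda>x. \<phi> x - J f x) \<in> H1 \<Omega>" by (rule H1_diff[OF open_\<Omega> test_functions_H1(1)[OF open_\<Omega> \<phi>(1)] J1])
  have "A\<eta> (\<lambda>x. \<phi> x - J f x) = (\<lambda>x. u x - A\<eta> (J f) x)"
    by (simp add: sym_eq u_def fun_eq_iff right_diff_distrib sum_subtractf del: of_real_divide)
  then have sd: "A\<eta> (\<lambda>x. \<phi> x - J f x) = (\<lambda>x. u x - J f x)" by (simp add: sym_J)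
  have "H1_sq \<Omega>p (\<lambda>x. u x - f x) = H1_sq \<Omega>p (\<lambda>x. u x - J f x)"
    by (rule H1_sq_AE_cong[OF open_positive_part H1_diff[OF open_positive_part u1(2) f1] H1_diff[OF open_positive_part u1(2) Jp]])
      (use ae in auto)
  also have "\<dots> \<le> H1_sq \<Omega> (\<lambda>x. u x - J f x)"
    by (rule H1_sq_subset_le[OF positive_part_subset open_\<Omega> open_positive_part H1_diff[OF open_\<Omega> u1(1) J1]])
  also have "\<dots> \<le> C * H1_sq \<Omega> (\<lambda>x. \<phi> x - J f x)" using C(2)[OF d] by (simp only: sd)
  also have "\<dots> < e" using \<phi>(2) C(1) by (simp add: pos_less_divide_eq mult.commute)
  finally show "\<exists>h\<in>H10 \<Omega>p. H1_sq \<Omega>p (\<lambda>x. h x - f x) < e" using uH by (intro bexI[of _ u])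
qed

text \<open>One inclusion, \<open>J_H10\<close>, is available for every character; the other uses
  that the determinant is -1 on reflections.\<close>

lemma H10_positive_part: "H10 \<Omega>p = invariant_form_domain.Dp R v \<Omega> sgn_det (H10 \<Omega>)"
proof -
  interpret F: invariant_form_domain R v \<Omega> sgn_det "H10 \<Omega>" by (rule H10_form_domain)
  show ?thesis using H10_of_J_H10 J_H10 H1_L2[OF H10_H1] by (auto simp: F.Dp_def)
qed

end

text \<open>An \<eta>-heat kernel is determined by its operator only up to null sets. The first
  formula therefore has three parts: the sum is a kernel, every kernel agrees with it almost
  everywhere, and a continuous one agrees everywhere. In the Dirichlet case both sides are
  continuous representatives, so the equality is pointwise.\<close>

theorem corollary1p2:
  fixes R \<Omega> \<Omega>p :: "(real^'n) set" and v :: "real^'n"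
    and \<eta> :: "(real^'n \<Rightarrow> real^'n) \<Rightarrow> real"
    and pN pD pDp :: "real \<Rightarrow> real^'n \<Rightarrow> real^'n \<Rightarrow> complex"
  assumes "normalized_root_system R"
    and "\<forall>\<alpha>\<in>R. \<alpha> \<bullet> v \<noteq> 0"
    and "open \<Omega>" and "\<Omega> \<noteq> {}" and "W_symmetric R \<Omega>"
    and "\<Omega>p = positive_part R v \<Omega>"
    and "\<eta> \<in> sign_homs R"
    and "smooth_heat_kernel \<Omega> (neumann_laplacian \<Omega>) pN"
    and "smooth_heat_kernel \<Omega> (dirichlet_laplacian \<Omega>) pD"
    and "smooth_heat_kernel \<Omega>p (dirichlet_laplacian \<Omega>p) pDp"
  shows "(\<forall>t>0. heat_kernel_at \<Omega>p (eta_laplacian R v \<eta> \<Omega>) t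
           (\<lambda>x y. \<Sum>g\<in>reflection_group R. \<eta> g *\<^sub>R pN t (g x) y))
    \<and> (\<forall>t>0. \<forall>K. heat_kernel_at \<Omega>p (eta_laplacian R v \<eta> \<Omega>) t K \<longrightarrow>
           (AE x in lebesgue_on \<Omega>p. AE y in lebesgue_on \<Omega>p.
              K x y = (\<Sum>g\<in>reflection_group R. \<eta> g *\<^sub>R pN t (g x) y)) \<and>
           (continuous_on (\<Omega>p \<times> \<Omega>p) (\<lambda>(x, y). K x y) \<longrightarrow>
              (\<forall>x\<in>\<Omega>p. \<forall>y\<in>\<Omega>p. K x y = (\<Sum>g\<in>reflection_group R. \<eta> g *\<^sub>R pN t (g x) y))))
    \<and> (\<forall>t>0. \<forall>x\<in>\<Omega>p. \<forall>y\<in>\<Omega>p.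
           pDp t x y = (\<Sum>g\<in>reflection_group R. sgn_det g *\<^sub>R pD t (g x) y))"
proof -
  interpret rs: root_system R v using assms(1,2) by unfold_locales auto
  interpret S: symmetric_domain R v \<Omega> \<eta> using assms(3,5,7) by unfold_locales auto
  interpret sg: symmetric_domain_sgn R v \<Omega>
    unfolding symmetric_domain_sgn_def
    using assms(3,5) rs.sgn_det_sign_homs by unfold_locales auto
  interpret N: invariant_form_domain R v \<Omega> \<eta> "H1 \<Omega>" by (rule S.H1_form_domain)
  interpret D: invariant_form_domain R v \<Omega> sgn_det "H10 \<Omega>" by (rule sg.H10_form_domain)
  note \<Omega>p = assms(6)
  have open_p: "open \<Omega>p" using S.open_positive_part \<Omega>p by simp
  \<comment> \<open>Group elements lead out of the positive part but stay in \<Omega>, so continuity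
    of the kernel on all of \<Omega> is used.\<close>
  have cont_sum: "continuous_on (\<Omega>p \<times> \<Omega>p) (\<lambda>(x, y). \<Sum>g\<in>reflection_group R. c g *\<^sub>R p t (g x) y)"
    if p: "smooth_heat_kernel \<Omega> A p" and t: "t > 0" for A p t and c :: "(real^'n \<Rightarrow> real^'n) \<Rightarrow> real"
  proof -
    have "continuous_on (\<Omega>p \<times> \<Omega>p) (\<lambda>z. p t (g (fst z)) (snd z))" if g: "g \<in> reflection_group R" for g
    proof -
      have "continuous_on UNIV g" using rs.W_linear[OF g] by (simp add: linear_continuous_on linear_linear)
      then have "continuous_on (\<Omega>p \<times> \<Omega>p) (\<lambda>z. g (fst z))"
        by (rule continuous_on_compose2[OF _ continuous_on_fst[OF continuous_on_id]]) simp
      then have "continuous_on (\<Omega>p \<times> \<Omega>p) (\<lambda>z. (g (fst z), snd z))"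
        by (intro continuous_on_Pair continuous_on_snd continuous_on_id)
      moreover have "(\<lambda>z. (g (fst z), snd z)) ` (\<Omega>p \<times> \<Omega>p) \<subseteq> \<Omega> \<times> \<Omega>"
        using S.positive_part_subset S.W_\<Omega>[OF g] \<Omega>p by auto
      ultimately show ?thesis
        using continuous_on_compose2[OF smooth_heat_kernel_continuous[OF p t]] by fastforce
    qed
    then show ?thesis by (auto simp: case_prod_unfold intro!: continuous_intros)
  qed
  have eta_op: "eta_laplacian R v \<eta> \<Omega> = N.op_plus"
    by (simp add: eta_laplacian_def S.H1_eta_eq)
  have dir_op: "dirichlet_laplacian \<Omega>p = D.op_plus"
    by (simp add: dirichlet_laplacian_def \<Omega>p sg.H10_positive_part)
  have kN: "heat_kernel_at \<Omega>p (eta_laplacian R v \<eta> \<Omega>) t (\<lambda>x y. \<Sum>g\<in>reflection_group R. \<eta> g *\<^sub>R pN t (g x) y)"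
    if "t > 0" for t
    using N.heat_kernel_plus[of t "pN t"] assms(8) that
    by (simp add: eta_op \<Omega>p smooth_heat_kernel_def neumann_laplacian_def)
  have kD: "heat_kernel_at \<Omega>p (dirichlet_laplacian \<Omega>p) t (\<lambda>x y. \<Sum>g\<in>reflection_group R. sgn_det g *\<^sub>R pD t (g x) y)"
    if "t > 0" for t
    using D.heat_kernel_plus[of t "pD t"] assms(9) that unfolding dir_op
    by (simp add: \<Omega>p smooth_heat_kernel_def dirichlet_laplacian_def)
  have unique: "AE x in lebesgue_on \<Omega>p. AE y in lebesgue_on \<Omega>p. K x y = L x y"
    if "heat_kernel_at \<Omega>p A t K" "heat_kernel_at \<Omega>p A t L" for A t K L
    by (rule integral_kernel_unique[OF open_p exp_operator_unique that[unfolded heat_kernel_at_def]])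
  show ?thesis
  proof (intro conjI allI impI ballI)
    fix t :: real assume t: "t > 0"
    show "heat_kernel_at \<Omega>p (eta_laplacian R v \<eta> \<Omega>) t (\<lambda>x y. \<Sum>g\<in>reflection_group R. \<eta> g *\<^sub>R pN t (g x) y)"
      by (rule kN[OF t])
    fix K assume K: "heat_kernel_at \<Omega>p (eta_laplacian R v \<eta> \<Omega>) t K"
    show ae: "AE x in lebesgue_on \<Omega>p. AE y in lebesgue_on \<Omega>p. K x y = (\<Sum>g\<in>reflection_group R. \<eta> g *\<^sub>R pN t (g x) y)"
      by (rule unique[OF K kN[OF t]])
    fix x y assume "continuous_on (\<Omega>p \<times> \<Omega>p) (\<lambda>(x, y). K x y)" "x \<in> \<Omega>p" "y \<in> \<Omega>p"
    then show "K x y = (\<Sum>g\<in>reflection_group R. \<eta> g *\<^sub>R pN t (g x) y)"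
      by (intro continuous_kernels_eq[OF open_p ae _ cont_sum[OF assms(8) t]])
  next
    fix t :: real and x y assume t: "t > 0" and xy: "x \<in> \<Omega>p" "y \<in> \<Omega>p"
    have "heat_kernel_at \<Omega>p (dirichlet_laplacian \<Omega>p) t (pDp t)"
      using assms(10) t by (simp add: smooth_heat_kernel_def)
    from unique[OF this kD[OF t]] show "pDp t x y = (\<Sum>g\<in>reflection_group R. sgn_det g *\<^sub>R pD t (g x) y)"
      by (rule continuous_kernels_eq[OF open_p _ smooth_heat_kernel_continuous[OF assms(10) t] cont_sum[OF assms(9) t] xy])
  qed
qed

end
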